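(* Let $\sigma>0$ and $\rho>0$ be real numbers. If $\mathsf{Z}$ is a distribution of points on $\mathbb{C}$ with $\mathsf{Z}(0)<+\infty$ such that $$\sup_{r\ge 0}\bigl(N_{\mathsf{Z}}(r)-\sigma r^{\rho}\bigr)<+\infty,$$ then there exists an entire function $f\neq 0$ (not identically zero) such that $f(\mathsf{Z})=0$ and $$M(r;f)\le e^{P(\rho)\sigma r^{\rho}}\quad\text{for all } r\ge 0.$$ Here, for any $\rho>0$, it is impossible to decrease the constant $P(\rho)$: for every $\rho>0$ and every real $P'<P(\rho)$ there exist $\sigma>0$ and a distribution of points $\mathsf{Z}$ with $\mathsf{Z}(0)<+\infty$ and $\sup_{r\ge 0}(N_{\mathsf{Z}}(r)-\sigma r^{\rho})<+\infty$ such that no entire function $f\neq 0$ with $f(\mathsf{Z})=0$ satisfies $M(r;f)\le e^{P'\sigma r^{\rho}}$ for all $r\ge 0$. In particular, if $\mathsf{Z}$ is a distribution of points with $\mathsf{Z}(0)<+\infty$ and $\limsup_{r\to+\infty}\dfrac{N_{\mathsf{Z}}(r)}{r^{\rho}}<\sigma$, then there is an entire function $f\neq 0$ such that $f(\mathsf{Z})=0$ and $$\limsup_{z\to\infty}\frac{\ln|f(z)|}{|z|^{\rho}}<P(\rho)\sigma .$$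
   Context: A distribution of points on $\mathbb{C}$ is an arbitrary function $\mathsf{Z}\colon\mathbb{C}\to\{0,1,2,\dots\}\cup\{+\infty\}$; $\mathsf{Z}(z)$ is the multiplicity of $\mathsf{Z}$ at $z$. Its radial counting function is $\mathsf{Z}^{\mathfrak r}(r):=\sum_{|z|\le r}\mathsf{Z}(z)\in[0,+\infty]$, $r\ge 0$ (so $\mathsf{Z}^{\mathfrak r}(0)=\mathsf{Z}(0)$). For $\mathsf{Z}(0)<+\infty$ its radial integral counting function is $$N_{\mathsf{Z}}(r):=\int_0^r\frac{\mathsf{Z}^{\mathfrak r}(t)-\mathsf{Z}^{\mathfrak r}(0)}{t}\,dt+\mathsf{Z}^{\mathfrak r}(0)\ln r,\quad r\ge 0,$$ with values in $[-\infty,+\infty]$ and the convention $0\cdot\ln 0=0$. For an entire function $f$, $\mathsf{Zero}_f(z)$ denotes the multiplicity of the zero of $f$ at $z$ ($0$ if $f(z)\ne0$; $+\infty$ everywhere if $f\equiv 0$). One writes $f(\mathsf{Z})=0$ if $\mathsf{Zero}_f(z)\ge\mathsf{Z}(z)$ for all $z\in\mathbb{C}$. $M(r;f):=\max_{|z|=r}|f(z)|$ for $r\ge 0$. The Paley constant is $P(\rho):=\pi\rho$ if $\rho\ge\frac12$, and $P(\rho):=\dfrac{\pi\rho}{\sin\pi\rho}$ if $0<\rho<\frac12$. *)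

theory Defs
  imports "HOL-Complex_Analysis.Complex_Analysis"
begin

type_synonym point_distribution = "complex \<Rightarrow> enat"

definition radial_count :: "point_distribution \<Rightarrow> real \<Rightarrow> ennreal" where
  "radial_count Z r = (\<Sum>\<^sub>\<infinity>z\<in>cball 0 r. ennreal_of_enat (Z z))"

(* The library's real logarithm has the junk value ln 0 = 0; here ln 0 = -\<infinity>. *)
definition ext_ln :: "real \<Rightarrow> ereal" where
  "ext_ln x = (if x = 0 then -\<infinity> else ereal (ln x))"

(* Intended for Z 0 < \<infinity>.  The subtraction is the truncated one of ennreal, which is harmless
   since radial_count Z is monotone.  In ereal, 0 * (-\<infinity>) = 0, so the value at r = 0 is 0 if
   Z 0 = 0 and -\<infinity> if 0 < Z 0 < \<infinity>. *)
definition radial_integral_count :: "point_distribution \<Rightarrow> real \<Rightarrow> ereal" where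
  "radial_integral_count Z r =
     enn2ereal (\<integral>\<^sup>+t\<in>{0..r}. ((radial_count Z t - radial_count Z 0) / ennreal t) \<partial>lborel)
     + enn2ereal (radial_count Z 0) * ext_ln r"

(* zorder is only meaningful for functions that do not vanish identically. *)
definition zero_mult :: "(complex \<Rightarrow> complex) \<Rightarrow> point_distribution" where
  "zero_mult f z =
     (if f = (\<lambda>_. 0) then \<infinity> else if f z \<noteq> 0 then 0 else enat (nat (zorder f z)))"

definition vanishes_on :: "(complex \<Rightarrow> complex) \<Rightarrow> point_distribution \<Rightarrow> bool" where
  "vanishes_on f Z \<longleftrightarrow> (\<forall>z. Z z \<le> zero_mult f z)"

(* For r \<ge> 0 and continuous f the supremum is attained, i.e. it is the maximum; the library's Max
   is specified for finite sets only. *)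
definition max_modulus :: "real \<Rightarrow> (complex \<Rightarrow> complex) \<Rightarrow> real" where
  "max_modulus r f = (SUP z\<in>sphere 0 r. norm (f z))"

definition paley :: "real \<Rightarrow> real" where
  "paley \<rho> = (if \<rho> \<ge> 1/2 then pi * \<rho> else pi * \<rho> / sin (pi * \<rho>))"

end

theory Submission
  imports Defs "HOL-Real_Asymp.Real_Asymp"
begin

text \<open>
  Put \<open>\<beta> = max 1 (2 * \<rho>)\<close>. Integrating the hypothesis on \<open>N_Z\<close> against the second derivative of
  \<open>ln (1 + exp (\<beta> * x))\<close> bounds the sum of \<open>ln (1 + (r / \<bar>z\<^sub>k\<bar>) powr \<beta>)\<close> over the points of \<open>Z\<close> by
  \<open>paley \<rho> * \<sigma> * r powr \<rho> + C\<close>; a Beta integral produces the constant. It therefore suffices to find,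
  for finitely many points, a polynomial vanishing there with this sum as a majorant of its logarithm, up
  to \<open>O (ln r)\<close> uniformly in the number of points. For an integer \<open>\<beta>\<close> take the product of \<open>1 - (z / z\<^sub>k) ^ \<beta>\<close>.
  For \<open>\<beta> = L + s\<close> with \<open>0 < s < 1\<close>, the function \<open>1 - (z / z\<^sub>k) powr \<beta>\<close> jumps across a ray; it equals a
  product of \<open>L\<close> linear factors times the exponential of potentials of positive masses on two rays, and
  rounding these masses to unit point masses costs \<open>O (ln r)\<close>. A bounded number of points spared from the
  polynomials absorbs the logarithm, and a normal family argument passes to infinitely many points.

  The constant is sharp for \<open>Z = {n powr (1 / \<rho>)}\<close> with \<open>\<sigma> = 1 / \<rho>\<close>. For \<open>\<rho> \<ge> 1/2\<close>, dividing
  \<open>f (z powr (1 / \<rho>))\<close> by the Blaschke factors of \<open>1, \<dots>, N\<close> in the right half-plane and comparing with the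
  harmonic function \<open>Re (z * Ln (1 + z))\<close> shows that \<open>f = 0\<close> when \<open>P' < paley \<rho>\<close>. For \<open>\<rho> < 1/2\<close>, the quotient
  of \<open>f\<close> by the product of the first \<open>N\<close> factors decays on the negative axis, hence in every direction by
  Phragmen--Lindelof in the slit plane.
\<close>

subsection \<open>The Cauchy kernel in logarithmic coordinates\<close>

text \<open>The exponent \<open>max 1 (2 * \<rho>)\<close> merges both cases of
  \<open>paley\<close>: the constant is \<open>pi * \<rho> / sin (pi * \<rho> / \<beta>)\<close>,
  and the sine is 1 as soon as \<open>\<rho> \<ge> 1/2\<close>. For noninteger
  \<open>\<beta>\<close> no entire factor with a zero at \<open>a\<close> is at hand that is bounded
  by \<open>1 + (r / norm a) powr \<beta>\<close>, and repairing each factor separately would lose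
  something per point, which infinitely many points do not allow. Therefore the points are sorted by
  argument into boundedly many windows, and the points of a window share the same two rays: their
  masses on a ray are added and rounded once. The rounded counting function then differs from the
  true one by at most 1, however many points there are. The angle between the rays is forced: the
  modulus has to be continuous across both of them, and both masses must be positive, so that
  rounding creates zeros and not poles. A spared point helps because its linear factor grows like
  \<open>r\<close>, while the majorant grants \<open>r powr \<beta>\<close>; for
  \<open>\<beta> = 1\<close> nothing is gained in this way, but there no logarithm arises
  either.\<close>

definition kap :: "complex \<Rightarrow> complex" where
  "kap u = 1 / (1 - exp u)"

lemma exp_eq_1_strip:
  assumes "exp u = 1" "\<bar>Im u\<bar> < 2 * pi"
  shows "u = 0"
proof -
  obtain n :: int where n: "Re u = 0" "Im u = of_int (2 * n) * pi"
    using assms(1) by (auto simp: exp_eq_1)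
  have "\<bar>real_of_int n\<bar> * (2 * pi) < 1 * (2 * pi)"
    using assms(2) n(2) by (simp add: abs_mult mult_ac)
  hence "\<bar>real_of_int n\<bar> < 1"
    by (subst (asm) mult_less_cancel_right_pos) auto
  hence "n = 0" by linarith
  thus ?thesis using n by (simp add: complex_eq_iff)
qed

text \<open>With \<zeta> = exp w and z = exp w0, the form \<open>kap (w - w0)\<close> dw is the
  Cauchy kernel (1 / (z - \<zeta>) + 1 / \<zeta>) d\<zeta>. The added term makes it decay at the
  right end of a strip. At the left end it only tends to 1, so decay there has to come from the
  function integrated against it.\<close>

lemma norm_kap_right:
  assumes "Re u \<ge> 1"
  shows "norm (kap u) \<le> 2 * exp (- Re u)"
proof -
  have "2 \<le> exp (1::real)" using exp_ge_add_one_self[of 1] by simp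
  also have "\<dots> \<le> exp (Re u)" using assms by simp
  finally have e: "2 \<le> exp (Re u)" .
  have "exp (Re u) / 2 \<le> exp (Re u) - 1" using e by simp
  also have "\<dots> \<le> norm (1 - exp u)"
    using norm_triangle_ineq2[of "exp u" 1] by (simp add: norm_minus_commute)
  finally have "norm (kap u) \<le> 1 / (exp (Re u) / 2)"
    unfolding kap_def norm_divide norm_one by (intro divide_left_mono) (use e in \<open>auto intro!: mult_pos_pos\<close>)
  thus ?thesis by (simp add: exp_minus field_simps)
qed

lemma norm_kap_left:
  assumes "Re u \<le> -1"
  shows "norm (kap u) \<le> 2"
proof -
  have "2 \<le> exp (1::real)" using exp_ge_add_one_self[of 1] by simp
  also have "\<dots> \<le> exp (- Re u)" using assms by simp
  finally have e: "exp (Re u) \<le> 1/2" by (simp add: exp_minus field_simps)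
  have "1/2 \<le> 1 - exp (Re u)" using e by simp
  also have "\<dots> \<le> norm (1 - exp u)"
    using norm_triangle_ineq2[of 1 "exp u"] by simp
  finally have "norm (kap u) \<le> 1 / (1/2)"
    unfolding kap_def norm_divide norm_one by (intro divide_left_mono) auto
  thus ?thesis by simp
qed

section \<open>Cauchy's formula on a horizontal strip\<close>

lemma contour_integral_linepath_same_Im:
  assumes "p < q"
  shows "contour_integral (linepath (Complex p c) (Complex q c)) f = integral {p..q} (\<lambda>x. f (Complex x c))"
proof -
  have "contour_integral (linepath (Complex p c) (Complex q c)) f =
         of_real (q - p) * integral {0..1} (\<lambda>x. f (linepath (Complex p c) (Complex q c) x))"
    by (simp add: contour_integral_integral complex_diff complex_of_real_def[symmetric] del: of_real_diff)
  also have "integral {0..1} (\<lambda>x. f (linepath (Complex p c) (Complex q c) x)) =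
             integral {0..1} (\<lambda>x. f (Complex (linepath p q x) c))"
    by (simp add: linepath_def Complex_eq scaleR_conv_of_real algebra_simps)
  also have "\<dots> = integral {0..(q - p) / (q - p)} (\<lambda>x. f (Complex (p + (q - p) * x) c))"
    using assms by (simp add: algebra_simps linepath_def)
  also have "{0..(q - p) / (q - p)} = (\<lambda>x. x / (q - p)) ` {0..q - p}"
    using assms by simp
  also have "integral \<dots> (\<lambda>x. f (Complex (p + (q - p) * x) c)) =
             integral {p-p..q-p} (\<lambda>x. f (Complex (x + p) c)) / of_real (q - p)"
    using assms by (subst integral_stretch_real) (auto simp: scaleR_conv_of_real add_ac)
  also have "\<dots> = integral {p..q} (\<lambda>x. f (Complex x c)) / of_real (q - p)"
    by (subst integral_shift_real_ivl) (rule refl)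
  finally show ?thesis
    using assms by simp
qed

lemma convex_strip: "convex {w::complex. a < Im w \<and> Im w < b}"
proof -
  have "{w::complex. a < Im w \<and> Im w < b} = {w. Im w > a} \<inter> {w. Im w < b}" by auto
  thus ?thesis by (simp add: convex_Int convex_halfspace_Im_gt convex_halfspace_Im_lt)
qed

lemma open_strip: "open {w::complex. a < Im w \<and> Im w < b}"
proof -
  have "{w::complex. a < Im w \<and> Im w < b} = {w. Im w > a} \<inter> {w. Im w < b}" by auto
  thus ?thesis by (simp add: open_Int open_halfspace_Im_gt open_halfspace_Im_lt)
qed

text \<open>The pole of \<open>kap\<close> at 0 is simple with residue -1, and it is the only one
  with imaginary part below 2 pi in modulus. Removing it brings integrals against \<open>kap\<close>
  into the form required by the Cauchy integral formula.\<close>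

lemma kap_times_holomorphic:
  defines "m \<equiv> (\<lambda>u. if u = 0 then -1 else u * kap u)"
  shows "m holomorphic_on {u. -2*pi < Im u \<and> Im u < 2*pi}"
proof (rule no_isolated_singularity'[where K = "{0}"])
  let ?S = "{u::complex. -2*pi < Im u \<and> Im u < 2*pi}"
  have nz: "exp u \<noteq> 1" if "u \<in> ?S - {0}" for u
  proof
    assume "exp u = 1"
    moreover have "\<bar>Im u\<bar> < 2 * pi" using that by (simp add: abs_less_iff)
    ultimately have "u = 0" by (rule exp_eq_1_strip)
    thus False using that by simp
  qed
  show "(m \<longlongrightarrow> m z) (at z within ?S)" if "z \<in> {0}" for z :: complex
  proof -
    have z: "z = 0" using that by simp
    have "((\<lambda>u::complex. (exp u - 1) / u) \<longlongrightarrow> 1) (at 0)"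
      using DERIV_exp[of "0::complex"] by (simp add: has_field_derivative_iff)
    hence "((\<lambda>u::complex. - inverse ((exp u - 1) / u)) \<longlongrightarrow> - inverse 1) (at 0)"
      by (intro tendsto_intros) auto
    moreover have "eventually (\<lambda>u. - inverse ((exp u - 1) / u) = m u) (at (0::complex))"
      by (auto simp: eventually_at_filter m_def kap_def minus_divide_right intro!: always_eventually)
    ultimately have "(m \<longlongrightarrow> - inverse 1) (at 0)" by (rule Lim_transform_eventually)
    hence "(m \<longlongrightarrow> m z) (at z)" by (simp add: z m_def)
    thus ?thesis by (rule tendsto_within_subset) simp
  qed
  show "m holomorphic_on ?S - {0}"
  proof (rule holomorphic_transform)
    show "(\<lambda>u. u * (1 / (1 - exp u))) holomorphic_on ?S - {0}"
      by (intro holomorphic_intros) (use nz in auto)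
  qed (auto simp: m_def kap_def)
  show "open ?S" by (rule open_strip)
qed auto

text \<open>The strip is lower than 2 pi, so no translate of \<open>w0\<close> by a period of
  \<open>exp\<close> lies in it, and the residue -1 of \<open>kap\<close> at 0 gives the
  sign.\<close>

lemma rect_cauchy:
  assumes hol: "\<Psi> holomorphic_on {w. a' < Im w \<and> Im w < b'}" and ab: "a' < a" "a < b" "b < b'" "b' - a' < 2*pi"
    and w0: "a' < Im w0" "Im w0 < b'" "Im w0 \<noteq> a" "Im w0 \<noteq> b" and X: "X > \<bar>Re w0\<bar>"
  shows "contour_integral (rectpath (Complex (-X) a) (Complex X b)) (\<lambda>w. \<Psi> w * kap (w - w0))
           = (if a < Im w0 \<and> Im w0 < b then - 2 * pi * \<i> * \<Psi> w0 else 0)"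
proof -
  let ?S = "{w::complex. a' < Im w \<and> Im w < b'}"
  let ?g = "rectpath (Complex (-X) a) (Complex X b)"
  define m where "m = (\<lambda>u. if u = 0 then -1 else u * kap u)"
  have m: "m holomorphic_on {u. -2*pi < Im u \<and> Im u < 2*pi}"
    unfolding m_def by (rule kap_times_holomorphic)
  have mm: "(\<lambda>w. m (w - w0)) holomorphic_on ?S"
  proof -
    have "(m \<circ> (\<lambda>w. w - w0)) holomorphic_on ?S"
      by (rule holomorphic_on_compose_gen[OF _ m]) (use ab w0 in \<open>auto intro!: holomorphic_intros\<close>)
    thus ?thesis by (simp add: o_def)
  qed
  have X0: "X > 0" using X by linarith
  have pim: "path_image ?g \<subseteq> ?S - {w0}"
  proof
    fix w assume "w \<in> path_image ?g"
    thus "w \<in> ?S - {w0}" using X0 X ab w0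
      by (auto simp: path_image_rectpath)
  qed
  have "((\<lambda>w. (\<Psi> w * m (w - w0)) / (w - w0)) has_contour_integral
            (2*pi * \<i> * winding_number ?g w0 * (\<Psi> w0 * m (w0 - w0)))) ?g"
  proof (rule Cauchy_integral_formula_convex_simple)
    show "convex ?S" by (rule convex_strip)
    show "(\<lambda>w. \<Psi> w * m (w - w0)) holomorphic_on ?S" by (intro holomorphic_intros hol mm)
    show "w0 \<in> interior ?S" using open_strip[of a' b'] w0 by (simp add: interior_open)
    show "valid_path ?g" by simp
  qed (use pim in auto)
  hence 1: "((\<lambda>w. \<Psi> w * kap (w - w0)) has_contour_integral
            (2*pi * \<i> * winding_number ?g w0 * (\<Psi> w0 * m (w0 - w0)))) ?g"
    by (rule has_contour_integral_eq) (use pim in \<open>auto simp: m_def\<close>)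
  have "winding_number ?g w0 = (if a < Im w0 \<and> Im w0 < b then 1 else 0)"
  proof (cases "a < Im w0 \<and> Im w0 < b")
    case True
    thus ?thesis using X by (auto intro!: winding_number_rectpath simp: in_box_complex_iff)
  next
    case False
    thus ?thesis using X ab w0 by (subst winding_number_rectpath_outside) (auto simp: in_cbox_complex_iff)
  qed
  thus ?thesis using contour_integral_unique[OF 1] by (simp add: m_def)
qed

lemma contour_integral_rectpath:
  assumes "p < q" "a < b" "continuous_on (path_image (rectpath (Complex p a) (Complex q b))) f"
  shows "contour_integral (rectpath (Complex p a) (Complex q b)) f =
     integral {p..q} (\<lambda>x. f (Complex x a)) - integral {p..q} (\<lambda>x. f (Complex x b))
     + contour_integral (linepath (Complex q a) (Complex q b)) f - contour_integral (linepath (Complex p a) (Complex p b)) f"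
proof -
  have sub: "closed_segment (Complex p a) (Complex q a) \<subseteq> path_image (rectpath (Complex p a) (Complex q b))"
    "closed_segment (Complex q a) (Complex q b) \<subseteq> path_image (rectpath (Complex p a) (Complex q b))"
    "closed_segment (Complex q b) (Complex p b) \<subseteq> path_image (rectpath (Complex p a) (Complex q b))"
    "closed_segment (Complex p b) (Complex p a) \<subseteq> path_image (rectpath (Complex p a) (Complex q b))"
    by (auto simp: rectpath_def Let_def path_image_join)
  have c: "f contour_integrable_on linepath (Complex p a) (Complex q a)"
      "f contour_integrable_on linepath (Complex q a) (Complex q b)"
      "f contour_integrable_on linepath (Complex q b) (Complex p b)"
      "f contour_integrable_on linepath (Complex p b) (Complex p a)"
    using sub by (auto intro!: contour_integrable_continuous_linepath continuous_on_subset[OF assms(3)])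
  have "contour_integral (rectpath (Complex p a) (Complex q b)) f =
    contour_integral (linepath (Complex p a) (Complex q a)) f + (contour_integral (linepath (Complex q a) (Complex q b)) f +
    (contour_integral (linepath (Complex q b) (Complex p b)) f + contour_integral (linepath (Complex p b) (Complex p a)) f))"
    using c by (simp add: rectpath_def Let_def)
  also have "contour_integral (linepath (Complex q b) (Complex p b)) f = - contour_integral (linepath (Complex p b) (Complex q b)) f"
    using sub(3) by (intro contour_integral_reverse_linepath continuous_on_subset[OF assms(3)])
  also have "contour_integral (linepath (Complex p b) (Complex p a)) f = - contour_integral (linepath (Complex p a) (Complex p b)) f"
    using sub(4) by (intro contour_integral_reverse_linepath continuous_on_subset[OF assms(3)])
  finally show ?thesis using assms(1) by (simp add: contour_integral_linepath_same_Im)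
qed

text \<open>The vertical sides disappear for different reasons: on the right the kernel decays
  exponentially and beats linear growth of \<open>\<Psi>\<close>, on the left the kernel is merely
  bounded and \<open>\<Psi>\<close> itself decays. Linear growth is what the logarithm of a power
  shows in these coordinates.\<close>

lemma strip_limit:
  assumes ab: "a < b"
    and cont: "continuous_on {w. a \<le> Im w \<and> Im w \<le> b \<and> (Im w = a \<or> Im w = b \<or> \<bar>Re w\<bar> > \<bar>Re w0\<bar>)} F"
    and c: "\<And>X. X > \<bar>Re w0\<bar> \<Longrightarrow> contour_integral (rectpath (Complex (-X) a) (Complex X b)) F = c"
    and C1: "\<And>w. a \<le> Im w \<Longrightarrow> Im w \<le> b \<Longrightarrow> Re w \<ge> 0 \<Longrightarrow> norm (\<Psi> w) \<le> C * (1 + Re w)"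
    and C2: "\<And>w. a \<le> Im w \<Longrightarrow> Im w \<le> b \<Longrightarrow> Re w \<le> 0 \<Longrightarrow> norm (\<Psi> w) \<le> C * exp (Re w)"
    and F: "F = (\<lambda>w. \<Psi> w * kap (w - w0))"
  shows "((\<lambda>X. integral {-X..X} (\<lambda>x. F (Complex x a)) - integral {-X..X} (\<lambda>x. F (Complex x b)))
           \<longlongrightarrow> c) at_top"
proof -
  define h where "h = (\<lambda>X. (C * (1 + X) * (2 * exp (Re w0 - X)) + C * exp (-X) * 2) * (b - a))"
  have "C \<ge> 0" using C2[of "Complex 0 a"] ab norm_ge_zero[of "\<Psi> (Complex 0 a)"]
    by (auto intro: order_trans simp del: norm_ge_zero)
  have main: "norm (integral {-X..X} (\<lambda>x. F (Complex x a)) - integral {-X..X} (\<lambda>x. F (Complex x b)) - c) \<le> h X"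
    if X: "X > \<bar>Re w0\<bar> + 1" for X
  proof -
    have X0: "X > 0" using X by linarith
    let ?g = "rectpath (Complex (-X) a) (Complex X b)"
    have pim: "path_image ?g \<subseteq> {w. a \<le> Im w \<and> Im w \<le> b \<and> (Im w = a \<or> Im w = b \<or> \<bar>Re w\<bar> > \<bar>Re w0\<bar>)}"
      using X0 X ab by (auto simp: path_image_rectpath)
    have eq: "c = integral {-X..X} (\<lambda>x. F (Complex x a)) - integral {-X..X} (\<lambda>x. F (Complex x b))
     + contour_integral (linepath (Complex X a) (Complex X b)) F - contour_integral (linepath (Complex (-X) a) (Complex (-X) b)) F"
      using contour_integral_rectpath[of "-X" X a b F] c[of X] X X0 ab continuous_on_subset[OF cont pim]
      by simp
    have int: "F contour_integrable_on linepath (Complex Y a) (Complex Y b)" if "\<bar>Y\<bar> > \<bar>Re w0\<bar>" for Y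
      using that ab by (intro contour_integrable_continuous_linepath continuous_on_subset[OF cont])
        (auto simp: closed_segment_same_Re closed_segment_eq_real_ivl)
    have r: "norm (contour_integral (linepath (Complex X a) (Complex X b)) F) \<le> C * (1 + X) * (2 * exp (Re w0 - X)) * norm (Complex X b - Complex X a)"
    proof (rule contour_integral_bound_linepath[OF int])
      fix w assume "w \<in> closed_segment (Complex X a) (Complex X b)"
      hence w: "Re w = X" "a \<le> Im w" "Im w \<le> b"
        using ab by (auto simp: closed_segment_same_Re closed_segment_eq_real_ivl)
      have "norm (\<Psi> w) \<le> C * (1 + X)" using C1[of w] w X0 by simp
      moreover have "norm (kap (w - w0)) \<le> 2 * exp (Re w0 - X)"
        using norm_kap_right[of "w - w0"] w X by simp
      ultimately show "norm (F w) \<le> C * (1 + X) * (2 * exp (Re w0 - X))"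
        unfolding F norm_mult using \<open>C \<ge> 0\<close> X0 by (intro mult_mono) auto
    qed (use X \<open>C \<ge> 0\<close> X0 in auto)
    have l: "norm (contour_integral (linepath (Complex (-X) a) (Complex (-X) b)) F) \<le> C * exp (-X) * 2 * norm (Complex (-X) b - Complex (-X) a)"
    proof (rule contour_integral_bound_linepath[OF int])
      fix w assume "w \<in> closed_segment (Complex (-X) a) (Complex (-X) b)"
      hence w: "Re w = -X" "a \<le> Im w" "Im w \<le> b"
        using ab by (auto simp: closed_segment_same_Re closed_segment_eq_real_ivl)
      have "norm (\<Psi> w) \<le> C * exp (-X)" using C2[of w] w X0 by simp
      moreover have "norm (kap (w - w0)) \<le> 2"
        using norm_kap_left[of "w - w0"] w X by simp
      ultimately show "norm (F w) \<le> C * exp (-X) * 2"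
        unfolding F norm_mult using \<open>C \<ge> 0\<close> X0 by (intro mult_mono) auto
    qed (use X \<open>C \<ge> 0\<close> X0 in auto)
    have nn: "norm (Complex Y b - Complex Y a) = b - a" for Y
      using ab by (simp add: complex_diff cmod_def)
    have "norm (integral {-X..X} (\<lambda>x. F (Complex x a)) - integral {-X..X} (\<lambda>x. F (Complex x b)) - c)
        = norm (contour_integral (linepath (Complex (-X) a) (Complex (-X) b)) F - contour_integral (linepath (Complex X a) (Complex X b)) F)"
      by (subst eq) (simp add: algebra_simps)
    also have "\<dots> \<le> norm (contour_integral (linepath (Complex (-X) a) (Complex (-X) b)) F) + norm (contour_integral (linepath (Complex X a) (Complex X b)) F)"
      by (rule norm_triangle_ineq4)
    also have "\<dots> \<le> h X" using r l unfolding nn h_def by (simp add: algebra_simps)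
    finally show ?thesis .
  qed
  have "(h \<longlongrightarrow> 0) at_top"
  proof -
    have "((\<lambda>X::real. X * exp (-X)) \<longlongrightarrow> 0) at_top" "((\<lambda>X::real. exp (-X)) \<longlongrightarrow> 0) at_top"
      by real_asymp+
    hence "((\<lambda>X. (C * 2 * exp (Re w0) * (exp (-X) + X * exp (-X)) + C * exp (-X) * 2) * (b - a)) \<longlongrightarrow> (C * 2 * exp (Re w0) * (0 + 0) + C * 0 * 2) * (b - a)) at_top"
      by (intro tendsto_intros)
    moreover have "h = (\<lambda>X. (C * 2 * exp (Re w0) * (exp (-X) + X * exp (-X)) + C * exp (-X) * 2) * (b - a))"
      by (rule ext) (simp add: h_def exp_diff exp_minus field_simps)
    ultimately show ?thesis by simp
  qed
  hence "((\<lambda>X. integral {-X..X} (\<lambda>x. F (Complex x a)) - integral {-X..X} (\<lambda>x. F (Complex x b)) - c) \<longlongrightarrow> 0) at_top"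
    by (rule Lim_null_comparison[rotated]) (rule eventually_mono[OF eventually_gt_at_top main])
  thus ?thesis by (rule LIM_zero_cancel)
qed

lemma strip_cauchy:
  assumes hol: "\<Psi> holomorphic_on {w. a' < Im w \<and> Im w < b'}" and ab: "a' < a" "a < b" "b < b'" "b' - a' < 2*pi"
    and w0: "a < Im w0" "Im w0 < b"
    and C1: "\<And>w. a \<le> Im w \<Longrightarrow> Im w \<le> b \<Longrightarrow> Re w \<ge> 0 \<Longrightarrow> norm (\<Psi> w) \<le> C * (1 + Re w)"
    and C2: "\<And>w. a \<le> Im w \<Longrightarrow> Im w \<le> b \<Longrightarrow> Re w \<le> 0 \<Longrightarrow> norm (\<Psi> w) \<le> C * exp (Re w)"
    and F: "F = (\<lambda>w. \<Psi> w * kap (w - w0))"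
  shows "((\<lambda>X. integral {-X..X} (\<lambda>x. F (Complex x a)) - integral {-X..X} (\<lambda>x. F (Complex x b)))
           \<longlongrightarrow> - 2 * pi * \<i> * \<Psi> w0) at_top"
proof (rule strip_limit[OF ab(2) _ _ C1 C2 F])
  show "contour_integral (rectpath (Complex (-X) a) (Complex X b)) F = - 2 * pi * \<i> * \<Psi> w0" if "\<bar>Re w0\<bar> < X" for X
    using rect_cauchy[OF hol ab _ _ _ _ that] ab w0 by (simp add: F)
  have "exp (w - w0) \<noteq> 1" if "w \<in> {w. a' < Im w \<and> Im w < b'} - {w0}" for w
  proof
    assume "exp (w - w0) = 1"
    moreover have "\<bar>Im (w - w0)\<bar> < 2 * pi"
      using that ab w0 by (simp add: abs_less_iff)
    ultimately have "w - w0 = 0" by (rule exp_eq_1_strip)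
    thus False using that by simp
  qed
  hence "continuous_on ({w. a' < Im w \<and> Im w < b'} - {w0}) F" unfolding F kap_def
    by (intro continuous_intros holomorphic_on_imp_continuous_on[OF holomorphic_on_subset[OF hol]]) auto
  thus "continuous_on {w. a \<le> Im w \<and> Im w \<le> b \<and> (Im w = a \<or> Im w = b \<or> \<bar>Re w\<bar> > \<bar>Re w0\<bar>)} F"
    by (rule continuous_on_subset) (use ab w0 in auto)
qed

text \<open>Here \<open>w0\<close> and all its translates by multiples of 2 pi i lie outside the
  strip, so the integrand has no pole. This serves the one of two adjacent strips that does not
  contain \<open>w0\<close>, so that the formulas of both can be added.\<close>

lemma strip_cauchy_0:
  assumes hol: "\<Psi> holomorphic_on {w. a' < Im w \<and> Im w < b'}" and ab: "a' < a" "a < b" "b < b'"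
    and w0: "\<And>w. a' < Im w \<Longrightarrow> Im w < b' \<Longrightarrow> exp (w - w0) \<noteq> 1"
    and C1: "\<And>w. a \<le> Im w \<Longrightarrow> Im w \<le> b \<Longrightarrow> Re w \<ge> 0 \<Longrightarrow> norm (\<Psi> w) \<le> C * (1 + Re w)"
    and C2: "\<And>w. a \<le> Im w \<Longrightarrow> Im w \<le> b \<Longrightarrow> Re w \<le> 0 \<Longrightarrow> norm (\<Psi> w) \<le> C * exp (Re w)"
    and F: "F = (\<lambda>w. \<Psi> w * kap (w - w0))"
  shows "((\<lambda>X. integral {-X..X} (\<lambda>x. F (Complex x a)) - integral {-X..X} (\<lambda>x. F (Complex x b)))
           \<longlongrightarrow> 0) at_top"
proof (rule strip_limit[OF ab(2) _ _ C1 C2 F])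
  have hF: "F holomorphic_on {w. a' < Im w \<and> Im w < b'}" unfolding F kap_def
    by (intro holomorphic_intros hol) (use w0 in force)
  show "contour_integral (rectpath (Complex (-X) a) (Complex X b)) F = 0" if "\<bar>Re w0\<bar> < X" for X
  proof (rule contour_integral_unique, rule Cauchy_theorem_convex_simple[OF hF convex_strip])
    show "path_image (rectpath (Complex (-X) a) (Complex X b)) \<subseteq> {w. a' < Im w \<and> Im w < b'}"
      using that ab by (subst path_image_rectpath) auto
  qed auto
  show "continuous_on {w. a \<le> Im w \<and> Im w \<le> b \<and> (Im w = a \<or> Im w = b \<or> \<bar>Re w\<bar> > \<bar>Re w0\<bar>)} F"
    by (rule continuous_on_subset[OF holomorphic_on_imp_continuous_on[OF hF]]) (use ab in auto)
qed

text \<open>The values lie in the discrete set of multiples of 2 pi i. Applied to the difference of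
  two continuous logarithms of one function.\<close>

lemma exp_one_const:
  assumes "connected S" "continuous_on S D" "\<And>w. w \<in> S \<Longrightarrow> exp (D w) = (1::complex)" "S \<noteq> {}"
  obtains n :: int where "\<And>w. w \<in> S \<Longrightarrow> D w = of_int n * (2 * pi * \<i>)"
proof -
  have D: "\<exists>n::int. D w = of_int n * (2 * pi * \<i>)" if w: "w \<in> S" for w
  proof -
    obtain n :: int where n: "Re (D w) = 0" "Im (D w) = of_int (2 * n) * pi"
      using assms(3)[OF w] by (auto simp: exp_eq_1)
    hence "D w = of_int n * (2 * pi * \<i>)" by (simp add: complex_eq_iff)
    thus ?thesis by blast
  qed
  have "D constant_on S"
  proof (rule continuous_discrete_range_constant[OF assms(1,2)])
    fix x assume x: "x \<in> S"
    have "1 \<le> norm (D y - D x)" if y: "y \<in> S" "D y \<noteq> D x" for y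
    proof -
      obtain n m :: int where nm: "D x = of_int n * (2 * pi * \<i>)" "D y = of_int m * (2 * pi * \<i>)"
        using D[OF x] D[OF y(1)] by blast
      hence "n \<noteq> m" using y by auto
      hence "1 \<le> \<bar>real_of_int m - real_of_int n\<bar>" by linarith
      moreover have "D y - D x = complex_of_real ((real_of_int m - real_of_int n) * (2 * pi)) * \<i>"
        using nm by (simp add: algebra_simps)
      hence "norm (D y - D x) = \<bar>real_of_int m - real_of_int n\<bar> * (2 * pi)"
        by (simp add: norm_mult abs_mult del: of_real_mult of_real_diff)
      moreover have "1 * 1 \<le> \<bar>real_of_int m - real_of_int n\<bar> * (2 * pi)"
        using calculation(1) pi_ge_two by (intro mult_mono) auto
      ultimately show ?thesis by simp
    qed
    thus "\<exists>e>0. \<forall>y. y \<in> S \<and> D y \<noteq> D x \<longrightarrow> e \<le> norm (D y - D x)"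
      by (intro exI[of _ 1]) auto
  qed
  then obtain c where c: "\<And>w. w \<in> S \<Longrightarrow> D w = c" unfolding constant_on_def by blast
  from assms(4) obtain w where w: "w \<in> S" by blast
  from D[OF w] obtain n :: int where "D w = of_int n * (2 * pi * \<i>)" by blast
  thus ?thesis using c w by (intro that[of n]) metis
qed

text \<open>All zeros are simple and common to both functions, so l'Hopital assigns the quotient a
  finite nonzero value at each of them.\<close>

lemma nonvanishing_quotient:
  assumes "open S" "finite K" "K \<subseteq> S" and hol: "f holomorphic_on S" "g holomorphic_on S"
    and K: "\<And>z. z \<in> K \<Longrightarrow> f z = 0 \<and> g z = 0 \<and> deriv f z \<noteq> 0 \<and> deriv g z \<noteq> 0"
    and nK: "\<And>z. z \<in> S - K \<Longrightarrow> f z \<noteq> 0 \<and> g z \<noteq> 0"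
  obtains R where "R holomorphic_on S" "\<And>z. z \<in> S \<Longrightarrow> R z \<noteq> 0" "\<And>z. z \<in> S \<Longrightarrow> f z = R z * g z"
proof
  define R where "R = (\<lambda>z. if z \<in> K then deriv f z / deriv g z else f z / g z)"
  show "R holomorphic_on S"
  proof (rule no_isolated_singularity'[where K = K])
    fix z assume z: "z \<in> K"
    hence zS: "z \<in> S" using assms by auto
    have "((\<lambda>w. f w / g w) \<longlongrightarrow> R z) (at z)"
      using z zS K[OF z] hol \<open>open S\<close>
      by (intro lhopital_complex_simple[where f' = "deriv f z" and g' = "deriv g z"])
         (auto simp: R_def intro!: holomorphic_derivI)
    moreover have "eventually (\<lambda>w. f w / g w = R w) (at z)"
      unfolding eventually_at_filter
    proof -
      have "eventually (\<lambda>w. w \<in> - (K - {z})) (nhds z)"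
        by (intro eventually_nhds_in_open open_Compl finite_imp_closed finite_Diff \<open>finite K\<close>) auto
      thus "eventually (\<lambda>w. w \<noteq> z \<longrightarrow> w \<in> UNIV \<longrightarrow> f w / g w = R w) (nhds z)"
        by eventually_elim (auto simp: R_def)
    qed
    ultimately have "(R \<longlongrightarrow> R z) (at z)" by (rule Lim_transform_eventually)
    thus "(R \<longlongrightarrow> R z) (at z within S)" by (rule tendsto_within_subset) auto
  next
    have "(\<lambda>z. f z / g z) holomorphic_on S - K"
      by (intro holomorphic_intros holomorphic_on_subset[OF hol(1)] holomorphic_on_subset[OF hol(2)]) (use nK in auto)
    thus "R holomorphic_on S - K"
      by (rule holomorphic_transform) (auto simp: R_def)
  qed (use assms in auto)
  show "R z \<noteq> 0" "f z = R z * g z" if "z \<in> S" for z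
    using K[of z] nK[of z] that by (auto simp: R_def)
qed

lemma norm_Ln_one_minus_exp:
  assumes "Re u \<le> -1"
  shows "norm (Ln (1 - exp u)) \<le> 2 * exp (Re u)"
proof -
  have "2 < exp (1::real)" using exp_lower_Taylor_quadratic[of 1] by simp
  also have "\<dots> \<le> exp (- Re u)" using assms by simp
  finally have e: "exp (Re u) < 1/2" by (simp add: exp_minus field_simps)
  have "norm (Ln (1 + (- exp u))) \<le> 2 * norm (- exp u)"
    by (rule norm_Ln_le) (use e in auto)
  thus ?thesis by simp
qed

text \<open>In the variable z = exp w this is the polynomial with value 1 at the origin and the
  zeros \<open>exp (a j)\<close>.\<close>

definition atoms_poly :: "nat \<Rightarrow> (nat \<Rightarrow> complex) \<Rightarrow> complex \<Rightarrow> complex" where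
  "atoms_poly L a w = (\<Prod>j<L. 1 - exp (w - a j))"

lemma one_minus_exp_pos_half:
  assumes "Re u < 0"
  shows "1 - exp u \<notin> \<real>\<^sub>\<le>\<^sub>0"
proof
  assume "1 - exp u \<in> \<real>\<^sub>\<le>\<^sub>0"
  hence "Re (1 - exp u) \<le> 0" by (auto simp: complex_nonpos_Reals_iff)
  moreover have "Re (exp u) \<le> norm (exp u)" by (rule complex_Re_le_cmod)
  moreover have "norm (exp u) < 1" using assms by simp
  ultimately show False by simp
qed

lemma exp_diff_eq_one:
  "exp P * A = G \<Longrightarrow> exp E = G / A \<Longrightarrow> A \<noteq> 0 \<Longrightarrow> G \<noteq> 0 \<Longrightarrow> exp (P - E) = (1::complex)"
  by (auto simp: exp_diff field_simps)

lemma Re_scaled_le: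
  fixes \<beta> b \<theta> :: real and w :: complex
  assumes "1 \<le> \<beta>" "Re w - b \<le> 0"
  shows "Re (\<beta> * (w - b) + \<i> * \<theta>) \<le> Re w - b"
proof -
  have "\<beta> * (Re w - b) \<le> 1 * (Re w - b)" by (rule mult_right_mono_neg[OF assms])
  moreover have "Re (\<beta> * (w - b) + \<i> * \<theta>) = \<beta> * (Re w - b)" by simp
  ultimately show ?thesis by (simp only: mult_1)
qed

lemma Re_scaled_ge:
  fixes \<beta> b \<theta> :: real and w :: complex
  assumes "1 \<le> \<beta>" "Re w - b \<ge> 0"
  shows "Re (- (\<beta> * (w - b) + \<i> * \<theta>)) \<le> - (Re w - b)"
proof -
  have "1 * (Re w - b) \<le> \<beta> * (Re w - b)" by (rule mult_right_mono[OF assms])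
  moreover have "Re (- (\<beta> * (w - b) + \<i> * \<theta>)) = - (\<beta> * (Re w - b))" by simp
  ultimately show ?thesis by (simp only: mult_1 neg_le_iff_le)
qed

text \<open>The strip is simply connected, so \<open>R\<close> has a logarithm. To the left of the
  line \<open>Re w = b\<close> it is, up to a constant, a combination of principal logarithms of
  numbers near 1, which decays. To the right the factors are inverted first, which leaves linear
  growth. In between compactness suffices.\<close>

lemma log_strip:
  fixes \<beta> b \<theta> :: real and a :: "nat \<Rightarrow> complex"
  assumes hol: "R holomorphic_on {w. a' < Im w \<and> Im w < b'}"
    and nz: "\<And>w. a' < Im w \<Longrightarrow> Im w < b' \<Longrightarrow> R w \<noteq> 0"
    and eq: "\<And>w::complex. a' < Im w \<Longrightarrow> Im w < b' \<Longrightarrow> 1 - exp (\<beta> * (w - b) + \<i> * \<theta>) = R w * atoms_poly L a w"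
    and \<beta>: "\<beta> \<ge> 1" and a: "\<And>j. j < L \<Longrightarrow> Re (a j) = b" and ab: "a' < p" "p < q" "q < b'"
  obtains \<Psi> C where "\<Psi> holomorphic_on {w. a' < Im w \<and> Im w < b'}"
    "\<And>w. a' < Im w \<Longrightarrow> Im w < b' \<Longrightarrow> exp (\<Psi> w) = R w"
    "\<And>w. p \<le> Im w \<Longrightarrow> Im w \<le> q \<Longrightarrow> Re w \<ge> 0 \<Longrightarrow> norm (\<Psi> w) \<le> C * (1 + Re w)"
    "\<And>w. p \<le> Im w \<Longrightarrow> Im w \<le> q \<Longrightarrow> Re w \<le> 0 \<Longrightarrow> norm (\<Psi> w) \<le> C * exp (Re w)"
proof -
  let ?S = "{w::complex. a' < Im w \<and> Im w < b'}"
  have sc: "simply_connected ?S" by (rule convex_imp_simply_connected[OF convex_strip])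
  have "\<forall>f. f holomorphic_on ?S \<and> (\<forall>z\<in>?S. f z \<noteq> 0) \<longrightarrow> (\<exists>g. g holomorphic_on ?S \<and> (\<forall>z\<in>?S. f z = exp (g z)))"
    using sc unfolding simply_connected_eq_holomorphic_log[OF open_strip] by (rule conjunct2)
  from this[rule_format, of R] hol nz
  obtain P where P: "P holomorphic_on ?S" "\<forall>w\<in>?S. R w = exp (P w)" by auto
  have cP: "continuous_on ?S P" by (rule holomorphic_on_imp_continuous_on[OF P(1)])
  define SL where "SL = ?S \<inter> {w. Re w < b}"
  define SR where "SR = ?S \<inter> {w. Re w > b}"
  have conv: "convex SL" "convex SR"
    unfolding SL_def SR_def by (intro convex_Int convex_strip convex_halfspace_Re_lt convex_halfspace_Re_gt)+
  have ne: "Complex (b - 1) p \<in> SL" "Complex (b + 1) p \<in> SR" using ab by (auto simp: SL_def SR_def)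
  have expR: "exp (P w) * atoms_poly L a w = 1 - exp (\<beta> * (w - b) + \<i> * \<theta>)" if "w \<in> ?S" for w :: complex
    using eq[of w] P(2) that by simp
  define EL where "EL = (\<lambda>w::complex. Ln (1 - exp (\<beta> * (w - b) + \<i> * \<theta>)) - (\<Sum>j<L. Ln (1 - exp (w - a j))))"
  have npL: "1 - exp (\<beta> * (w - b) + \<i> * \<theta>) \<notin> \<real>\<^sub>\<le>\<^sub>0" "j < L \<Longrightarrow> 1 - exp (w - a j) \<notin> \<real>\<^sub>\<le>\<^sub>0" if "Re w < b" for w :: complex and j
    by (rule one_minus_exp_pos_half; use that \<beta> a in \<open>simp add: mult_pos_neg\<close>)+
  have neq: "u \<notin> \<real>\<^sub>\<le>\<^sub>0 \<Longrightarrow> u \<noteq> 0" for u :: complex by auto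
  obtain n :: int where n: "\<And>w. w \<in> SL \<Longrightarrow> P w - EL w = of_int n * (2 * pi * \<i>)"
  proof (rule exp_one_const[of SL "\<lambda>w. P w - EL w"])
    show "continuous_on SL (\<lambda>w. P w - EL w)" unfolding EL_def
      by (intro continuous_intros continuous_on_subset[OF cP]) (use npL in \<open>auto simp: SL_def\<close>)
    fix w assume w: "w \<in> SL"
    have wb: "Re w < b" using w by (simp add: SL_def)
    have e2: "1 - exp (w - a j) \<noteq> 0" if "j < L" for j by (rule neq[OF npL(2)[OF wb that]])
    have E1: "exp (EL w) = (1 - exp (\<beta> * (w - b) + \<i> * \<theta>)) / atoms_poly L a w"
      unfolding EL_def atoms_poly_def exp_diff[of "Ln _"] exp_sum[OF finite_lessThan] exp_Ln[OF neq[OF npL(1)[OF wb]]]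
      by (rule arg_cong2[where f="(/)"], rule refl, rule prod.cong, rule refl, rule exp_Ln, rule e2, simp)
    have E2: "atoms_poly L a w \<noteq> 0"
      using e2 by (simp add: atoms_poly_def)
    have E3: "1 - exp (\<beta> * (w - b) + \<i> * \<theta>) \<noteq> 0" by (rule neq[OF npL(1)[OF wb]])
    have "w \<in> ?S" using w by (simp add: SL_def)
    thus "exp (P w - EL w) = 1" by (rule exp_diff_eq_one[OF expR E1 E2 E3])
  next
    show "connected SL" by (rule convex_connected[OF conv(1)])
    show "SL \<noteq> {}" using ne(1) by blast
  qed blast
  \<comment> \<open>Removing the constant makes the logarithm vanish at the left end of the strip,
    as the Cauchy formula needs it.\<close>
  define \<Psi> where "\<Psi> = (\<lambda>w. P w - of_int n * (2 * pi * \<i>))"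
  have h\<Psi>: "\<Psi> holomorphic_on ?S" unfolding \<Psi>_def by (intro holomorphic_intros P)
  have exp\<Psi>: "exp (\<Psi> w) = exp (P w)" for w
  proof -
    have "exp (of_int n * (2 * pi * \<i>)) = 1" by (auto simp: exp_eq_1 intro!: exI[of _ n])
    thus ?thesis by (simp only: \<Psi>_def exp_diff) simp
  qed
  have \<Psi>L: "\<Psi> w = EL w" if "w \<in> SL" for w using n[OF that] by (simp add: \<Psi>_def algebra_simps)
  \<comment> \<open>For positive real part \<open>1 - exp u\<close> is not confined to the domain of
    the principal logarithm. Factoring out \<open>- exp u\<close>, which is
    \<open>exp (u + \<i> * pi)\<close>, leaves \<open>1 - exp (-u)\<close>, a number with positive
    real part.\<close>
  define EL' where "EL' = (\<lambda>w::complex. \<beta> * (w - b) + \<i> * \<theta> + \<i> * pi + Ln (1 - exp (-(\<beta> * (w - b) + \<i> * \<theta>))) - (\<Sum>j<L. w - a j + \<i> * pi + Ln (1 - exp (-(w - a j)))))"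
  have npR: "1 - exp (-(\<beta> * (w - b) + \<i> * \<theta>)) \<notin> \<real>\<^sub>\<le>\<^sub>0" "j < L \<Longrightarrow> 1 - exp (-(w - a j)) \<notin> \<real>\<^sub>\<le>\<^sub>0" if "Re w > b" for w :: complex and j
    by (rule one_minus_exp_pos_half; use that \<beta> a in \<open>simp add: mult_pos_pos\<close>)+
  have flip: "exp (u + \<i> * pi) * (1 - exp (-u)) = 1 - exp u" for u :: complex
    by (simp add: exp_add exp_minus field_simps)
  obtain k :: int where k: "\<And>w. w \<in> SR \<Longrightarrow> \<Psi> w - EL' w = of_int k * (2 * pi * \<i>)"
  proof (rule exp_one_const[of SR "\<lambda>w. \<Psi> w - EL' w"])
    show "continuous_on SR (\<lambda>w. \<Psi> w - EL' w)" unfolding EL'_def \<Psi>_def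
      by (intro continuous_intros continuous_on_subset[OF cP]) (use npR in \<open>auto simp: SR_def\<close>)
    fix w assume w: "w \<in> SR"
    have wb: "Re w > b" using w by (simp add: SR_def)
    have expLn: "exp (A + Ln B) = exp A * B" if "B \<noteq> 0" for A B :: complex using that by (simp add: exp_add)
    have e1: "exp (\<beta> * (w - b) + \<i> * \<theta> + \<i> * pi + Ln (1 - exp (-(\<beta> * (w - b) + \<i> * \<theta>)))) = 1 - exp (\<beta> * (w - b) + \<i> * \<theta>)"
      by (simp only: expLn[OF neq[OF npR(1)[OF wb]]] flip)
    have e2: "exp (w - a j + \<i> * pi + Ln (1 - exp (-(w - a j)))) = 1 - exp (w - a j)" if "j < L" for j
      by (simp only: expLn[OF neq[OF npR(2)[OF wb that]]] flip)
    have E1: "exp (EL' w) = (1 - exp (\<beta> * (w - b) + \<i> * \<theta>)) / atoms_poly L a w"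
      unfolding EL'_def atoms_poly_def
      by (subst exp_diff, subst exp_sum, simp, subst e1, rule arg_cong2[where f="(/)"], rule refl, rule prod.cong, rule refl, rule e2, simp)
    have nzR: "1 - exp u \<noteq> 0" if "Re u > 0" for u :: complex
    proof
      assume "1 - exp u = 0" hence "exp u = 1" by simp
      hence "norm (exp u) = 1" by simp
      thus False using that by simp
    qed
    have E2: "atoms_poly L a w \<noteq> 0"
      using w nzR[of "w - a j" for j] a by (auto simp: atoms_poly_def SR_def)
    have E3: "1 - exp (\<beta> * (w - b) + \<i> * \<theta>) \<noteq> 0" using nzR[of "\<beta> * (w - b) + \<i> * \<theta>"] w \<beta> by (auto simp: SR_def)
    have "w \<in> ?S" using w by (simp add: SR_def)
    thus "exp (\<Psi> w - EL' w) = 1" by (rule exp_diff_eq_one[OF expR[folded exp\<Psi>] E1 E2 E3])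
  next
    show "connected SR" by (rule convex_connected[OF conv(2)])
    show "SR \<noteq> {}" using ne(2) by blast
  qed blast
  \<comment> \<open>The margin 1 keeps all the exponentials concerned below 1/2 in modulus, where
    the principal logarithm has a linear bound.\<close>
  define T where "T = \<bar>b\<bar> + 1"
  have T: "T \<ge> 1" by (simp add: T_def)
  have "compact (\<Psi> ` cbox (Complex (-T) p) (Complex T q))"
    by (intro compact_continuous_image continuous_on_subset[OF holomorphic_on_imp_continuous_on[OF h\<Psi>]] compact_cbox)
       (use ab in \<open>auto simp: in_cbox_complex_iff\<close>)
  hence "bounded (\<Psi> ` cbox (Complex (-T) p) (Complex T q))" by (rule compact_imp_bounded)
  then obtain B where B': "\<forall>x\<in>\<Psi> ` cbox (Complex (-T) p) (Complex T q). norm x \<le> B"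
    unfolding bounded_iff ..
  have B: "norm (\<Psi> w) \<le> B" if "w \<in> cbox (Complex (-T) p) (Complex T q)" for w
    by (rule B'[rule_format], rule imageI, rule that)
  have "Complex 0 p \<in> cbox (Complex (-T) p) (Complex T q)" using ab T by (simp add: in_cbox_complex_iff)
  hence B0: "B \<ge> 0" by (rule order_trans[OF norm_ge_zero B])
  define CL where "CL = 2 * exp \<bar>b\<bar> * (1 + real L)"
  have left: "norm (\<Psi> w) \<le> CL * exp (Re w)" if w: "a' < Im w" "Im w < b'" "Re w \<le> - T" for w
  proof -
    have wb: "Re w - b \<le> -1" using w by (simp add: T_def)
    have wSL: "w \<in> SL" using w wb by (simp add: SL_def)
    have "Re w - b \<le> 0" using wb by linarith
    note re = Re_scaled_le[OF \<beta> this, of \<theta>]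
    have "norm (Ln (1 - exp (\<beta> * (w - b) + \<i> * \<theta>))) \<le> 2 * exp (Re (\<beta> * (w - b) + \<i> * \<theta>))"
      by (rule norm_Ln_one_minus_exp, rule order_trans[OF re wb])
    also have "\<dots> \<le> 2 * exp (Re w - b)" by (rule mult_left_mono, rule exp_le_cancel_iff[THEN iffD2, OF re]) simp
    finally have 1: "norm (Ln (1 - exp (\<beta> * (w - b) + \<i> * \<theta>))) \<le> 2 * exp (Re w - b)" .
    have 2: "norm (Ln (1 - exp (w - a j))) \<le> 2 * exp (Re w - b)" if "j < L" for j
      using norm_Ln_one_minus_exp[of "w - a j"] a[OF that] wb by simp
    have "norm (\<Psi> w) \<le> norm (Ln (1 - exp (\<beta> * (w - b) + \<i> * \<theta>))) + norm (\<Sum>j<L. Ln (1 - exp (w - a j)))"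
      unfolding \<Psi>L[OF wSL] EL_def by (rule norm_triangle_ineq4)
    also have "\<dots> \<le> 2 * exp (Re w - b) + (\<Sum>j<L. 2 * exp (Re w - b))"
      by (intro add_mono 1 sum_norm_le 2) simp
    also have "\<dots> = 2 * exp (- b) * (1 + real L) * exp (Re w)" by (simp add: exp_diff exp_minus divide_inverse algebra_simps)
    also have "\<dots> \<le> CL * exp (Re w)" unfolding CL_def by (intro mult_right_mono mult_left_mono) auto
    finally show ?thesis .
  qed
  define A where "A = \<bar>q\<bar> + \<bar>p\<bar>"
  define c1 where "c1 = \<beta> * (2 + \<bar>b\<bar> + A) + \<bar>\<theta>\<bar> + pi + 2"
  define c2 where "c2 = (\<Sum>j<L. 1 + A + norm (a j) + pi + 2)"
  define CR where "CR = c1 + c2 + \<bar>real_of_int k\<bar> * (2 * pi)"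
  have right: "norm (\<Psi> w) \<le> CR * (1 + Re w)" if w: "p \<le> Im w" "Im w \<le> q" "Re w \<ge> T" for w
  proof -
    have wb: "Re w - b \<ge> 1" using w by (simp add: T_def)
    have wSR: "w \<in> SR" using w wb ab by (simp add: SR_def)
    have Re1: "Re w \<ge> 1" using w T by linarith
    have nw: "norm w \<le> Re w + A" using cmod_le[of w] w Re1 by (auto simp: A_def)
    have e1: "exp (t::real) \<le> 1" if "t \<le> -1" for t using that by simp
    have "Re w - b \<ge> 0" using wb by linarith
    note re' = Re_scaled_ge[OF \<beta> this, of \<theta>]
    have re: "Re (-(\<beta> * (w - b) + \<i> * \<theta>)) \<le> -1" by (rule order_trans[OF re']) (use wb in linarith)
    have "norm (Ln (1 - exp (-(\<beta> * (w - b) + \<i> * \<theta>)))) \<le> 2 * exp (Re (-(\<beta> * (w - b) + \<i> * \<theta>)))"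
      by (rule norm_Ln_one_minus_exp, rule re)
    also have "\<dots> \<le> 2 * 1" by (rule mult_left_mono, rule e1, rule re) simp
    finally have 1: "norm (Ln (1 - exp (-(\<beta> * (w - b) + \<i> * \<theta>)))) \<le> 2" by simp
    have 2: "norm (Ln (1 - exp (- (w - a j)))) \<le> 2" if "j < L" for j
    proof -
      have re: "Re (-(w - a j)) \<le> -1" using a[OF that] wb by simp
      have "norm (Ln (1 - exp (-(w - a j)))) \<le> 2 * exp (Re (-(w - a j)))" by (rule norm_Ln_one_minus_exp[OF re])
      also have "\<dots> \<le> 2 * 1" by (rule mult_left_mono, rule e1, rule re) simp
      finally show ?thesis by simp
    qed
    have 3: "norm (\<beta> * (w - b) + \<i> * \<theta> + \<i> * pi + Ln (1 - exp (-(\<beta> * (w - b) + \<i> * \<theta>)))) \<le> \<beta> * (Re w + A + \<bar>b\<bar>) + \<bar>\<theta>\<bar> + pi + 2"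
    proof -
      have "norm (w - b) \<le> Re w + A + \<bar>b\<bar>"
        using nw norm_triangle_ineq4[of w b] by simp
      hence "\<beta> * norm (w - b) \<le> \<beta> * (Re w + A + \<bar>b\<bar>)" using \<beta> by (intro mult_left_mono) auto
      hence n1: "norm (\<beta> * (w - b)) \<le> \<beta> * (Re w + A + \<bar>b\<bar>)" using \<beta> by (simp add: norm_mult)
      have n2: "norm (\<i> * \<theta>) \<le> \<bar>\<theta>\<bar>" "norm (\<i> * pi) \<le> pi" by (simp_all add: norm_mult)
      show ?thesis by (intro norm_triangle_le add_mono n1 n2 1)
    qed
    have 4: "norm (w - a j + \<i> * pi + Ln (1 - exp (-(w - a j)))) \<le> Re w + A + norm (a j) + pi + 2" if "j < L" for j
    proof -
      have n2: "norm (\<i> * pi) \<le> pi" by (simp add: norm_mult)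
      have n1: "norm (w - a j) \<le> Re w + A + norm (a j)" using nw norm_triangle_ineq4[of w "a j"] by simp
      show ?thesis by (intro norm_triangle_le add_mono n1 n2 2 that)
    qed
    have "norm (\<Psi> w) = norm (EL' w + of_int k * (2 * pi * \<i>))"
      using k[OF wSR] by (simp add: algebra_simps)
    also have "\<dots> \<le> (\<beta> * (Re w + A + \<bar>b\<bar>) + \<bar>\<theta>\<bar> + pi + 2 + (\<Sum>j<L. Re w + A + norm (a j) + pi + 2)) + \<bar>real_of_int k\<bar> * (2 * pi)"
    proof (intro norm_triangle_le add_mono)
      show "norm (EL' w) \<le> \<beta> * (Re w + A + \<bar>b\<bar>) + \<bar>\<theta>\<bar> + pi + 2 + (\<Sum>j<L. Re w + A + norm (a j) + pi + 2)"
        unfolding EL'_def by (rule norm_triangle_le_diff, rule add_mono[OF 3], rule sum_norm_le, rule 4) simp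
    qed (simp add: norm_mult)
    also have "\<dots> \<le> CR * (1 + Re w)"
    proof -
      have m: "c \<le> c * (1 + Re w)" if "c \<ge> 0" for c
        using mult_left_mono[of 1 "1 + Re w" c] that Re1 by simp
      have A0: "A \<ge> 0" by (simp add: A_def)
      have "\<beta> * (Re w + A + \<bar>b\<bar>) + \<bar>\<theta>\<bar> + pi + 2 \<le> c1 * (1 + Re w)"
      proof -
        have "Re w + A + \<bar>b\<bar> \<le> (2 + \<bar>b\<bar> + A) * (1 + Re w)"
          using Re1 A0 by (simp add: algebra_simps)
        hence "\<beta> * (Re w + A + \<bar>b\<bar>) \<le> \<beta> * ((2 + \<bar>b\<bar> + A) * (1 + Re w))" using \<beta> by (intro mult_left_mono) auto
        moreover have "\<bar>\<theta>\<bar> + pi + 2 \<le> (\<bar>\<theta>\<bar> + pi + 2) * (1 + Re w)" by (rule m) auto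
        ultimately show ?thesis by (simp add: c1_def algebra_simps)
      qed
      moreover have "(\<Sum>j<L. Re w + A + norm (a j) + pi + 2) \<le> c2 * (1 + Re w)"
        unfolding sum_distrib_right c2_def
      proof (rule sum_mono)
        fix j
        have "A + norm (a j) + pi + 2 \<le> (A + norm (a j) + pi + 2) * (1 + Re w)" using A0 by (intro m) auto
        thus "Re w + A + norm (a j) + pi + 2 \<le> (1 + A + norm (a j) + pi + 2) * (1 + Re w)"
          by (simp add: algebra_simps)
      qed
      moreover have "\<bar>real_of_int k\<bar> * (2 * pi) \<le> \<bar>real_of_int k\<bar> * (2 * pi) * (1 + Re w)" by (rule m) auto
      ultimately show ?thesis unfolding CR_def distrib_right[of _ _ "1 + Re w"] by (intro add_mono)
    qed
    finally show ?thesis .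
  qed
  define C where "C = max (max CL CR) (B * exp T)"
  have Be: "B \<le> B * exp T" using B0 T mult_left_mono[of 1 "exp T" B] by simp
  show ?thesis
  proof (rule that[of \<Psi> C])
    show "exp (\<Psi> w) = R w" if "a' < Im w" "Im w < b'" for w using exp\<Psi> P(2) that by simp
    show "norm (\<Psi> w) \<le> C * (1 + Re w)" if w: "p \<le> Im w" "Im w \<le> q" "Re w \<ge> 0" for w
    proof (cases "Re w \<ge> T")
      case True
      have "norm (\<Psi> w) \<le> CR * (1 + Re w)" by (rule right[OF w(1,2) True])
      also have "\<dots> \<le> C * (1 + Re w)" using w by (intro mult_right_mono) (auto simp: C_def)
      finally show ?thesis .
    next
      case False
      have "norm (\<Psi> w) \<le> B * 1" using B[of w] w False T by (simp add: in_cbox_complex_iff)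
      also have "\<dots> \<le> C * (1 + Re w)" using w Be B0 by (intro mult_mono) (auto simp: C_def)
      finally show ?thesis .
    qed
    show "norm (\<Psi> w) \<le> C * exp (Re w)" if w: "p \<le> Im w" "Im w \<le> q" "Re w \<le> 0" for w
    proof (cases "Re w \<le> - T")
      case True
      have "norm (\<Psi> w) \<le> CL * exp (Re w)" using left[of w] w ab True by simp
      also have "\<dots> \<le> C * exp (Re w)" by (intro mult_right_mono) (auto simp: C_def)
      finally show ?thesis .
    next
      case False
      have "norm (\<Psi> w) \<le> B * 1" using B[of w] w False T by (simp add: in_cbox_complex_iff)
      also have "\<dots> \<le> B * (exp T * exp (Re w))" using False B0 by (intro mult_left_mono) (auto simp: exp_add[symmetric])
      also have "\<dots> = (B * exp T) * exp (Re w)" by simp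
      also have "\<dots> \<le> C * exp (Re w)" by (intro mult_right_mono) (auto simp: C_def)
      finally show ?thesis .
    qed
  qed (rule h\<Psi>)
qed

text \<open>Lines at vertical distance 2 pi represent the same ray of the plane, so integrals along
  them against the kernel can be combined into one.\<close>

lemma kap_periodic: "kap (w - 2 * pi * \<i>) = kap w"
  using exp_two_pi_i by (simp add: kap_def exp_diff mult_ac)

lemma deriv_atoms_poly:
  assumes j: "j < L" and inj: "\<And>i. i < L \<Longrightarrow> i \<noteq> j \<Longrightarrow> exp (a j - a i) \<noteq> 1"
  shows "deriv (atoms_poly L a) (a j) \<noteq> 0"
proof -
  have split: "atoms_poly L a w = (1 - exp (w - a j)) * (\<Prod>i\<in>{..<L}-{j}. 1 - exp (w - a i))" for w
    unfolding atoms_poly_def using j by (subst prod.remove[of _ j]) auto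
  define h where "h = (\<lambda>w. \<Prod>i\<in>{..<L}-{j}. 1 - exp (w - a i))"
  have "h holomorphic_on UNIV" unfolding h_def by (intro holomorphic_intros)
  hence h: "(h has_field_derivative deriv h (a j)) (at (a j))" by (intro holomorphic_derivI[of _ UNIV]) auto
  have "((\<lambda>w. (1 - exp (w - a j)) * h w) has_field_derivative
       (1 - exp (a j - a j)) * deriv h (a j) + (- exp (a j - a j)) * h (a j)) (at (a j))"
    by (rule derivative_eq_intros h refl | simp)+
  moreover have "atoms_poly L a = (\<lambda>w. (1 - exp (w - a j)) * h w)"
    using split by (auto simp: h_def)
  ultimately have "deriv (atoms_poly L a) (a j) = - h (a j)"
    by (simp add: DERIV_imp_deriv)
  thus ?thesis using inj by (auto simp: h_def)
qed

lemma holomorphic_atoms_poly: "atoms_poly L a holomorphic_on S"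
  unfolding atoms_poly_def[abs_def] by (intro holomorphic_intros)

lemma inv_mult_cancel: "c \<noteq> 0 \<Longrightarrow> inverse c * (c * u) = (u::complex)"
  by (simp add: mult.assoc[symmetric])

lemma two_pi_less_cancel: "2 * pi * a < 2 * pi * b \<Longrightarrow> a < b"
  using mult_less_cancel_left_pos[of "2 * pi" a b] by simp

subsection \<open>Noninteger powers on a sector\<close>

text \<open>In w = ln z the rays of argument 0 and \<open>\<eta>\<close> cut the plane into strips
  of heights \<open>\<eta>\<close> and 2 pi - \<open>\<eta>\<close>. On the smaller one the phase -
  \<gamma> is used in \<open>1 - exp (\<beta> * (w - b) + \<i> * \<theta>)\<close>, on the larger
  one the phase \<gamma>. Opposite phases make the modulus continuous across argument 0. Across
  argument \<open>\<eta>\<close> the same requires \<open>\<beta> * \<eta>\<close> to equal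
  \<open>pi * s\<close> modulo pi, which is the origin of \<open>\<eta>\<close>.\<close>

locale sector_kernel =
  fixes \<beta> \<eta> s :: real and L :: nat
  assumes s: "0 < s" "s < 1" and L: "L \<ge> 1" and \<beta>: "\<beta> = real L + s" and \<eta>: "\<eta> = pi * s / \<beta>"
begin

lemma \<beta>1: "\<beta> > 1" using s L \<beta> by simp

lemma \<beta>\<eta>: "\<beta> * \<eta> = pi * s" using \<beta>1 \<eta> by simp

lemma \<eta>_pos: "\<eta> > 0" using \<eta> \<beta>1 s by simp

lemma \<eta>_less: "\<eta> < pi"
proof -
  have "s / \<beta> < 1" using s \<beta>1 by (simp add: field_simps)
  hence "pi * (s / \<beta>) < pi * 1" by (intro mult_strict_left_mono) auto
  thus ?thesis by (simp add: \<eta>)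
qed

definition G :: "real \<Rightarrow> real \<Rightarrow> complex \<Rightarrow> complex" where
  "G b \<theta> w = 1 - exp (complex_of_real \<beta> * (w - complex_of_real b) + \<i> * \<theta>)"

definition atom :: "real \<Rightarrow> real \<Rightarrow> nat \<Rightarrow> complex" where
  "atom b \<gamma> j = Complex b (- (\<gamma> + 2 * pi * real j) / \<beta>)"

text \<open>The mass on a boundary ray within distance \<open>exp x\<close> of the origin, namely the jump of the logarithm of \<open>G\<close>
  across the ray divided by \<open>2 * pi * \<i>\<close>.\<close>

definition lam :: "real \<Rightarrow> real \<Rightarrow> real \<Rightarrow> real" where
  "lam b \<alpha> x = Im (Ln (1 + exp (\<beta> * (x - b)) * cis \<alpha>)) / pi"

lemma holomorphic_G: "G b \<theta> holomorphic_on S"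
  unfolding G_def[abs_def] by (intro holomorphic_intros)

lemma G_eq_0D:
  assumes "G b \<theta> w = 0"
  obtains n :: int where "Re w = b" "\<beta> * Im w + \<theta> = 2 * pi * of_int n"
proof -
  from assms have "exp (\<beta> * (w - b) + \<i> * \<theta>) = 1" by (simp add: G_def)
  then obtain n :: int where "Re (\<beta> * (w - b) + \<i> * \<theta>) = 0" "Im (\<beta> * (w - b) + \<i> * \<theta>) = of_int (2 * n) * pi"
    by (auto simp: exp_eq_1)
  thus ?thesis using \<beta>1 by (intro that[of n]) (auto simp: algebra_simps)
qed

lemma G_atom: "G b \<gamma> (atom b \<gamma> j) = 0" "deriv (G b \<gamma>) (atom b \<gamma> j) \<noteq> 0"
proof -
  have "\<beta> * (atom b \<gamma> j - b) + \<i> * \<gamma> = \<i> * of_real (- 2 * pi * real j)"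
    using \<beta>1 by (simp add: atom_def complex_eq_iff field_simps)
  also have "exp \<dots> = 1" by (auto simp: exp_eq_1 intro!: exI[of _ "- int j"])
  finally have e: "exp (\<beta> * (atom b \<gamma> j - b) + \<i> * \<gamma>) = 1" .
  thus "G b \<gamma> (atom b \<gamma> j) = 0" by (simp add: G_def)
  have "(G b \<gamma> has_field_derivative - (exp (\<beta> * (atom b \<gamma> j - b) + \<i> * \<gamma>) * \<beta>)) (at (atom b \<gamma> j))"
    unfolding G_def[abs_def] by (rule derivative_eq_intros refl | simp)+
  hence "deriv (G b \<gamma>) (atom b \<gamma> j) = - (exp (\<beta> * (atom b \<gamma> j - b) + \<i> * \<gamma>) * \<beta>)"
    by (rule DERIV_imp_deriv)
  thus "deriv (G b \<gamma>) (atom b \<gamma> j) \<noteq> 0" using e \<beta>1 by simp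
qed

text \<open>The window for \<open>\<gamma>\<close> has length \<open>pi * s\<close>, that is
  \<open>\<beta> * \<eta>\<close>. For \<open>\<gamma>\<close> in it all L zeros keep the distance
  \<open>pi / \<beta>\<close> from the two lines that bound the larger strip.\<close>

lemma Im_atom:
  assumes "pi \<le> \<gamma>" "\<gamma> \<le> pi + pi * s" "j < L"
  shows "Im (atom b \<gamma> j) \<le> - (pi / \<beta>)" "Im (atom b \<gamma> j) \<ge> \<eta> - 2 * pi + pi / \<beta>"
proof -
  have jL: "real j \<le> real L - 1" using assms(3) by linarith
  have "0 \<le> 2 * pi * real j" by simp
  hence "pi \<le> \<gamma> + 2 * pi * real j" using assms(1) by linarith
  hence "pi / \<beta> \<le> (\<gamma> + 2 * pi * real j) / \<beta>" using \<beta>1 by (intro divide_right_mono) auto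
  thus "Im (atom b \<gamma> j) \<le> - (pi / \<beta>)" unfolding atom_def complex.sel minus_divide_left by (simp only: minus_divide_left[symmetric] neg_le_iff_le)
  have "pi * (2 * real j) \<le> pi * (2 * (real L - 1))" using jL by (intro mult_left_mono) auto
  hence "\<gamma> + 2 * pi * real j \<le> 2 * pi * \<beta> - \<beta> * \<eta> - pi"
    using assms(2) unfolding \<beta>\<eta> by (simp add: \<beta> algebra_simps)
  hence "(\<gamma> + 2 * pi * real j) / \<beta> \<le> (2 * pi * \<beta> - \<beta> * \<eta> - pi) / \<beta>"
    using \<beta>1 by (intro divide_right_mono) auto
  also have "\<dots> = 2 * pi - \<eta> - pi / \<beta>" using \<beta>1 by (simp add: diff_divide_distrib)
  finally show "Im (atom b \<gamma> j) \<ge> \<eta> - 2 * pi + pi / \<beta>"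
    unfolding atom_def complex.sel minus_divide_left[symmetric] by linarith
qed

text \<open>Zeros of \<open>G b \<gamma>\<close> lie on \<open>Re w = b\<close> where
  \<open>\<beta> * Im w + \<gamma>\<close> is a multiple of 2 pi, and the strip leaves room for
  exactly L multiples. It is widened by \<open>\<epsilon>\<close> so that both integration lines
  become interior; \<open>\<beta> * \<epsilon> < pi * (1 - s)\<close> lets no further multiple in,
  and \<open>2 * \<epsilon> < \<eta>\<close> keeps the height below 2 pi.\<close>

lemma nonvanishing_quotient_below:
  assumes \<gamma>: "pi \<le> \<gamma>" "\<gamma> \<le> pi + pi * s" and \<epsilon>: "0 < \<epsilon>" "2 * \<epsilon> < \<eta>" "\<beta> * \<epsilon> < pi * (1 - s)"
  obtains R where "R holomorphic_on {w. \<eta> - 2 * pi - \<epsilon> < Im w \<and> Im w < \<epsilon>}"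
    "\<And>w. \<eta> - 2 * pi - \<epsilon> < Im w \<Longrightarrow> Im w < \<epsilon> \<Longrightarrow> R w \<noteq> 0"
    "\<And>w. \<eta> - 2 * pi - \<epsilon> < Im w \<Longrightarrow> Im w < \<epsilon> \<Longrightarrow> G b \<gamma> w = R w * atoms_poly L (atom b \<gamma>) w"
proof -
  let ?S = "{w. \<eta> - 2 * pi - \<epsilon> < Im w \<and> Im w < \<epsilon>}"
  let ?K = "atom b \<gamma> ` {..<L}"
  have pb: "pi / \<beta> > 0" using \<beta>1 by simp
  have KS: "?K \<subseteq> ?S"
    using Im_atom[OF \<gamma>, of _ b] pb \<epsilon> by fastforce
  have Den0: "w = atom b \<gamma> j" if "w \<in> ?S" "j < L" "exp (w - atom b \<gamma> j) = 1" for w j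
  proof -
    have "atom b \<gamma> j \<in> ?S" using KS that by auto
    hence "\<bar>Im (w - atom b \<gamma> j)\<bar> < 2 * pi" using that(1) \<epsilon> by (auto simp: abs_less_iff)
    from exp_eq_1_strip[OF that(3) this] show ?thesis by simp
  qed
  have atom_inj: "atom b \<gamma> i \<noteq> atom b \<gamma> j" if "i \<noteq> j" for i j
    using that \<beta>1 by (auto simp: atom_def)
  obtain R where "R holomorphic_on ?S" "\<And>w. w \<in> ?S \<Longrightarrow> R w \<noteq> 0"
    "\<And>w. w \<in> ?S \<Longrightarrow> G b \<gamma> w = R w * atoms_poly L (atom b \<gamma>) w"
  proof (rule nonvanishing_quotient[OF open_strip _ KS holomorphic_G holomorphic_atoms_poly])
    fix z assume "z \<in> ?K"
    then obtain j where j: "j < L" "z = atom b \<gamma> j" by auto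
    have "deriv (atoms_poly L (atom b \<gamma>)) z \<noteq> 0" unfolding j(2)
    proof (rule deriv_atoms_poly[OF j(1)])
      show "exp (atom b \<gamma> j - atom b \<gamma> i) \<noteq> 1" if "i < L" "i \<noteq> j" for i
        using Den0[of "atom b \<gamma> j" i] atom_inj[of j i] that KS j(1) by auto
    qed
    moreover have "atoms_poly L (atom b \<gamma>) z = 0"
      using j by (auto simp: atoms_poly_def intro!: bexI[of _ j])
    ultimately show "G b \<gamma> z = 0 \<and> atoms_poly L (atom b \<gamma>) z = 0 \<and> deriv (G b \<gamma>) z \<noteq> 0 \<and> deriv (atoms_poly L (atom b \<gamma>)) z \<noteq> 0"
      using G_atom[of b \<gamma> j] j by simp
  next
    fix w assume w: "w \<in> ?S - ?K"
    have "atoms_poly L (atom b \<gamma>) w \<noteq> 0"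
      using Den0[of w] w by (auto simp: atoms_poly_def)
    moreover have "G b \<gamma> w \<noteq> 0"
    proof
      assume "G b \<gamma> w = 0"
      then obtain n :: int where n: "Re w = b" "\<beta> * Im w + \<gamma> = 2 * pi * of_int n" by (rule G_eq_0D)
      have "\<beta> * Im w < \<beta> * \<epsilon>" "\<beta> * (\<eta> - 2 * pi - \<epsilon>) < \<beta> * Im w"
        using w \<beta>1 by (auto intro!: mult_strict_left_mono)
      moreover have "\<beta> * (\<eta> - 2 * pi - \<epsilon>) = pi * s - 2 * pi * (real L + s) - \<beta> * \<epsilon>"
        using \<beta>\<eta> \<beta> by (simp add: algebra_simps)
      moreover have "pi * (1 - s) = pi - pi * s" "2 * pi * (real L + s) = 2 * pi * real L + 2 * (pi * s)" "2 * pi * (- real L) = - (2 * pi * real L)"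
        by (simp_all add: algebra_simps)
      ultimately have "2 * pi * of_int n < 2 * pi * 1" "2 * pi * (- real L) < 2 * pi * of_int n"
        using n \<gamma> \<epsilon> by linarith+
      hence "real_of_int n < 1" "- real L < of_int n"
        using two_pi_less_cancel[of "of_int n" 1] two_pi_less_cancel[of "- real L" "of_int n"] by blast+
      hence n': "n \<le> 0" "- int L < n" by linarith+
      hence "w = atom b \<gamma> (nat (- n))" "nat (- n) < L"
        using n \<beta>1 by (auto simp: atom_def complex_eq_iff field_simps)
      thus False using w by auto
    qed
    ultimately show "G b \<gamma> w \<noteq> 0 \<and> atoms_poly L (atom b \<gamma>) w \<noteq> 0" by blast
  qed auto
  thus ?thesis by (intro that[of R]) auto
qed

text \<open>On this strip \<open>\<beta> * Im w - \<gamma>\<close> stays strictly between -2 pi and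
  0, so \<open>G b (- \<gamma>)\<close> has no zeros, and the atoms lie below the strip. Dividing by
  the same polynomial as on the other strip makes it cancel in the jumps across the rays.\<close>

lemma nonvanishing_quotient_above:
  assumes \<gamma>: "pi \<le> \<gamma>" "\<gamma> \<le> pi + pi * s" and \<epsilon>: "0 < \<epsilon>" "2 * \<epsilon> < \<eta>" "\<beta> * \<epsilon> < pi * (1 - s)"
  obtains R where "R holomorphic_on {w. - \<epsilon> < Im w \<and> Im w < \<eta> + \<epsilon>}"
    "\<And>w. - \<epsilon> < Im w \<Longrightarrow> Im w < \<eta> + \<epsilon> \<Longrightarrow> R w \<noteq> 0"
    "\<And>w. - \<epsilon> < Im w \<Longrightarrow> Im w < \<eta> + \<epsilon> \<Longrightarrow> G b (- \<gamma>) w = R w * atoms_poly L (atom b \<gamma>) w"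
proof -
  let ?S = "{w. - \<epsilon> < Im w \<and> Im w < \<eta> + \<epsilon>}"
  have "pi * (1 - s) < pi * 1" using s by (intro mult_strict_left_mono) auto
  hence \<epsilon>': "\<epsilon> < pi / \<beta>" using \<epsilon> \<beta>1 by (simp add: field_simps)
  obtain R where "R holomorphic_on ?S" "\<And>w. w \<in> ?S \<Longrightarrow> R w \<noteq> 0"
    "\<And>w. w \<in> ?S \<Longrightarrow> G b (-\<gamma>) w = R w * atoms_poly L (atom b \<gamma>) w"
  proof (rule nonvanishing_quotient[OF open_strip, of "{}" "- \<epsilon>" "\<eta> + \<epsilon>" "G b (-\<gamma>)" "atoms_poly L (atom b \<gamma>)"])
    fix w assume w: "w \<in> ?S - {}"
    have "exp (w - atom b \<gamma> j) \<noteq> 1" if j: "j < L" for j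
    proof
      assume e: "exp (w - atom b \<gamma> j) = 1"
      have "\<bar>Im (w - atom b \<gamma> j)\<bar> < 2 * pi" "Im (w - atom b \<gamma> j) > 0"
        using Im_atom[OF \<gamma> j, of b] w \<epsilon>' by auto
      with exp_eq_1_strip[OF e] show False by auto
    qed
    hence "atoms_poly L (atom b \<gamma>) w \<noteq> 0" by (auto simp: atoms_poly_def)
    moreover have "G b (-\<gamma>) w \<noteq> 0"
    proof
      assume "G b (-\<gamma>) w = 0"
      then obtain n :: int where n: "Re w = b" "\<beta> * Im w + (-\<gamma>) = 2 * pi * of_int n" by (rule G_eq_0D)
      have "\<beta> * (- \<epsilon>) < \<beta> * Im w" "\<beta> * Im w < \<beta> * (\<eta> + \<epsilon>)"
        by (rule mult_strict_left_mono; use w \<beta>1 in simp)+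
      moreover have "\<beta> * (\<eta> + \<epsilon>) = pi * s + \<beta> * \<epsilon>"
        using \<beta>\<eta> by (simp add: algebra_simps)
      moreover have "pi * (1 - s) = pi - pi * s" "\<beta> * (- \<epsilon>) = - (\<beta> * \<epsilon>)" by (simp_all add: algebra_simps)
      ultimately have "2 * pi * of_int n < 2 * pi * 0" "2 * pi * (- 1) < 2 * pi * of_int n"
        using n \<gamma> \<epsilon> by linarith+
      hence "real_of_int n < 0" "- 1 < real_of_int n"
        using two_pi_less_cancel[of "of_int n" 0] two_pi_less_cancel[of "- 1" "of_int n"] by blast+
      hence "n < 0" "- 1 < n" by linarith+
      thus False by simp
    qed
    ultimately show "G b (-\<gamma>) w \<noteq> 0 \<and> atoms_poly L (atom b \<gamma>) w \<noteq> 0" by blast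
  qed (auto intro: holomorphic_G holomorphic_atoms_poly)
  thus ?thesis by (intro that[of R]) auto
qed

lemma lam_arg_notin:
  assumes "0 \<le> \<alpha>" "\<alpha> < pi"
  shows "1 + exp (\<beta> * (x - b)) * cis \<alpha> \<notin> \<real>\<^sub>\<le>\<^sub>0"
proof
  let ?q = "1 + exp (\<beta> * (x - b)) * cis \<alpha>"
  assume "?q \<in> \<real>\<^sub>\<le>\<^sub>0"
  hence q: "Re ?q \<le> 0" "Im ?q = 0" by (auto simp: complex_nonpos_Reals_iff)
  hence "sin \<alpha> = 0" by simp
  hence "\<alpha> = 0" using assms sin_gt_zero[of \<alpha>] by (cases "\<alpha> = 0") auto
  with q(1) show False using exp_gt_zero[of "\<beta> * (x - b)"] by (simp add: not_le add_pos_pos del: exp_gt_zero)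
qed

text \<open>The denominator is the conjugate of the numerator, so the difference of their logarithms
  is purely imaginary: the jump changes the phase and not the modulus, and the mass is real.\<close>

lemma exp_lam:
  assumes "0 \<le> \<alpha>" "\<alpha> < pi"
  shows "exp (2 * pi * \<i> * lam b \<alpha> x) = (1 + exp (\<beta> * (x - b)) * cis \<alpha>) / (1 + exp (\<beta> * (x - b)) * cis (-\<alpha>))"
proof -
  let ?q = "1 + exp (\<beta> * (x - b)) * cis \<alpha>"
  have q0: "?q \<noteq> 0" using lam_arg_notin[OF assms, of x b] by auto
  have "2 * pi * \<i> * lam b \<alpha> x = Ln ?q - cnj (Ln ?q)"
    by (simp add: lam_def complex_eq_iff)
  also have "exp \<dots> = ?q / cnj ?q" using q0 by (simp add: exp_diff exp_cnj[symmetric])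
  also have "cnj ?q = 1 + exp (\<beta> * (x - b)) * cis (-\<alpha>)" by (simp add: cis_cnj)
  finally show ?thesis .
qed

lemma continuous_lam:
  assumes "0 \<le> \<alpha>" "\<alpha> < pi"
  shows "continuous_on S (lam b \<alpha>)"
  unfolding lam_def[abs_def] by (intro continuous_intros) (use lam_arg_notin[OF assms] in auto)

lemma lam_tendsto_0:
  shows "(lam b \<alpha> \<longlongrightarrow> 0) at_bot"
proof -
  have e: "((\<lambda>x. exp (\<beta> * (x - b))) \<longlongrightarrow> 0) at_bot"
    using \<beta>1 by real_asymp
  have "((\<lambda>x. 1 + complex_of_real (exp (\<beta> * (x - b))) * cis \<alpha>) \<longlongrightarrow> 1 + of_real 0 * cis \<alpha>) at_bot"
    by (intro tendsto_intros e)
  hence "((\<lambda>x. 1 + complex_of_real (exp (\<beta> * (x - b))) * cis \<alpha>) \<longlongrightarrow> 1) at_bot" by simp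
  hence "((\<lambda>x. Im (Ln (1 + complex_of_real (exp (\<beta> * (x - b))) * cis \<alpha>)) / pi) \<longlongrightarrow> Im (Ln 1) / pi) at_bot"
    by (intro tendsto_intros) auto
  thus ?thesis by (simp add: lam_def[abs_def])
qed

text \<open>Both sides are continuous logarithms of one function and both vanish at the left end, so
  the integer between them is 0. This is the second use of the normalization of the
  logarithms.\<close>

lemma jump_relation:
  fixes D :: "real \<Rightarrow> complex"
  assumes \<alpha>: "0 \<le> \<alpha>" "\<alpha> < pi" and cont: "continuous_on UNIV D" and lim: "(D \<longlongrightarrow> 0) at_bot"
    and ex: "\<And>x. exp (D x) = (1 + exp (\<beta> * (x - b)) * cis \<alpha>) / (1 + exp (\<beta> * (x - b)) * cis (-\<alpha>))"
  shows "D x = 2 * pi * \<i> * lam b \<alpha> x"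
proof -
  obtain n :: int where n: "\<And>x. x \<in> UNIV \<Longrightarrow> D x - 2 * pi * \<i> * lam b \<alpha> x = of_int n * (2 * pi * \<i>)"
  proof (rule exp_one_const[of UNIV "\<lambda>x. D x - 2 * pi * \<i> * lam b \<alpha> x"])
    show "connected (UNIV :: real set)" by (rule connected_UNIV)
    show "continuous_on UNIV (\<lambda>x. D x - 2 * pi * \<i> * lam b \<alpha> x)"
      by (intro continuous_intros cont continuous_lam \<alpha>)
    show "exp (D x - 2 * pi * \<i> * lam b \<alpha> x) = 1" for x
    proof -
      have "exp (D x) = exp (2 * pi * \<i> * lam b \<alpha> x)" by (simp only: ex exp_lam[OF \<alpha>])
      thus ?thesis by (simp add: exp_diff)
    qed
  qed auto
  have "((\<lambda>x. D x - 2 * pi * \<i> * lam b \<alpha> x) \<longlongrightarrow> 0 - 2 * pi * \<i> * of_real 0) at_bot"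
    by (intro tendsto_intros lim lam_tendsto_0)
  hence "((\<lambda>x::real. of_int n * (2 * pi * \<i>)) \<longlongrightarrow> 0) at_bot" using n by simp
  hence "of_int n * (2 * pi * \<i>) = 0" by (rule tendsto_unique[OF _ tendsto_const, rotated]) simp
  with n[of x] show ?thesis by simp
qed

lemma sector_logs:
  assumes \<gamma>: "pi \<le> \<gamma>" "\<gamma> \<le> pi + pi * s" and \<epsilon>: "0 < \<epsilon>" "2 * \<epsilon> < \<eta>" "\<beta> * \<epsilon> < pi * (1 - s)"
  obtains \<Psi>1 \<Psi>2 C1 C2 where
    "\<Psi>1 holomorphic_on {w. \<eta> - 2 * pi - \<epsilon> < Im w \<and> Im w < \<epsilon>}"
    "\<Psi>2 holomorphic_on {w. - \<epsilon> < Im w \<and> Im w < \<eta> + \<epsilon>}"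
    "\<And>w. \<eta> - 2 * pi - \<epsilon> < Im w \<Longrightarrow> Im w < \<epsilon> \<Longrightarrow> G b \<gamma> w = exp (\<Psi>1 w) * atoms_poly L (atom b \<gamma>) w"
    "\<And>w. - \<epsilon> < Im w \<Longrightarrow> Im w < \<eta> + \<epsilon> \<Longrightarrow> G b (- \<gamma>) w = exp (\<Psi>2 w) * atoms_poly L (atom b \<gamma>) w"
    "\<And>w. \<eta> - 2 * pi \<le> Im w \<Longrightarrow> Im w \<le> 0 \<Longrightarrow> Re w \<ge> 0 \<Longrightarrow> norm (\<Psi>1 w) \<le> C1 * (1 + Re w)"
    "\<And>w. \<eta> - 2 * pi \<le> Im w \<Longrightarrow> Im w \<le> 0 \<Longrightarrow> Re w \<le> 0 \<Longrightarrow> norm (\<Psi>1 w) \<le> C1 * exp (Re w)"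
    "\<And>w. 0 \<le> Im w \<Longrightarrow> Im w \<le> \<eta> \<Longrightarrow> Re w \<ge> 0 \<Longrightarrow> norm (\<Psi>2 w) \<le> C2 * (1 + Re w)"
    "\<And>w. 0 \<le> Im w \<Longrightarrow> Im w \<le> \<eta> \<Longrightarrow> Re w \<le> 0 \<Longrightarrow> norm (\<Psi>2 w) \<le> C2 * exp (Re w)"
    "\<And>x. \<Psi>1 (Complex x 0) - \<Psi>2 (Complex x 0) = 2 * pi * \<i> * lam b (\<gamma> - pi) x"
    "\<And>x. \<Psi>2 (Complex x \<eta>) - \<Psi>1 (Complex x (\<eta> - 2 * pi)) = 2 * pi * \<i> * lam b (pi + pi * s - \<gamma>) x"
proof -
  have pis: "pi * s < pi" using s by simp
  obtain R1 where R1: "R1 holomorphic_on {w. \<eta> - 2 * pi - \<epsilon> < Im w \<and> Im w < \<epsilon>}"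
    "\<And>w. \<eta> - 2 * pi - \<epsilon> < Im w \<Longrightarrow> Im w < \<epsilon> \<Longrightarrow> R1 w \<noteq> 0"
    "\<And>w. \<eta> - 2 * pi - \<epsilon> < Im w \<Longrightarrow> Im w < \<epsilon> \<Longrightarrow> G b \<gamma> w = R1 w * atoms_poly L (atom b \<gamma>) w"
    using nonvanishing_quotient_below[OF \<gamma> \<epsilon>, of b] by blast
  obtain R2 where R2: "R2 holomorphic_on {w. - \<epsilon> < Im w \<and> Im w < \<eta> + \<epsilon>}"
    "\<And>w. - \<epsilon> < Im w \<Longrightarrow> Im w < \<eta> + \<epsilon> \<Longrightarrow> R2 w \<noteq> 0"
    "\<And>w. - \<epsilon> < Im w \<Longrightarrow> Im w < \<eta> + \<epsilon> \<Longrightarrow> G b (- \<gamma>) w = R2 w * atoms_poly L (atom b \<gamma>) w"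
    using nonvanishing_quotient_above[OF \<gamma> \<epsilon>, of b] by blast
  have Reatom: "Re (atom b \<gamma> j) = b" for j by (simp add: atom_def)
  have b1: "1 \<le> \<beta>" using \<beta>1 by simp
  obtain \<Psi>1 C1 where P1: "\<Psi>1 holomorphic_on {w. \<eta> - 2 * pi - \<epsilon> < Im w \<and> Im w < \<epsilon>}"
    "\<And>w. \<eta> - 2 * pi - \<epsilon> < Im w \<Longrightarrow> Im w < \<epsilon> \<Longrightarrow> exp (\<Psi>1 w) = R1 w"
    "\<And>w. \<eta> - 2 * pi \<le> Im w \<Longrightarrow> Im w \<le> 0 \<Longrightarrow> Re w \<ge> 0 \<Longrightarrow> norm (\<Psi>1 w) \<le> C1 * (1 + Re w)"
    "\<And>w. \<eta> - 2 * pi \<le> Im w \<Longrightarrow> Im w \<le> 0 \<Longrightarrow> Re w \<le> 0 \<Longrightarrow> norm (\<Psi>1 w) \<le> C1 * exp (Re w)"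
  proof (rule log_strip[of R1 "\<eta> - 2 * pi - \<epsilon>" \<epsilon> \<beta> b \<gamma> L "atom b \<gamma>" "\<eta> - 2 * pi" 0])
    show "1 - exp (\<beta> * (w - b) + \<i> * \<gamma>) = R1 w * atoms_poly L (atom b \<gamma>) w"
      if "\<eta> - 2 * pi - \<epsilon> < Im w" "Im w < \<epsilon>" for w :: complex
      using R1(3)[OF that] by (simp add: G_def)
  qed (use R1 b1 Reatom \<epsilon> \<eta>_less pi_gt_zero in \<open>auto\<close>)
  obtain \<Psi>2 C2 where P2: "\<Psi>2 holomorphic_on {w. - \<epsilon> < Im w \<and> Im w < \<eta> + \<epsilon>}"
    "\<And>w. - \<epsilon> < Im w \<Longrightarrow> Im w < \<eta> + \<epsilon> \<Longrightarrow> exp (\<Psi>2 w) = R2 w"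
    "\<And>w. 0 \<le> Im w \<Longrightarrow> Im w \<le> \<eta> \<Longrightarrow> Re w \<ge> 0 \<Longrightarrow> norm (\<Psi>2 w) \<le> C2 * (1 + Re w)"
    "\<And>w. 0 \<le> Im w \<Longrightarrow> Im w \<le> \<eta> \<Longrightarrow> Re w \<le> 0 \<Longrightarrow> norm (\<Psi>2 w) \<le> C2 * exp (Re w)"
  proof (rule log_strip[of R2 "- \<epsilon>" "\<eta> + \<epsilon>" \<beta> b "-\<gamma>" L "atom b \<gamma>" 0 \<eta>])
    show "1 - exp (\<beta> * (w - b) + \<i> * (-\<gamma>)) = R2 w * atoms_poly L (atom b \<gamma>) w"
      if "- \<epsilon> < Im w" "Im w < \<eta> + \<epsilon>" for w :: complex
      using R2(3)[OF that] by (simp add: G_def)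
  qed (use R2 b1 Reatom \<epsilon> \<eta>_pos in \<open>auto\<close>)
  have G1: "G b \<gamma> w = exp (\<Psi>1 w) * atoms_poly L (atom b \<gamma>) w" if "\<eta> - 2 * pi - \<epsilon> < Im w" "Im w < \<epsilon>" for w
    using R1(3)[OF that] P1(2)[OF that] by simp
  have G2: "G b (-\<gamma>) w = exp (\<Psi>2 w) * atoms_poly L (atom b \<gamma>) w" if "- \<epsilon> < Im w" "Im w < \<eta> + \<epsilon>" for w
    using R2(3)[OF that] P2(2)[OF that] by simp
  have ecis: "exp (\<beta> * (Complex x y - b) + \<i> * \<theta>) = exp (\<beta> * (x - b)) * cis (\<beta> * y + \<theta>)" for x y \<theta> :: real
  proof -
    have "\<beta> * (Complex x y - b) + \<i> * \<theta> = complex_of_real (\<beta> * (x - b)) + \<i> * complex_of_real (\<beta> * y + \<theta>)"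
      by (simp add: complex_eq_iff)
    thus ?thesis by (simp only: exp_add exp_of_real cis_conv_exp)
  qed
  have cispi: "cis (y + pi) = - cis y" "cis (y - pi) = - cis y" for y
    by (simp_all add: complex_eq_iff)
  have expq: "exp (A - B) = X / Y" if "X = exp A * d" "Y = exp B * d" "d \<noteq> 0" for A B X Y d :: complex
    using that by (simp add: exp_diff)
  have contC: "continuous_on UNIV (\<lambda>x. f (Complex x y))" if "f holomorphic_on {w. p < Im w \<and> Im w < q}" "p < y" "y < q" for f p q y
    by (rule continuous_on_compose2[OF holomorphic_on_imp_continuous_on[OF that(1)]])
       (use that in \<open>auto simp: Complex_eq intro!: continuous_intros\<close>)
  have limC: "((\<lambda>x. f (Complex x y)) \<longlongrightarrow> 0) at_bot" if "\<And>w. Im w = y \<Longrightarrow> Re w \<le> 0 \<Longrightarrow> norm (f w) \<le> C * exp (Re w)"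
    for f :: "complex \<Rightarrow> complex" and y C
  proof (rule Lim_null_comparison)
    show "eventually (\<lambda>x. norm (f (Complex x y)) \<le> C * exp x) at_bot"
      using eventually_le_at_bot[of 0] by eventually_elim (use that[of "Complex _ y"] in auto)
    show "((\<lambda>x. C * exp x) \<longlongrightarrow> 0) at_bot" by real_asymp
  qed
  show ?thesis
  proof (rule that[OF P1(1) P2(1) G1 G2 P1(3,4) P2(3,4)])
    show "\<Psi>1 (Complex x 0) - \<Psi>2 (Complex x 0) = 2 * pi * \<i> * lam b (\<gamma> - pi) x" for x
    proof (rule jump_relation[of "\<gamma> - pi"])
      show "continuous_on UNIV (\<lambda>x. \<Psi>1 (Complex x 0) - \<Psi>2 (Complex x 0))"
        using \<epsilon> \<eta>_pos \<eta>_less pi_gt_zero by (intro continuous_intros contC[OF P1(1)] contC[OF P2(1)]) linarith+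
      have "((\<lambda>x. \<Psi>1 (Complex x 0) - \<Psi>2 (Complex x 0)) \<longlongrightarrow> 0 - 0) at_bot"
        using \<eta>_pos \<eta>_less pi_gt_zero by (intro tendsto_diff limC[of 0 \<Psi>1 C1] limC[of 0 \<Psi>2 C2] P1(4) P2(4)) linarith+
      thus "((\<lambda>x. \<Psi>1 (Complex x 0) - \<Psi>2 (Complex x 0)) \<longlongrightarrow> 0) at_bot" by simp
      fix x :: real
      have "G b \<gamma> (Complex x 0) = exp (\<Psi>1 (Complex x 0)) * atoms_poly L (atom b \<gamma>) (Complex x 0)"
        using \<epsilon> \<eta>_less pi_gt_zero by (intro G1) auto
      moreover have "G b (-\<gamma>) (Complex x 0) = exp (\<Psi>2 (Complex x 0)) * atoms_poly L (atom b \<gamma>) (Complex x 0)"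
        using \<epsilon> \<eta>_pos by (intro G2) auto
      moreover have "atoms_poly L (atom b \<gamma>) (Complex x 0) \<noteq> 0"
      proof -
        have "exp (Complex x 0 - atom b \<gamma> j) \<noteq> 1" if j: "j < L" for j
        proof
          assume e: "exp (Complex x 0 - atom b \<gamma> j) = 1"
          have "pi / \<beta> > 0" using \<beta>1 by simp
          hence "\<bar>Im (Complex x 0 - atom b \<gamma> j)\<bar> < 2 * pi" "Im (Complex x 0 - atom b \<gamma> j) > 0"
            using Im_atom[OF \<gamma> j, of b] \<eta>_pos by auto
          with exp_eq_1_strip[OF e] show False by auto
        qed
        thus ?thesis by (auto simp: atoms_poly_def)
      qed
      ultimately have "exp (\<Psi>1 (Complex x 0) - \<Psi>2 (Complex x 0)) = G b \<gamma> (Complex x 0) / G b (-\<gamma>) (Complex x 0)"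
        by (rule expq)
      also have "G b \<gamma> (Complex x 0) = 1 + exp (\<beta> * (x - b)) * cis (\<gamma> - pi)"
        unfolding G_def ecis cispi by simp
      also have "G b (-\<gamma>) (Complex x 0) = 1 + exp (\<beta> * (x - b)) * cis (-(\<gamma> - pi))"
        unfolding G_def ecis using cispi(1)[of "-\<gamma>"] by (simp add: algebra_simps)
      finally show "exp (\<Psi>1 (Complex x 0) - \<Psi>2 (Complex x 0)) = (1 + exp (\<beta> * (x - b)) * cis (\<gamma> - pi)) / (1 + exp (\<beta> * (x - b)) * cis (-(\<gamma> - pi)))" .
    qed (use \<gamma> pis in \<open>linarith+\<close>)
    show "\<Psi>2 (Complex x \<eta>) - \<Psi>1 (Complex x (\<eta> - 2 * pi)) = 2 * pi * \<i> * lam b (pi + pi * s - \<gamma>) x" for x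
    proof (rule jump_relation[of "pi + pi * s - \<gamma>"])
      show "continuous_on UNIV (\<lambda>x. \<Psi>2 (Complex x \<eta>) - \<Psi>1 (Complex x (\<eta> - 2 * pi)))"
        using \<epsilon> \<eta>_pos \<eta>_less pi_gt_zero by (intro continuous_intros contC[OF P1(1)] contC[OF P2(1)]) linarith+
      have "((\<lambda>x. \<Psi>2 (Complex x \<eta>) - \<Psi>1 (Complex x (\<eta> - 2 * pi))) \<longlongrightarrow> 0 - 0) at_bot"
        using \<eta>_pos \<eta>_less pi_gt_zero by (intro tendsto_diff limC[of "\<eta> - 2 * pi" \<Psi>1 C1] limC[of \<eta> \<Psi>2 C2] P1(4) P2(4)) linarith+
      thus "((\<lambda>x. \<Psi>2 (Complex x \<eta>) - \<Psi>1 (Complex x (\<eta> - 2 * pi))) \<longlongrightarrow> 0) at_bot" by simp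
      fix x :: real
      have per: "atoms_poly L (atom b \<gamma>) (Complex x (\<eta> - 2 * pi)) = atoms_poly L (atom b \<gamma>) (Complex x \<eta>)"
      proof -
        have "exp (Complex x (\<eta> - 2 * pi) - a) = exp (Complex x \<eta> - a)" for a
        proof -
          have "Complex x (\<eta> - 2 * pi) - a = Complex x \<eta> - a - 2 * pi * \<i>" by (simp add: complex_eq_iff)
          thus ?thesis using exp_two_pi_i by (simp add: exp_diff mult_ac)
        qed
        thus ?thesis by (simp add: atoms_poly_def)
      qed
      have "G b (-\<gamma>) (Complex x \<eta>) = exp (\<Psi>2 (Complex x \<eta>)) * atoms_poly L (atom b \<gamma>) (Complex x \<eta>)"
        using \<epsilon> \<eta>_pos by (intro G2) auto
      moreover have "G b \<gamma> (Complex x (\<eta> - 2 * pi)) = exp (\<Psi>1 (Complex x (\<eta> - 2 * pi))) * atoms_poly L (atom b \<gamma>) (Complex x \<eta>)"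
        unfolding per[symmetric] using \<epsilon> \<eta>_less pi_gt_zero by (intro G1) auto
      moreover have "atoms_poly L (atom b \<gamma>) (Complex x \<eta>) \<noteq> 0"
      proof -
        have "exp (Complex x \<eta> - atom b \<gamma> j) \<noteq> 1" if j: "j < L" for j
        proof
          assume e: "exp (Complex x \<eta> - atom b \<gamma> j) = 1"
          have "pi / \<beta> > 0" using \<beta>1 by simp
          hence "\<bar>Im (Complex x \<eta> - atom b \<gamma> j)\<bar> < 2 * pi" "Im (Complex x \<eta> - atom b \<gamma> j) > 0"
            using Im_atom[OF \<gamma> j, of b] \<eta>_pos by auto
          with exp_eq_1_strip[OF e] show False by auto
        qed
        thus ?thesis by (auto simp: atoms_poly_def)
      qed
      ultimately have "exp (\<Psi>2 (Complex x \<eta>) - \<Psi>1 (Complex x (\<eta> - 2 * pi))) = G b (-\<gamma>) (Complex x \<eta>) / G b \<gamma> (Complex x (\<eta> - 2 * pi))"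
        by (rule expq)
      also have "G b (-\<gamma>) (Complex x \<eta>) = 1 + exp (\<beta> * (x - b)) * cis (pi + pi * s - \<gamma>)"
        unfolding G_def ecis \<beta>\<eta> using cispi(1)[of "pi * s - \<gamma>"] by (simp add: algebra_simps)
      also have "G b \<gamma> (Complex x (\<eta> - 2 * pi)) = 1 + exp (\<beta> * (x - b)) * cis (-(pi + pi * s - \<gamma>))"
      proof -
        \<comment> \<open>A full turn changes the phase by 2 pi \<beta>, which is 2 pi L + 2 pi s;
          the part from L is invisible to \<open>cis\<close>.\<close>
        have "\<beta> * (\<eta> - 2 * pi) + \<gamma> = (\<gamma> - pi * s) - 2 * pi * real L"
          using \<beta>\<eta> \<beta> by (simp add: algebra_simps)
        hence e: "\<beta> * (\<eta> - 2 * pi) + \<gamma> = (\<gamma> - pi * s) + (- (2 * pi * real L))" by linarith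
        have "cis (\<beta> * (\<eta> - 2 * pi) + \<gamma>) = cis (\<gamma> - pi * s) * cis (- (2 * pi * real L))"
          unfolding e cis_mult ..
        also have "cis (- (2 * pi * real L)) = 1"
          using cis_multiple_2pi[of "- real L"] by simp
        finally show ?thesis unfolding G_def ecis using cispi(2)[of "\<gamma> - pi * s"] by (simp add: algebra_simps)
      qed
      finally show "exp (\<Psi>2 (Complex x \<eta>) - \<Psi>1 (Complex x (\<eta> - 2 * pi))) = (1 + exp (\<beta> * (x - b)) * cis (pi + pi * s - \<gamma>)) / (1 + exp (\<beta> * (x - b)) * cis (-(pi + pi * s - \<gamma>)))" .
    qed (use \<gamma> pis in \<open>linarith+\<close>)
  qed
qed

text \<open>The Cauchy formulas of the two strips are added. The strip with \<open>w0\<close>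
  contributes the logarithm at \<open>w0\<close>, the other one nothing, and along the rays only the
  jumps \<open>lam\<close> survive. So \<open>Re l\<close> is the potential of the masses on the two
  rays, and \<open>w0\<close> has to avoid these.\<close>

lemma lam_contour_form:
  assumes \<gamma>: "pi \<le> \<gamma>" "\<gamma> \<le> pi + pi * s" and w0: "Im w0 \<noteq> 0" "Im w0 \<noteq> \<eta>" "\<eta> - 2 * pi < Im w0" "Im w0 < \<eta>"
  obtains l where
    "((\<lambda>X. integral {-X..X} (\<lambda>x. lam b (\<gamma> - pi) x * kap (Complex x 0 - w0) + lam b (pi + pi * s - \<gamma>) x * kap (Complex x \<eta> - w0))) \<longlongrightarrow> l) at_top"
    "G b (if Im w0 < 0 then \<gamma> else - \<gamma>) w0 = exp l * atoms_poly L (atom b \<gamma>) w0"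
proof -
  have pis: "pi * s < pi" using s by simp
  \<comment> \<open>The first two bounds serve the count of zeros. The other three keep
    \<open>w0\<close> and its translates out of the widened strip that does not belong to
    \<open>w0\<close>.\<close>
  define \<epsilon> where "\<epsilon> = Min {\<eta> / 4, pi * (1 - s) / (2 * \<beta>), \<bar>Im w0\<bar> / 2, (\<eta> - Im w0) / 2, (Im w0 - (\<eta> - 2 * pi)) / 2}"
  have pos: "\<eta> / 4 > 0" "pi * (1 - s) / (2 * \<beta>) > 0" "\<bar>Im w0\<bar> / 2 > 0" "(\<eta> - Im w0) / 2 > 0" "(Im w0 - (\<eta> - 2 * pi)) / 2 > 0"
    using \<eta>_pos s \<beta>1 w0 by auto
  hence \<epsilon>0: "\<epsilon> > 0" unfolding \<epsilon>_def by (subst Min_gr_iff) auto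
  have "\<epsilon> \<le> y" if "y \<in> {\<eta> / 4, pi * (1 - s) / (2 * \<beta>), \<bar>Im w0\<bar> / 2, (\<eta> - Im w0) / 2, (Im w0 - (\<eta> - 2 * pi)) / 2}" for y
    unfolding \<epsilon>_def using that by (intro Min_le) auto
  hence le: "\<epsilon> \<le> \<eta> / 4" "\<epsilon> \<le> pi * (1 - s) / (2 * \<beta>)" "\<epsilon> \<le> \<bar>Im w0\<bar> / 2" "\<epsilon> \<le> (\<eta> - Im w0) / 2" "\<epsilon> \<le> (Im w0 - (\<eta> - 2 * pi)) / 2"
    by blast+
  have \<epsilon>1: "2 * \<epsilon> < \<eta>" using le(1) \<eta>_pos by linarith
  have "pi * (1 - s) > 0" using s by simp
  have "\<beta> * \<epsilon> \<le> \<beta> * (pi * (1 - s) / (2 * \<beta>))" using le(2) \<beta>1 by (intro mult_left_mono) auto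
  also have "\<dots> = pi * (1 - s) / 2" using \<beta>1 by simp
  also have "\<dots> < pi * (1 - s)" using \<open>pi * (1 - s) > 0\<close> by linarith
  finally have \<epsilon>2: "\<beta> * \<epsilon> < pi * (1 - s)" .
  have \<epsilon>w: "\<epsilon> < \<bar>Im w0\<bar>" "\<epsilon> < \<eta> - Im w0" "\<epsilon> < Im w0 - (\<eta> - 2 * pi)"
    using le(3) pos(3) apply linarith using le(4) w0(4) apply (simp add: field_simps) using le(5) w0(3) by (simp add: field_simps)
  obtain \<Psi>1 \<Psi>2 C1 C2 where P:
    "\<Psi>1 holomorphic_on {w. \<eta> - 2 * pi - \<epsilon> < Im w \<and> Im w < \<epsilon>}"
    "\<Psi>2 holomorphic_on {w. - \<epsilon> < Im w \<and> Im w < \<eta> + \<epsilon>}"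
    "\<And>w. \<eta> - 2 * pi - \<epsilon> < Im w \<Longrightarrow> Im w < \<epsilon> \<Longrightarrow> G b \<gamma> w = exp (\<Psi>1 w) * atoms_poly L (atom b \<gamma>) w"
    "\<And>w. - \<epsilon> < Im w \<Longrightarrow> Im w < \<eta> + \<epsilon> \<Longrightarrow> G b (- \<gamma>) w = exp (\<Psi>2 w) * atoms_poly L (atom b \<gamma>) w"
    "\<And>w. \<eta> - 2 * pi \<le> Im w \<Longrightarrow> Im w \<le> 0 \<Longrightarrow> Re w \<ge> 0 \<Longrightarrow> norm (\<Psi>1 w) \<le> C1 * (1 + Re w)"
    "\<And>w. \<eta> - 2 * pi \<le> Im w \<Longrightarrow> Im w \<le> 0 \<Longrightarrow> Re w \<le> 0 \<Longrightarrow> norm (\<Psi>1 w) \<le> C1 * exp (Re w)"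
    "\<And>w. 0 \<le> Im w \<Longrightarrow> Im w \<le> \<eta> \<Longrightarrow> Re w \<ge> 0 \<Longrightarrow> norm (\<Psi>2 w) \<le> C2 * (1 + Re w)"
    "\<And>w. 0 \<le> Im w \<Longrightarrow> Im w \<le> \<eta> \<Longrightarrow> Re w \<le> 0 \<Longrightarrow> norm (\<Psi>2 w) \<le> C2 * exp (Re w)"
    "\<And>x. \<Psi>1 (Complex x 0) - \<Psi>2 (Complex x 0) = 2 * pi * \<i> * lam b (\<gamma> - pi) x"
    "\<And>x. \<Psi>2 (Complex x \<eta>) - \<Psi>1 (Complex x (\<eta> - 2 * pi)) = 2 * pi * \<i> * lam b (pi + pi * s - \<gamma>) x"
    by (rule sector_logs[OF \<gamma> \<epsilon>0 \<epsilon>1 \<epsilon>2, of b]) (rule that)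
  define F1 where "F1 = (\<lambda>w. \<Psi>1 w * kap (w - w0))"
  define F2 where "F2 = (\<lambda>w. \<Psi>2 w * kap (w - w0))"
  define l where "l = (if Im w0 < 0 then \<Psi>1 w0 else \<Psi>2 w0)"
  have nopole: "exp (w - w0) \<noteq> 1" if "Im (w - w0) \<noteq> 0" "\<bar>Im (w - w0)\<bar> < 2 * pi" for w
    using exp_eq_1_strip[of "w - w0"] that by auto
  have lim1: "((\<lambda>X. integral {-X..X} (\<lambda>x. F1 (Complex x (\<eta> - 2 * pi))) - integral {-X..X} (\<lambda>x. F1 (Complex x 0)))
           \<longlongrightarrow> (if Im w0 < 0 then - 2 * pi * \<i> * l else 0)) at_top"
  proof (cases "Im w0 < 0")
    case True
    have "((\<lambda>X. integral {-X..X} (\<lambda>x. F1 (Complex x (\<eta> - 2 * pi))) - integral {-X..X} (\<lambda>x. F1 (Complex x 0))) \<longlongrightarrow> - 2 * pi * \<i> * \<Psi>1 w0) at_top"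
      by (rule strip_cauchy[where a = "\<eta> - 2 * pi" and b = 0, OF P(1) _ _ _ _ _ _ P(5,6) F1_def])
         (use True \<epsilon>0 \<epsilon>1 \<eta>_less pi_gt_zero w0 in \<open>linarith | assumption\<close>)+
    thus ?thesis using True by (simp add: l_def)
  next
    case False
    have "exp (w - w0) \<noteq> 1" if "\<eta> - 2 * pi - \<epsilon> < Im w" "Im w < \<epsilon>" for w
      by (rule nopole) (use that False \<epsilon>w in \<open>auto simp: abs_less_iff\<close>)
    hence "((\<lambda>X. integral {-X..X} (\<lambda>x. F1 (Complex x (\<eta> - 2 * pi))) - integral {-X..X} (\<lambda>x. F1 (Complex x 0))) \<longlongrightarrow> 0) at_top"
      by (intro strip_cauchy_0[where a = "\<eta> - 2 * pi" and b = 0, OF P(1) _ _ _ _ P(5,6) F1_def])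
         (use \<epsilon>0 \<eta>_less pi_gt_zero in \<open>linarith | blast\<close>)+
    thus ?thesis using False by simp
  qed
  have lim2: "((\<lambda>X. integral {-X..X} (\<lambda>x. F2 (Complex x 0)) - integral {-X..X} (\<lambda>x. F2 (Complex x \<eta>)))
           \<longlongrightarrow> (if Im w0 < 0 then 0 else - 2 * pi * \<i> * l)) at_top"
  proof (cases "Im w0 < 0")
    case True
    have "exp (w - w0) \<noteq> 1" if "- \<epsilon> < Im w" "Im w < \<eta> + \<epsilon>" for w
      by (rule nopole) (use that True \<epsilon>w in \<open>auto simp: abs_less_iff\<close>)
    hence "((\<lambda>X. integral {-X..X} (\<lambda>x. F2 (Complex x 0)) - integral {-X..X} (\<lambda>x. F2 (Complex x \<eta>))) \<longlongrightarrow> 0) at_top"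
      by (intro strip_cauchy_0[where a = 0 and b = \<eta>, OF P(2) _ _ _ _ P(7,8) F2_def])
         (use \<epsilon>0 \<eta>_pos in \<open>linarith | blast\<close>)+
    thus ?thesis using True by simp
  next
    case False
    have "((\<lambda>X. integral {-X..X} (\<lambda>x. F2 (Complex x 0)) - integral {-X..X} (\<lambda>x. F2 (Complex x \<eta>))) \<longlongrightarrow> - 2 * pi * \<i> * \<Psi>2 w0) at_top"
      by (rule strip_cauchy[where a = 0 and b = \<eta>, OF P(2) _ _ _ _ _ _ P(7,8) F2_def])
         (use False \<epsilon>0 \<epsilon>1 \<eta>_less \<eta>_pos pi_gt_zero w0 in \<open>linarith | assumption\<close>)+
    thus ?thesis using False by (simp add: l_def)
  qed
  have contC: "continuous_on A (\<lambda>x. f (Complex x y))" if "f holomorphic_on {w. p < Im w \<and> Im w < q}" "p < y" "y < q" for f p q y A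
    by (rule continuous_on_compose2[OF holomorphic_on_imp_continuous_on[OF that(1)]])
       (use that in \<open>auto simp: Complex_eq intro!: continuous_intros\<close>)
  have contK: "continuous_on A (\<lambda>x. kap (Complex x y - w0))" if "Im w0 \<noteq> y" "\<bar>y - Im w0\<bar> < 2 * pi" for y A
    unfolding kap_def Complex_eq using nopole[of "Complex _ y"] that
    by (intro continuous_intros) (auto simp: Complex_eq)
  have K0: "continuous_on A (\<lambda>x. kap (Complex x 0 - w0))" "continuous_on A (\<lambda>x. kap (Complex x \<eta> - w0))" for A
    using w0 \<eta>_pos \<eta>_less by (intro contK; simp add: abs_less_iff)+
  have per: "kap (Complex x (\<eta> - 2 * pi) - w0) = kap (Complex x \<eta> - w0)" for x
  proof -
    have "Complex x (\<eta> - 2 * pi) - w0 = (Complex x \<eta> - w0) - 2 * pi * \<i>" by (simp add: complex_eq_iff)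
    thus ?thesis by (simp only: kap_periodic)
  qed
  have c1: "continuous_on A (\<lambda>x. F1 (Complex x (\<eta> - 2 * pi)))" "continuous_on A (\<lambda>x. F1 (Complex x 0))"
      "continuous_on A (\<lambda>x. F2 (Complex x 0))" "continuous_on A (\<lambda>x. F2 (Complex x \<eta>))" for A
    unfolding F1_def F2_def per using \<epsilon>0 \<eta>_pos \<eta>_less pi_gt_zero
    by (intro continuous_intros contC[OF P(1)] contC[OF P(2)] K0; linarith)+
  have i1: "(\<lambda>x. F1 (Complex x (\<eta> - 2 * pi))) integrable_on {-X..X}" "(\<lambda>x. F1 (Complex x 0)) integrable_on {-X..X}"
      "(\<lambda>x. F2 (Complex x 0)) integrable_on {-X..X}" "(\<lambda>x. F2 (Complex x \<eta>)) integrable_on {-X..X}" for X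
    by (intro integrable_continuous_real c1)+
  define J where "J = (\<lambda>x. lam b (\<gamma> - pi) x * kap (Complex x 0 - w0) + lam b (pi + pi * s - \<gamma>) x * kap (Complex x \<eta> - w0))"
  have pt: "F1 (Complex x (\<eta> - 2 * pi)) - F1 (Complex x 0) + (F2 (Complex x 0) - F2 (Complex x \<eta>)) = (- 2 * pi * \<i>) * J x" for x
  proof -
    have "F1 (Complex x (\<eta> - 2 * pi)) - F1 (Complex x 0) + (F2 (Complex x 0) - F2 (Complex x \<eta>))
      = - (\<Psi>2 (Complex x \<eta>) - \<Psi>1 (Complex x (\<eta> - 2 * pi))) * kap (Complex x \<eta> - w0) - (\<Psi>1 (Complex x 0) - \<Psi>2 (Complex x 0)) * kap (Complex x 0 - w0)"
      unfolding F1_def F2_def per by (simp add: algebra_simps)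
    thus ?thesis unfolding P(9,10) J_def by (simp add: algebra_simps)
  qed
  have int: "(- 2 * pi * \<i>) * integral {-X..X} J = integral {-X..X} (\<lambda>x. F1 (Complex x (\<eta> - 2 * pi))) - integral {-X..X} (\<lambda>x. F1 (Complex x 0))
     + (integral {-X..X} (\<lambda>x. F2 (Complex x 0)) - integral {-X..X} (\<lambda>x. F2 (Complex x \<eta>)))" for X
  proof -
    have "(- 2 * pi * \<i>) * integral {-X..X} J = integral {-X..X} (\<lambda>x. (- 2 * pi * \<i>) * J x)" by simp
    also have "\<dots> = integral {-X..X} (\<lambda>x. F1 (Complex x (\<eta> - 2 * pi)) - F1 (Complex x 0) + (F2 (Complex x 0) - F2 (Complex x \<eta>)))"
      by (simp only: pt)
    also have "\<dots> = integral {-X..X} (\<lambda>x. F1 (Complex x (\<eta> - 2 * pi))) - integral {-X..X} (\<lambda>x. F1 (Complex x 0))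
     + (integral {-X..X} (\<lambda>x. F2 (Complex x 0)) - integral {-X..X} (\<lambda>x. F2 (Complex x \<eta>)))"
      by (simp add: integral_add integral_diff integrable_diff i1)
    finally show ?thesis .
  qed
  have "((\<lambda>X. (- 2 * pi * \<i>) * integral {-X..X} J) \<longlongrightarrow>
     (if Im w0 < 0 then - 2 * pi * \<i> * l else 0) + (if Im w0 < 0 then 0 else - 2 * pi * \<i> * l)) at_top"
    unfolding int by (rule tendsto_add[OF lim1 lim2])
  also have "(if Im w0 < 0 then - 2 * pi * \<i> * l else 0) + (if Im w0 < 0 then 0 else - 2 * pi * \<i> * l) = - 2 * pi * \<i> * l" by simp
  finally have "((\<lambda>X. inverse (- 2 * pi * \<i>) * ((- 2 * pi * \<i>) * integral {-X..X} J)) \<longlongrightarrow> inverse (- 2 * pi * \<i>) * (- 2 * pi * \<i> * l)) at_top"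
    by (rule tendsto_mult_left)
  moreover have c0: "(- 2 * pi * \<i> :: complex) \<noteq> 0" by simp
  ultimately have "((\<lambda>X. integral {-X..X} J) \<longlongrightarrow> l) at_top"
    by (simp only: inv_mult_cancel[OF c0])
  moreover have "G b (if Im w0 < 0 then \<gamma> else - \<gamma>) w0 = exp l * atoms_poly L (atom b \<gamma>) w0"
    using P(3)[of w0] P(4)[of w0] w0 \<epsilon>0 \<epsilon>w by (auto simp: l_def)
  ultimately show ?thesis by (intro that[of l]) (auto simp: J_def)
qed

end

subsection \<open>Rounding the masses on a ray\<close>

text \<open>Separates the distance from 1 into a radial and an angular part, both nonnegative, so
  that each of them alone is a lower bound.\<close>

lemma norm_one_minus_exp_sq: "(norm (1 - exp (Complex t v)))\<^sup>2 = (1 - exp t)\<^sup>2 + 4 * exp t * (sin (v / 2))\<^sup>2"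
proof -
  have c: "cos v = 1 - 2 * (sin (v/2))\<^sup>2" using cos_double_sin[of "v/2"] by simp
  have "(norm (1 - exp (Complex t v)))\<^sup>2 = (1 - exp t * cos v)\<^sup>2 + (exp t * sin v)\<^sup>2"
    by (simp add: cmod_power2 Re_exp Im_exp)
  also have "\<dots> = 1 - 2 * exp t * cos v + (exp t)\<^sup>2 * ((sin v)\<^sup>2 + (cos v)\<^sup>2)"
    by (simp add: power2_eq_square algebra_simps del: sin_cos_squared_add sin_cos_squared_add2 sin_cos_squared_add3)
  also have "\<dots> = 1 - 2 * exp t * cos v + (exp t)\<^sup>2"
    by (simp only: sin_cos_squared_add mult_1_right)
  also have "\<dots> = (1 - exp t)\<^sup>2 + 4 * exp t * (sin (v / 2))\<^sup>2"
    unfolding c by (simp add: power2_eq_square algebra_simps)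
  finally show ?thesis .
qed

text \<open>The radial part gives the lower bound |t| / (1 + |t|) for the denominator, the angular
  part gives \<bar>sin (v / 2)\<bar> if |t| is smaller than this. The form chosen combines both and
  has an integral over t near 0 that grows only logarithmically as the ray is approached.\<close>

lemma norm_kap_bound_neg:
  assumes t: "t \<le> 0" and v: "sin (v / 2) \<noteq> 0"
  shows "norm (kap (Complex t v)) \<le> 2 + 2 / (\<bar>t\<bar> + \<bar>sin (v / 2)\<bar>)"
proof -
  define a where "a = - t"
  define \<delta> where "\<delta> = \<bar>sin (v/2)\<bar>"
  have a: "a \<ge> 0" "\<bar>t\<bar> = a" using t by (auto simp: a_def)
  have \<delta>: "\<delta> > 0" "\<delta> \<le> 1" using v by (auto simp: \<delta>_def)
  let ?D = "norm (1 - exp (Complex t v))"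
  have "0 \<le> 4 * exp t * (sin (v / 2))\<^sup>2" by simp
  hence "(1 - exp t)\<^sup>2 \<le> ?D\<^sup>2" unfolding norm_one_minus_exp_sq by linarith
  hence D1: "1 - exp t \<le> ?D" by (rule power2_le_imp_le) simp
  have "1 + a \<le> exp a" by (rule exp_ge_add_one_self)
  hence "exp t \<le> 1 / (1 + a)" using a by (simp add: a_def exp_minus field_simps)
  moreover have "a / (1 + a) = 1 - 1 / (1 + a)" using a by (simp add: field_simps)
  ultimately have D1': "a / (1 + a) \<le> ?D" using D1 by linarith
  have D2: "\<delta> \<le> ?D" if "a < \<delta>"
  proof (rule power2_le_imp_le)
    have "exp t \<ge> 1 + t" by (rule exp_ge_add_one_self)
    have "exp (1::real) \<le> 4" using exp_le by simp
    moreover have "exp a \<le> exp 1" using that \<delta> by simp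
    ultimately have "exp a \<le> 4" by linarith
    hence "4 * exp t \<ge> 1" by (simp add: a_def exp_minus field_simps)
    hence "1 * \<delta>\<^sup>2 \<le> 4 * exp t * \<delta>\<^sup>2" by (intro mult_right_mono) auto
    moreover have "0 \<le> (1 - exp t)\<^sup>2" by simp
    ultimately show "\<delta>\<^sup>2 \<le> ?D\<^sup>2" unfolding norm_one_minus_exp_sq \<delta>_def power2_abs mult_1 by linarith
  qed simp
  have "(a + \<delta>) / (2 * (1 + a)) \<le> ?D"
  proof (cases "a < \<delta>")
    case True
    have "\<delta> * (2 * (1 + a)) = 2 * \<delta> + 2 * (\<delta> * a)" by (simp add: algebra_simps)
    moreover have "\<delta> * a \<ge> 0" using \<delta> a by simp
    ultimately have "a + \<delta> \<le> \<delta> * (2 * (1 + a))" using True \<delta>(1) by linarith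
    hence "(a + \<delta>) / (2 * (1 + a)) \<le> \<delta>" using a by (subst pos_divide_le_eq) auto
    thus ?thesis using D2[OF True] by linarith
  next
    case False
    hence "(a + \<delta>) / (2 * (1 + a)) \<le> (2 * a) / (2 * (1 + a))" using a by (intro divide_right_mono) auto
    also have "\<dots> = a / (1 + a)" by (rule mult_divide_mult_cancel_left) simp
    finally have "(a + \<delta>) / (2 * (1 + a)) \<le> a / (1 + a)" .
    thus ?thesis using D1' by linarith
  qed
  moreover have p: "(a + \<delta>) / (2 * (1 + a)) > 0" using a \<delta> by simp
  ultimately have "?D > 0" by linarith
  have "1 / ?D \<le> 1 / ((a + \<delta>) / (2 * (1 + a)))"
    by (rule divide_left_mono[OF \<open>(a + \<delta>) / (2 * (1 + a)) \<le> ?D\<close> _ mult_pos_pos[OF \<open>?D > 0\<close> p]]) simp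
  also have "\<dots> = 2 * (1 + a) / (a + \<delta>)" by simp
  also have "\<dots> \<le> 2 + 2 / (a + \<delta>)" using a \<delta> by (simp add: field_simps)
  finally show ?thesis unfolding kap_def norm_divide norm_one a(2) \<delta>_def[symmetric] .
qed

lemma norm_kap_reflect: "norm (kap (Complex t v)) = exp (- t) * norm (kap (Complex (- t) v))"
proof -
  have "(norm (1 - exp (Complex t v)))\<^sup>2 = (exp t * norm (1 - exp (Complex (-t) v)))\<^sup>2"
    unfolding power_mult_distrib norm_one_minus_exp_sq
    by (simp add: power2_eq_square exp_minus field_simps)
  hence "norm (1 - exp (Complex t v)) = exp t * norm (1 - exp (Complex (-t) v))"
    by (subst (asm) power2_eq_iff_nonneg) auto
  thus ?thesis by (simp add: kap_def norm_divide exp_minus field_simps)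
qed

text \<open>Term by term a bound for the integrals of the majorants \<open>p1\<close> to
  \<open>p5\<close> below. Its exponential grows like the fourth power of \<open>exp u\<close>, the
  modulus of the point, has a singularity of order 4 at the ray, and depends on the points of the
  distribution through \<open>M\<close> alone.\<close>

definition ray_error :: "real \<Rightarrow> real \<Rightarrow> real \<Rightarrow> real" where
  "ray_error M u v = 6 + 4 * ln ((1 + \<bar>sin (v / 2)\<bar>) / \<bar>sin (v / 2)\<bar>) + 4 * M + 4 * max 0 u"

text \<open>Intended for \<open>f\<close> equal to the real part of the kernel times the difference
  between a mass function and its rounding. This difference is at most 1 everywhere, and on the left
  also at most the mass itself, which is what the two hypotheses on \<open>f\<close>
  express.\<close>

lemma kap_integral_bound:
  assumes v: "sin (v / 2) \<noteq> 0" and M: "M \<ge> 0" and X: "X \<ge> 0"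
    and int: "f integrable_on {-X..X}"
    and f1: "\<And>y. \<bar>f y\<bar> \<le> norm (kap (Complex (y - u) v))"
    and f2: "\<And>y. y \<le> 0 \<Longrightarrow> \<bar>f y\<bar> \<le> M * exp y * norm (kap (Complex (y - u) v))"
  shows "\<bar>integral {-X..X} f\<bar> \<le> ray_error M u v"
proof -
  define \<delta> where "\<delta> = \<bar>sin (v/2)\<bar>"
  have \<delta>: "\<delta> > 0" using v by (simp add: \<delta>_def)
  \<comment> \<open>In this order: the right tail, where the kernel decays; the unit intervals to
    the left and right of \<open>u\<close>, which carry the logarithmic singularity; the negative
    half-line, where the mass is at most \<open>M * exp y\<close>; and the stretch from 0 to
    \<open>u\<close>, where the kernel is only bounded and whose length produces the power of the
    modulus.\<close>
  define p1 where "p1 = (\<lambda>y. if y \<in> {u..} then 4 * exp (- (y - u)) else 0)"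
  define p2 where "p2 = (\<lambda>y. if y \<in> {u-1..u} then 2 + 2 / ((u - y) + \<delta>) else 0)"
  define p3 where "p3 = (\<lambda>y. if y \<in> {u..u+1} then 2 / ((y - u) + \<delta>) else 0)"
  define p4 where "p4 = (\<lambda>y. if y \<in> {-X..0} then 4 * M * exp y else 0)"
  define p5 where "p5 = (\<lambda>y. if y \<in> {0..max 0 u} then 4 else 0 :: real)"
  have e: "((\<lambda>x::real. exp (- 1 * x)) has_integral exp (- 1 * c) / 1) {c..}" for c
    by (rule has_integral_exp_minus_to_infinity) simp
  have i1: "(p1 has_integral 4) UNIV"
  proof -
    have "((\<lambda>x. 4 * exp u * exp (- 1 * x)) has_integral 4 * exp u * (exp (- 1 * u) / 1)) {u..}"
      by (intro has_integral_mult_right e)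
    hence "((\<lambda>x. 4 * exp (- (x - u))) has_integral 4) {u..}"
      by (simp add: exp_diff exp_minus field_simps)
    thus ?thesis unfolding p1_def by (subst has_integral_restrict_UNIV)
  qed
  have i2: "(p2 has_integral (2 + 2 * ln ((1 + \<delta>) / \<delta>))) UNIV"
  proof -
    have "((\<lambda>y. 2 + 2 / ((u - y) + \<delta>)) has_integral ((2 * u - 2 * ln ((u - u) + \<delta>)) - (2 * (u - 1) - 2 * ln ((u - (u - 1)) + \<delta>)))) {u-1..u}"
    proof (rule fundamental_theorem_of_calculus)
      fix y assume y: "y \<in> {u-1..u}"
      hence "(u - y) + \<delta> > 0" using \<delta> by auto
      thus "((\<lambda>y. 2 * y - 2 * ln ((u - y) + \<delta>)) has_vector_derivative 2 + 2 / ((u - y) + \<delta>)) (at y within {u-1..u})"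
        unfolding has_real_derivative_iff_has_vector_derivative[symmetric]
        by (auto intro!: derivative_eq_intros simp: field_simps)
    qed simp
    hence "((\<lambda>y. 2 + 2 / ((u - y) + \<delta>)) has_integral (2 + 2 * ln ((1 + \<delta>) / \<delta>))) {u-1..u}"
      using \<delta> by (simp add: ln_div algebra_simps)
    thus ?thesis unfolding p2_def by (subst has_integral_restrict_UNIV)
  qed
  have i3: "(p3 has_integral (2 * ln ((1 + \<delta>) / \<delta>))) UNIV"
  proof -
    have "((\<lambda>y. 2 / ((y - u) + \<delta>)) has_integral (2 * ln ((u + 1 - u) + \<delta>) - 2 * ln ((u - u) + \<delta>))) {u..u+1}"
    proof (rule fundamental_theorem_of_calculus)
      fix y assume y: "y \<in> {u..u+1}"
      hence "(y - u) + \<delta> > 0" using \<delta> by auto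
      thus "((\<lambda>y. 2 * ln ((y - u) + \<delta>)) has_vector_derivative 2 / ((y - u) + \<delta>)) (at y within {u..u+1})"
        unfolding has_real_derivative_iff_has_vector_derivative[symmetric]
        by (auto intro!: derivative_eq_intros simp: field_simps)
    qed simp
    hence "((\<lambda>y. 2 / ((y - u) + \<delta>)) has_integral (2 * ln ((1 + \<delta>) / \<delta>))) {u..u+1}"
      using \<delta> by (simp add: ln_div algebra_simps)
    thus ?thesis unfolding p3_def by (subst has_integral_restrict_UNIV)
  qed
  have i4: "(p4 has_integral 4 * M * (1 - exp (- X))) UNIV"
  proof -
    have "((\<lambda>x::real. 4 * M * exp x) has_integral 4 * M * exp 0 - 4 * M * exp (- X)) {-X..0}"
      by (rule fundamental_theorem_of_calculus)
         (use X in \<open>auto intro!: derivative_eq_intros simp: has_real_derivative_iff_has_vector_derivative[symmetric]\<close>)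
    hence "((\<lambda>x::real. 4 * M * exp x) has_integral 4 * M * (1 - exp (- X))) {-X..0}" by (simp add: algebra_simps)
    thus ?thesis unfolding p4_def by (subst has_integral_restrict_UNIV)
  qed
  have i5: "(p5 has_integral 4 * max 0 u) UNIV"
  proof -
    have "((\<lambda>x::real. 4::real) has_integral 4 * max 0 u) {0..max 0 u}"
      using has_integral_const_real[of "4::real" 0 "max 0 u"] by (simp add: mult.commute)
    thus ?thesis unfolding p5_def by (subst has_integral_restrict_UNIV)
  qed
  define p where "p = (\<lambda>y. p1 y + p2 y + p3 y + p4 y + p5 y)"
  define E where "E = 4 + (2 + 2 * ln ((1 + \<delta>) / \<delta>)) + 2 * ln ((1 + \<delta>) / \<delta>) + 4 * M * (1 - exp (- X)) + 4 * max 0 u"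
  have ip: "(p has_integral E) UNIV"
    unfolding p_def E_def by (intro has_integral_add i1 i2 i3 i4 i5)
  have "4 * M * (1 - exp (- X)) \<le> 4 * M * 1" using M by (intro mult_left_mono) auto
  hence E: "E \<le> ray_error M u v" by (simp add: E_def ray_error_def \<delta>_def)
  have nn: "p1 y \<ge> 0" "p2 y \<ge> 0" "p3 y \<ge> 0" "p4 y \<ge> 0" "p5 y \<ge> 0" for y
    using \<delta> M by (auto simp: p1_def p2_def p3_def p4_def p5_def)
  have bound: "\<bar>f y\<bar> \<le> p y" if "y \<in> {-X..X}" for y
  proof (cases "y \<ge> u")
    case True
    define t where "t = y - u"
    have t: "t \<ge> 0" using True by (simp add: t_def)
    have "\<bar>f y\<bar> \<le> exp (- t) * norm (kap (Complex (- t) v))"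
      using f1[of y] by (simp add: t_def norm_kap_reflect[of "y - u"])
    also have "\<dots> \<le> exp (- t) * (2 + 2 / (t + \<delta>))"
      using norm_kap_bound_neg[of "-t" v] t v by (intro mult_left_mono) (auto simp: \<delta>_def)
    also have "\<dots> \<le> p1 y + p3 y"
    proof (cases "t \<le> 1")
      case True
      have "exp (- t) * (2 / (t + \<delta>)) \<le> 1 * (2 / (t + \<delta>))" using t \<delta> by (intro mult_right_mono) auto
      moreover have "p1 y = 4 * exp (- t)" "p3 y = 2 / (t + \<delta>)" using t True by (auto simp: p1_def p3_def t_def)
      ultimately show ?thesis using exp_gt_zero[of "-t"] by (simp only: distrib_left mult_1)
    next
      case False
      have "2 / (t + \<delta>) \<le> 2" using False \<delta> by (simp add: field_simps)
      hence "exp (- t) * (2 + 2 / (t + \<delta>)) \<le> exp (- t) * 4" by (intro mult_left_mono) auto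
      moreover have "p1 y = 4 * exp (- t)" using t by (auto simp: p1_def t_def)
      ultimately show ?thesis using nn(3)[of y] by linarith
    qed
    finally show ?thesis using nn[of y] by (simp add: p_def)
  next
    case False
    define a where "a = u - y"
    have a: "a > 0" using False by (simp add: a_def)
    have k: "norm (kap (Complex (y - u) v)) \<le> 2 + 2 / (a + \<delta>)"
      using norm_kap_bound_neg[of "y - u" v] a v by (simp add: a_def \<delta>_def)
    show ?thesis
    proof (cases "a \<le> 1")
      case True
      hence "p2 y = 2 + 2 / (a + \<delta>)" using a by (simp add: p2_def a_def)
      thus ?thesis using f1[of y] k nn[of y] by (simp add: p_def)
    next
      case a1: False
      have "2 / (a + \<delta>) \<le> 2" using a1 \<delta> by (simp add: field_simps)
      hence k4: "norm (kap (Complex (y - u) v)) \<le> 4" using k by linarith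
      show ?thesis
      proof (cases "y \<le> 0")
        case True
        have "\<bar>f y\<bar> \<le> M * exp y * norm (kap (Complex (y - u) v))" by (rule f2[OF True])
        also have "\<dots> \<le> M * exp y * 4" using M k4 by (intro mult_left_mono) auto
        also have "\<dots> = p4 y" using True that by (simp add: p4_def)
        finally show ?thesis using nn[of y] by (simp add: p_def)
      next
        case y0: False
        hence "p5 y = 4" using False by (simp add: p5_def)
        thus ?thesis using f1[of y] k4 nn[of y] by (simp add: p_def)
      qed
    qed
  qed
  have "norm (integral {-X..X} f) \<le> integral {-X..X} p"
    by (intro integral_norm_bound_integral int integrable_on_subinterval[OF has_integral_integrable[OF ip]])
       (use bound in auto)
  also have "\<dots> \<le> integral UNIV p"
    by (intro integral_subset_le integrable_on_subinterval[OF has_integral_integrable[OF ip]] has_integral_integrable[OF ip])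
       (use nn in \<open>auto simp: p_def\<close>)
  also have "\<dots> = E" by (rule integral_unique[OF ip])
  also note E
  finally show ?thesis by simp
qed

text \<open>The points are places where \<open>\<Lambda>\<close> takes the values 1, 2, 3 and so on,
  which exist by continuity; the index i belongs to the level i + 1.\<close>

lemma counting_points:
  fixes \<Lambda> :: "real \<Rightarrow> real"
  assumes cont: "continuous_on UNIV \<Lambda>" and mono: "mono \<Lambda>" and lim: "(\<Lambda> \<longlongrightarrow> 0) at_bot" and bdd: "\<And>x. \<Lambda> x \<le> B"
  obtains N :: nat and t :: "nat \<Rightarrow> real" where
    "\<And>y. real (card {i. i < N \<and> t i \<le> y}) \<le> \<Lambda> y" "\<And>y. \<Lambda> y \<le> real (card {i. i < N \<and> t i \<le> y}) + 1"
proof -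
  have ivt: "\<exists>x. \<Lambda> x = c" if "c > 0" "c \<le> \<Lambda> y" for c y
  proof -
    have "eventually (\<lambda>x. \<Lambda> x < c) at_bot" using lim that(1) by (rule order_tendstoD)
    moreover have "eventually (\<lambda>x. x \<le> y) at_bot" by (rule eventually_le_at_bot)
    ultimately have "eventually (\<lambda>x. \<Lambda> x < c \<and> x \<le> y) at_bot" by (rule eventually_conj)
    then obtain x where "\<Lambda> x < c" "x \<le> y" using eventually_happens'[OF trivial_limit_at_bot_linorder] by blast
    hence "\<exists>z. x \<le> z \<and> z \<le> y \<and> \<Lambda> z = c"
      using that by (intro IVT' continuous_on_subset[OF cont]) auto
    thus ?thesis by blast
  qed
  define A where "A = {i::nat. \<exists>y. real (Suc i) \<le> \<Lambda> y}"
  have down: "i \<in> A" if "j \<in> A" "i \<le> j" for i j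
  proof -
    obtain y where "real (Suc j) \<le> \<Lambda> y" using \<open>j \<in> A\<close> by (auto simp: A_def)
    moreover have "real (Suc i) \<le> real (Suc j)" using \<open>i \<le> j\<close> by simp
    ultimately show ?thesis unfolding A_def by (intro CollectI exI[of _ y]) linarith
  qed
  have "A \<subseteq> {..<nat \<lceil>B\<rceil>}"
  proof
    fix i assume "i \<in> A"
    then obtain y where "real (Suc i) \<le> \<Lambda> y" by (auto simp: A_def)
    hence "real (Suc i) \<le> B" using bdd[of y] by linarith
    hence "real i < B" by simp
    thus "i \<in> {..<nat \<lceil>B\<rceil>}" by (simp add: less_ceiling_iff zless_nat_eq_int_zless)
  qed
  hence finA: "finite A" by (rule finite_subset) simp
  define N where "N = card A"
  have A: "A = {..<N}"
  proof (cases "A = {}")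
    case False
    define m where "m = Max A"
    have Am: "A = {..m}" unfolding m_def
    proof (intro equalityI subsetI)
      show "x \<in> {..Max A}" if "x \<in> A" for x using Max_ge[OF finA that] by simp
      show "x \<in> A" if "x \<in> {..Max A}" for x using down[OF Max_in[OF finA False]] that by simp
    qed
    show ?thesis unfolding N_def Am by (simp add: lessThan_Suc_atMost)
  qed (simp add: N_def)
  have "\<exists>x. \<Lambda> x = real (Suc i)" if "i \<in> A" for i
    using that ivt[of "real (Suc i)"] unfolding A_def by auto
  hence "\<forall>i\<in>A. \<exists>x. \<Lambda> x = real (Suc i)" by blast
  from bchoice[OF this] obtain t where t': "\<forall>i\<in>A. \<Lambda> (t i) = real (Suc i)" ..
  have t: "\<Lambda> (t i) = real (Suc i)" if "i < N" for i
    using t' that by (simp add: A)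
  show ?thesis
  proof (rule that[of N t])
    fix y
    let ?C = "{i. i < N \<and> t i \<le> y}"
    have pos: "\<Lambda> y \<ge> 0"
    proof (rule tendsto_upperbound[OF lim])
      show "eventually (\<lambda>x. \<Lambda> x \<le> \<Lambda> y) at_bot" using eventually_le_at_bot[of y] by eventually_elim (rule monoD[OF mono])
    qed simp
    have "?C \<subseteq> {..<nat \<lfloor>\<Lambda> y\<rfloor>}"
    proof
      fix i assume i: "i \<in> ?C"
      have "real (Suc i) = \<Lambda> (t i)" using t i by simp
      also have "\<dots> \<le> \<Lambda> y" using i by (intro monoD[OF mono]) auto
      finally have "real (Suc i) \<le> \<Lambda> y" .
      hence "Suc i \<le> nat \<lfloor>\<Lambda> y\<rfloor>" by (simp add: le_nat_floor)
      thus "i \<in> {..<nat \<lfloor>\<Lambda> y\<rfloor>}" by simp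
    qed
    hence "card ?C \<le> nat \<lfloor>\<Lambda> y\<rfloor>" using card_mono[of "{..<nat \<lfloor>\<Lambda> y\<rfloor>}" ?C] by simp
    thus "real (card ?C) \<le> \<Lambda> y" using pos by (simp add: le_nat_iff le_floor_iff)
    \<comment> \<open>If \<open>\<Lambda>\<close> is constant near \<open>y\<close> at an integer
      level, the point chosen for this level may lie to the right of \<open>y\<close>. Only levels
      strictly below \<open>\<Lambda> y\<close> are certain to be counted, hence the ceiling minus
      1.\<close>
    have "{..<nat \<lceil>\<Lambda> y\<rceil> - 1} \<subseteq> ?C"
    proof
      fix i assume i: "i \<in> {..<nat \<lceil>\<Lambda> y\<rceil> - 1}"
      hence "int (Suc i) < \<lceil>\<Lambda> y\<rceil>" by (simp add: zless_nat_eq_int_zless)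
      hence iy: "real (Suc i) < \<Lambda> y" by (simp add: less_ceiling_iff)
      hence "i \<in> A" by (auto simp: A_def intro!: exI[of _ y])
      hence iN: "i < N" by (simp add: A)
      have "t i \<le> y"
      proof (rule ccontr)
        assume "\<not> t i \<le> y"
        hence "\<Lambda> y \<le> \<Lambda> (t i)" by (intro monoD[OF mono]) auto
        thus False using iy t[OF iN] by simp
      qed
      thus "i \<in> ?C" using iN by simp
    qed
    hence "nat \<lceil>\<Lambda> y\<rceil> - 1 \<le> card ?C" using card_mono[of ?C "{..<nat \<lceil>\<Lambda> y\<rceil> - 1}"] by simp
    moreover have "\<Lambda> y \<le> real (nat \<lceil>\<Lambda> y\<rceil>)" by (rule real_nat_ceiling_ge)
    ultimately show "\<Lambda> y \<le> real (card ?C) + 1" by linarith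
  qed
qed

lemma sin_half_neq_0:
  assumes "v \<noteq> 0" "\<bar>v\<bar> < 2 * pi"
  shows "sin (v / 2) \<noteq> 0"
proof (cases "v > 0")
  case True
  thus ?thesis using sin_gt_zero[of "v / 2"] assms by auto
next
  case False
  thus ?thesis using sin_gt_zero[of "- v / 2"] assms by auto
qed

lemma Re_kap_antiderivative:
  assumes v: "sin (v / 2) \<noteq> 0"
  shows "((\<lambda>y. ln (norm (1 - exp (Complex (u - y) v)))) has_real_derivative - Re (kap (Complex (y - u) (- v)))) (at y)"
proof -
  define D where "D = (\<lambda>y. (1 - exp (u - y))\<^sup>2 + 4 * exp (u - y) * (sin (v / 2))\<^sup>2)"
  have Dpos: "D y > 0" for y
    unfolding D_def using v by (intro add_nonneg_pos) auto
  have eq: "ln (norm (1 - exp (Complex (u - y) v))) = ln (D y) / 2" for y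
  proof -
    have "D y = (norm (1 - exp (Complex (u - y) v)))\<^sup>2" by (simp only: D_def norm_one_minus_exp_sq)
    moreover from this have "norm (1 - exp (Complex (u - y) v)) \<noteq> 0" using Dpos[of y] by auto
    hence "norm (1 - exp (Complex (u - y) v)) > 0" by simp
    ultimately show ?thesis by (simp add: ln_realpow)
  qed
  define e where "e = exp (u - y)"
  have e: "e > 0" by (simp add: e_def)
  have c: "cos v = 1 - 2 * (sin (v/2))\<^sup>2" using cos_double_sin[of "v/2"] by simp
  have D2: "D y = 1 - 2 * e * cos v + e\<^sup>2" unfolding D_def e_def c by (simp add: power2_eq_square algebra_simps)
  have "(D has_real_derivative (2 * e * cos v - 2 * e\<^sup>2)) (at y)"
    unfolding D_def e_def c by (auto intro!: derivative_eq_intros simp: power2_eq_square algebra_simps)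
  hence "((\<lambda>y. ln (D y) / 2) has_real_derivative (2 * e * cos v - 2 * e\<^sup>2) / D y / 2) (at y)"
    using Dpos[of y] by (auto intro!: derivative_eq_intros simp: field_simps)
  moreover have "(2 * e * cos v - 2 * e\<^sup>2) / D y / 2 = - Re (kap (Complex (y - u) (- v)))"
  proof -
    have ie: "exp (y - u) = 1 / e" by (simp add: e_def exp_diff)
    have "Re (kap (Complex (y - u) (- v))) = Re (1 - exp (Complex (y - u) (-v))) / (norm (1 - exp (Complex (y - u) (-v))))\<^sup>2"
      unfolding kap_def by (simp add: Re_divide cmod_power2)
    also have "(norm (1 - exp (Complex (y - u) (-v))))\<^sup>2 = D y / e\<^sup>2"
      unfolding norm_one_minus_exp_sq D2 ie c using e by (simp add: power2_eq_square field_simps)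
    also have "Re (1 - exp (Complex (y - u) (-v))) = 1 - cos v / e"
      by (simp add: Re_exp ie)
    also have "(1 - cos v / e) / (D y / e\<^sup>2) = (e\<^sup>2 - e * cos v) / D y"
      using e Dpos[of y] by (simp add: field_simps power2_eq_square)
    finally show ?thesis using Dpos[of y] by (simp add: field_simps)
  qed
  ultimately show ?thesis by (simp only: eq)
qed

text \<open>A unit mass at distance \<open>exp t\<close> has a counting function that jumps from 0
  to 1 at \<open>t\<close>. Integrated against the kernel this gives its potential, the logarithm of
  the linear factor, where \<open>v\<close> is the angle to the ray. Continuous and discrete masses
  thus obey the same formula and can be compared under the integral.\<close>

lemma log_factor_integral:
  assumes v: "sin (v / 2) \<noteq> 0"
  shows "((\<lambda>X. integral {-X..X} (\<lambda>y. if t \<le> y then Re (kap (Complex (y - u) (- v))) else 0)) \<longlongrightarrow> ln (norm (1 - exp (Complex (u - t) v)))) at_top"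
proof -
  define F where "F = (\<lambda>y. ln (norm (1 - exp (Complex (u - y) v))))"
  have i: "integral {-X..X} (\<lambda>y. if t \<le> y then Re (kap (Complex (y - u) (- v))) else 0) = F t - F X" if "X \<ge> \<bar>t\<bar>" for X
  proof -
    have "((\<lambda>y. - Re (kap (Complex (y - u) (- v)))) has_integral (F X - F t)) {t..X}"
    proof (rule fundamental_theorem_of_calculus)
      show "(F has_vector_derivative - Re (kap (Complex (y - u) (- v)))) (at y within {t..X})" for y
        unfolding has_real_derivative_iff_has_vector_derivative[symmetric] F_def
        by (rule has_field_derivative_at_within[OF Re_kap_antiderivative[OF v]])
    qed (use that in auto)
    from has_integral_neg[OF this] have "((\<lambda>y. Re (kap (Complex (y - u) (- v)))) has_integral (F t - F X)) ({t..} \<inter> {-X..X})"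
      using that by (simp add: Int_atLeastAtMostL1 inf_commute)
    hence "((\<lambda>y. if y \<in> {t..} then Re (kap (Complex (y - u) (- v))) else 0) has_integral (F t - F X)) {-X..X}"
      by (subst has_integral_restrict_Int) 
    thus ?thesis by (simp add: integral_unique)
  qed
  have "(F \<longlongrightarrow> 0) at_top"
  proof -
    have e0: "((\<lambda>y. exp (u - y)) \<longlongrightarrow> 0) at_top" by real_asymp
    have "exp (Complex (u - y) v) = of_real (exp (u - y)) * cis v" for y
      by (simp add: complex_eq_iff Re_exp Im_exp)
    moreover have "((\<lambda>y. ln (norm (1 - complex_of_real (exp (u - y)) * cis v))) \<longlongrightarrow> ln (norm (1 - of_real 0 * cis v))) at_top"
      by (intro tendsto_intros e0) auto
    ultimately show ?thesis by (simp add: F_def)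
  qed
  hence "((\<lambda>X. F t - F X) \<longlongrightarrow> F t - 0) at_top" by (intro tendsto_intros)
  moreover have "eventually (\<lambda>X. F t - F X = integral {-X..X} (\<lambda>y. if t \<le> y then Re (kap (Complex (y - u) (- v))) else 0)) at_top"
    using eventually_ge_at_top[of "\<bar>t\<bar>"] by eventually_elim (simp add: i)
  ultimately have "((\<lambda>X. integral {-X..X} (\<lambda>y. if t \<le> y then Re (kap (Complex (y - u) (- v))) else 0)) \<longlongrightarrow> F t - 0) at_top"
    by (rule Lim_transform_eventually)
  thus ?thesis by (simp add: F_def)
qed

section \<open>The ray masses of a whole group of points\<close>

context sector_kernel
begin

lemma lam_nonneg_le_1:
  assumes "0 \<le> \<alpha>" "\<alpha> < pi"
  shows "0 \<le> lam b \<alpha> x" "lam b \<alpha> x \<le> 1"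
proof -
  let ?q = "1 + exp (\<beta> * (x - b)) * cis \<alpha>"
  have q0: "?q \<noteq> 0" using lam_arg_notin[OF assms, of x b] by auto
  have "Im ?q \<ge> 0" using assms by (simp add: sin_ge_zero)
  hence "0 \<le> Im (Ln ?q)" "Im (Ln ?q) \<le> pi"
    using Im_Ln_pos_le[OF q0] by auto
  thus "0 \<le> lam b \<alpha> x" "lam b \<alpha> x \<le> 1" by (auto simp: lam_def field_simps)
qed

lemma lam_le_exp:
  assumes "0 \<le> \<alpha>" "\<alpha> < pi"
  shows "lam b \<alpha> x \<le> 2 * exp (\<beta> * (x - b))"
proof (cases "exp (\<beta> * (x - b)) < 1 / 2")
  case True
  let ?z = "exp (\<beta> * (x - b)) * cis \<alpha>"
  have "\<bar>Im (Ln (1 + ?z))\<bar> \<le> norm (Ln (1 + ?z))" by (rule abs_Im_le_cmod)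
  also have "\<dots> \<le> 2 * norm ?z" by (rule norm_Ln_le) (use True in \<open>simp add: norm_mult\<close>)
  finally have 1: "Im (Ln (1 + ?z)) \<le> 2 * exp (\<beta> * (x - b))" by (simp add: norm_mult)
  have "lam b \<alpha> x \<le> (2 * exp (\<beta> * (x - b))) / pi"
    unfolding lam_def by (rule divide_right_mono[OF 1]) simp
  also have "\<dots> \<le> (2 * exp (\<beta> * (x - b))) / 1"
    using pi_ge_two by (intro divide_left_mono) auto
  finally show ?thesis by simp
next
  case False
  thus ?thesis using lam_nonneg_le_1(2)[OF assms, of b x] by linarith
qed

text \<open>The argument of \<open>1 + E * cis \<alpha>\<close> grows with E because the quotient of
  two such numbers lies in the closed upper half-plane. Monotonicity means that the ray carries
  positive mass; it rests on \<open>\<alpha>\<close> being between 0 and pi, hence on the window for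
  \<open>\<gamma>\<close>.\<close>

lemma lam_mono:
  assumes "0 \<le> \<alpha>" "\<alpha> < pi"
  shows "mono (lam b \<alpha>)"
proof
  fix x y :: real assume xy: "x \<le> y"
  define E where "E = exp (\<beta> * (x - b))"
  define E' where "E' = exp (\<beta> * (y - b))"
  have E: "E > 0" "E \<le> E'" using xy \<beta>1 by (auto simp: E_def E'_def)
  define q where "q = 1 + E * cis \<alpha>"
  define q' where "q' = 1 + E' * cis \<alpha>"
  have q0: "q \<noteq> 0" "q' \<noteq> 0"
    using lam_arg_notin[OF assms, of x b] lam_arg_notin[OF assms, of y b]
    by (auto simp: q_def q'_def E_def E'_def)
  have ImL: "0 \<le> Im (Ln q)" "Im (Ln q) < pi" "0 \<le> Im (Ln q')" "Im (Ln q') < pi"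
    using lam_arg_notin[OF assms, of x b] lam_arg_notin[OF assms, of y b] q0
      lam_nonneg_le_1(1)[OF assms, of b x] lam_nonneg_le_1(1)[OF assms, of b y]
    by (auto intro!: Im_Ln_less_pi simp: q_def q'_def E_def E'_def lam_def field_simps)
  have "Im (q' / q) = Im (q' * cnj q) / (norm q)\<^sup>2"
    by (simp add: complex_div_cnj[of q'])
  also have "Im (q' * cnj q) = (E' - E) * sin \<alpha>"
    by (simp add: q_def q'_def algebra_simps)
  finally have "Im (q' / q) \<ge> 0" using E assms by (simp add: sin_ge_zero)
  hence r: "0 \<le> Im (Ln (q' / q))" "Im (Ln (q' / q)) \<le> pi"
    using Im_Ln_pos_le[of "q' / q"] q0 by auto
  \<comment> \<open>All three imaginary parts lie between 0 and pi, which leaves no room for a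
    multiple of 2 pi i in the addition formula.\<close>
  have "exp (Ln q') = exp (Ln q + Ln (q' / q))" using q0 by (simp add: exp_add)
  then obtain n :: int where n: "Ln q' = Ln q + Ln (q' / q) + (of_int (2 * n) * pi) * \<i>"
    unfolding exp_eq by blast
  hence "Im (Ln q') = Im (Ln q) + Im (Ln (q' / q)) + of_int n * (2 * pi)" by simp
  hence "of_int n * (2 * pi) < 1 * (2 * pi)" "(- 1) * (2 * pi) < of_int n * (2 * pi)"
    using ImL r by linarith+
  hence "real_of_int n < 1" "- 1 < real_of_int n"
    by (simp_all only: mult_less_cancel_right_pos pi_gt_zero zero_less_mult_iff zero_less_numeral simp_thms) 
  hence "n < 1" "- 1 < n" by linarith+
  hence "n = 0" by simp
  hence "Im (Ln q') \<ge> Im (Ln q)" using n r by simp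
  thus "lam b \<alpha> x \<le> lam b \<alpha> y"
    unfolding lam_def q_def[unfolded E_def, symmetric] q'_def[unfolded E'_def, symmetric]
    by (rule divide_right_mono) simp
qed

definition ray_mass :: "'k set \<Rightarrow> ('k \<Rightarrow> nat) \<Rightarrow> ('k \<Rightarrow> real) \<Rightarrow> ('k \<Rightarrow> real) \<Rightarrow> real \<Rightarrow> real" where
  "ray_mass K n b \<alpha> x = (\<Sum>k\<in>K. real (n k) * lam (b k) (\<alpha> k) x)"

lemma ray_mass_properties:
  assumes fin: "finite K" and \<alpha>: "\<forall>k\<in>K. 0 \<le> \<alpha> k \<and> \<alpha> k < pi"
    and M: "(\<Sum>k\<in>K. real (n k) * (2 * exp (- \<beta> * b k))) \<le> M"
  shows "continuous_on UNIV (ray_mass K n b \<alpha>)" "mono (ray_mass K n b \<alpha>)" "(ray_mass K n b \<alpha> \<longlongrightarrow> 0) at_bot"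
    "\<And>x. ray_mass K n b \<alpha> x \<le> (\<Sum>k\<in>K. real (n k))" "\<And>x. 0 \<le> ray_mass K n b \<alpha> x"
    "\<And>x. x \<le> 0 \<Longrightarrow> ray_mass K n b \<alpha> x \<le> M * exp x"
proof -
  show "continuous_on UNIV (ray_mass K n b \<alpha>)" unfolding ray_mass_def[abs_def]
    by (intro continuous_intros continuous_lam) (use \<alpha> in auto)
  show "mono (ray_mass K n b \<alpha>)" unfolding ray_mass_def
    by (intro monoI sum_mono mult_left_mono monoD[OF lam_mono]) (use \<alpha> in auto)
  have "((\<lambda>x. \<Sum>k\<in>K. real (n k) * lam (b k) (\<alpha> k) x) \<longlongrightarrow> (\<Sum>k\<in>K. real (n k) * 0)) at_bot"
    by (intro tendsto_intros lam_tendsto_0)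
  thus "(ray_mass K n b \<alpha> \<longlongrightarrow> 0) at_bot" by (simp add: ray_mass_def[abs_def])
  show "ray_mass K n b \<alpha> x \<le> (\<Sum>k\<in>K. real (n k))" for x unfolding ray_mass_def
    by (rule sum_mono) (use \<alpha> lam_nonneg_le_1(2) in \<open>auto intro!: mult_left_le\<close>)
  show "0 \<le> ray_mass K n b \<alpha> x" for x unfolding ray_mass_def
    by (rule sum_nonneg) (use \<alpha> lam_nonneg_le_1(1) in \<open>auto intro!: mult_nonneg_nonneg\<close>)
  show "ray_mass K n b \<alpha> x \<le> M * exp x" if x: "x \<le> 0" for x
  proof -
    have "ray_mass K n b \<alpha> x \<le> (\<Sum>k\<in>K. real (n k) * (2 * exp (- \<beta> * b k)) * exp x)"
      unfolding ray_mass_def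
    proof (rule sum_mono)
      fix k assume k: "k \<in> K"
      \<comment> \<open>On the negative half-line the rate \<open>\<beta>\<close> may be lowered to
        1, which is enough for integrability there.\<close>
      have "\<beta> * x \<le> 1 * x" using x \<beta>1 by (intro mult_right_mono_neg) auto
      hence "exp (\<beta> * (x - b k)) \<le> exp (- \<beta> * b k) * exp x"
        by (simp add: exp_add[symmetric] algebra_simps)
      hence "lam (b k) (\<alpha> k) x \<le> 2 * (exp (- \<beta> * b k) * exp x)"
        using lam_le_exp[of "\<alpha> k" "b k" x] bspec[OF \<alpha> k] by linarith
      thus "real (n k) * lam (b k) (\<alpha> k) x \<le> real (n k) * (2 * exp (- \<beta> * b k)) * exp x"
        by (metis mult.assoc mult_left_mono of_nat_0_le_iff)
    qed
    also have "\<dots> \<le> M * exp x" unfolding sum_distrib_right[symmetric] by (intro mult_right_mono M) auto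
    finally show ?thesis .
  qed
qed

lemma discretized_ray_limit:
  fixes N :: nat and t :: "nat \<Rightarrow> real"
  assumes fin: "finite K" and \<alpha>: "\<forall>k\<in>K. 0 \<le> \<alpha> k \<and> \<alpha> k < pi"
    and M: "(\<Sum>k\<in>K. real (n k) * (2 * exp (- \<beta> * b k))) \<le> M" "M \<ge> 0"
    and cnt: "\<And>y. real (card {i. i < N \<and> t i \<le> y}) \<le> ray_mass K n b \<alpha> y"
      "\<And>y. ray_mass K n b \<alpha> y \<le> real (card {i. i < N \<and> t i \<le> y}) + 1"
    and v: "sin (v / 2) \<noteq> 0"
  shows "continuous_on A (\<lambda>y. kap (Complex (y - u) (- v)))"
    and "((\<lambda>X. integral {-X..X} (\<lambda>y. real (card {i. i < N \<and> t i \<le> y}) * Re (kap (Complex (y - u) (- v))))) \<longlongrightarrow>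
           ln (\<Prod>i<N. norm (1 - exp (Complex (u - t i) v)))) at_top"
    and "(\<lambda>y. real (card {i. i < N \<and> t i \<le> y}) * Re (kap (Complex (y - u) (- v)))) integrable_on {-X..X}"
    and "X \<ge> 0 \<Longrightarrow> \<bar>integral {-X..X} (\<lambda>y. (real (card {i. i < N \<and> t i \<le> y}) - ray_mass K n b \<alpha> y) * Re (kap (Complex (y - u) (- v))))\<bar> \<le> ray_error M u v"
proof -
  have nz: "exp (Complex x v') \<noteq> 1" if "v' = v \<or> v' = - v" for x v'
  proof
    assume "exp (Complex x v') = 1"
    hence "(1 - exp x)\<^sup>2 + 4 * exp x * (sin (v' / 2))\<^sup>2 = 0" using norm_one_minus_exp_sq[of x v'] by simp
    hence "4 * exp x * (sin (v' / 2))\<^sup>2 = 0" by (subst (asm) add_nonneg_eq_0_iff) auto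
    thus False using v that by auto
  qed
  show cK: "continuous_on A (\<lambda>y. kap (Complex (y - u) (- v)))" for A
  proof -
    have "exp (complex_of_real y - complex_of_real u - \<i> * complex_of_real v) \<noteq> 1" for y
      using nz[of "-v" "y - u"] by (simp add: Complex_eq)
    thus ?thesis unfolding kap_def Complex_eq by (intro continuous_intros) auto
  qed
  have cRe: "continuous_on A (\<lambda>y. Re (kap (Complex (y - u) (- v))))" for A
    by (intro continuous_intros cK)
  let ?f = "\<lambda>i y. if t i \<le> y then Re (kap (Complex (y - u) (- v))) else 0"
  have i1: "?f i integrable_on {-X..X}" for i X
  proof -
    have "(\<lambda>y. Re (kap (Complex (y - u) (- v)))) integrable_on {max (t i) (-X)..X}"
      by (intro integrable_continuous_real cRe)
    also have "{max (t i) (-X)..X} = {t i..} \<inter> {-X..X}" by auto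
    finally have "(\<lambda>y. if y \<in> {t i..} then Re (kap (Complex (y - u) (- v))) else 0) integrable_on {-X..X}"
      by (subst integrable_restrict_Int) 
    thus ?thesis by simp
  qed
  have cardeq: "real (card {i. i < N \<and> t i \<le> y}) * c = (\<Sum>i<N. if t i \<le> y then c else 0)" for y c
  proof -
    have "(\<Sum>i<N. if t i \<le> y then c else 0) = (\<Sum>i\<in>{..<N} \<inter> {i. t i \<le> y}. c)"
      by (subst sum.inter_restrict) auto
    also have "{..<N} \<inter> {i. t i \<le> y} = {i. i < N \<and> t i \<le> y}" by auto
    finally show ?thesis by simp
  qed
  show i2: "(\<lambda>y. real (card {i. i < N \<and> t i \<le> y}) * Re (kap (Complex (y - u) (- v)))) integrable_on {-X..X}" for X
    unfolding cardeq by (intro integrable_sum i1) auto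
  have "((\<lambda>X. \<Sum>i<N. integral {-X..X} (?f i)) \<longlongrightarrow> (\<Sum>i<N. ln (norm (1 - exp (Complex (u - t i) v))))) at_top"
    by (intro tendsto_sum log_factor_integral v)
  moreover have "(\<Sum>i<N. ln (norm (1 - exp (Complex (u - t i) v)))) = ln (\<Prod>i<N. norm (1 - exp (Complex (u - t i) v)))"
    using nz[of v] by (subst ln_prod) auto
  ultimately show "((\<lambda>X. integral {-X..X} (\<lambda>y. real (card {i. i < N \<and> t i \<le> y}) * Re (kap (Complex (y - u) (- v))))) \<longlongrightarrow>
           ln (\<Prod>i<N. norm (1 - exp (Complex (u - t i) v)))) at_top"
    unfolding cardeq by (simp add: integral_sum i1)
  show "\<bar>integral {-X..X} (\<lambda>y. (real (card {i. i < N \<and> t i \<le> y}) - ray_mass K n b \<alpha> y) * Re (kap (Complex (y - u) (- v))))\<bar> \<le> ray_error M u v"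
    if X: "X \<ge> 0"
  proof -
    let ?g = "\<lambda>y. (real (card {i. i < N \<and> t i \<le> y}) - ray_mass K n b \<alpha> y) * Re (kap (Complex (y - u) (- v)))"
    note rm = ray_mass_properties[OF fin \<alpha> M(1)]
    have "(\<lambda>y. ray_mass K n b \<alpha> y * Re (kap (Complex (y - u) (- v)))) integrable_on {-X..X}"
      by (intro integrable_continuous_real continuous_intros cRe continuous_on_subset[OF rm(1)]) auto
    hence int: "?g integrable_on {-X..X}"
      unfolding left_diff_distrib by (intro integrable_diff i2)
    have b1: "\<bar>real (card {i. i < N \<and> t i \<le> y}) - ray_mass K n b \<alpha> y\<bar> \<le> 1"
         "\<bar>real (card {i. i < N \<and> t i \<le> y}) - ray_mass K n b \<alpha> y\<bar> \<le> ray_mass K n b \<alpha> y" for y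
      using cnt(1)[of y] cnt(2)[of y] by auto
    have "\<bar>integral {-X..X} ?g\<bar> \<le> ray_error M u (- v)"
    proof (rule kap_integral_bound[OF _ M(2) X int])
      show "sin (- v / 2) \<noteq> 0" using v by simp
      show "\<bar>?g y\<bar> \<le> norm (kap (Complex (y - u) (- v)))" for y
        unfolding abs_mult using mult_mono[OF b1(1) abs_Re_le_cmod] by simp
      show "\<bar>?g y\<bar> \<le> M * exp y * norm (kap (Complex (y - u) (- v)))" if "y \<le> 0" for y
        unfolding abs_mult using rm(6)[OF that] b1(2)[of y]
        by (intro mult_mono abs_Re_le_cmod) auto
    qed
    thus ?thesis by (simp add: ray_error_def)
  qed
qed

text \<open>The atoms times the exponential of the potential of the continuous masses have the
  modulus of \<open>G\<close>, hence at most \<open>1 + exp (\<beta> * (u - b k))\<close> for every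
  point. Replacing the continuous masses by point masses changes the logarithm by the two ray
  errors. The masses are summed over \<open>K\<close> before rounding, so these errors occur once
  and not once per point.\<close>

lemma discretized_product_bound:
  assumes fin: "finite K" and \<gamma>: "\<And>k. k \<in> K \<Longrightarrow> pi \<le> \<gamma> k \<and> \<gamma> k \<le> pi + pi * s"
    and M: "(\<Sum>k\<in>K. real (n k) * (2 * exp (- \<beta> * b k))) \<le> M" "M \<ge> 0"
  obtains N1 N2 :: nat and t1 t2 :: "nat \<Rightarrow> real" where
    "\<And>u v. v \<noteq> 0 \<Longrightarrow> \<eta> - 2 * pi < v \<Longrightarrow> v < \<eta> \<Longrightarrow>
       (\<Prod>k\<in>K. norm (atoms_poly L (atom (b k) (\<gamma> k)) (Complex u v)) ^ n k) *
       (\<Prod>i<N1. norm (1 - exp (Complex (u - t1 i) v))) * (\<Prod>i<N2. norm (1 - exp (Complex (u - t2 i) (v - \<eta>))))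
       \<le> (\<Prod>k\<in>K. (1 + exp (\<beta> * (u - b k))) ^ n k) * exp (ray_error M u v + ray_error M u (v - \<eta>))"
proof -
  have pis: "pi * s < pi" using s by simp
  define \<alpha>1 where "\<alpha>1 = (\<lambda>k. \<gamma> k - pi)"
  define \<alpha>2 where "\<alpha>2 = (\<lambda>k. pi + pi * s - \<gamma> k)"
  have \<alpha>1: "\<forall>k\<in>K. 0 \<le> \<alpha>1 k \<and> \<alpha>1 k < pi"
    proof
    fix k assume "k \<in> K"
    from \<gamma>[OF this] pis show "0 \<le> \<alpha>1 k \<and> \<alpha>1 k < pi" unfolding \<alpha>1_def by linarith
  qed
  have \<alpha>2: "\<forall>k\<in>K. 0 \<le> \<alpha>2 k \<and> \<alpha>2 k < pi"
    proof
    fix k assume "k \<in> K"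
    from \<gamma>[OF this] pis show "0 \<le> \<alpha>2 k \<and> \<alpha>2 k < pi" unfolding \<alpha>2_def by linarith
  qed
  note rm1 = ray_mass_properties[OF fin \<alpha>1 M(1)]
  note rm2 = ray_mass_properties[OF fin \<alpha>2 M(1)]
  obtain N1 :: nat and t1 :: "nat \<Rightarrow> real" where c1: "\<And>y. real (card {i. i < N1 \<and> t1 i \<le> y}) \<le> ray_mass K n b \<alpha>1 y"
      "\<And>y. ray_mass K n b \<alpha>1 y \<le> real (card {i. i < N1 \<and> t1 i \<le> y}) + 1"
  proof (rule counting_points[OF rm1(1-4)], goal_cases)
    case (1 N t)
    show ?case by (rule that[OF 1(2,3)])
  qed
  obtain N2 :: nat and t2 :: "nat \<Rightarrow> real" where c2: "\<And>y. real (card {i. i < N2 \<and> t2 i \<le> y}) \<le> ray_mass K n b \<alpha>2 y"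
      "\<And>y. ray_mass K n b \<alpha>2 y \<le> real (card {i. i < N2 \<and> t2 i \<le> y}) + 1"
  proof (rule counting_points[OF rm2(1-4)], goal_cases)
    case (1 N t)
    show ?case by (rule that[OF 1(2,3)])
  qed
  show ?thesis
  proof (rule that[of t1 N1 t2 N2])
    fix u v :: real assume v: "v \<noteq> 0" "\<eta> - 2 * pi < v" "v < \<eta>"
    have s1: "sin (v / 2) \<noteq> 0" using v \<eta>_less \<eta>_pos pi_gt_zero by (intro sin_half_neq_0) auto
    have s2: "sin ((v - \<eta>) / 2) \<noteq> 0" using v \<eta>_less \<eta>_pos pi_gt_zero by (intro sin_half_neq_0) auto
    define w0 where "w0 = Complex u v"
    note d1 = discretized_ray_limit[OF fin \<alpha>1 M c1 s1]
    note d2 = discretized_ray_limit[OF fin \<alpha>2 M c2 s2]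
    define k1 where "k1 = (\<lambda>y. Re (kap (Complex (y - u) (- v))))"
    define k2 where "k2 = (\<lambda>y. Re (kap (Complex (y - u) (- (v - \<eta>)))))"
    have cont: "continuous_on A k1" "continuous_on A k2" for A
      unfolding k1_def k2_def by (intro continuous_intros d1(1) d2(1))+
    have kapc: "continuous_on A (\<lambda>y. kap (Complex y 0 - w0))" "continuous_on A (\<lambda>y. kap (Complex y \<eta> - w0))" for A
      using d1(1)[where u = u and A = A] d2(1)[where u = u and A = A] by (simp_all add: w0_def complex_diff)
    have keq: "Re (kap (Complex y 0 - w0)) = k1 y" "Re (kap (Complex y \<eta> - w0)) = k2 y" for y
      by (simp_all add: k1_def k2_def w0_def complex_diff)
    let ?J = "\<lambda>k x. lam (b k) (\<gamma> k - pi) x * kap (Complex x 0 - w0) + lam (b k) (pi + pi * s - \<gamma> k) x * kap (Complex x \<eta> - w0)"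
    have "\<exists>l. ((\<lambda>X. integral {-X..X} (?J k)) \<longlongrightarrow> l) at_top \<and>
       G (b k) (if v < 0 then \<gamma> k else - \<gamma> k) w0 = exp l * atoms_poly L (atom (b k) (\<gamma> k)) w0" if k: "k \<in> K" for k
    proof -
      have g: "pi \<le> \<gamma> k" "\<gamma> k \<le> pi + pi * s" using \<gamma>[OF k] by auto
      have w: "Im w0 \<noteq> 0" "Im w0 \<noteq> \<eta>" "\<eta> - 2 * pi < Im w0" "Im w0 < \<eta>" using v by (auto simp: w0_def)
      have iv: "Im w0 = v" by (simp add: w0_def)
      show ?thesis
      proof (rule lam_contour_form[OF g w, of "b k"], goal_cases)
        case (1 l)
        thus ?case unfolding iv by (intro exI[of _ l] conjI)
      qed
    qed
    hence "\<forall>k\<in>K. \<exists>l. ((\<lambda>X. integral {-X..X} (?J k)) \<longlongrightarrow> l) at_top \<and>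
       G (b k) (if v < 0 then \<gamma> k else - \<gamma> k) w0 = exp l * atoms_poly L (atom (b k) (\<gamma> k)) w0" by blast
    from bchoice[OF this] obtain l where l: "\<And>k. k \<in> K \<Longrightarrow> ((\<lambda>X. integral {-X..X} (?J k)) \<longlongrightarrow> l k) at_top"
       "\<And>k. k \<in> K \<Longrightarrow> G (b k) (if v < 0 then \<gamma> k else - \<gamma> k) w0 = exp (l k) * atoms_poly L (atom (b k) (\<gamma> k)) w0"
      by blast
    have cJ: "continuous_on A (?J k)" if k: "k \<in> K" for k A
      using bspec[OF \<alpha>1 k] bspec[OF \<alpha>2 k] unfolding \<alpha>1_def \<alpha>2_def by (intro continuous_intros continuous_lam kapc) auto
    have ReJ: "Re (integral {-X..X} (?J k)) = integral {-X..X} (\<lambda>x. lam (b k) (\<alpha>1 k) x * k1 x + lam (b k) (\<alpha>2 k) x * k2 x)"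
      if k: "k \<in> K" for k X
    proof -
      have "?J k integrable_on {-X..X}" by (intro integrable_continuous_real cJ k)
      from integral_linear[OF this bounded_linear_Re]
      have "Re (integral {-X..X} (?J k)) = integral {-X..X} (\<lambda>x. Re (?J k x))" unfolding o_def by (rule sym)
      also have "(\<lambda>x. Re (?J k x)) = (\<lambda>x. lam (b k) (\<alpha>1 k) x * k1 x + lam (b k) (\<alpha>2 k) x * k2 x)"
        by (rule ext) (simp add: keq \<alpha>1_def \<alpha>2_def)
      finally show ?thesis .
    qed
    have ilam: "(\<lambda>x. lam (b k) (\<alpha>1 k) x * k1 x + lam (b k) (\<alpha>2 k) x * k2 x) integrable_on {-X..X}" if k: "k \<in> K" for k X
      using bspec[OF \<alpha>1 k] bspec[OF \<alpha>2 k] by (intro integrable_continuous_real continuous_intros continuous_lam cont) auto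
    \<comment> \<open>The joint potential at \<open>w0\<close> of the masses of all points on both
      rays.\<close>
    define S where "S = (\<Sum>k\<in>K. real (n k) * Re (l k))"
    have limS: "((\<lambda>X. integral {-X..X} (\<lambda>x. ray_mass K n b \<alpha>1 x * k1 x + ray_mass K n b \<alpha>2 x * k2 x)) \<longlongrightarrow> S) at_top"
    proof -
      have "((\<lambda>X. \<Sum>k\<in>K. real (n k) * Re (integral {-X..X} (?J k))) \<longlongrightarrow> S) at_top"
        unfolding S_def by (intro tendsto_intros l(1))
      moreover have "(\<Sum>k\<in>K. real (n k) * Re (integral {-X..X} (?J k))) = integral {-X..X} (\<lambda>x. ray_mass K n b \<alpha>1 x * k1 x + ray_mass K n b \<alpha>2 x * k2 x)" for X
      proof -
        have "(\<Sum>k\<in>K. real (n k) * Re (integral {-X..X} (?J k))) = (\<Sum>k\<in>K. integral {-X..X} (\<lambda>x. real (n k) * (lam (b k) (\<alpha>1 k) x * k1 x + lam (b k) (\<alpha>2 k) x * k2 x)))"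
          by (intro sum.cong refl) (simp only: ReJ integral_mult_right)
        also have "\<dots> = integral {-X..X} (\<lambda>x. \<Sum>k\<in>K. real (n k) * (lam (b k) (\<alpha>1 k) x * k1 x + lam (b k) (\<alpha>2 k) x * k2 x))"
          by (rule integral_sum[symmetric]) (use fin in \<open>auto intro!: integrable_on_mult_right ilam\<close>)
        also have "(\<lambda>x. \<Sum>k\<in>K. real (n k) * (lam (b k) (\<alpha>1 k) x * k1 x + lam (b k) (\<alpha>2 k) x * k2 x))
           = (\<lambda>x. ray_mass K n b \<alpha>1 x * k1 x + ray_mass K n b \<alpha>2 x * k2 x)"
          unfolding ray_mass_def sum_distrib_right sum.distrib[symmetric]
          by (intro ext sum.cong refl) (simp only: distrib_left mult.assoc)
        finally show ?thesis .
      qed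
      ultimately show ?thesis by simp
    qed
    define P1 where "P1 = (\<Prod>i<N1. norm (1 - exp (Complex (u - t1 i) v)))"
    define P2 where "P2 = (\<Prod>i<N2. norm (1 - exp (Complex (u - t2 i) (v - \<eta>))))"
    define n1 where "n1 = (\<lambda>y. real (card {i. i < N1 \<and> t1 i \<le> y}))"
    define n2 where "n2 = (\<lambda>y. real (card {i. i < N2 \<and> t2 i \<le> y}))"
    have nzf: "norm (1 - exp (Complex x v')) > 0" if "sin (v' / 2) \<noteq> 0" for x v'
    proof -
      have "(norm (1 - exp (Complex x v')))\<^sup>2 > 0"
        unfolding norm_one_minus_exp_sq using that by (intro add_nonneg_pos) auto
      thus ?thesis by (cases "norm (1 - exp (Complex x v')) = 0") auto
    qed
    have P: "P1 > 0" "P2 > 0" unfolding P1_def P2_def by (intro prod_pos ballI nzf s1 s2)+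
    have limP: "((\<lambda>X. integral {-X..X} (\<lambda>y. n1 y * k1 y) + integral {-X..X} (\<lambda>y. n2 y * k2 y)) \<longlongrightarrow> ln P1 + ln P2) at_top"
      unfolding P1_def P2_def n1_def n2_def k1_def k2_def by (intro tendsto_add d1(2) d2(2))
    have "ln P1 + ln P2 - S \<le> ray_error M u v + ray_error M u (v - \<eta>)"
    proof (rule tendsto_upperbound[OF tendsto_diff[OF limP limS]])
      show "eventually (\<lambda>X. integral {-X..X} (\<lambda>y. n1 y * k1 y) + integral {-X..X} (\<lambda>y. n2 y * k2 y)
         - integral {-X..X} (\<lambda>x. ray_mass K n b \<alpha>1 x * k1 x + ray_mass K n b \<alpha>2 x * k2 x) \<le> ray_error M u v + ray_error M u (v - \<eta>)) at_top"
        using eventually_ge_at_top[of 0]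
      proof eventually_elim
        fix X :: real assume X: "0 \<le> X"
        have ir: "(\<lambda>x. ray_mass K n b \<alpha>1 x * k1 x) integrable_on {-X..X}" "(\<lambda>x. ray_mass K n b \<alpha>2 x * k2 x) integrable_on {-X..X}"
          by (intro integrable_continuous_real continuous_intros cont continuous_on_subset[OF rm1(1)] continuous_on_subset[OF rm2(1)]; simp)+
        have inn: "(\<lambda>y. n1 y * k1 y) integrable_on {-X..X}" "(\<lambda>y. n2 y * k2 y) integrable_on {-X..X}"
          unfolding n1_def n2_def k1_def k2_def by (rule d1(3) d2(3))+
        have e1: "integral {-X..X} (\<lambda>y. (n1 y - ray_mass K n b \<alpha>1 y) * k1 y) \<le> ray_error M u v"
          using d1(4)[OF X, of u] unfolding n1_def k1_def by linarith
        have e2: "integral {-X..X} (\<lambda>y. (n2 y - ray_mass K n b \<alpha>2 y) * k2 y) \<le> ray_error M u (v - \<eta>)"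
          using d2(4)[OF X, of u] unfolding n2_def k2_def by linarith
        show "integral {-X..X} (\<lambda>y. n1 y * k1 y) + integral {-X..X} (\<lambda>y. n2 y * k2 y)
         - integral {-X..X} (\<lambda>x. ray_mass K n b \<alpha>1 x * k1 x + ray_mass K n b \<alpha>2 x * k2 x) \<le> ray_error M u v + ray_error M u (v - \<eta>)"
          using e1 e2 ir inn by (simp add: left_diff_distrib integral_diff integral_add)
      qed
    qed simp
    hence "exp (ln P1 + ln P2) \<le> exp (S + (ray_error M u v + ray_error M u (v - \<eta>)))" by simp
    hence ex: "P1 * P2 \<le> exp S * exp (ray_error M u v + ray_error M u (v - \<eta>))"
      using P by (simp only: exp_add exp_ln)
    have G: "(\<Prod>k\<in>K. norm (atoms_poly L (atom (b k) (\<gamma> k)) w0) ^ n k) * exp S \<le> (\<Prod>k\<in>K. (1 + exp (\<beta> * (u - b k))) ^ n k)"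
    proof -
      have "(\<Prod>k\<in>K. norm (atoms_poly L (atom (b k) (\<gamma> k)) w0) ^ n k) * exp S = (\<Prod>k\<in>K. (norm (atoms_poly L (atom (b k) (\<gamma> k)) w0) * exp (Re (l k))) ^ n k)"
        unfolding S_def exp_sum[OF fin] prod.distrib[symmetric]
        by (intro prod.cong refl) (simp add: power_mult_distrib exp_of_nat_mult)
      also have "\<dots> \<le> (\<Prod>k\<in>K. (1 + exp (\<beta> * (u - b k))) ^ n k)"
      proof (rule prod_mono, intro conjI power_mono)
        fix k assume k: "k \<in> K"
        let ?\<theta> = "if v < 0 then \<gamma> k else - \<gamma> k"
        have "norm (atoms_poly L (atom (b k) (\<gamma> k)) w0) * exp (Re (l k)) = norm (G (b k) ?\<theta> w0)"
          unfolding l(2)[OF k] by (simp add: norm_mult)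
        also have "\<dots> \<le> norm (1::complex) + norm (exp (complex_of_real \<beta> * (w0 - complex_of_real (b k)) + \<i> * ?\<theta>))"
          unfolding G_def by (rule norm_triangle_ineq4)
        also have "\<dots> = 1 + exp (\<beta> * (u - b k))" by (simp add: w0_def)
        finally show "norm (atoms_poly L (atom (b k) (\<gamma> k)) w0) * exp (Re (l k)) \<le> 1 + exp (\<beta> * (u - b k))" .
      qed auto
      finally show ?thesis .
    qed
    let ?A = "\<Prod>k\<in>K. norm (atoms_poly L (atom (b k) (\<gamma> k)) w0) ^ n k"
    let ?E = "exp (ray_error M u v + ray_error M u (v - \<eta>))"
    have A0: "?A \<ge> 0" by (intro prod_nonneg) auto
    have "?A * P1 * P2 \<le> ?A * (exp S * ?E)"
      using mult_left_mono[OF ex A0] by (simp only: mult.assoc)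
    also have "\<dots> = (?A * exp S) * ?E" by (simp only: mult.assoc)
    also have "\<dots> \<le> (\<Prod>k\<in>K. (1 + exp (\<beta> * (u - b k))) ^ n k) * ?E"
      by (intro mult_right_mono G) auto
    finally show "(\<Prod>k\<in>K. norm (atoms_poly L (atom (b k) (\<gamma> k)) (Complex u v)) ^ n k) *
       (\<Prod>i<N1. norm (1 - exp (Complex (u - t1 i) v))) * (\<Prod>i<N2. norm (1 - exp (Complex (u - t2 i) (v - \<eta>))))
       \<le> (\<Prod>k\<in>K. (1 + exp (\<beta> * (u - b k))) ^ n k) * exp (ray_error M u v + ray_error M u (v - \<eta>))"
      unfolding P1_def P2_def w0_def .
  qed
qed

end

subsection \<open>Polynomials with prescribed zeros and majorant\<close>

lemma maximum_modulus_cball: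
  assumes "f holomorphic_on UNIV" "\<And>z. z \<in> sphere p r \<Longrightarrow> norm (f z) \<le> B" "w \<in> cball p r" "r > 0"
  shows "norm (f w) \<le> B"
proof (rule maximum_modulus_frontier[of f "cball p r"])
  show "f holomorphic_on interior (cball p r)" using assms(1) by (rule holomorphic_on_subset) auto
  show "continuous_on (closure (cball p r)) f"
    using holomorphic_on_imp_continuous_on[OF assms(1)] by (rule continuous_on_subset) auto
qed (use assms in auto)

text \<open>The circle around the projection of \<open>z\<close> meets the real axis in two points,
  and these are the zeros of the multiplier
  \<open>(w - p)\<^sup>2 - of_real (\<rho>\<^sup>2)\<close>. On the circle its modulus is exactly
  \<open>2 * \<rho> * \<bar>Im w\<bar>\<close>, which matches the assumed singularity, and at
  \<open>z\<close> it is at least \<open>\<rho>\<^sup>2\<close>. The maximum principle compares the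
  two.\<close>

lemma remove_line_singularity_aux:
  assumes f: "f holomorphic_on UNIV" and \<rho>: "\<rho> > 0"
    and b: "\<And>w. norm (w - of_real (Re z)) = \<rho> \<Longrightarrow> norm (f w) * \<bar>Im w\<bar> ^ m \<le> B"
    and z: "\<bar>Im z\<bar> \<le> \<rho>"
  shows "norm (f z) \<le> (2 / \<rho>) ^ m * B"
proof -
  define p where "p = complex_of_real (Re z)"
  define g where "g = (\<lambda>w. f w * ((w - p)\<^sup>2 - of_real (\<rho>\<^sup>2)) ^ m)"
  have key: "norm ((w - p)\<^sup>2 - of_real (\<rho>\<^sup>2)) = 2 * \<rho> * \<bar>Im w\<bar>" if w: "norm (w - p) = \<rho>" for w
  proof -
    define x where "x = Re (w - p)"
    define y where "y = Im w"
    have wp: "w - p = Complex x y" by (simp add: x_def y_def p_def complex_eq_iff)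
    have xy: "x\<^sup>2 + y\<^sup>2 = \<rho>\<^sup>2" using w unfolding wp by (metis cmod_power2 complex.sel)
    have e: "(w - p)\<^sup>2 - of_real (\<rho>\<^sup>2) = 2 * y * Complex (- y) x"
      unfolding wp xy[symmetric] by (simp add: complex_eq_iff power2_eq_square)
    have "norm (Complex (- y) x) = \<rho>"
    proof -
      have "norm (Complex (- y) x) = sqrt (x\<^sup>2 + y\<^sup>2)" by (simp add: cmod_def add.commute)
      thus ?thesis using xy \<rho> by simp
    qed
    thus ?thesis unfolding e norm_mult by (simp add: y_def)
  qed
  have "norm (g z) \<le> (2 * \<rho>) ^ m * B"
  proof (rule maximum_modulus_cball[of g p \<rho>])
    show "g holomorphic_on UNIV" unfolding g_def by (intro holomorphic_intros f)
    show "z \<in> cball p \<rho>" using z by (simp add: p_def dist_norm norm_minus_commute cmod_def)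
    fix w assume "w \<in> sphere p \<rho>"
    hence w: "norm (w - p) = \<rho>" by (simp add: dist_norm norm_minus_commute)
    have "norm (g w) = (2 * \<rho>) ^ m * (norm (f w) * \<bar>Im w\<bar> ^ m)"
      unfolding g_def norm_mult norm_power key[OF w] by (simp add: power_mult_distrib)
    also have "\<dots> \<le> (2 * \<rho>) ^ m * B" using b w \<rho> by (intro mult_left_mono) (auto simp: p_def)
    finally show "norm (g w) \<le> (2 * \<rho>) ^ m * B" .
  qed (use \<rho> in auto)
  moreover have "(z - p)\<^sup>2 - of_real (\<rho>\<^sup>2) = - of_real ((Im z)\<^sup>2 + \<rho>\<^sup>2)"
    by (simp add: p_def complex_eq_iff power2_eq_square)
  hence "norm ((z - p)\<^sup>2 - of_real (\<rho>\<^sup>2)) = (Im z)\<^sup>2 + \<rho>\<^sup>2"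
    by (simp only: norm_minus_cancel norm_of_real) simp
  hence "norm (g z) = norm (f z) * ((Im z)\<^sup>2 + \<rho>\<^sup>2) ^ m"
    by (simp add: g_def norm_mult norm_power)
  moreover have "norm (f z) * (\<rho>\<^sup>2) ^ m \<le> norm (f z) * ((Im z)\<^sup>2 + \<rho>\<^sup>2) ^ m"
    by (intro mult_left_mono power_mono) auto
  ultimately have "norm (f z) * (\<rho>\<^sup>2) ^ m \<le> (2 * \<rho>) ^ m * B" by linarith
  hence "norm (f z) \<le> (2 * \<rho>) ^ m * B / (\<rho>\<^sup>2) ^ m" using \<rho> by (simp add: field_simps)
  also have "\<dots> = (2 / \<rho>) ^ m * B" using \<rho>
    by (simp add: power_divide power_mult_distrib power2_eq_square)
  finally show ?thesis .
qed

lemma remove_line_singularity: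
  assumes f: "f holomorphic_on UNIV" and \<rho>: "\<rho> > 0"
    and b: "\<And>w. norm (w - z) \<le> 2 * \<rho> \<Longrightarrow> norm (f w) * \<bar>Im w\<bar> ^ m \<le> B"
  shows "norm (f z) \<le> (2 / \<rho>) ^ m * B"
proof (cases "\<bar>Im z\<bar> \<le> \<rho>")
  case True
  show ?thesis
  proof (rule remove_line_singularity_aux[OF f \<rho> b True])
    fix w :: complex assume w: "norm (w - of_real (Re z)) = \<rho>"
    have "norm (of_real (Re z) - z) \<le> \<rho>" using True by (simp add: cmod_def)
    moreover have "norm (w - z) \<le> norm (w - of_real (Re z)) + norm (of_real (Re z) - z)"
      using norm_triangle_ineq[of "w - of_real (Re z)" "of_real (Re z) - z"] by simp
    ultimately show "norm (w - z) \<le> 2 * \<rho>" using w by linarith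
  qed
next
  case False
  have b0: "norm (f z) * \<bar>Im z\<bar> ^ m \<le> B" using b[of z] \<rho> by simp
  hence B0: "B \<ge> 0" by (rule order_trans[rotated]) auto
  have "norm (f z) * \<rho> ^ m \<le> norm (f z) * \<bar>Im z\<bar> ^ m"
    using False \<rho> by (intro mult_left_mono power_mono) auto
  hence "norm (f z) \<le> B / \<rho> ^ m" using b0 \<rho> by (simp add: field_simps)
  also have "\<dots> = (1 / \<rho>) ^ m * B" by (simp add: power_divide)
  also have "\<dots> \<le> (2 / \<rho>) ^ m * B"
    using \<rho> B0 by (intro mult_right_mono power_mono divide_right_mono) auto
  finally show ?thesis .
qed

text \<open>The lines intersect, so they are removed one at a time. Removing the real axis at a
  point with distance h from the second line takes a disc of radius comparable to h and costs
  another power \<open>h ^ m\<close>. The second line is therefore removed with exponent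
  \<open>2 * m\<close>, which makes \<open>3 * m\<close> in total.\<close>

lemma remove_two_lines:
  assumes f: "f holomorphic_on UNIV" and \<rho>: "\<rho> > 0" "\<rho> \<le> 1" and c: "norm c = 1"
    and b: "\<And>w. norm (w - z) \<le> 4 * \<rho> \<Longrightarrow> norm (f w) * \<bar>Im w\<bar> ^ m * \<bar>Im (w * c)\<bar> ^ m \<le> B"
    and R: "norm z + 4 \<le> R"
  shows "norm (f z) \<le> (16 * R / \<rho>) ^ (3 * m) * B"
proof -
  have c0: "c \<noteq> 0" using c by auto
  have B0: "B \<ge> 0" using b[of z] \<rho> by (intro order_trans[OF _ b[of z]]) auto
  have R1: "R \<ge> 4" using R norm_ge_zero[of z] by linarith
  have step: "norm (f w) * \<bar>Im (w * c)\<bar> ^ (2 * m) \<le> (8 * R / \<rho>) ^ m * 2 ^ m * B" if w: "norm (w - z) \<le> 2 * \<rho>" for w :: complex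
  proof (cases "Im (w * c) = 0")
    case True
    show ?thesis
    proof (cases "m = 0")
      case True
      thus ?thesis using b[of w] w \<rho> by simp
    next
      case False
      hence "\<bar>Im (w * c)\<bar> ^ (2 * m) = 0" using True by simp
      moreover have "(8 * R / \<rho>) ^ m * 2 ^ m * B \<ge> 0" using B0 R1 \<rho> by simp
      ultimately show ?thesis by (simp only: mult_zero_right)
    qed
  next
    case False
    define h where "h = \<bar>Im (w * c)\<bar>"
    have h: "h > 0" using False by (simp add: h_def)
    have hR: "h \<le> R"
    proof -
      have "h \<le> norm (w * c)" unfolding h_def by (rule abs_Im_le_cmod)
      also have "\<dots> = norm w" using c by (simp add: norm_mult)
      also have "\<dots> \<le> norm z + 2 * \<rho>" using w norm_triangle_ineq2[of w z] by linarith
      finally show ?thesis using R \<rho> by linarith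
    qed
    \<comment> \<open>In the disc of radius \<open>2 * \<rho>'\<close> the distance to the second
      line stays at least h / 2.\<close>
    define \<rho>' where "\<rho>' = min \<rho> (h / 4)"
    have \<rho>': "\<rho>' > 0" "\<rho>' \<le> \<rho>" "\<rho>' \<le> h / 4" using \<rho> h by (auto simp: \<rho>'_def)
    have "norm (f w) \<le> (2 / \<rho>') ^ m * (B / (h / 2) ^ m)"
    proof (rule remove_line_singularity[OF f \<rho>'(1)])
      fix y assume y: "norm (y - w) \<le> 2 * \<rho>'"
      have "norm (y - z) \<le> norm (y - w) + norm (w - z)"
        using norm_triangle_ineq[of "y - w" "w - z"] by simp
      hence yz: "norm (y - z) \<le> 4 * \<rho>" using y w \<rho>' by linarith
      have "\<bar>Im ((y - w) * c)\<bar> \<le> norm ((y - w) * c)" by (rule abs_Im_le_cmod)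
      also have "\<dots> \<le> 2 * \<rho>'" using y c by (simp add: norm_mult)
      also have "\<dots> \<le> h / 2" using \<rho>' by simp
      finally have "\<bar>Im (y * c) - Im (w * c)\<bar> \<le> h / 2" by (simp add: left_diff_distrib)
      hence "h / 2 \<le> \<bar>Im (y * c)\<bar>" unfolding h_def by linarith
      hence "(h / 2) ^ m \<le> \<bar>Im (y * c)\<bar> ^ m" using h by (intro power_mono) auto
      hence "norm (f y) * \<bar>Im y\<bar> ^ m * (h / 2) ^ m \<le> norm (f y) * \<bar>Im y\<bar> ^ m * \<bar>Im (y * c)\<bar> ^ m"
        by (intro mult_left_mono) auto
      also have "\<dots> \<le> B" by (rule b[OF yz])
      finally show "norm (f y) * \<bar>Im y\<bar> ^ m \<le> B / (h / 2) ^ m" using h by (simp add: field_simps)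
    qed
    hence "norm (f w) * h ^ (2 * m) \<le> (2 / \<rho>') ^ m * (B / (h / 2) ^ m) * h ^ (2 * m)"
      using h by (intro mult_right_mono) auto
    also have "\<dots> = (2 * h / \<rho>') ^ m * 2 ^ m * B"
    proof -
      have "h ^ (2 * m) = h ^ m * h ^ m" by (simp add: mult_2 power_add)
      thus ?thesis using h by (simp add: power_divide power_mult_distrib)
    qed
    also have "\<dots> \<le> (8 * R / \<rho>) ^ m * 2 ^ m * B"
    proof (intro mult_right_mono power_mono)
      show "2 * h / \<rho>' \<le> 8 * R / \<rho>"
      proof (cases "\<rho> \<le> h / 4")
        case True
        hence "2 * h / \<rho>' = 2 * h / \<rho>" by (simp add: \<rho>'_def)
        also have "\<dots> \<le> 8 * R / \<rho>" using hR R1 \<rho> by (intro divide_right_mono) auto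
        finally show ?thesis .
      next
        case False
        hence "\<rho>' = h / 4" by (simp add: \<rho>'_def)
        hence "h = 4 * \<rho>'" by simp
        hence "2 * h / \<rho>' = 8" using \<rho>'(1) by simp
        also have "8 * \<rho> \<le> 8 * R" using \<rho> R1 by simp
        hence "8 \<le> 8 * R / \<rho>" using \<rho> by (simp add: field_simps)
        finally show ?thesis .
      qed
    qed (use h \<rho>' B0 in auto)
    finally show ?thesis by (simp add: h_def)
  qed
  define g where "g = (\<lambda>w. f (w / c))"
  have "norm (g (z * c)) \<le> (2 / \<rho>) ^ (2 * m) * ((8 * R / \<rho>) ^ m * 2 ^ m * B)"
  proof (rule remove_line_singularity[where f = g and z = "z * c", OF _ \<rho>(1)])
    have "(f \<circ> (\<lambda>w. w / c)) holomorphic_on UNIV"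
      by (rule holomorphic_on_compose_gen[OF _ f]) (auto intro!: holomorphic_intros simp: c0)
    thus "g holomorphic_on UNIV" by (simp add: g_def o_def)
    fix w assume w: "norm (w - z * c) \<le> 2 * \<rho>"
    have "norm (w / c - z) = norm ((w - z * c) / c)" using c0 by (simp add: field_simps)
    also have "\<dots> \<le> 2 * \<rho>" using w c by (simp add: norm_divide)
    finally show "norm (g w) * \<bar>Im w\<bar> ^ (2 * m) \<le> (8 * R / \<rho>) ^ m * 2 ^ m * B"
      using step[of "w / c"] c0 by (simp add: g_def)
  qed
  also have "g (z * c) = f z" using c0 by (simp add: g_def)
  also have "(2 / \<rho>) ^ (2 * m) * ((8 * R / \<rho>) ^ m * 2 ^ m * B) \<le> (16 * R / \<rho>) ^ (3 * m) * B"
  proof -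
    have "(2 / \<rho>) ^ (2 * m) * ((8 * R / \<rho>) ^ m * 2 ^ m) = (2 / \<rho>) ^ (2 * m) * (16 * R / \<rho>) ^ m"
      by (simp add: power_mult_distrib[symmetric])
    also have "\<dots> \<le> (16 * R / \<rho>) ^ (2 * m) * (16 * R / \<rho>) ^ m"
      using \<rho> R1 by (intro mult_right_mono power_mono divide_right_mono) auto
    also have "\<dots> = (16 * R / \<rho>) ^ (3 * m)" by (simp add: power_add[symmetric])
    finally show ?thesis using B0 by (simp add: mult.assoc[symmetric] mult_right_mono)
  qed
  finally show ?thesis .
qed

section \<open>The majorant under a small change of the radius\<close>

lemma powr_one_plus_le:
  fixes \<epsilon> \<beta> :: real
  assumes "0 \<le> \<epsilon>" "\<epsilon> \<le> 1" "\<beta> \<ge> 0"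
  shows "(1 + \<epsilon>) powr \<beta> \<le> 1 + \<beta> * exp \<beta> * \<epsilon>"
proof -
  have "(1 + \<epsilon>) powr \<beta> = exp (\<beta> * ln (1 + \<epsilon>))" using assms by (simp add: powr_def)
  also have "\<dots> \<le> exp (\<beta> * \<epsilon>)" using ln_add_one_self_le_self[of \<epsilon>] assms by (simp add: mult_left_mono)
  also have "exp (\<beta> * \<epsilon>) \<le> 1 + \<beta> * \<epsilon> * exp (\<beta> * \<epsilon>)"
  proof -
    have "1 - \<beta> * \<epsilon> \<le> exp (- (\<beta> * \<epsilon>))" using exp_ge_add_one_self[of "- (\<beta> * \<epsilon>)"] by simp
    hence "(1 - \<beta> * \<epsilon>) * exp (\<beta> * \<epsilon>) \<le> exp (- (\<beta> * \<epsilon>)) * exp (\<beta> * \<epsilon>)" by (intro mult_right_mono) auto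
    thus ?thesis by (simp add: exp_minus algebra_simps)
  qed
  also have "\<dots> \<le> 1 + \<beta> * \<epsilon> * exp \<beta>"
    using assms by (intro add_left_mono mult_left_mono) (auto simp: mult_left_le)
  finally show ?thesis by (simp add: mult_ac)
qed

definition kernel_sum :: "real \<Rightarrow> 'k set \<Rightarrow> ('k \<Rightarrow> nat) \<Rightarrow> ('k \<Rightarrow> real) \<Rightarrow> real \<Rightarrow> real" where
  "kernel_sum \<beta> K n b r = (\<Sum>k\<in>K. real (n k) * ln (1 + (r / exp (b k)) powr \<beta>))"

lemma kernel_sum_nonneg: "kernel_sum \<beta> K n b r \<ge> 0"
  unfolding kernel_sum_def by (intro sum_nonneg mult_nonneg_nonneg) auto

lemma kernel_sum_mono:
  assumes "\<beta> \<ge> 0" "0 \<le> r" "r \<le> r'"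
  shows "kernel_sum \<beta> K n b r \<le> kernel_sum \<beta> K n b r'"
  unfolding kernel_sum_def
proof (intro sum_mono mult_left_mono)
  fix k
  have "(r / exp (b k)) powr \<beta> \<le> (r' / exp (b k)) powr \<beta>"
    using assms by (intro powr_mono2 divide_right_mono) auto
  thus "ln (1 + (r / exp (b k)) powr \<beta>) \<le> ln (1 + (r' / exp (b k)) powr \<beta>)"
    by (subst ln_le_cancel_iff) (auto intro: add_pos_nonneg)
qed auto

lemma ln_one_plus_mult_le:
  fixes c x :: real
  assumes "c \<ge> 1" "x \<ge> 0"
  shows "ln (1 + c * x) \<le> c * ln (1 + x)"
proof -
  have "c * ln (1 + 0) - ln (1 + c * 0) \<le> c * ln (1 + x) - ln (1 + c * x)"
  proof (rule DERIV_nonneg_imp_nondecreasing[OF assms(2)])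
    fix t :: real assume t: "0 \<le> t" "t \<le> x"
    have p: "1 + t > 0" "1 + c * t > 0" using t assms by (auto intro: add_pos_nonneg)
    have "((\<lambda>t. c * ln (1 + t) - ln (1 + c * t)) has_real_derivative (c / (1 + t) - c / (1 + c * t))) (at t)"
      using p by (auto intro!: derivative_eq_intros)
    moreover have "1 + t \<le> 1 + c * t" using assms(1) t mult_right_mono[of 1 c t] by simp
    hence "c / (1 + c * t) \<le> c / (1 + t)" using assms p by (intro divide_left_mono) auto
    ultimately show "\<exists>y. ((\<lambda>t. c * ln (1 + t) - ln (1 + c * t)) has_real_derivative y) (at t) \<and> 0 \<le> y"
      by (intro exI[of _ "c / (1 + t) - c / (1 + c * t)"]) simp
  qed
  thus ?thesis by simp
qed

text \<open>By concavity of the logarithm, scaling the radius by \<open>1 + \<epsilon>\<close>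
  multiplies the sum by at most \<open>(1 + \<epsilon>) powr \<beta>\<close>, and for
  \<open>\<epsilon> = 1 / (1 + r) ^ m\<close> the growth hypothesis turns the increase into a
  constant. This decides how large the discs may be in which line singularities are removed: with a
  fixed radius the exponent could grow by an unbounded amount.\<close>

lemma kernel_sum_shift:
  assumes \<beta>: "\<beta> \<ge> 0" and A: "\<And>r. r \<ge> 0 \<Longrightarrow> kernel_sum \<beta> K n b r \<le> A * (1 + r) ^ m" "A \<ge> 0" and r: "r \<ge> 0"
  shows "kernel_sum \<beta> K n b (r + 1 / (1 + r) ^ m) \<le> kernel_sum \<beta> K n b r + (\<beta> * exp \<beta> * A + A * 3 ^ m)"
proof (cases "r \<ge> 1")
  case True
  define \<epsilon> where "\<epsilon> = 1 / (1 + r) ^ m"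
  have \<epsilon>: "\<epsilon> \<ge> 0" "\<epsilon> \<le> 1" using r by (auto simp: \<epsilon>_def divide_le_eq)
  have "r + \<epsilon> \<le> (1 + \<epsilon>) * r" using True \<epsilon> mult_left_mono[of 1 r \<epsilon>] by (simp add: algebra_simps)
  hence "kernel_sum \<beta> K n b (r + \<epsilon>) \<le> kernel_sum \<beta> K n b ((1 + \<epsilon>) * r)"
    using \<beta> r \<epsilon> by (intro kernel_sum_mono) auto
  also have "\<dots> \<le> (1 + \<epsilon>) powr \<beta> * kernel_sum \<beta> K n b r"
    unfolding kernel_sum_def sum_distrib_left
  proof (rule sum_mono)
    fix k
    have "ln (1 + ((1 + \<epsilon>) * r / exp (b k)) powr \<beta>) = ln (1 + (1 + \<epsilon>) powr \<beta> * (r / exp (b k)) powr \<beta>)"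
      using \<epsilon> r by (simp add: powr_mult powr_divide)
    also have "\<dots> \<le> (1 + \<epsilon>) powr \<beta> * ln (1 + (r / exp (b k)) powr \<beta>)"
      using \<epsilon> \<beta> by (intro ln_one_plus_mult_le) (auto intro: ge_one_powr_ge_zero)
    finally have "real (n k) * ln (1 + ((1 + \<epsilon>) * r / exp (b k)) powr \<beta>) \<le> real (n k) * ((1 + \<epsilon>) powr \<beta> * ln (1 + (r / exp (b k)) powr \<beta>))"
      by (rule mult_left_mono) simp
    thus "real (n k) * ln (1 + ((1 + \<epsilon>) * r / exp (b k)) powr \<beta>) \<le> (1 + \<epsilon>) powr \<beta> * (real (n k) * ln (1 + (r / exp (b k)) powr \<beta>))"
      by (simp only: mult_ac)
  qed
  also have "\<dots> \<le> (1 + \<beta> * exp \<beta> * \<epsilon>) * kernel_sum \<beta> K n b r"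
    by (intro mult_right_mono powr_one_plus_le \<epsilon> \<beta> kernel_sum_nonneg)
  also have "\<dots> = kernel_sum \<beta> K n b r + \<beta> * exp \<beta> * (\<epsilon> * kernel_sum \<beta> K n b r)" by (simp add: algebra_simps)
  also have "\<epsilon> * kernel_sum \<beta> K n b r \<le> \<epsilon> * (A * (1 + r) ^ m)" using A(1)[OF r] \<epsilon> by (intro mult_left_mono)
  also have "\<epsilon> * (A * (1 + r) ^ m) = A" using r by (simp add: \<epsilon>_def)
  finally have "kernel_sum \<beta> K n b (r + \<epsilon>) \<le> kernel_sum \<beta> K n b r + \<beta> * exp \<beta> * A" using \<beta> by (simp add: mult_left_mono)
  moreover have "A * 3 ^ m \<ge> 0" using A(2) by simp
  ultimately show ?thesis unfolding \<epsilon>_def by linarith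
next
  case False
  have e: "1 / (1 + r) ^ m \<le> 1" "1 / (1 + r) ^ m \<ge> 0" using r by (auto simp: divide_le_eq)
  have "kernel_sum \<beta> K n b (r + 1 / (1 + r) ^ m) \<le> kernel_sum \<beta> K n b 2"
    by (rule kernel_sum_mono) (use False \<beta> r e in linarith)+
  also have "\<dots> \<le> A * (1 + 2) ^ m" by (rule A(1)) simp
  finally have "kernel_sum \<beta> K n b (r + 1 / (1 + r) ^ m) \<le> A * 3 ^ m" by simp
  moreover have "\<beta> * exp \<beta> * A \<ge> 0" using \<beta> A(2) by simp
  ultimately show ?thesis using kernel_sum_nonneg[of \<beta> K n b r] by linarith
qed

section \<open>Polynomials for one window of arguments\<close>

context sector_kernel
begin

text \<open>The atoms with their multiplicities, and linear factors for the rounded masses on the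
  rays of argument 0 and \<open>\<eta>\<close>.\<close>

definition group_poly :: "'k set \<Rightarrow> ('k \<Rightarrow> nat) \<Rightarrow> ('k \<Rightarrow> real) \<Rightarrow> ('k \<Rightarrow> real) \<Rightarrow> nat \<Rightarrow> (nat \<Rightarrow> real) \<Rightarrow> nat \<Rightarrow> (nat \<Rightarrow> real) \<Rightarrow> complex \<Rightarrow> complex" where
  "group_poly K n b \<gamma> N1 t1 N2 t2 z =
    (\<Prod>k\<in>K. (\<Prod>j<L. 1 - z * exp (- atom (b k) (\<gamma> k) j)) ^ n k) *
    (\<Prod>i<N1. 1 - z * exp (- t1 i)) * (\<Prod>i<N2. 1 - z * exp (- Complex (t2 i) \<eta>))"

text \<open>\<open>exp u * \<bar>sin v\<bar>\<close> is the distance to the line that contains the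
  ray. Its fourth power cancels the singularity, since \<open>ray_error\<close> has the coefficient
  4 in front of the logarithm and \<open>sin v\<close> contains the factor
  \<open>sin (v / 2)\<close>.\<close>

lemma exp_ray_error_le:
  assumes v: "sin (v / 2) \<noteq> 0" and M: "M \<ge> 0"
  shows "exp (ray_error M u v) * (exp u * \<bar>sin v\<bar>) ^ 4 \<le> exp (6 + 4 * M) * 4 ^ 4 * (1 + exp u) ^ 8"
proof -
  define \<delta> where "\<delta> = \<bar>sin (v / 2)\<bar>"
  have \<delta>: "\<delta> > 0" "\<delta> \<le> 1" using v by (auto simp: \<delta>_def)
  have "exp (ray_error M u v) = exp (6 + 4 * M) * exp (4 * ln ((1 + \<delta>) / \<delta>)) * exp (4 * max 0 u)"
    by (simp add: ray_error_def \<delta>_def exp_add[symmetric] algebra_simps)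
  also have "exp (4 * ln ((1 + \<delta>) / \<delta>)) = ((1 + \<delta>) / \<delta>) ^ 4"
    using exp_of_nat_mult[of 4 "ln ((1 + \<delta>) / \<delta>)"] \<delta> by simp
  also have "exp (4 * max 0 u) = exp (max 0 u) ^ 4"
    using exp_of_nat_mult[of 4 "max 0 u"] by simp
  finally have e: "exp (ray_error M u v) = exp (6 + 4 * M) * ((1 + \<delta>) / \<delta>) ^ 4 * exp (max 0 u) ^ 4" .
  have "sin v = 2 * sin (v / 2) * cos (v / 2)" using sin_double[of "v / 2"] by simp
  hence "\<bar>sin v\<bar> = 2 * \<delta> * \<bar>cos (v / 2)\<bar>" by (simp add: abs_mult \<delta>_def)
  also have "\<dots> \<le> 2 * \<delta> * 1" using \<delta> by (intro mult_left_mono) auto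
  finally have sv: "\<bar>sin v\<bar> \<le> 2 * \<delta>" by simp
  have "(1 + \<delta>) / \<delta> * (exp u * \<bar>sin v\<bar>) \<le> (1 + \<delta>) / \<delta> * (exp u * (2 * \<delta>))"
    using sv \<delta> by (intro mult_left_mono) auto
  also have "\<dots> = 2 * (1 + \<delta>) * exp u" using \<delta> by simp
  also have "\<dots> \<le> 4 * (1 + exp u)" using \<delta> by (intro mult_mono) auto
  finally have 1: "(1 + \<delta>) / \<delta> * (exp u * \<bar>sin v\<bar>) \<le> 4 * (1 + exp u)" .
  have 2: "exp (max 0 u) \<le> 1 + exp u" by (auto simp: max_def)
  have "exp (ray_error M u v) * (exp u * \<bar>sin v\<bar>) ^ 4 = exp (6 + 4 * M) * (((1 + \<delta>) / \<delta> * (exp u * \<bar>sin v\<bar>)) ^ 4 * exp (max 0 u) ^ 4)"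
    unfolding e by (simp only: power_mult_distrib mult_ac)
  also have "\<dots> \<le> exp (6 + 4 * M) * ((4 * (1 + exp u)) ^ 4 * (1 + exp u) ^ 4)"
    by (intro mult_left_mono mult_mono power_mono 1 2) (use \<delta> in auto)
  also have "\<dots> = exp (6 + 4 * M) * 4 ^ 4 * (1 + exp u) ^ 8"
  proof -
    have e8: "(1 + exp u) ^ 8 = (1 + exp u) ^ 4 * (1 + exp u) ^ 4"
      using power_add[of "1 + exp u" 4 4] by simp
    show ?thesis unfolding power_mult_distrib e8 by (simp only: mult_ac)
  qed
  finally show ?thesis .
qed

text \<open>In this multiplied form the estimate extends to the rays, where the potentials were
  excluded: there the left-hand side is 0.\<close>

lemma group_poly_bound:
  assumes fin: "finite K" and \<gamma>: "\<And>k. k \<in> K \<Longrightarrow> pi \<le> \<gamma> k \<and> \<gamma> k \<le> pi + pi * s"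
    and M: "(\<Sum>k\<in>K. real (n k) * (2 * exp (- \<beta> * b k))) \<le> M" "M \<ge> 0"
  obtains N1 t1 N2 t2 where
    "\<And>z. norm (group_poly K n b \<gamma> N1 t1 N2 t2 z) * \<bar>Im z\<bar> ^ 4 * \<bar>Im (z * cis (- \<eta>))\<bar> ^ 4
       \<le> exp (kernel_sum \<beta> K n b (norm z)) * ((exp (6 + 4 * M) * 4 ^ 4) ^ 2 * (1 + norm z) ^ 16)"
proof (rule discretized_product_bound[of K \<gamma> n b M], goal_cases)
  case 1
  show ?case by (rule fin)
next
  case (2 k)
  show ?case by (rule \<gamma>[OF 2(2)])
next
  case 3
  show ?case by (rule M)
next
  case 4
  show ?case by (rule M)
next
  case (5 N1 N2 t1 t2)
  note main = 5(2)
  show ?case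
  proof (rule that[of N1 t1 N2 t2])
    fix z :: complex
    let ?F = "group_poly K n b \<gamma> N1 t1 N2 t2 z"
    let ?R = "exp (kernel_sum \<beta> K n b (norm z)) * ((exp (6 + 4 * M) * 4 ^ 4) ^ 2 * (1 + norm z) ^ 16)"
    show "norm ?F * \<bar>Im z\<bar> ^ 4 * \<bar>Im (z * cis (- \<eta>))\<bar> ^ 4 \<le> ?R"
    proof (cases "Im z = 0 \<or> Im (z * cis (- \<eta>)) = 0")
      case True
      thus ?thesis by auto
    next
      case False
      hence z0: "z \<noteq> 0" by auto
      define u where "u = ln (norm z)"
      have eu: "exp u = norm z" using z0 by (simp add: u_def)
      \<comment> \<open>The branch of the argument that fits the two strips, with values from
        \<open>\<eta> - 2 * pi\<close> up to \<open>\<eta>\<close>.\<close>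
      define v where "v = (if Arg z < \<eta> then Arg z else Arg z - 2 * pi)"
      have zw: "z = exp (Complex u v)"
      proof -
        have "exp (Complex u v) = of_real (exp u) * cis v" by (simp add: complex_eq_iff Re_exp Im_exp)
        also have "cis v = cis (Arg z)" by (simp add: v_def complex_eq_iff cos_diff sin_diff)
        also have "of_real (exp u) * cis (Arg z) = z" unfolding eu by (rule rcis_cmod_Arg[unfolded rcis_def])
        finally show ?thesis ..
      qed
      have v: "\<eta> - 2 * pi \<le> v" "v < \<eta>"
        using Arg_bounded[of z] \<eta>_pos \<eta>_less by (auto simp: v_def)
      have Imz: "Im z = exp u * sin v" by (subst zw) (simp add: Im_exp)
      have Imz2: "Im (z * cis (- \<eta>)) = exp u * sin (v - \<eta>)"
        by (subst zw) (simp add: Im_exp Re_exp sin_diff algebra_simps)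
      have v0: "v \<noteq> 0" using False Imz by auto
      have v1: "v \<noteq> \<eta> - 2 * pi" using False Imz2 by auto
      have s1: "sin (v / 2) \<noteq> 0" "sin ((v - \<eta>) / 2) \<noteq> 0"
        using v v0 v1 \<eta>_pos \<eta>_less pi_gt_zero by (intro sin_half_neq_0; auto)+
      have Feq: "norm ?F = (\<Prod>k\<in>K. norm (atoms_poly L (atom (b k) (\<gamma> k)) (Complex u v)) ^ n k) *
       (\<Prod>i<N1. norm (1 - exp (Complex (u - t1 i) v))) * (\<Prod>i<N2. norm (1 - exp (Complex (u - t2 i) (v - \<eta>))))"
      proof -
        have 1: "z * exp (- atom (b k) (\<gamma> k) j) = exp (Complex u v - atom (b k) (\<gamma> k) j)" for k j
          unfolding zw by (simp add: exp_diff exp_minus field_simps)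
        have 2: "z * exp (- complex_of_real (t1 i)) = exp (Complex (u - t1 i) v)" for i
          unfolding zw exp_add[symmetric] by (rule arg_cong[of _ _ exp]) (simp add: complex_eq_iff)
        have 3: "z * exp (- Complex (t2 i) \<eta>) = exp (Complex (u - t2 i) (v - \<eta>))" for i
          unfolding zw exp_add[symmetric] by (rule arg_cong[of _ _ exp]) (simp add: complex_eq_iff)
        have q2: "z * complex_of_real (exp (- t1 i)) = exp (Complex (u - t1 i) v)" for i
          using 2[of i] by (simp add: exp_of_real[symmetric])
        show ?thesis unfolding group_poly_def atoms_poly_def
          by (simp add: 1 q2 3 norm_mult prod_norm[symmetric] norm_power)
      qed
      have Ueq: "(\<Prod>k\<in>K. (1 + exp (\<beta> * (u - b k))) ^ n k) = exp (kernel_sum \<beta> K n b (norm z))"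
      proof -
        have p: "(norm z / exp (b k)) powr \<beta> = exp (\<beta> * (u - b k))" for k
          unfolding eu[symmetric] exp_diff[symmetric] by (simp add: powr_def)
        have "real (n k) * ln (1 + exp (\<beta> * (u - b k))) = ln ((1 + exp (\<beta> * (u - b k))) ^ n k)" for k
          by (subst ln_realpow) (auto intro: add_pos_pos)
        thus ?thesis unfolding kernel_sum_def p exp_sum[OF fin]
          by (simp add: add_pos_pos)
      qed
      have F: "norm ?F \<le> exp (kernel_sum \<beta> K n b (norm z)) * exp (ray_error M u v + ray_error M u (v - \<eta>))"
        unfolding Feq Ueq[symmetric] using v v0 v1 by (intro main) auto
      have "norm ?F * \<bar>Im z\<bar> ^ 4 * \<bar>Im (z * cis (- \<eta>))\<bar> ^ 4
         = norm ?F * ((exp u * \<bar>sin v\<bar>) ^ 4 * (exp u * \<bar>sin (v - \<eta>)\<bar>) ^ 4)"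
        unfolding Imz Imz2 abs_mult by simp
      also have "\<dots> \<le> (exp (kernel_sum \<beta> K n b (norm z)) * exp (ray_error M u v + ray_error M u (v - \<eta>))) * ((exp u * \<bar>sin v\<bar>) ^ 4 * (exp u * \<bar>sin (v - \<eta>)\<bar>) ^ 4)"
        by (intro mult_right_mono F) auto
      also have "\<dots> = exp (kernel_sum \<beta> K n b (norm z)) * ((exp (ray_error M u v) * (exp u * \<bar>sin v\<bar>) ^ 4) * (exp (ray_error M u (v - \<eta>)) * (exp u * \<bar>sin (v - \<eta>)\<bar>) ^ 4))"
        by (simp only: exp_add mult_ac)
      also have "\<dots> \<le> exp (kernel_sum \<beta> K n b (norm z)) * ((exp (6 + 4 * M) * 4 ^ 4 * (1 + exp u) ^ 8) * (exp (6 + 4 * M) * 4 ^ 4 * (1 + exp u) ^ 8))"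
        by (intro mult_left_mono mult_mono exp_ray_error_le s1 M(2)) auto
      also have "\<dots> = ?R" unfolding eu by (simp add: power2_eq_square power_add[symmetric] mult_ac)
      finally show ?thesis .
    qed
  qed
qed

text \<open>Only the atoms with index 0 will be placed at prescribed points; the remaining atoms and
  the ray points are surplus zeros, collected in \<open>H\<close>.\<close>

lemma group_poly_factor:
  obtains H where "H holomorphic_on UNIV"
    "\<And>z. group_poly K n b \<gamma> N1 t1 N2 t2 z = (\<Prod>k\<in>K. (1 - z * exp (- atom (b k) (\<gamma> k) 0)) ^ n k) * H z"
proof
  define H where "H = (\<lambda>z. (\<Prod>k\<in>K. (\<Prod>j\<in>{1..<L}. 1 - z * exp (- atom (b k) (\<gamma> k) j)) ^ n k) *
    (\<Prod>i<N1. 1 - z * exp (- t1 i)) * (\<Prod>i<N2. 1 - z * exp (- Complex (t2 i) \<eta>)))"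
  show "H holomorphic_on UNIV" unfolding H_def by (intro holomorphic_intros)
  have "{..<L} = insert 0 {1..<L}" using L by auto
  hence "(\<Prod>j<L. f j) = f 0 * (\<Prod>j\<in>{1..<L}. f j)" for f :: "nat \<Rightarrow> complex" by simp
  thus "group_poly K n b \<gamma> N1 t1 N2 t2 z = (\<Prod>k\<in>K. (1 - z * exp (- atom (b k) (\<gamma> k) 0)) ^ n k) * H z" for z
    by (simp add: group_poly_def H_def power_mult_distrib prod.distrib mult_ac)
qed

lemma group_poly_holomorphic: "group_poly K n b \<gamma> N1 t1 N2 t2 holomorphic_on S"
  unfolding group_poly_def[abs_def] by (intro holomorphic_intros)

lemma group_poly_0: "group_poly K n b \<gamma> N1 t1 N2 t2 0 = 1"
  by (simp add: group_poly_def)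

text \<open>The majorant at radius 1 controls the mass near the origin. As \<open>ln (1 + x)\<close>
  is much smaller than a large x, each single point with positive multiplicity is first used to show
  \<open>1 + x \<le> exp A\<close>; then \<open>x \<le> (1 + x) * ln (1 + x)\<close>
  applies.\<close>

lemma kernel_sum_mass:
  assumes fin: "finite K" and A: "kernel_sum \<beta> K n b 1 \<le> A"
  shows "(\<Sum>k\<in>K. real (n k) * (2 * exp (- \<beta> * b k))) \<le> 2 * (1 + exp A) * A"
proof -
  have "real (n k) * (2 * exp (- \<beta> * b k)) \<le> 2 * (1 + exp A) * (real (n k) * ln (1 + (1 / exp (b k)) powr \<beta>))" if k: "k \<in> K" for k
  proof (cases "n k = 0")
    case False
    define x where "x = exp (- \<beta> * b k)"
    have x: "x > 0" by (simp add: x_def)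
    have px: "(1 / exp (b k)) powr \<beta> = x"
      by (simp add: x_def powr_def ln_div)
    have "1 * ln (1 + x) \<le> real (n k) * ln (1 + x)" using False x by (intro mult_right_mono) auto
    also have "\<dots> \<le> kernel_sum \<beta> K n b 1" unfolding kernel_sum_def px[symmetric]
      by (rule member_le_sum[OF k]) (use fin in auto)
    finally have "ln (1 + x) \<le> A" using A by simp
    hence "exp (ln (1 + x)) \<le> exp A" by simp
    hence "1 + x \<le> exp A" using x by simp
    hence "x * ln (1 + x) \<le> exp A * ln (1 + x)" using x by (intro mult_right_mono) auto
    moreover have "x \<le> (1 + x) * ln (1 + x)"
    proof -
      have "1 - 1 / (1 + x) \<le> ln (1 + x)" using ln_le_minus_one[of "1 / (1 + x)"] x by (simp add: ln_div)
      hence "(1 + x) * (1 - 1 / (1 + x)) \<le> (1 + x) * ln (1 + x)" using x by (intro mult_left_mono) auto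
      moreover have "(1 + x) * (1 - 1 / (1 + x)) = x" using x by (simp add: field_simps)
      ultimately show ?thesis by simp
    qed
    ultimately have "x \<le> (1 + exp A) * ln (1 + x)" by (simp add: algebra_simps)
    hence "real (n k) * (2 * x) \<le> real (n k) * (2 * ((1 + exp A) * ln (1 + x)))" by (intro mult_left_mono) auto
    thus ?thesis unfolding px x_def[symmetric] by (simp only: mult_ac)
  qed simp
  hence "(\<Sum>k\<in>K. real (n k) * (2 * exp (- \<beta> * b k))) \<le> (\<Sum>k\<in>K. 2 * (1 + exp A) * (real (n k) * ln (1 + (1 / exp (b k)) powr \<beta>)))"
    by (rule sum_mono)
  also have "\<dots> = 2 * (1 + exp A) * kernel_sum \<beta> K n b 1"
    unfolding kernel_sum_def by (simp add: sum_distrib_left)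
  also have "\<dots> \<le> 2 * (1 + exp A) * A" using A by (intro mult_left_mono) (auto intro: add_nonneg_nonneg)
  finally show ?thesis .
qed

text \<open>\<open>C\<close> and \<open>d\<close> are chosen before the points, from
  \<open>A\<close> and \<open>m\<close> within the fixed sector. This uniformity is what makes a
  limit over growing sets of points possible.\<close>

lemma group_polynomial:
  assumes A: "A \<ge> 0"
  obtains C :: real and d :: nat where "C \<ge> 0"
    "\<And>(K :: 'k set) n b \<gamma>. finite K \<Longrightarrow> (\<And>k. k \<in> K \<Longrightarrow> pi \<le> \<gamma> k \<and> \<gamma> k \<le> pi + pi * s) \<Longrightarrow>
       (\<And>r. r \<ge> 0 \<Longrightarrow> kernel_sum \<beta> K n b r \<le> A * (1 + r) ^ m) \<Longrightarrow>
       \<exists>F H. F holomorphic_on UNIV \<and> H holomorphic_on UNIV \<and> F 0 = 1 \<and>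
         (\<forall>z. F z = (\<Prod>k\<in>K. (1 - z * exp (- atom (b k) (\<gamma> k) 0)) ^ n k) * H z) \<and>
         (\<forall>z. norm (F z) \<le> C * (1 + norm z) ^ d * exp (kernel_sum \<beta> K n b (norm z)))"
proof -
  define M where "M = 2 * (1 + exp (A * 2 ^ m)) * (A * 2 ^ m)"
  define C1 where "C1 = \<beta> * exp \<beta> * A + A * 3 ^ m"
  define C0 where "C0 = (exp (6 + 4 * M) * 4 ^ 4) ^ 2"
  define C where "C = 320 ^ 12 * (exp C1 * C0 * 2 ^ 16)"
  \<comment> \<open>Two lines with exponent 4 give the power 12 of a quantity of order
    \<open>(1 + r) ^ Suc m\<close>; the two ray errors contribute 16.\<close>
  define d where "d = 12 + 12 * m + 16"
  have C0: "C0 \<ge> 0" by (simp add: C0_def)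
  have M0: "M \<ge> 0" using A by (simp add: M_def add_nonneg_nonneg)
  show ?thesis
  proof (rule that[of C d])
    show "C \<ge> 0" using C0 by (simp add: C_def)
    fix K :: "'k set" and n b \<gamma>
    assume fin: "finite K" and \<gamma>: "\<And>k. k \<in> K \<Longrightarrow> pi \<le> \<gamma> k \<and> \<gamma> k \<le> pi + pi * s"
      and U: "\<And>r. r \<ge> 0 \<Longrightarrow> kernel_sum \<beta> K n b r \<le> A * (1 + r) ^ m"
    have "kernel_sum \<beta> K n b 1 \<le> A * 2 ^ m" using U[of 1] by simp
    hence M: "(\<Sum>k\<in>K. real (n k) * (2 * exp (- \<beta> * b k))) \<le> M"
      unfolding M_def by (rule kernel_sum_mass[OF fin])
    show "\<exists>F H. F holomorphic_on UNIV \<and> H holomorphic_on UNIV \<and> F 0 = 1 \<and>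
         (\<forall>z. F z = (\<Prod>k\<in>K. (1 - z * exp (- atom (b k) (\<gamma> k) 0)) ^ n k) * H z) \<and>
         (\<forall>z. norm (F z) \<le> C * (1 + norm z) ^ d * exp (kernel_sum \<beta> K n b (norm z)))"
    proof (rule group_poly_bound[of K \<gamma> n b M], goal_cases)
      case 1
      show ?case by (rule fin)
    next
      case (2 k)
      thus ?case by (rule \<gamma>)
    next
      case 3
      show ?case by (rule M)
    next
      case 4
      show ?case by (rule M0)
    next
      case (5 N1 t1 N2 t2)
      note main = 5
      define F where "F = group_poly K n b \<gamma> N1 t1 N2 t2"
      obtain H where H: "H holomorphic_on UNIV"
        "\<And>z. group_poly K n b \<gamma> N1 t1 N2 t2 z = (\<Prod>k\<in>K. (1 - z * exp (- atom (b k) (\<gamma> k) 0)) ^ n k) * H z"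
        using group_poly_factor[of K n b \<gamma> N1 t1 N2 t2] by blast
      have hF: "F holomorphic_on UNIV" unfolding F_def by (rule group_poly_holomorphic)
      have bound: "norm (F z) \<le> C * (1 + norm z) ^ d * exp (kernel_sum \<beta> K n b (norm z))" for z
      proof -
        define r where "r = norm z"
        have r: "r \<ge> 0" by (simp add: r_def)
        \<comment> \<open>The disc of radius \<open>4 * \<rho>\<close> changes the modulus by no
          more than the shift that \<open>kernel_sum_shift\<close> tolerates.\<close>
        define \<rho> where "\<rho> = 1 / (4 * (1 + r) ^ m)"
        have p1: "(1 + r) ^ m \<ge> 1" using r by simp
        have \<rho>: "\<rho> > 0" "\<rho> \<le> 1" "4 * \<rho> = 1 / (1 + r) ^ m" "4 * \<rho> \<le> 1"
        proof -
          show 1: "\<rho> > 0" using p1 by (simp add: \<rho>_def)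
          show 2: "4 * \<rho> = 1 / (1 + r) ^ m" by (simp add: \<rho>_def)
          show 3: "4 * \<rho> \<le> 1" unfolding 2 using p1 by (simp add: divide_le_eq)
          show "\<rho> \<le> 1" using 1 3 by linarith
        qed
        define B where "B = exp (kernel_sum \<beta> K n b r + C1) * (C0 * (2 * (1 + r)) ^ 16)"
        have "norm (F z) \<le> (16 * (r + 4) / \<rho>) ^ (3 * 4) * B"
        proof (rule remove_two_lines[OF hF \<rho>(1,2), of "cis (- \<eta>)"])
          fix w assume w: "norm (w - z) \<le> 4 * \<rho>"
          have wr: "norm w \<le> r + 4 * \<rho>" using w norm_triangle_ineq2[of w z] by (simp add: r_def)
          have "norm (F w) * \<bar>Im w\<bar> ^ 4 * \<bar>Im (w * cis (- \<eta>))\<bar> ^ 4 \<le> exp (kernel_sum \<beta> K n b (norm w)) * (C0 * (1 + norm w) ^ 16)"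
            unfolding F_def C0_def by (rule main)
          also have "\<dots> \<le> B" unfolding B_def
          proof (intro mult_mono power_mono)
            have "kernel_sum \<beta> K n b (norm w) \<le> kernel_sum \<beta> K n b (r + 1 / (1 + r) ^ m)"
              using wr \<beta>1 \<rho>(3) by (intro kernel_sum_mono) auto
            also have "\<dots> \<le> kernel_sum \<beta> K n b r + C1" unfolding C1_def
              using \<beta>1 by (intro kernel_sum_shift U A r) auto
            finally show "exp (kernel_sum \<beta> K n b (norm w)) \<le> exp (kernel_sum \<beta> K n b r + C1)" by simp
            have "norm w \<le> r + 1" using wr \<rho>(4) by (rule order_trans[OF _ add_left_mono])
            thus "1 + norm w \<le> 2 * (1 + r)" using r by simp
          qed (use C0 in auto)
          finally show "norm (F w) * \<bar>Im w\<bar> ^ 4 * \<bar>Im (w * cis (- \<eta>))\<bar> ^ 4 \<le> B" .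
        qed (auto simp: r_def)
        also have "(16 * (r + 4) / \<rho>) ^ (3 * 4) \<le> (320 * (1 + r) ^ (Suc m)) ^ 12"
        proof -
          have "16 * (r + 4) / \<rho> = 64 * (r + 4) * (1 + r) ^ m" by (simp add: \<rho>_def)
          also have "\<dots> \<le> (320 * (1 + r)) * (1 + r) ^ m" using r by (intro mult_right_mono) auto
          finally have "16 * (r + 4) / \<rho> \<le> 320 * (1 + r) ^ (Suc m)" by (simp only: power_Suc mult.assoc)
          moreover have "0 \<le> 16 * (r + 4) / \<rho>" using \<rho>(1) r by simp
          moreover have "3 * 4 = (12 :: nat)" by simp
          ultimately show ?thesis by (simp only: power_mono)
        qed
        finally have "norm (F z) \<le> (320 * (1 + r) ^ (Suc m)) ^ 12 * B" 
          using C0 r by (simp add: B_def mult_right_mono)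
        also have "\<dots> = C * (1 + r) ^ d * exp (kernel_sum \<beta> K n b r)"
        proof -
          have e: "((1 + r) ^ Suc m) ^ 12 * (1 + r) ^ 16 = (1 + r) ^ d"
            unfolding d_def by (simp only: power_mult[symmetric] power_add[symmetric]) (simp add: algebra_simps)
          show ?thesis unfolding B_def C_def exp_add power_mult_distrib e[symmetric] by (simp only: mult_ac)
        qed
        finally show ?thesis by (simp add: r_def)
      qed
      show ?case
        by (rule exI[of _ F], rule exI[of _ H]) (use hF H bound in \<open>auto simp: F_def group_poly_0\<close>)
    qed
  qed
qed

end

section \<open>Combining the windows of arguments\<close>

lemma kernel_sum_split:
  assumes "finite K" "finite J" "g ` K \<subseteq> J"
  shows "(\<Sum>j\<in>J. kernel_sum \<beta> {a\<in>K. g a = j} n b r) = kernel_sum \<beta> K n b r"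
  unfolding kernel_sum_def by (rule sum.group[OF assms])

lemma exp_kernel_sum:
  assumes "finite K"
  shows "exp (kernel_sum \<beta> K n b r) = (\<Prod>a\<in>K. (1 + (r / exp (b a)) powr \<beta>) ^ n a)"
proof -
  have "exp (real m * ln (1 + (r / exp c) powr \<beta>)) = (1 + (r / exp c) powr \<beta>) ^ m" for m c
    by (simp add: exp_of_nat_mult add_pos_nonneg)
  thus ?thesis unfolding kernel_sum_def exp_sum[OF assms] by simp
qed

text \<open>Since \<open>ln 0 = 0\<close>, a point at the origin is treated as if it lay on the unit circle.\<close>

definition log_mod :: "complex \<Rightarrow> real" where "log_mod a = ln (norm a)"

text \<open>\<open>H\<close> collects surplus zeros. The normalization \<open>F 0 = 1\<close>
  prevents limits of such functions from vanishing identically, so that no further lower bound is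
  asked for.\<close>

definition majorant_product :: "real \<Rightarrow> complex set \<Rightarrow> (complex \<Rightarrow> nat) \<Rightarrow> real \<Rightarrow> nat \<Rightarrow> bool" where
  "majorant_product \<beta> K n C d \<longleftrightarrow> (\<exists>F H. F holomorphic_on UNIV \<and> H holomorphic_on UNIV \<and> F 0 = 1 \<and>
      (\<forall>z. F z = (\<Prod>a\<in>K. (1 - z / a) ^ n a) * H z) \<and>
      (\<forall>z. norm (F z) \<le> C * (1 + norm z) ^ d * exp (kernel_sum \<beta> K n log_mod (norm z))))"

text \<open>For integer exponent the function \<open>1 - (z / a) ^ q\<close> is itself a polynomial
  of the required size; its surplus zeros are the rotated copies of \<open>a\<close>, collected in
  the geometric sum.\<close>

lemma majorant_product_integer:
  assumes q: "q \<ge> (1::nat)" and fin: "finite K" and K: "0 \<notin> K"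
  shows "majorant_product (real q) K n 1 0"
proof -
  define F where "F = (\<lambda>z. \<Prod>a\<in>K. (1 - (z / a) ^ q) ^ n a)"
  define H where "H = (\<lambda>z. \<Prod>a\<in>K. (\<Sum>i<q. (z / a) ^ i) ^ n a)"
  have hol: "F holomorphic_on UNIV" "H holomorphic_on UNIV"
    unfolding F_def H_def using K by (auto intro!: holomorphic_intros)
  have F0: "F 0 = 1" using q by (simp add: F_def power_0_left)
  have fac: "F z = (\<Prod>a\<in>K. (1 - z / a) ^ n a) * H z" for z
    unfolding F_def H_def prod.distrib[symmetric] power_mult_distrib[symmetric]
    by (simp only: one_diff_power_eq)
  have bd: "norm (F z) \<le> 1 * (1 + norm z) ^ 0 * exp (kernel_sum q K n log_mod (norm z))" for z
  proof -
    have "norm (F z) \<le> (\<Prod>a\<in>K. (1 + (norm z / exp (log_mod a)) powr real q) ^ n a)"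
      unfolding F_def prod_norm[symmetric] norm_power
    proof (rule prod_mono, intro conjI power_mono)
      fix a assume "a \<in> K"
      hence a: "a \<noteq> 0" using K by auto
      have "norm (1 - (z / a) ^ q) \<le> 1 + (norm z / norm a) ^ q"
        using norm_triangle_ineq4[of 1 "(z / a) ^ q"] by (simp add: norm_power norm_divide)
      also have "(norm z / norm a) ^ q = (norm z / exp (log_mod a)) powr real q"
        using q a by (cases "z = 0") (auto simp: powr_realpow log_mod_def)
      finally show "norm (1 - (z / a) ^ q) \<le> 1 + (norm z / exp (log_mod a)) powr real q" .
    qed auto
    thus ?thesis by (simp add: exp_kernel_sum[OF fin])
  qed
  show ?thesis unfolding majorant_product_def
    by (rule exI[of _ F], rule exI[of _ H]) (use hol F0 fac bd in auto)
qed

text \<open>The atom with index 0 has argument \<open>- \<gamma> / \<beta>\<close>, and this runs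
  through an interval of length \<open>\<eta>\<close> while \<open>\<gamma>\<close> runs through its
  window. So for every point some rotation by a multiple of \<open>\<eta>\<close> makes it such an
  atom, and the number of rotations does not depend on \<open>K\<close>. The polynomials of the
  windows are multiplied, and their majorants add up to the full sum.\<close>

lemma (in sector_kernel) majorant_product_noninteger:
  assumes A: "A \<ge> 0"
  obtains C d where "C \<ge> 0"
    "\<And>K n. finite K \<Longrightarrow> 0 \<notin> K \<Longrightarrow> (\<And>r. r \<ge> 0 \<Longrightarrow> kernel_sum \<beta> K n log_mod r \<le> A * (1 + r) ^ m) \<Longrightarrow>
      majorant_product \<beta> K n C d"
proof (rule group_polynomial[OF A, of m, where 'k = complex])
  fix C :: real and d :: nat
  assume C: "C \<ge> 0" and main: "\<And>(K :: complex set) n b \<gamma>. finite K \<Longrightarrow> (\<And>k. k \<in> K \<Longrightarrow> pi \<le> \<gamma> k \<and> \<gamma> k \<le> pi + pi * s) \<Longrightarrow>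
       (\<And>r. r \<ge> 0 \<Longrightarrow> kernel_sum \<beta> K n b r \<le> A * (1 + r) ^ m) \<Longrightarrow>
       \<exists>F H. F holomorphic_on UNIV \<and> H holomorphic_on UNIV \<and> F 0 = 1 \<and>
         (\<forall>z. F z = (\<Prod>k\<in>K. (1 - z * exp (- atom (b k) (\<gamma> k) 0)) ^ n k) * H z) \<and>
         (\<forall>z. norm (F z) \<le> C * (1 + norm z) ^ d * exp (kernel_sum \<beta> K n b (norm z)))"
  \<comment> \<open>Contains all values of \<open>g\<close>, since
    \<open>Arg a + pi / \<beta>\<close> lies between - pi and 2 pi.\<close>
  define J where "J = {\<lceil>- pi / \<eta>\<rceil> .. \<lceil>2 * pi / \<eta>\<rceil>}"
  define g where "g = (\<lambda>a. \<lceil>(Arg a + pi / \<beta>) / \<eta>\<rceil>)"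
  define \<gamma> where "\<gamma> = (\<lambda>a. \<beta> * (of_int (g a) * \<eta> - Arg a))"
  have pb: "pi / \<beta> > 0" "pi / \<beta> \<le> pi" using \<beta>1 by (auto simp: field_simps)
  have gJ: "g a \<in> J" for a
  proof -
    have "- pi / \<eta> \<le> (Arg a + pi / \<beta>) / \<eta>" "(Arg a + pi / \<beta>) / \<eta> \<le> 2 * pi / \<eta>"
      using Arg_bounded[of a] pb \<eta>_pos by (intro divide_right_mono; linarith)+
    thus ?thesis unfolding g_def J_def by (simp add: ceiling_mono)
  qed
  have \<gamma>: "pi \<le> \<gamma> a \<and> \<gamma> a \<le> pi + pi * s" for a
  proof -
    have "(Arg a + pi / \<beta>) / \<eta> \<le> of_int (g a)" "of_int (g a) < (Arg a + pi / \<beta>) / \<eta> + 1"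
      unfolding g_def by linarith+
    hence "Arg a + pi / \<beta> \<le> of_int (g a) * \<eta>" "of_int (g a) * \<eta> \<le> Arg a + pi / \<beta> + \<eta>"
      using \<eta>_pos by (simp_all add: field_simps)
    hence "\<beta> * (pi / \<beta>) \<le> \<gamma> a" "\<gamma> a \<le> \<beta> * (pi / \<beta> + \<eta>)"
      unfolding \<gamma>_def using \<beta>1 by (intro mult_left_mono; linarith)+
    thus ?thesis using \<beta>1 \<beta>\<eta> by (simp add: distrib_left)
  qed
  show ?thesis
  proof (rule that[of "C ^ card J" "d * card J"])
    show "C ^ card J \<ge> 0" using C by simp
    fix K :: "complex set" and n
    assume fin: "finite K" and K0: "0 \<notin> K" and U: "\<And>r. r \<ge> 0 \<Longrightarrow> kernel_sum \<beta> K n log_mod r \<le> A * (1 + r) ^ m"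
    define Kj where "Kj = (\<lambda>j. {a\<in>K. g a = j})"
    have finJ: "finite J" by (simp add: J_def)
    have sub: "kernel_sum \<beta> (Kj j) n log_mod r \<le> kernel_sum \<beta> K n log_mod r" for j r
      unfolding kernel_sum_def Kj_def using fin by (intro sum_mono2) auto
    have "\<forall>j\<in>J. \<exists>FH. (fst FH) holomorphic_on UNIV \<and> (snd FH) holomorphic_on UNIV \<and> (fst FH) 0 = 1 \<and>
         (\<forall>z. (fst FH) z = (\<Prod>k\<in>Kj j. (1 - z * exp (- atom (log_mod k) (\<gamma> k) 0)) ^ n k) * (snd FH) z) \<and>
         (\<forall>z. norm ((fst FH) z) \<le> C * (1 + norm z) ^ d * exp (kernel_sum \<beta> (Kj j) n log_mod (norm z)))"
    proof
      fix j
      have "\<exists>F H. F holomorphic_on UNIV \<and> H holomorphic_on UNIV \<and> F 0 = 1 \<and>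
         (\<forall>z. F z = (\<Prod>k\<in>Kj j. (1 - z * exp (- atom (log_mod k) (\<gamma> k) 0)) ^ n k) * H z) \<and>
         (\<forall>z. norm (F z) \<le> C * (1 + norm z) ^ d * exp (kernel_sum \<beta> (Kj j) n log_mod (norm z)))"
      proof (rule main)
        show "finite (Kj j)" using fin by (simp add: Kj_def)
        show "kernel_sum \<beta> (Kj j) n log_mod r \<le> A * (1 + r) ^ m" if "r \<ge> 0" for r
          using sub[of j r] U[OF that] by linarith
      qed (rule \<gamma>)
      then obtain F H where FH: "F holomorphic_on UNIV" "H holomorphic_on UNIV" "F 0 = 1"
         "\<forall>z. F z = (\<Prod>k\<in>Kj j. (1 - z * exp (- atom (log_mod k) (\<gamma> k) 0)) ^ n k) * H z"
         "\<forall>z. norm (F z) \<le> C * (1 + norm z) ^ d * exp (kernel_sum \<beta> (Kj j) n log_mod (norm z))" by blast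
      show "\<exists>FH. (fst FH) holomorphic_on UNIV \<and> (snd FH) holomorphic_on UNIV \<and> (fst FH) 0 = 1 \<and>
         (\<forall>z. (fst FH) z = (\<Prod>k\<in>Kj j. (1 - z * exp (- atom (log_mod k) (\<gamma> k) 0)) ^ n k) * (snd FH) z) \<and>
         (\<forall>z. norm ((fst FH) z) \<le> C * (1 + norm z) ^ d * exp (kernel_sum \<beta> (Kj j) n log_mod (norm z)))"
        by (rule exI[of _ "(F, H)"]) (simp only: fst_conv snd_conv, use FH in blast)
    qed
    from bchoice[OF this] obtain FH where FH: "\<And>j. j \<in> J \<Longrightarrow> fst (FH j) holomorphic_on UNIV"
      "\<And>j. j \<in> J \<Longrightarrow> snd (FH j) holomorphic_on UNIV" "\<And>j. j \<in> J \<Longrightarrow> fst (FH j) 0 = 1"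
      "\<And>j z. j \<in> J \<Longrightarrow> fst (FH j) z = (\<Prod>k\<in>Kj j. (1 - z * exp (- atom (log_mod k) (\<gamma> k) 0)) ^ n k) * snd (FH j) z"
      "\<And>j z. j \<in> J \<Longrightarrow> norm (fst (FH j) z) \<le> C * (1 + norm z) ^ d * exp (kernel_sum \<beta> (Kj j) n log_mod (norm z))"
      by blast
    define rot where "rot = (\<lambda>j z. z * cis (- (of_int j * \<eta>)))"
    define F where "F = (\<lambda>z. \<Prod>j\<in>J. fst (FH j) (rot j z))"
    define H where "H = (\<lambda>z. \<Prod>j\<in>J. snd (FH j) (rot j z))"
    have comp: "(\<lambda>z. f (rot j z)) holomorphic_on UNIV" if "f holomorphic_on UNIV" for f j
    proof -
      have "(f \<circ> (\<lambda>z. rot j z)) holomorphic_on UNIV"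
        by (rule holomorphic_on_compose_gen[OF _ that]) (auto intro!: holomorphic_intros simp: rot_def)
      thus ?thesis by (simp add: o_def)
    qed
    have hol: "F holomorphic_on UNIV" "H holomorphic_on UNIV"
      unfolding F_def H_def by (intro holomorphic_on_prod comp FH; assumption)+
    have F0: "F 0 = 1" unfolding F_def rot_def using FH(3) by simp
    have normrot: "norm (rot j z) = norm z" for j z by (simp add: rot_def norm_mult)
    have pt: "rot (g a) z * exp (- atom (log_mod a) (\<gamma> a) 0) = z / a" if "a \<in> K" for a z
    proof -
      have a: "a \<noteq> 0" using that K0 by auto
      have "exp (atom (log_mod a) (\<gamma> a) 0) = of_real (norm a) * cis (- \<gamma> a / \<beta>)"
        using a by (simp add: atom_def log_mod_def complex_eq_iff Re_exp Im_exp)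
      also have "- \<gamma> a / \<beta> = Arg a + (- (of_int (g a) * \<eta>))" using \<beta>1 by (simp add: \<gamma>_def field_simps)
      also have "of_real (norm a) * cis (Arg a + (- (of_int (g a) * \<eta>))) = a * cis (- (of_int (g a) * \<eta>))"
        unfolding cis_mult[symmetric] mult.assoc[symmetric] rcis_cmod_Arg[unfolded rcis_def] ..
      finally have "exp (- atom (log_mod a) (\<gamma> a) 0) = 1 / (a * cis (- (of_int (g a) * \<eta>)))"
        by (simp add: exp_minus inverse_eq_divide)
      thus ?thesis using a by (simp add: rot_def)
    qed
    have fac: "F z = (\<Prod>a\<in>K. (1 - z / a) ^ n a) * H z" for z
    proof -
      have "F z = (\<Prod>j\<in>J. \<Prod>k\<in>Kj j. (1 - rot j z * exp (- atom (log_mod k) (\<gamma> k) 0)) ^ n k) * H z"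
        unfolding F_def H_def prod.distrib[symmetric] by (intro prod.cong refl FH(4))
      also have "(\<Prod>j\<in>J. \<Prod>k\<in>Kj j. (1 - rot j z * exp (- atom (log_mod k) (\<gamma> k) 0)) ^ n k) = (\<Prod>j\<in>J. \<Prod>k\<in>Kj j. (1 - z / k) ^ n k)"
        by (intro prod.cong refl) (auto simp: Kj_def pt)
      also have "\<dots> = (\<Prod>a\<in>K. (1 - z / a) ^ n a)"
        unfolding Kj_def by (rule prod.group[OF fin finJ]) (use gJ in auto)
      finally show ?thesis .
    qed
    have bd: "norm (F z) \<le> C ^ card J * (1 + norm z) ^ (d * card J) * exp (kernel_sum \<beta> K n log_mod (norm z))" for z
    proof -
      have "norm (F z) \<le> (\<Prod>j\<in>J. C * (1 + norm z) ^ d * exp (kernel_sum \<beta> (Kj j) n log_mod (norm z)))"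
        unfolding F_def prod_norm[symmetric]
        using FH(5)[of _ "rot _ z"] by (intro prod_mono) (auto simp: normrot)
      also have "\<dots> = C ^ card J * (1 + norm z) ^ (d * card J) * exp (\<Sum>j\<in>J. kernel_sum \<beta> (Kj j) n log_mod (norm z))"
        unfolding exp_sum[OF finJ] by (simp add: prod.distrib power_mult power_mult_distrib)
      also have "(\<Sum>j\<in>J. kernel_sum \<beta> (Kj j) n log_mod (norm z)) = kernel_sum \<beta> K n log_mod (norm z)"
        unfolding Kj_def by (rule kernel_sum_split[OF fin finJ]) (use gJ in auto)
      finally show ?thesis .
    qed
    show "majorant_product \<beta> K n (C ^ card J) (d * card J)" unfolding majorant_product_def
      by (rule exI[of _ F], rule exI[of _ H]) (use hol F0 fac bd in blast)
  qed
qed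

text \<open>The clause on \<open>\<beta> = 1\<close> records that the integer case loses no power of
  the radius. It matters because a spared point yields only the power \<open>\<beta> - 1\<close> in
  compensation for \<open>d\<close>.\<close>

theorem majorant_product_exists:
  fixes \<beta> A :: real
  assumes \<beta>: "\<beta> \<ge> 1" and A: "A \<ge> 0"
  obtains C d where "C \<ge> 0" "\<beta> = 1 \<Longrightarrow> d = 0"
    "\<And>K n. finite K \<Longrightarrow> 0 \<notin> K \<Longrightarrow> (\<And>r. r \<ge> 0 \<Longrightarrow> kernel_sum \<beta> K n log_mod r \<le> A * (1 + r) ^ m) \<Longrightarrow>
      majorant_product \<beta> K n C d"
proof (cases "\<beta> \<in> \<nat>")
  case True
  then obtain q :: nat where q: "\<beta> = real q" by (elim Nats_cases)
  hence "q \<ge> 1" using \<beta> by simp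
  thus ?thesis using majorant_product_integer[of q] q by (intro that[of 1 0]) auto
next
  case False
  define L where "L = nat \<lfloor>\<beta>\<rfloor>"
  define s where "s = \<beta> - real L"
  have L: "real L = of_int \<lfloor>\<beta>\<rfloor>" using \<beta> by (simp add: L_def)
  have "s \<ge> 0" "s < 1" unfolding s_def L by linarith+
  moreover have "s \<noteq> 0" using False by (auto simp: s_def)
  ultimately have "0 < s" "s < 1" by auto
  moreover have "L \<ge> 1" using \<beta> by (simp add: L_def le_nat_iff le_floor_iff)
  ultimately interpret sector_kernel \<beta> "pi * s / \<beta>" s L
    by unfold_locales (auto simp: s_def)
  show ?thesis
  proof (rule majorant_product_noninteger[OF A, of m])
    fix C d assume C: "C \<ge> 0" and main: "\<And>K n. finite K \<Longrightarrow> 0 \<notin> K \<Longrightarrow> (\<And>r. r \<ge> 0 \<Longrightarrow> kernel_sum \<beta> K n log_mod r \<le> A * (1 + r) ^ m) \<Longrightarrow>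
      majorant_product \<beta> K n C d"
    show ?thesis
    proof (rule that[OF C _ main])
      assume "\<beta> = 1"
      thus "d = 0" using False by simp
    qed
  qed
qed

subsection \<open>The kernel producing the Paley constant\<close>

text \<open>The second derivative of \<open>ln (1 + exp (\<beta> * x))\<close>.\<close>

definition kern :: "real \<Rightarrow> real \<Rightarrow> real" where
  "kern \<beta> x = \<beta>\<^sup>2 * exp (\<beta> * x) / (1 + exp (\<beta> * x))\<^sup>2"

lemma one_plus_exp_pos: "1 + exp (x::real) > 0" "1 + exp (x::real) \<noteq> 0"
  using exp_gt_zero[of x] by linarith+

lemma kern_nonneg: "kern \<beta> x \<ge> 0"
  by (simp add: kern_def)

lemma continuous_kern [continuous_intros]: "isCont (kern \<beta>) x"
  unfolding kern_def[abs_def] by (intro continuous_intros) (simp add: one_plus_exp_pos)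

text \<open>The hinge has a point mass as second derivative and \<open>kern\<close> is even, so this
  recovers \<open>ln (1 + exp (\<beta> * d))\<close> from its second derivative by convolution. The
  antiderivative \<open>F\<close> comes from integrating by parts.\<close>

lemma kern_hinge:
  assumes \<beta>: "\<beta> > 0"
  shows "has_bochner_integral lborel (\<lambda>x. max 0 (d + x) * kern \<beta> x) (ln (1 + exp (\<beta> * d)))"
proof -
  define F where "F = (\<lambda>x. (d + x) * (\<beta> * exp (\<beta> * x) / (1 + exp (\<beta> * x))) - ln (1 + exp (\<beta> * x)))"
  have D: "(F has_real_derivative (d + x) * kern \<beta> x) (at x)" for x
  proof -
    have Q1: "((\<lambda>x. \<beta> * exp (\<beta> * x) / (1 + exp (\<beta> * x))) has_real_derivative kern \<beta> x) (at x)"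
      unfolding kern_def using one_plus_exp_pos[of "\<beta> * x"]
      by (auto intro!: derivative_eq_intros simp: field_simps power2_eq_square)
    have Q0: "((\<lambda>x. ln (1 + exp (\<beta> * x))) has_real_derivative \<beta> * exp (\<beta> * x) / (1 + exp (\<beta> * x))) (at x)"
      using one_plus_exp_pos[of "\<beta> * x"] by (auto intro!: derivative_eq_intros simp: mult.commute)
    show ?thesis unfolding F_def by (rule derivative_eq_intros Q1 Q0 refl | simp)+
  qed
  have T: "(F \<longlongrightarrow> d * \<beta>) at_top" unfolding F_def using \<beta> by real_asymp
  have "(F \<longlongrightarrow> F (- d)) (at (- d))" using DERIV_isCont[OF D[of "-d"]] by (simp add: isCont_def)
  hence B: "(F \<longlongrightarrow> F (- d)) (at_right (- d))" by (rule tendsto_within_subset) auto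
  have lt: "ereal (- d) < \<infinity>" by simp
  note ftc = interval_integral_FTC_nonneg[where F = F and f = "\<lambda>x. (d + x) * kern \<beta> x" and a = "ereal (- d)" and b = \<infinity> and A = "F (- d)" and B = "d * \<beta>", OF lt D]
  have 1: "set_integrable lborel (einterval (ereal (- d)) \<infinity>) (\<lambda>x. (d + x) * kern \<beta> x)"
    by (rule ftc(1)) (use T B in \<open>auto intro!: continuous_intros kern_nonneg mult_nonneg_nonneg AE_I2 simp: ereal_tendsto_simps\<close>)
  have 2: "(LBINT x=ereal (- d)..\<infinity>. (d + x) * kern \<beta> x) = d * \<beta> - F (- d)"
    by (rule ftc(2)) (use T B in \<open>auto intro!: continuous_intros kern_nonneg mult_nonneg_nonneg AE_I2 simp: ereal_tendsto_simps\<close>)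
  have pt: "indicator (einterval (ereal (- d)) \<infinity>) x *\<^sub>R ((d + x) * kern \<beta> x) = max 0 (d + x) * kern \<beta> x" for x
    by (auto simp: indicator_def einterval_def max_def)
  have 3: "integrable lborel (\<lambda>x. max 0 (d + x) * kern \<beta> x)"
    using 1 unfolding set_integrable_def pt .
  have 4: "integral\<^sup>L lborel (\<lambda>x. max 0 (d + x) * kern \<beta> x) = d * \<beta> - F (- d)"
    using 2 unfolding interval_lebesgue_integral_def set_lebesgue_integral_def pt by simp
  have "d * \<beta> - F (- d) = d * \<beta> + ln (1 + exp (- (\<beta> * d)))" by (simp add: F_def)
  also have "\<dots> = ln (exp (\<beta> * d)) + ln (1 + exp (- (\<beta> * d)))" by simp
  also have "\<dots> = ln (exp (\<beta> * d) * (1 + exp (- (\<beta> * d))))" by (subst ln_mult) (auto simp: one_plus_exp_pos)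
  also have "exp (\<beta> * d) * (1 + exp (- (\<beta> * d))) = 1 + exp (\<beta> * d)" by (simp add: algebra_simps exp_minus)
  finally show ?thesis using 3 4 by (simp add: has_bochner_integral_iff)
qed

text \<open>The logistic substitution, p = exp (\<beta> x) / (1 + exp (\<beta> x)) with inverse
  \<open>g\<close>, produces a Beta integral; \<open>\<rho> < \<beta>\<close> makes it converge at p
  = 1.\<close>

lemma kern_exp_Beta:
  assumes \<beta>: "\<beta> > 0" and \<rho>: "0 \<le> \<rho>" "\<rho> < \<beta>"
  shows "has_bochner_integral lborel (\<lambda>x. exp (\<rho> * x) * kern \<beta> x) (\<beta> * Beta (1 + \<rho> / \<beta>) (1 - \<rho> / \<beta>))"
proof -
  define a where "a = \<rho> / \<beta>"
  have a: "0 \<le> a" "a < 1" using assms by (auto simp: a_def)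
  define f where "f = (\<lambda>x. exp (\<rho> * x) * kern \<beta> x)"
  define g where "g = (\<lambda>p::real. (ln p - ln (1 - p)) / \<beta>)"
  define g' where "g' = (\<lambda>p::real. (1 / p + 1 / (1 - p)) / \<beta>)"
  have fg: "f (g p) * g' p = \<beta> * (p powr (1 + a - 1) * (1 - p) powr (1 - a - 1))" if p: "0 < p" "p < 1" for p
  proof -
    have e1: "exp (\<beta> * g p) = p / (1 - p)" using \<beta> p by (simp add: g_def exp_diff)
    have "\<rho> * g p = a * (ln p - ln (1 - p))" by (simp add: g_def a_def)
    hence e2: "exp (\<rho> * g p) = p powr a * (1 - p) powr (- a)"
      using p by (simp add: powr_def exp_add[symmetric] algebra_simps)
    have "1 + p / (1 - p) = 1 / (1 - p)" using p by (simp add: field_simps)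
    hence "kern \<beta> (g p) = \<beta>\<^sup>2 * (p * (1 - p))"
      unfolding kern_def e1 using p by (simp add: power2_eq_square field_simps)
    moreover have "p * (1 - p) * (1 / p + 1 / (1 - p)) = 1" using p by (simp add: field_simps)
    hence "\<beta>\<^sup>2 * (p * (1 - p)) * g' p = \<beta>" unfolding g'_def using \<beta>
      by (metis (no_types, opaque_lifting) mult.assoc mult.commute mult.right_neutral nonzero_mult_div_cancel_left order_less_irrefl power2_eq_square times_divide_eq_right)
    ultimately have "f (g p) * g' p = exp (\<rho> * g p) * \<beta>" unfolding f_def by (simp only: mult.assoc)
    thus ?thesis unfolding e2 by simp
  qed
  have seteq: "einterval (0::ereal) 1 = {0<..<1}" by (auto simp: einterval_def zero_ereal_def one_ereal_def)
  have B: "set_integrable lborel {0..1} (\<lambda>t. t powr (1 + a - 1) * (1 - t) powr (1 - a - 1))"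
    by (rule integrable_Beta) (use a in auto)
  have B2: "set_integrable lborel {0<..<1} (\<lambda>t. \<beta> * (t powr (1 + a - 1) * (1 - t) powr (1 - a - 1)))"
    by (intro set_integrable_mult_right set_integrable_subset[OF B]) auto
  have I: "set_integrable lborel (einterval 0 1) (\<lambda>x. f (g x) * g' x)"
    unfolding seteq by (subst set_integrable_cong[OF refl refl fg]) (use B2 in auto)
  have dg: "(g has_real_derivative g' p) (at p)" if "0 < p" "p < 1" for p
    unfolding g_def g'_def using that \<beta> by (auto intro!: derivative_eq_intros simp: field_simps)
  have lim0: "filterlim g at_bot (at_right 0)" unfolding g_def using \<beta> by real_asymp
  have lim1: "filterlim g at_top (at_left 1)" unfolding g_def using \<beta> by real_asymp
  have L0: "((ereal \<circ> g \<circ> real_of_ereal) \<longlongrightarrow> -\<infinity>) (at_right 0)"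
    using lim0 unfolding zero_ereal_def by (simp add: ereal_tendsto_simps)
  have L1: "((ereal \<circ> g \<circ> real_of_ereal) \<longlongrightarrow> \<infinity>) (at_left 1)"
    using lim1 unfolding one_ereal_def by (simp add: ereal_tendsto_simps)
  have contf: "isCont f x" for x unfolding f_def by (intro continuous_intros)
  have contg': "isCont g' p" if "0 < p" "p < 1" for p unfolding g'_def using that \<beta> by (intro continuous_intros) auto
  have fn: "f x \<ge> 0" for x unfolding f_def using kern_nonneg by simp
  have gn: "g' p \<ge> 0" if "0 \<le> p" "p \<le> 1" for p unfolding g'_def using that \<beta> by simp
  have r1: "set_integrable lborel (einterval (-\<infinity>) \<infinity>) f"
    by (rule interval_integral_substitution_nonneg(1)[where a = 0 and b = 1 and g = g and g' = g'])
       (use dg contf contg' fn gn L0 L1 I in \<open>auto simp: zero_ereal_def one_ereal_def\<close>)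
  have r2: "(LBINT x=-\<infinity>..\<infinity>. f x) = (LBINT x=0..1. f (g x) * g' x)"
    by (rule interval_integral_substitution_nonneg(2)[where a = 0 and b = 1 and g = g and g' = g'])
       (use dg contf contg' fn gn L0 L1 I in \<open>auto simp: zero_ereal_def one_ereal_def\<close>)
  have U: "einterval (-\<infinity>) \<infinity> = (UNIV :: real set)" by (auto simp: einterval_def)
  have i1: "integrable lborel f" using r1 unfolding U set_integrable_def by simp
  have "integral\<^sup>L lborel f = (LBINT x=0..1. f (g x) * g' x)"
    using r2 unfolding interval_lebesgue_integral_def U set_lebesgue_integral_def by simp
  also have "\<dots> = (LINT x:{0<..<1}|lborel. f (g x) * g' x)"
    unfolding interval_lebesgue_integral_def seteq by simp
  also have "\<dots> = (LINT x:{0<..<1}|lborel. \<beta> * (x powr (1 + a - 1) * (1 - x) powr (1 - a - 1)))"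
    by (rule set_lebesgue_integral_cong) (use fg in auto)
  also have "\<dots> = integral {0<..<1} (\<lambda>x. \<beta> * (x powr (1 + a - 1) * (1 - x) powr (1 - a - 1)))"
    by (rule set_borel_integral_eq_integral(2)[OF B2])
  also have "\<dots> = \<beta> * Beta (1 + a) (1 - a)"
  proof (rule integral_unique)
    have "((\<lambda>t. t powr (1 + a - 1) * (1 - t) powr (1 - a - 1)) has_integral Beta (1 + a) (1 - a)) {0<..<1}"
      using has_integral_Beta_real[of "1 + a" "1 - a"] a by (simp add: has_integral_Icc_iff_Ioo)
    thus "((\<lambda>t. \<beta> * (t powr (1 + a - 1) * (1 - t) powr (1 - a - 1))) has_integral \<beta> * Beta (1 + a) (1 - a)) {0<..<1}"
      by (rule has_integral_mult_right)
  qed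
  finally show ?thesis using i1 by (simp add: has_bochner_integral_iff f_def a_def)
qed

lemma Gamma_two_real: "Gamma (2 :: real) = 1"
  using Gamma_fact[of 1, where 'a = real] by simp

lemma kern_total: "\<beta> > 0 \<Longrightarrow> has_bochner_integral lborel (kern \<beta>) \<beta>"
  using kern_exp_Beta[of \<beta> 0] by (simp add: Beta_def Gamma_two_real)

text \<open>With \<open>a = \<rho> / \<beta>\<close>, the reflection formula gives Gamma (1 + a)
  Gamma (1 - a) = pi a / sin (pi a).\<close>

lemma kern_exp:
  assumes \<rho>: "0 < \<rho>" "\<rho> < \<beta>"
  shows "has_bochner_integral lborel (\<lambda>x. exp (\<rho> * x) * kern \<beta> x) (pi * \<rho> / sin (pi * \<rho> / \<beta>))"
proof -
  define a where "a = \<rho> / \<beta>"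
  have a: "0 < a" "a < 1" using assms by (auto simp: a_def)
  have ref: "Gamma a * Gamma (1 - a) = pi / sin (pi * a)"
  proof -
    have "complex_of_real (Gamma a * Gamma (1 - a)) = Gamma (of_real a) * Gamma (1 - of_real a)"
      using Gamma_complex_of_real[of a] Gamma_complex_of_real[of "1 - a"] by simp
    also have "\<dots> = of_real pi / sin (of_real pi * of_real a)" by (rule Gamma_reflection_complex)
    also have "\<dots> = complex_of_real (pi / sin (pi * a))" by (simp add: sin_of_real[symmetric])
    finally show ?thesis unfolding of_real_eq_iff .
  qed
  have "Beta (1 + a) (1 - a) = Gamma (a + 1) * Gamma (1 - a)" by (simp add: Beta_def add.commute Gamma_two_real)
  also have "Gamma (a + 1) = a * Gamma a" using a by (intro Gamma_plus1) auto
  finally have "\<beta> * Beta (1 + a) (1 - a) = \<beta> * a * (pi / sin (pi * a))" using ref by (simp add: mult.assoc)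
  also have "\<dots> = pi * \<rho> / sin (pi * \<rho> / \<beta>)" using assms by (simp add: a_def)
  finally show ?thesis using kern_exp_Beta[of \<beta> \<rho>] assms by (simp add: a_def)
qed

text \<open>With y the logarithm of the radius, the sum of hinges is the integral counting function
  of the points. Averaging its bound over translates with the nonnegative weight \<open>kern\<close>
  preserves the inequality and replaces hinges, exponential and constant by their closed
  forms.\<close>

theorem hinge_sum_le:
  assumes \<rho>: "0 < \<rho>" "\<rho> < \<beta>" and fin: "finite K"
    and h: "\<And>y. (\<Sum>k\<in>K. c k * max 0 (y - b k)) \<le> \<sigma> * exp (\<rho> * y) + C"
  shows "(\<Sum>k\<in>K. c k * ln (1 + exp (\<beta> * (a - b k)))) \<le> pi * \<rho> / sin (pi * \<rho> / \<beta>) * \<sigma> * exp (\<rho> * a) + \<beta> * C"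
proof -
  have \<beta>: "\<beta> > 0" using \<rho> by simp
  have L: "has_bochner_integral lborel (\<lambda>x. \<Sum>k\<in>K. c k * (max 0 ((a - b k) + x) * kern \<beta> x)) (\<Sum>k\<in>K. c k * ln (1 + exp (\<beta> * (a - b k))))"
    by (intro has_bochner_integral_sum has_bochner_integral_mult_right kern_hinge \<beta>)
  have R: "has_bochner_integral lborel (\<lambda>x. \<sigma> * exp (\<rho> * a) * (exp (\<rho> * x) * kern \<beta> x) + C * kern \<beta> x)
     (\<sigma> * exp (\<rho> * a) * (pi * \<rho> / sin (pi * \<rho> / \<beta>)) + C * \<beta>)"
    by (intro has_bochner_integral_add has_bochner_integral_mult_right kern_exp kern_total \<beta> \<rho>)
  have "integral\<^sup>L lborel (\<lambda>x. \<Sum>k\<in>K. c k * (max 0 ((a - b k) + x) * kern \<beta> x)) \<le> integral\<^sup>L lborel (\<lambda>x. \<sigma> * exp (\<rho> * a) * (exp (\<rho> * x) * kern \<beta> x) + C * kern \<beta> x)"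
  proof (rule integral_mono)
    fix x
    have "(\<Sum>k\<in>K. c k * (max 0 ((a - b k) + x) * kern \<beta> x)) = (\<Sum>k\<in>K. c k * max 0 ((a + x) - b k)) * kern \<beta> x"
    proof -
      have "(a - b k) + x = (a + x) - b k" for k by simp
      thus ?thesis by (simp only: sum_distrib_right mult.assoc)
    qed
    also have "\<dots> \<le> (\<sigma> * exp (\<rho> * (a + x)) + C) * kern \<beta> x" by (intro mult_right_mono h kern_nonneg)
    also have "\<dots> = \<sigma> * exp (\<rho> * a) * (exp (\<rho> * x) * kern \<beta> x) + C * kern \<beta> x"
      by (simp add: distrib_left exp_add algebra_simps)
    finally show "(\<Sum>k\<in>K. c k * (max 0 ((a - b k) + x) * kern \<beta> x)) \<le> \<sigma> * exp (\<rho> * a) * (exp (\<rho> * x) * kern \<beta> x) + C * kern \<beta> x" .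
  qed (use L R in \<open>auto simp: has_bochner_integral_iff\<close>)
  thus ?thesis using L R by (simp add: has_bochner_integral_iff mult_ac)
qed

subsection \<open>Passage to infinitely many points\<close>

lemma power_le_exp_powr:
  fixes c \<rho> :: real
  assumes c: "c > 0" and \<rho>: "\<rho> > 0"
  obtains B where "B \<ge> 0" "\<And>r. r \<ge> 0 \<Longrightarrow> (1 + r) ^ D \<le> B * exp (c * r powr \<rho>)"
proof -
  define k where "k = nat \<lceil>real D / \<rho>\<rceil>"
  have k: "real D \<le> \<rho> * real k"
  proof -
    have "real D / \<rho> \<le> real k" unfolding k_def by (rule real_nat_ceiling_ge)
    thus ?thesis using \<rho> by (simp add: field_simps)
  qed
  define B where "B = 2 ^ D * (1 + fact k / c ^ k)"
  have B1: "2 ^ D \<le> B" using c by (simp add: B_def)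
  have B0: "B \<ge> 0" by (rule order_trans[OF _ B1]) simp
  show ?thesis
  proof (rule that[of B])
    show "B \<ge> 0" by (rule B0)
    fix r :: real assume r: "r \<ge> 0"
    show "(1 + r) ^ D \<le> B * exp (c * r powr \<rho>)"
    proof (cases "r \<le> 1")
      case True
      have "(1 + r) ^ D \<le> 2 ^ D * 1" using r True by (auto intro!: power_mono)
      also have "\<dots> \<le> B * exp (c * r powr \<rho>)" using B1 B0 c by (intro mult_mono) auto
      finally show ?thesis .
    next
      case False
      have "(1 + r) ^ D \<le> (2 * r) ^ D" using False by (intro power_mono) auto
      also have "\<dots> = 2 ^ D * r powr real D" using False by (simp add: power_mult_distrib powr_realpow)
      also have "r powr real D \<le> r powr (\<rho> * real k)" using False k by (intro powr_mono) auto
      also have "r powr (\<rho> * real k) = (r powr \<rho>) ^ k" using False by (simp add: powr_powr[symmetric] powr_realpow)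
      also have "\<dots> = (c * r powr \<rho>) ^ k / c ^ k" using c by (simp add: power_mult_distrib)
      also have "(c * r powr \<rho>) ^ k \<le> fact k * exp (c * r powr \<rho>)"
      proof -
        define x where "x = c * r powr \<rho>"
        have "x \<ge> 0" using c by (simp add: x_def)
        hence "x ^ k / fact k \<le> exp x"
          using sum_le_suminf[OF summable_exp_generic[of x], of "{k}"] by (simp add: exp_def divide_inverse mult.commute)
        thus ?thesis unfolding x_def[symmetric] by (simp add: field_simps)
      qed
      finally have "(1 + r) ^ D \<le> 2 ^ D * (fact k * exp (c * r powr \<rho>) / c ^ k)" using c by (simp add: divide_right_mono)
      also have "\<dots> = (2 ^ D * (fact k / c ^ k)) * exp (c * r powr \<rho>)" by simp
      also have "\<dots> \<le> B * exp (c * r powr \<rho>)" unfolding B_def by (intro mult_right_mono mult_left_mono) auto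
      finally show ?thesis .
    qed
  qed
qed

text \<open>Multiplicities are kept by passing to the limit in the cofactors and not in the zeros.
  On a circle around \<open>a\<close> the modulus of \<open>1 - z / a\<close> is constant, so the
  cofactors inherit local bounds by the maximum principle, and a subsequence of them converges as
  well.\<close>

lemma montel_limit_factor:
  fixes h :: "nat \<Rightarrow> complex \<Rightarrow> complex"
  assumes hol: "\<And>k. h k holomorphic_on UNIV" and bnd: "\<And>k z. norm (h k z) \<le> \<Phi> (norm z)" and \<Phi>: "\<And>x y. 0 \<le> x \<Longrightarrow> x \<le> y \<Longrightarrow> \<Phi> x \<le> \<Phi> y"
    and lim: "\<And>z. (\<lambda>k. h k z) \<longlonglongrightarrow> g z" and a: "a \<noteq> 0"
    and q: "\<And>k. q k holomorphic_on UNIV" "\<And>k z. h k z = (1 - z / a) ^ n * q k z"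
  obtains p where "p holomorphic_on UNIV" "\<And>z. g z = (1 - z / a) ^ n * p z"
proof -
  have qb: "norm (q k w) \<le> \<Phi> (norm a + R) / (R / norm a) ^ n" if R: "norm (w - a) \<le> R" "R > 0" for k w R
  proof (rule maximum_modulus_cball[OF q(1) _ _ R(2)])
    show "w \<in> cball a R" using R by (simp add: dist_norm norm_minus_commute)
    fix z assume "z \<in> sphere a R"
    hence z: "norm (z - a) = R" by (simp add: dist_norm norm_minus_commute)
    have "1 - z / a = - (z - a) / a" using a by (simp add: field_simps)
    hence "norm (1 - z / a) = R / norm a" using z by (simp add: norm_divide norm_minus_commute)
    hence "norm (h k z) = (R / norm a) ^ n * norm (q k z)" using q(2)[of k z] by (simp add: norm_mult norm_power)
    moreover have "norm z \<le> norm a + R" using norm_triangle_ineq2[of z a] z by linarith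
    hence "norm (h k z) \<le> \<Phi> (norm a + R)" using bnd[of k z] \<Phi>[of "norm z" "norm a + R"] by simp
    ultimately have "norm (q k z) * (R / norm a) ^ n \<le> \<Phi> (norm a + R)" by (simp only: mult.commute)
    moreover have "(R / norm a) ^ n > 0" using a R by simp
    ultimately show "norm (q k z) \<le> \<Phi> (norm a + R) / (R / norm a) ^ n" by (simp only: pos_le_divide_eq)
  qed
  obtain p r where p: "p holomorphic_on UNIV" "strict_mono (r :: nat \<Rightarrow> nat)" "\<And>x. x \<in> UNIV \<Longrightarrow> (\<lambda>k. q (r k) x) \<longlonglongrightarrow> p x"
  proof (rule Montel[of UNIV "range q" q])
    fix K :: "complex set" assume "compact K" "K \<subseteq> UNIV"
    hence "bounded K" by (simp add: compact_imp_bounded)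
    then obtain B where B: "\<And>x. x \<in> K \<Longrightarrow> norm x \<le> B" by (auto simp: bounded_iff)
    define R where "R = \<bar>B\<bar> + norm a + 1"
    have "norm (h' z) \<le> \<Phi> (norm a + R) / (R / norm a) ^ n" if "h' \<in> range q" "z \<in> K" for h' z
    proof -
      have "norm (z - a) \<le> R" using B[OF that(2)] norm_triangle_ineq4[of z a] by (simp add: R_def)
      moreover have "R > 0" by (simp add: R_def add_nonneg_pos)
      ultimately show ?thesis using that(1) qb by auto
    qed
    thus "\<exists>B. \<forall>h\<in>range q. \<forall>z\<in>K. norm (h z) \<le> B" by blast
  qed (use q in auto)
  show ?thesis
  proof (rule that[OF p(1)])
    fix z
    have "(\<lambda>k. h (r k) z) \<longlonglongrightarrow> g z" using LIMSEQ_subseq_LIMSEQ[OF lim p(2)] by (simp add: o_def)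
    moreover have "(\<lambda>k. h (r k) z) \<longlonglongrightarrow> (1 - z / a) ^ n * p z"
      unfolding q(2) by (intro tendsto_intros p(3)) simp
    ultimately show "g z = (1 - z / a) ^ n * p z" by (rule LIMSEQ_unique)
  qed
qed

text \<open>A linear factor where \<open>1 + (r / t) powr \<beta>\<close> is allowed leaves a
  reserve of \<open>(1 + r) powr (\<beta> - 1)\<close>. It is drawn from one of the n equal factors,
  which is why n is at least 1.\<close>

lemma point_factor_bound:
  fixes r t \<beta> :: real
  assumes \<beta>: "\<beta> \<ge> 1" and t: "t > 0" and n: "n \<ge> (1::nat)" and r: "r \<ge> 0"
  shows "(1 + r / t) ^ n * (1 + r) powr (\<beta> - 1) \<le> 2 ^ n * (2 powr \<beta> * (max 1 t) powr (\<beta> - 1)) * (1 + (r / t) powr \<beta>) ^ n"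
proof -
  define x where "x = r / t"
  have x: "x \<ge> 0" using r t by (simp add: x_def)
  define m where "m = max 1 t"
  have m: "m \<ge> 1" "m \<ge> t" by (auto simp: m_def)
  have "1 + r \<le> m * (1 + x)"
  proof -
    have "r = t * x" using t by (simp add: x_def)
    also have "\<dots> \<le> m * x" using m x by (intro mult_right_mono) auto
    finally show ?thesis using m by (simp add: distrib_left)
  qed
  hence "(1 + r) powr (\<beta> - 1) \<le> (m * (1 + x)) powr (\<beta> - 1)" using r \<beta> by (intro powr_mono2) auto
  hence 1: "(1 + r) powr (\<beta> - 1) \<le> m powr (\<beta> - 1) * (1 + x) powr (\<beta> - 1)" using m x by (simp add: powr_mult)
  have xp: "x powr \<beta> \<ge> 0" by simp
  have 2: "(1 + x) powr \<beta> \<le> 2 powr \<beta> * (1 + x powr \<beta>)"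
  proof (cases "x \<le> 1")
    case True
    have "(1 + x) powr \<beta> \<le> 2 powr \<beta>" using True x \<beta> by (intro powr_mono2) auto
    also have "\<dots> \<le> 2 powr \<beta> * (1 + x powr \<beta>)" using mult_left_mono[of 1 "1 + x powr \<beta>" "2 powr \<beta>"] by simp
    finally show ?thesis .
  next
    case False
    have "(1 + x) powr \<beta> \<le> (2 * x) powr \<beta>" using False \<beta> by (intro powr_mono2) auto
    also have "\<dots> = 2 powr \<beta> * x powr \<beta>" using x by (simp add: powr_mult)
    also have "\<dots> \<le> 2 powr \<beta> * (1 + x powr \<beta>)" by (intro mult_left_mono) auto
    finally show ?thesis .
  qed
  have 3: "1 + x \<le> 2 * (1 + x powr \<beta>)"
  proof (cases "x \<le> 1")
    case True
    hence "1 + x \<le> 2 * 1" by simp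
    also have "2 * 1 \<le> 2 * (1 + x powr \<beta>)" by (rule mult_left_mono) auto
    finally show ?thesis .
  next
    case False
    hence "x powr 1 \<le> x powr \<beta>" using \<beta> by (intro powr_mono) auto
    thus ?thesis using False by simp
  qed
  obtain k where k: "n = Suc k" using n by (cases n) auto
  have "(1 + x) ^ n * (1 + r) powr (\<beta> - 1) \<le> (1 + x) ^ n * (m powr (\<beta> - 1) * (1 + x) powr (\<beta> - 1))"
    using 1 x by (intro mult_left_mono) auto
  also have "\<dots> = (1 + x) ^ k * m powr (\<beta> - 1) * ((1 + x) powr 1 * (1 + x) powr (\<beta> - 1))"
    using x by (simp add: k)
  also have "(1 + x) powr 1 * (1 + x) powr (\<beta> - 1) = (1 + x) powr \<beta>" by (simp only: powr_add[symmetric]) simp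
  also have "(1 + x) ^ k * m powr (\<beta> - 1) * (1 + x) powr \<beta> \<le> (2 * (1 + x powr \<beta>)) ^ k * m powr (\<beta> - 1) * (2 powr \<beta> * (1 + x powr \<beta>))"
    using x by (intro mult_mono power_mono 2 3) auto
  also have "\<dots> = 2 ^ k * (2 powr \<beta> * m powr (\<beta> - 1)) * (1 + x powr \<beta>) ^ n"
    by (simp only: k power_mult_distrib power_Suc mult_ac)
  also have "\<dots> \<le> 2 ^ n * (2 powr \<beta> * m powr (\<beta> - 1)) * (1 + x powr \<beta>) ^ n"
    by (intro mult_right_mono) (auto simp: k)
  finally show ?thesis by (simp add: x_def m_def)
qed

lemma entire_majorant:
  fixes n :: "complex \<Rightarrow> nat" and \<beta> \<rho> P :: real
  assumes \<beta>: "\<beta> \<ge> 1" and \<rho>: "\<rho> > 0" and P: "P > 0" and C0: "C0 \<ge> 0"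
    and locfin: "\<And>R. finite {a. n a \<noteq> 0 \<and> norm a \<le> R}"
    and U: "\<And>K r. finite K \<Longrightarrow> r \<ge> 0 \<Longrightarrow> kernel_sum \<beta> K n log_mod r \<le> P * r powr \<rho> + C0"
  obtains f B where "f holomorphic_on UNIV" "f \<noteq> (\<lambda>_. 0)" "B \<ge> 0"
    "\<And>a. \<exists>g. g holomorphic_on UNIV \<and> (\<forall>z. f z = (z - a) ^ n a * g z)"
    "\<And>z. norm (f z) \<le> B * exp (P * norm z powr \<rho>)"
proof -
  define S where "S = {a. n a \<noteq> 0 \<and> a \<noteq> 0}"
  have fac: "\<exists>g. g holomorphic_on UNIV \<and> (\<forall>z. f z = (z - a) ^ n a * g z)"
    if "a \<noteq> 0" "p holomorphic_on UNIV" "\<And>z. f z = (1 - z / a) ^ n a * p z" for f p and a :: complex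
  proof (intro exI conjI allI)
    show "(\<lambda>z. (- 1 / a) ^ n a * p z) holomorphic_on UNIV" by (intro holomorphic_intros that)
    fix z
    have "1 - z / a = (z - a) * (- 1 / a)" using that(1) by (simp add: field_simps)
    hence "(1 - z / a) ^ n a = (z - a) ^ n a * (- 1 / a) ^ n a" by (simp only: power_mult_distrib)
    thus "f z = (z - a) ^ n a * ((- 1 / a) ^ n a * p z)" using that(3)[of z] by (simp only: mult.assoc)
  qed
  show ?thesis
  proof (cases "finite S")
    case True
    \<comment> \<open>With finitely many points there may be too few to spare, but then a polynomial
      with just these zeros grows slowly enough.\<close>
    define h where "h = (\<lambda>z. \<Prod>a\<in>S. (1 - z / a) ^ n a)"
    define f where "f = (\<lambda>z. z ^ n 0 * h z)"
    have S0: "\<And>a. a \<in> S \<Longrightarrow> a \<noteq> 0" by (auto simp: S_def)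
    have hol: "h holomorphic_on UNIV" "f holomorphic_on UNIV" unfolding f_def h_def using S0 by (auto intro!: holomorphic_intros)
    define D where "D = n 0 + (\<Sum>a\<in>S. n a)"
    obtain B where B: "B \<ge> 0" "\<And>r. r \<ge> 0 \<Longrightarrow> (1 + r) ^ D \<le> B * exp (P * r powr \<rho>)"
      using power_le_exp_powr[OF P \<rho>, of D] by blast
    define E where "E = (\<Prod>a\<in>S. (1 + 1 / norm a) ^ n a)"
    have E0: "E \<ge> 0" unfolding E_def by (intro prod_nonneg) auto
    have bd: "norm (f z) \<le> (E * B) * exp (P * norm z powr \<rho>)" for z
    proof -
      have "norm (h z) \<le> (\<Prod>a\<in>S. ((1 + 1 / norm a) * (1 + norm z)) ^ n a)"
        unfolding h_def prod_norm[symmetric] norm_power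
      proof (rule prod_mono, intro conjI power_mono)
        fix a assume "a \<in> S"
        have "norm (1 - z / a) \<le> 1 + norm z * (1 / norm a)" using norm_triangle_ineq4[of 1 "z / a"] by (simp add: norm_divide)
        also have "\<dots> \<le> 1 + norm z * (1 / norm a) + norm z + 1 / norm a" by simp
        also have "\<dots> = (1 + 1 / norm a) * (1 + norm z)" by (simp only: distrib_left distrib_right mult_1 mult_1_right) simp
        finally show "norm (1 - z / a) \<le> (1 + 1 / norm a) * (1 + norm z)" .
      qed auto
      also have "\<dots> = E * (1 + norm z) ^ (\<Sum>a\<in>S. n a)"
        unfolding E_def power_mult_distrib prod.distrib power_sum ..
      finally have "norm (f z) \<le> (1 + norm z) ^ n 0 * (E * (1 + norm z) ^ (\<Sum>a\<in>S. n a))"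
        unfolding f_def norm_mult norm_power by (intro mult_mono power_mono) auto
      also have "\<dots> = E * (1 + norm z) ^ D" by (simp add: D_def power_add)
      also have "\<dots> \<le> E * (B * exp (P * norm z powr \<rho>))" by (intro mult_left_mono B E0) auto
      finally show ?thesis by (simp add: mult.assoc)
    qed
    show ?thesis
    proof (rule that[OF hol(2) _ _ _ bd])
      show "f \<noteq> (\<lambda>_. 0)"
      proof
        assume f0: "f = (\<lambda>_. 0)"
        have "finite (insert 0 S)" using True by simp
        then obtain z where "z \<notin> insert 0 S" using infinite_UNIV_char_0 ex_new_if_finite by blast
        moreover have "f z = 0" by (simp add: f0)
        ultimately show False using S0 True by (auto simp: f_def h_def)
      qed
      show "E * B \<ge> 0" using E0 B by simp
      show "\<exists>g. g holomorphic_on UNIV \<and> (\<forall>z. f z = (z - a) ^ n a * g z)" for a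
      proof (cases "a \<in> S")
        case aS: True
        show ?thesis
        proof (rule fac[OF S0[OF aS]])
          show "(\<lambda>z. z ^ n 0 * (\<Prod>a\<in>S - {a}. (1 - z / a) ^ n a)) holomorphic_on UNIV"
            using S0 by (auto intro!: holomorphic_intros)
          show "f z = (1 - z / a) ^ n a * (z ^ n 0 * (\<Prod>a\<in>S - {a}. (1 - z / a) ^ n a))" for z
            unfolding f_def h_def prod.remove[OF True aS] by (simp only: mult_ac)
        qed
      next
        case False
        show ?thesis
        proof (cases "a = 0")
          case True
          thus ?thesis using hol by (intro exI[of _ h]) (simp add: f_def)
        next
          case a0: False
          hence "n a = 0" using False by (simp add: S_def)
          thus ?thesis using hol by (intro exI[of _ f]) simp
        qed
      qed
    qed
  next
    case False
    define m where "m = nat \<lceil>\<rho>\<rceil>"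
    define A where "A = P + C0"
    have U': "kernel_sum \<beta> K n log_mod r \<le> A * (1 + r) ^ m" if K: "finite K" "r \<ge> 0" for K r
    proof -
      have "r powr \<rho> \<le> (1 + r) powr \<rho>" using K \<rho> by (intro powr_mono2) auto
      also have "\<dots> \<le> (1 + r) powr real m" using K unfolding m_def by (intro powr_mono real_nat_ceiling_ge) auto
      also have "\<dots> = (1 + r) ^ m" using K by (simp add: powr_realpow)
      finally have 1: "P * r powr \<rho> \<le> P * (1 + r) ^ m" using P by simp
      have "C0 * 1 \<le> C0 * (1 + r) ^ m" using C0 K by (intro mult_left_mono one_le_power) auto
      thus ?thesis using U[OF K] 1 by (simp add: A_def distrib_right)
    qed
    obtain C d where C: "C \<ge> 0" "\<beta> = 1 \<Longrightarrow> d = 0"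
      and mp: "\<And>K n. finite K \<Longrightarrow> 0 \<notin> K \<Longrightarrow> (\<And>r. r \<ge> 0 \<Longrightarrow> kernel_sum \<beta> K n log_mod r \<le> A * (1 + r) ^ m) \<Longrightarrow> majorant_product \<beta> K n C d"
    proof (rule majorant_product_exists[OF \<beta>, of A m])
      show "A \<ge> 0" using P C0 by (simp add: A_def)
      fix C d assume x: "C \<ge> 0" "\<beta> = 1 \<Longrightarrow> d = 0" "\<And>K n. finite K \<Longrightarrow> 0 \<notin> K \<Longrightarrow> (\<And>r. r \<ge> 0 \<Longrightarrow> kernel_sum \<beta> K n log_mod r \<le> A * (1 + r) ^ m) \<Longrightarrow> majorant_product \<beta> K n C d"
      show thesis by (rule that[OF x])
    qed
    \<comment> \<open>So many spared points that their reserves outweigh \<open>(1 + r) ^ d\<close>.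
      For \<open>\<beta> = 1\<close> the quotient is 0 and \<open>d\<close> vanishes as
      well.\<close>
    define M where "M = nat \<lceil>real d / (\<beta> - 1)\<rceil>"
    have M: "real d \<le> (\<beta> - 1) * real M"
    proof (cases "\<beta> = 1")
      case False
      have "real d / (\<beta> - 1) \<le> real M" unfolding M_def by (rule real_nat_ceiling_ge)
      thus ?thesis using False \<beta> by (simp add: field_simps)
    qed (use C in simp)
    obtain T where T: "T \<subseteq> S" "finite T" "card T = M" using infinite_arbitrarily_large[OF False] by blast
    have S0: "\<And>a. a \<in> S \<Longrightarrow> a \<noteq> 0 \<and> n a \<ge> 1" by (auto simp: S_def)
    define K where "K = (\<lambda>R::nat. {a\<in>S. norm a \<le> real R} - T)"
    have K: "finite (K R)" "0 \<notin> K R" for R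
      using finite_subset[OF _ locfin[of "real R"], of "K R"] by (auto simp: K_def S_def)
    have "\<forall>R. \<exists>FH. fst FH holomorphic_on UNIV \<and> snd FH holomorphic_on UNIV \<and> fst FH 0 = 1 \<and>
      (\<forall>z. fst FH z = (\<Prod>a\<in>K R. (1 - z / a) ^ n a) * snd FH z) \<and>
      (\<forall>z. norm (fst FH z) \<le> C * (1 + norm z) ^ d * exp (kernel_sum \<beta> (K R) n log_mod (norm z)))"
    proof
      fix R
      have "majorant_product \<beta> (K R) n C d" by (rule mp[OF K U'[OF K(1)]])
      then obtain F H where FH: "F holomorphic_on UNIV" "H holomorphic_on UNIV" "F 0 = 1"
      "\<forall>z. F z = (\<Prod>a\<in>K R. (1 - z / a) ^ n a) * H z"
      "\<forall>z. norm (F z) \<le> C * (1 + norm z) ^ d * exp (kernel_sum \<beta> (K R) n log_mod (norm z))"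
        unfolding majorant_product_def by blast
      show "\<exists>FH. fst FH holomorphic_on UNIV \<and> snd FH holomorphic_on UNIV \<and> fst FH 0 = 1 \<and>
      (\<forall>z. fst FH z = (\<Prod>a\<in>K R. (1 - z / a) ^ n a) * snd FH z) \<and>
      (\<forall>z. norm (fst FH z) \<le> C * (1 + norm z) ^ d * exp (kernel_sum \<beta> (K R) n log_mod (norm z)))"
        by (rule exI[of _ "(F, H)"]) (simp only: fst_conv snd_conv, use FH in blast)
    qed
    from choice[OF this] obtain FH where FH: "\<And>R. fst (FH R) holomorphic_on UNIV" "\<And>R. snd (FH R) holomorphic_on UNIV" "\<And>R. fst (FH R) 0 = 1"
      "\<And>R z. fst (FH R) z = (\<Prod>a\<in>K R. (1 - z / a) ^ n a) * snd (FH R) z"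
      "\<And>R z. norm (fst (FH R) z) \<le> C * (1 + norm z) ^ d * exp (kernel_sum \<beta> (K R) n log_mod (norm z))"
      by blast
    define h where "h = (\<lambda>R z. (\<Prod>a\<in>T. (1 - z / a) ^ n a) * fst (FH R) z)"
    have hh: "h R holomorphic_on UNIV" for R
      unfolding h_def using T S0 by (intro holomorphic_intros FH) auto
    have h0: "h R 0 = 1" for R by (simp add: h_def FH(3))
    define CT where "CT = (\<Prod>a\<in>T. 2 ^ n a * (2 powr \<beta> * (max 1 (norm a)) powr (\<beta> - 1)))"
    have CT: "CT \<ge> 0" unfolding CT_def by (intro prod_nonneg) auto
    define B where "B = CT * C * exp C0"
    have B: "B \<ge> 0" using CT C by (simp add: B_def)
    have bd: "norm (z ^ n 0 * h R z) \<le> B * exp (P * norm z powr \<rho>)" for R z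
    proof -
      define r where "r = norm z"
      have r: "r \<ge> 0" by (simp add: r_def)
      have TK: "T \<inter> K R = {}" "0 \<notin> T" "0 \<notin> K R" using T S0 K by (auto simp: K_def)
      have e: "r / exp (log_mod a) = r / norm a" if "a \<noteq> 0" for a using that by (simp add: log_mod_def)
      have i1: "norm (\<Prod>a\<in>T. (1 - z / a) ^ n a) \<le> (\<Prod>a\<in>T. (1 + r / norm a) ^ n a)"
        unfolding prod_norm[symmetric] norm_power
      proof (rule prod_mono, intro conjI power_mono)
        fix a
        show "norm (1 - z / a) \<le> 1 + r / norm a" using norm_triangle_ineq4[of 1 "z / a"] by (simp add: norm_divide r_def)
      qed auto
      have i2: "(\<Prod>a\<in>T. (1 + r / norm a) ^ n a) * (1 + r) ^ d \<le> CT * (\<Prod>a\<in>T. (1 + (r / exp (log_mod a)) powr \<beta>) ^ n a)"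
      proof -
        have "(1 + r) ^ d = (1 + r) powr real d" using r by (simp add: powr_realpow)
        also have "\<dots> \<le> (1 + r) powr ((\<beta> - 1) * real (card T))" using M r T by (intro powr_mono) auto
        also have "\<dots> = (\<Prod>a\<in>T. (1 + r) powr (\<beta> - 1))" using r by (simp add: powr_powr[symmetric] powr_realpow)
        finally have "(\<Prod>a\<in>T. (1 + r / norm a) ^ n a) * (1 + r) ^ d \<le> (\<Prod>a\<in>T. (1 + r / norm a) ^ n a * (1 + r) powr (\<beta> - 1))"
          unfolding prod.distrib using r by (intro mult_left_mono prod_nonneg) auto
        also have "\<dots> \<le> (\<Prod>a\<in>T. 2 ^ n a * (2 powr \<beta> * (max 1 (norm a)) powr (\<beta> - 1)) * (1 + (r / exp (log_mod a)) powr \<beta>) ^ n a)"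
        proof (rule prod_mono, intro conjI)
          fix a assume "a \<in> T"
          hence a: "a \<noteq> 0" "n a \<ge> 1" using T S0 by auto
          show "(1 + r / norm a) ^ n a * (1 + r) powr (\<beta> - 1) \<le> 2 ^ n a * (2 powr \<beta> * (max 1 (norm a)) powr (\<beta> - 1)) * (1 + (r / exp (log_mod a)) powr \<beta>) ^ n a"
            unfolding e[OF a(1)] by (rule point_factor_bound[OF \<beta> _ a(2) r]) (use a in simp)
        qed (use r in auto)
        finally show ?thesis unfolding CT_def prod.distrib .
      qed
      \<comment> \<open>The zero at the origin: as \<open>log_mod 0\<close> is 0, its share of the
        majorant is \<open>(1 + r powr \<beta>) ^ n 0\<close>, which dominates the monomial.\<close>
      have i3: "norm z ^ n 0 \<le> (1 + (r / exp (log_mod 0)) powr \<beta>) ^ n 0"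
      proof (rule power_mono)
        have "r \<le> 1 + r powr \<beta>"
        proof (cases "r \<le> 1")
          case False
          hence "r powr 1 \<le> r powr \<beta>" using \<beta> by (intro powr_mono) auto
          thus ?thesis using False by simp
        qed (use powr_ge_zero[of r \<beta>] in linarith)
        thus "norm z \<le> 1 + (r / exp (log_mod 0)) powr \<beta>" by (simp add: r_def log_mod_def)
      qed simp
      have "norm (\<Prod>a\<in>T. (1 - z / a) ^ n a) * (1 + r) ^ d \<le> (\<Prod>a\<in>T. (1 + r / norm a) ^ n a) * (1 + r) ^ d"
        using i1 r by (intro mult_right_mono) auto
      note i4 = order_trans[OF this i2]
      have "norm z ^ n 0 * (norm (\<Prod>a\<in>T. (1 - z / a) ^ n a) * (1 + r) ^ d) \<le>
         (1 + (r / exp (log_mod 0)) powr \<beta>) ^ n 0 * (CT * (\<Prod>a\<in>T. (1 + (r / exp (log_mod a)) powr \<beta>) ^ n a))"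
        using r by (intro mult_mono i3 i4) auto
      hence "norm z ^ n 0 * (norm (\<Prod>a\<in>T. (1 - z / a) ^ n a) * (1 + r) ^ d) * (C * exp (kernel_sum \<beta> (K R) n log_mod r)) \<le>
         (1 + (r / exp (log_mod 0)) powr \<beta>) ^ n 0 * (CT * (\<Prod>a\<in>T. (1 + (r / exp (log_mod a)) powr \<beta>) ^ n a)) * (C * exp (kernel_sum \<beta> (K R) n log_mod r))"
        using C by (intro mult_right_mono) auto
      moreover have "norm (z ^ n 0 * h R z) \<le> norm z ^ n 0 * (norm (\<Prod>a\<in>T. (1 - z / a) ^ n a) * (1 + r) ^ d) * (C * exp (kernel_sum \<beta> (K R) n log_mod r))"
      proof -
        have "norm (z ^ n 0 * h R z) = norm z ^ n 0 * (norm (\<Prod>a\<in>T. (1 - z / a) ^ n a) * norm (fst (FH R) z))"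
          by (simp add: h_def norm_mult norm_power)
        also have "\<dots> \<le> norm z ^ n 0 * (norm (\<Prod>a\<in>T. (1 - z / a) ^ n a) * (C * (1 + r) ^ d * exp (kernel_sum \<beta> (K R) n log_mod r)))"
          unfolding r_def by (intro mult_left_mono FH) auto
        finally show ?thesis by (simp only: mult_ac)
      qed
      moreover have "(1 + (r / exp (log_mod 0)) powr \<beta>) ^ n 0 * (CT * (\<Prod>a\<in>T. (1 + (r / exp (log_mod a)) powr \<beta>) ^ n a)) * (C * exp (kernel_sum \<beta> (K R) n log_mod r))
         = CT * C * exp (kernel_sum \<beta> (insert 0 (T \<union> K R)) n log_mod r)"
      proof -
        have "exp (kernel_sum \<beta> (insert 0 (T \<union> K R)) n log_mod r) = (1 + (r / exp (log_mod 0)) powr \<beta>) ^ n 0 * ((\<Prod>a\<in>T. (1 + (r / exp (log_mod a)) powr \<beta>) ^ n a) * exp (kernel_sum \<beta> (K R) n log_mod r))"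
          using TK T(2) K(1)[of R] by (simp add: exp_kernel_sum prod.union_disjoint)
        thus ?thesis by (simp only: mult_ac)
      qed
      moreover have "CT * C * exp (kernel_sum \<beta> (insert 0 (T \<union> K R)) n log_mod r) \<le> CT * C * exp (P * r powr \<rho> + C0)"
        using U[of "insert 0 (T \<union> K R)" r] T K r CT C by (intro mult_left_mono) auto
      moreover have "CT * C * exp (P * r powr \<rho> + C0) = B * exp (P * r powr \<rho>)" by (simp add: B_def exp_add)
      ultimately show ?thesis unfolding r_def by linarith
    qed
    \<comment> \<open>Near the origin the bound for \<open>z ^ n 0 * h R z\<close> gives none for
      \<open>h R z\<close>. The maximum principle on the unit disc fills the gap, hence the
      truncation of the radius at 1.\<close>
    define \<Phi> where "\<Phi> = (\<lambda>r::real. B * exp (P * (max 1 r) powr \<rho>))"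
    have \<Phi>mono: "\<Phi> x \<le> \<Phi> y" if "0 \<le> x" "x \<le> y" for x y
    proof -
      have "(max 1 x) powr \<rho> \<le> (max 1 y) powr \<rho>" using that \<rho> by (intro powr_mono2) auto
      thus ?thesis unfolding \<Phi>_def using P B by (intro mult_left_mono) auto
    qed
    have big: "norm (h R z) \<le> B * exp (P * norm z powr \<rho>)" if "norm z \<ge> 1" for R z
    proof -
      have "1 * norm (h R z) \<le> norm z ^ n 0 * norm (h R z)" using that by (intro mult_right_mono one_le_power) auto
      thus ?thesis using bd[of z R] by (simp add: norm_mult norm_power)
    qed
    have hb: "norm (h R z) \<le> \<Phi> (norm z)" for R z
    proof (cases "norm z \<ge> 1")
      case True
      thus ?thesis using big[OF True, of R] by (simp add: \<Phi>_def max_absorb2)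
    next
      case False
      have "norm (h R z) \<le> \<Phi> 0"
      proof (rule maximum_modulus_cball[OF hh, of 0 1])
        fix w :: complex assume "w \<in> sphere 0 1"
        thus "norm (h R w) \<le> \<Phi> 0" using big[of w R] by (simp add: \<Phi>_def)
      qed (use False in auto)
      also have "\<dots> \<le> \<Phi> (norm z)" by (rule \<Phi>mono) auto
      finally show ?thesis .
    qed
    obtain g r where g: "g holomorphic_on UNIV" "strict_mono (r :: nat \<Rightarrow> nat)" "\<And>x. x \<in> UNIV \<Longrightarrow> (\<lambda>k. h (r k) x) \<longlonglongrightarrow> g x"
    proof (rule Montel[of UNIV "range h" h])
      fix K :: "complex set" assume "compact K" "K \<subseteq> UNIV"
      hence "bounded K" by (simp add: compact_imp_bounded)
      then obtain B' where B': "\<And>x. x \<in> K \<Longrightarrow> norm x \<le> B'" by (auto simp: bounded_iff)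
      have "norm (h' z) \<le> \<Phi> B'" if "h' \<in> range h" "z \<in> K" for h' z
        using that(1) hb[of _ z] \<Phi>mono[of "norm z" B'] B'[OF that(2)] by (auto intro: order_trans)
      thus "\<exists>B. \<forall>h\<in>range h. \<forall>z\<in>K. norm (h z) \<le> B" by blast
    qed (use hh in auto)
    define f where "f = (\<lambda>z. z ^ n 0 * g z)"
    have hf: "f holomorphic_on UNIV" unfolding f_def by (intro holomorphic_intros g)
    have "(\<lambda>k. h (r k) 0) \<longlonglongrightarrow> 1" by (simp add: h0)
    hence g0: "g 0 = 1" using g(3)[of 0] LIMSEQ_unique by blast
    show ?thesis
    proof (rule that[OF hf _ B])
      show "f \<noteq> (\<lambda>_. 0)"
      proof
        assume f0: "f = (\<lambda>_. 0)"
        have "g z = 0" if "z \<noteq> 0" for z using fun_cong[OF f0, of z] that by (simp add: f_def)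
        hence "eventually (\<lambda>z. g z = 0) (at 0)" by (auto simp: eventually_at_filter)
        hence "(g \<longlongrightarrow> 0) (at 0)" by (rule tendsto_eventually)
        moreover have "(g \<longlongrightarrow> g 0) (at 0)"
          using holomorphic_on_imp_continuous_on[OF g(1)] by (simp add: continuous_on_def)
        ultimately have "g 0 = 0" by (metis LIM_unique)
        thus False using g0 by simp
      qed
      show "norm (f z) \<le> B * exp (P * norm z powr \<rho>)" for z
      proof (rule Lim_norm_ubound)
        show "(\<lambda>k. z ^ n 0 * h (r k) z) \<longlonglongrightarrow> f z" unfolding f_def by (intro tendsto_intros g(3)) simp
      qed (use bd in auto)
      show "\<exists>g. g holomorphic_on UNIV \<and> (\<forall>z. f z = (z - a) ^ n a * g z)" for a
      proof (cases "a \<in> S")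
        case False
        show ?thesis
        proof (cases "a = 0")
          case True
          thus ?thesis using g by (intro exI[of _ g]) (simp add: f_def)
        next
          case a0: False
          hence "n a = 0" using False by (simp add: S_def)
          thus ?thesis using hf by (intro exI[of _ f]) simp
        qed
      next
        case aS: True
        have a0: "a \<noteq> 0" using S0[OF aS] by simp
        \<comment> \<open>From this index on the truncated sets contain \<open>a\<close> unless it
          was spared, so its factor can be split off from every member of the sequence.\<close>
        define N where "N = nat \<lceil>norm a\<rceil>"
        define q where "q = (\<lambda>k z. if a \<in> T then (\<Prod>b\<in>T - {a}. (1 - z / b) ^ n b) * fst (FH (r (k + N))) z
           else (\<Prod>b\<in>T. (1 - z / b) ^ n b) * ((\<Prod>b\<in>K (r (k + N)) - {a}. (1 - z / b) ^ n b) * snd (FH (r (k + N))) z))"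
        have qh: "q k holomorphic_on UNIV" for k
          unfolding q_def using T S0 K(2) by (cases "a \<in> T") (auto intro!: holomorphic_intros FH)
        have qf: "h (r (k + N)) z = (1 - z / a) ^ n a * q k z" for k z
        proof (cases "a \<in> T")
          case True
          show ?thesis unfolding q_def h_def if_P[OF True] prod.remove[OF T(2) True] by (simp only: mult.assoc)
        next
          case False
          have "norm a \<le> real N" unfolding N_def by (rule real_nat_ceiling_ge)
          also have "N \<le> r (k + N)" using seq_suble[OF g(2), of "k + N"] by linarith
          finally have aK: "a \<in> K (r (k + N))" using aS False by (simp add: K_def)
          show ?thesis unfolding q_def h_def FH(4) if_not_P[OF False] prod.remove[OF K(1) aK] by (simp only: mult_ac)
        qed
        have lim: "(\<lambda>k. h (r (k + N)) z) \<longlonglongrightarrow> g z" for z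
          by (rule LIMSEQ_ignore_initial_segment) (rule g(3), simp)
        obtain p where p: "p holomorphic_on UNIV" "\<And>z. g z = (1 - z / a) ^ n a * p z"
          using montel_limit_factor[of "\<lambda>k. h (r (k + N))" \<Phi> g a q "n a", OF hh hb \<Phi>mono lim a0 qh qf] by blast
        show ?thesis
        proof (rule fac[OF a0])
          show "(\<lambda>z. z ^ n 0 * p z) holomorphic_on UNIV" by (intro holomorphic_intros p)
          show "f z = (1 - z / a) ^ n a * (z ^ n 0 * p z)" for z unfolding f_def p(2) by (simp only: mult_ac)
        qed
      qed
    qed
  qed
qed

subsection \<open>Point distributions\<close>

lemma zero_mult_ge:
  assumes f: "f holomorphic_on UNIV" "f \<noteq> (\<lambda>_. 0)" and g: "g holomorphic_on UNIV" "\<And>z. f z = (z - a) ^ N * g z"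
  shows "enat N \<le> zero_mult f a"
proof (cases "N = 0")
  case False
  hence fa: "f a = 0" using g(2)[of a] by simp
  define k where "k = nat (zorder f a)"
  have "\<exists>w\<in>UNIV. f w \<noteq> 0" using f(2) by auto
  from zorder_exist_zero[OF f(1) open_UNIV connected_UNIV UNIV_I this]
  obtain r where r: "r > 0" "zor_poly f a holomorphic_on cball a r" "\<And>w. w \<in> cball a r \<Longrightarrow> f w = zor_poly f a w * (w - a) ^ k \<and> zor_poly f a w \<noteq> 0"
    unfolding k_def by blast
  have "N \<le> k"
  proof (rule ccontr)
    assume "\<not> N \<le> k"
    hence Nk: "N = k + (N - k)" "N - k > 0" by auto
    define p where "p = zor_poly f a"
    have eq: "p w = (w - a) ^ (N - k) * g w" if "w \<in> ball a r" "w \<noteq> a" for w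
    proof -
      have "p w * (w - a) ^ k = (w - a) ^ N * g w" using r(3)[of w] g(2)[of w] that by (simp add: p_def)
      also have "(w - a) ^ N = (w - a) ^ (N - k) * (w - a) ^ k" using Nk(1) by (metis add.commute power_add)
      finally show ?thesis using that by simp
    qed
    have pa: "(p \<longlongrightarrow> p a) (at a)"
    proof -
      have "continuous_on (ball a r) p"
        unfolding p_def using holomorphic_on_imp_continuous_on[OF r(2)] by (rule continuous_on_subset) auto
      thus ?thesis using r(1) by (simp add: continuous_on_eq_continuous_at isCont_def)
    qed
    have "((\<lambda>w. (w - a) ^ (N - k) * g w) \<longlongrightarrow> (a - a) ^ (N - k) * g a) (at a)"
      using holomorphic_on_imp_continuous_on[OF g(1)] by (intro tendsto_intros) (simp add: continuous_on_eq_continuous_at isCont_def)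
    moreover have "(a - a) ^ (N - k) * g a = 0" using Nk(2) by (simp add: power_0_left)
    ultimately have "((\<lambda>w. (w - a) ^ (N - k) * g w) \<longlongrightarrow> 0) (at a)" by (simp only:)
    moreover have "eventually (\<lambda>w. (w - a) ^ (N - k) * g w = p w) (at a)"
      using eventually_at_in_open[of "ball a r" a] r(1) by (auto elim!: eventually_mono simp: eq)
    ultimately have "(p \<longlongrightarrow> 0) (at a)" by (rule Lim_transform_eventually)
    with pa have "p a = 0" by (metis LIM_unique)
    thus False using r(1) r(3)[of a] by (simp add: p_def)
  qed
  thus ?thesis using fa f(2) by (simp add: zero_mult_def k_def)
qed (simp add: zero_enat_def[symmetric])

section \<open>Counting functions of a distribution\<close>

lemma sum_le_radial_count:
  assumes "finite F" "F \<subseteq> cball 0 r"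
  shows "(\<Sum>z\<in>F. ennreal_of_enat (Z z)) \<le> radial_count Z r"
  unfolding radial_count_def
  by (subst nonneg_infsum_complete) (use assms in \<open>auto intro!: SUP_upper\<close>)

lemma radial_count_0: "radial_count Z 0 = ennreal_of_enat (Z 0)"
  by (simp add: radial_count_def)

lemma radial_count_mono: "r \<le> s \<Longrightarrow> radial_count Z r \<le> radial_count Z s"
  unfolding radial_count_def
  by (subst (1 2) nonneg_infsum_complete) (auto intro!: SUP_subset_mono)

definition count_integral :: "point_distribution \<Rightarrow> real \<Rightarrow> ennreal" where
  "count_integral Z r = (\<integral>\<^sup>+t\<in>{0..r}. ((radial_count Z t - radial_count Z 0) / ennreal t) \<partial>lborel)"

lemma ennreal_of_enat_enat: "ennreal_of_enat (enat m) = ennreal (real m)"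
  by (simp add: ennreal_of_nat_eq_real_of_nat)

text \<open>On the interval from s to 2 s the integrand is at least its numerator at s divided by 2
  s. An infinite count at s would therefore make the integral at 2 s infinite.\<close>

lemma radial_count_finite:
  assumes Z0: "Z 0 < \<infinity>" and fin: "\<And>r. r > 0 \<Longrightarrow> count_integral Z r < top"
  shows "radial_count Z r < top"
proof -
  obtain m where m: "Z 0 = enat m" using Z0 by (cases "Z 0") auto
  define s where "s = max r 1"
  have s: "s > 0" "r \<le> s" by (auto simp: s_def)
  let ?d = "(radial_count Z s - radial_count Z 0) / ennreal (2 * s)"
  have "?d * ennreal s = (\<integral>\<^sup>+t. ?d * indicator {s..2 * s} t \<partial>lborel)"
    using s by (simp add: nn_integral_cmult_indicator)
  also have "\<dots> \<le> count_integral Z (2 * s)" unfolding count_integral_def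
  proof (rule nn_integral_mono)
    fix t
    show "?d * indicator {s..2 * s} t \<le> (radial_count Z t - radial_count Z 0) / ennreal t * indicator {0..2 * s} t"
    proof (cases "t \<in> {s..2 * s}")
      case True
      have "?d \<le> (radial_count Z t - radial_count Z 0) / ennreal t"
        unfolding divide_ennreal_def
      proof (intro mult_mono ennreal_minus_mono radial_count_mono order_refl)
        have "inverse (ennreal (2 * s)) = ennreal (inverse (2 * s))" using s by (intro inverse_ennreal) auto
        also have "\<dots> \<le> ennreal (inverse t)" using True s by (intro ennreal_leI le_imp_inverse_le) auto
        also have "\<dots> = inverse (ennreal t)" using True s by (intro inverse_ennreal[symmetric]) auto
        finally show "inverse (ennreal (2 * s)) \<le> inverse (ennreal t)" .
      qed (use True in auto)
      thus ?thesis using True s by simp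
    qed simp
  qed
  also have "\<dots> < top" using fin[of "2 * s"] s by simp
  finally have "?d * ennreal s < top" .
  hence "radial_count Z s - radial_count Z 0 \<noteq> top"
    using s by (auto simp: ennreal_top_divide ennreal_top_mult)
  hence "radial_count Z s \<noteq> top"
    by (auto simp: radial_count_0 m ennreal_of_enat_enat)
  thus ?thesis using radial_count_mono[OF s(2), of Z] by (simp add: less_top order.strict_trans1 top.not_eq_extremum)
qed

lemma distribution_locally_finite:
  assumes rc: "\<And>r. radial_count Z r < top"
  shows "Z z < \<infinity>" "finite {a. Z a \<noteq> 0 \<and> norm a \<le> R}"
proof -
  have "ennreal_of_enat (Z z) \<le> radial_count Z (norm z)"
    using sum_le_radial_count[of "{z}" "norm z" Z] by simp
  also have "\<dots> < top" by (rule rc)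
  finally show "Z z < \<infinity>" by (cases "Z z") auto
  show "finite {a. Z a \<noteq> 0 \<and> norm a \<le> R}"
  proof (rule ccontr)
    assume inf: "infinite {a. Z a \<noteq> 0 \<and> norm a \<le> R}"
    obtain c where c: "radial_count Z R = ennreal c" "c \<ge> 0" using rc[of R] by (cases "radial_count Z R") auto
    obtain F where F: "F \<subseteq> {a. Z a \<noteq> 0 \<and> norm a \<le> R}" "finite F" "card F = nat \<lceil>c\<rceil> + 1"
      using infinite_arbitrarily_large[OF inf] by blast
    have "ennreal (real (card F)) = (\<Sum>z\<in>F. 1)" by (simp add: ennreal_of_nat_eq_real_of_nat)
    also have "\<dots> \<le> (\<Sum>z\<in>F. ennreal_of_enat (Z z))"
    proof (rule sum_mono)
      fix z assume "z \<in> F"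
      hence "Z z \<noteq> 0" using F by auto
      hence "1 \<le> Z z" by (simp add: ileI1 one_eSuc i0_less)
      thus "1 \<le> ennreal_of_enat (Z z)" by (metis ennreal_of_enat_1 ennreal_of_enat_le_iff)
    qed
    also have "\<dots> \<le> radial_count Z R" by (rule sum_le_radial_count) (use F in auto)
    finally have "real (card F) \<le> c" using c by (simp add: ennreal_le_iff)
    thus False using F(3) real_nat_ceiling_ge[of c] by simp
  qed
qed

text \<open>A point \<open>a\<close> adds 1 to the count from radius \<open>norm a\<close> on, hence
  the integral of 1 / t from there to \<open>r\<close>. Together with the logarithm at the origin
  this is the counting term of Jensen's formula; finitely many of the points give a lower
  bound.\<close>

lemma log_sum_le_count_integral:
  assumes Z: "\<And>z. Z z = enat (n z)" and K: "finite K" "0 \<notin> K" and r: "r > 0"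
  shows "ennreal (\<Sum>a\<in>K. real (n a) * max 0 (ln r - ln (norm a))) \<le> count_integral Z r"
proof -
  have one: "(\<integral>\<^sup>+t. ennreal (1 / t) * indicator {norm a..r} t \<partial>lborel) = ennreal (max 0 (ln r - ln (norm a)))" if a: "a \<noteq> 0" for a :: complex
  proof (cases "norm a \<le> r")
    case True
    have "(\<integral>\<^sup>+t. ennreal (1 / t) * indicator {norm a..r} t \<partial>lborel) = ennreal (ln r - ln (norm a))"
    proof (rule nn_integral_FTC_Icc)
      fix t assume "t \<in> {norm a..r}"
      hence "norm a \<le> t" by simp
      hence "t > 0" using a by (metis zero_less_norm_iff less_le_trans)
      thus "(ln has_real_derivative 1 / t) (at t)" by (auto intro!: derivative_eq_intros)
      show "0 \<le> 1 / t" using \<open>t > 0\<close> by simp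
    qed (use True in auto)
    moreover have "ln (norm a) \<le> ln r" using True a r by simp
    ultimately show ?thesis by (simp add: max_def)
  next
    case False
    hence "ln r \<le> ln (norm a)" using r a by simp
    thus ?thesis using False by (simp add: max_def)
  qed
  have "ennreal (\<Sum>a\<in>K. real (n a) * max 0 (ln r - ln (norm a))) = (\<Sum>a\<in>K. ennreal (real (n a)) * ennreal (max 0 (ln r - ln (norm a))))"
    by (subst sum_ennreal[symmetric]) (auto simp: ennreal_mult)
  also have "\<dots> = (\<Sum>a\<in>K. \<integral>\<^sup>+t. ennreal (real (n a)) * (ennreal (1 / t) * indicator {norm a..r} t) \<partial>lborel)"
  proof (rule sum.cong[OF refl])
    fix a assume "a \<in> K"
    hence "a \<noteq> 0" using K by auto
    thus "ennreal (real (n a)) * ennreal (max 0 (ln r - ln (norm a))) = (\<integral>\<^sup>+t. ennreal (real (n a)) * (ennreal (1 / t) * indicator {norm a..r} t) \<partial>lborel)"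
      by (subst nn_integral_cmult) (auto simp: one)
  qed
  also have "\<dots> = (\<integral>\<^sup>+t. (\<Sum>a\<in>K. ennreal (real (n a)) * (ennreal (1 / t) * indicator {norm a..r} t)) \<partial>lborel)"
    by (rule nn_integral_sum[symmetric]) auto
  also have "\<dots> \<le> count_integral Z r" unfolding count_integral_def
  proof (rule nn_integral_mono)
    fix t
    show "(\<Sum>a\<in>K. ennreal (real (n a)) * (ennreal (1 / t) * indicator {norm a..r} t)) \<le> (radial_count Z t - radial_count Z 0) / ennreal t * indicator {0..r} t"
    proof (cases "0 < t \<and> t \<le> r")
      case False
      have "ennreal (real (n a)) * (ennreal (1 / t) * indicator {norm a..r} t) = 0" if "a \<in> K" for a
      proof -
        have "norm a > 0" using that K by auto
        hence "norm a \<le> t \<Longrightarrow> t > 0" by (rule less_le_trans)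
        hence "t \<notin> {norm a..r}" using False by simp
        thus ?thesis by simp
      qed
      hence "(\<Sum>a\<in>K. ennreal (real (n a)) * (ennreal (1 / t) * indicator {norm a..r} t)) = 0" by (intro sum.neutral) blast
      thus ?thesis by simp
    next
      case True
      define Kt where "Kt = {a\<in>K. norm a \<le> t}"
      have Kt: "finite Kt" "0 \<notin> Kt" using K by (auto simp: Kt_def)
      have "(\<Sum>a\<in>K. ennreal (real (n a)) * (ennreal (1 / t) * indicator {norm a..r} t)) = (\<Sum>a\<in>Kt. ennreal (real (n a)) * ennreal (1 / t))"
        unfolding Kt_def using K True by (intro sum.mono_neutral_cong_right) (auto simp: indicator_def)
      also have "\<dots> = (\<Sum>a\<in>Kt. ennreal (real (n a))) * ennreal (1 / t)" by (rule sum_distrib_right[symmetric])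
      also have "\<dots> = (\<Sum>a\<in>Kt. ennreal (real (n a))) / ennreal t"
        using True by (simp add: divide_ennreal_def inverse_ennreal inverse_eq_divide)
      also have "\<dots> \<le> (radial_count Z t - radial_count Z 0) / ennreal t"
      proof (rule divide_right_mono_ennreal)
        have "(\<Sum>a\<in>insert 0 Kt. ennreal_of_enat (Z a)) \<le> radial_count Z t"
          using Kt True by (intro sum_le_radial_count) (auto simp: Kt_def)
        hence "radial_count Z 0 + (\<Sum>a\<in>Kt. ennreal (real (n a))) \<le> radial_count Z t"
          by (simp only: sum.insert[OF Kt] Z radial_count_0 ennreal_of_enat_enat)
        hence "radial_count Z 0 + (\<Sum>a\<in>Kt. ennreal (real (n a))) - radial_count Z 0 \<le> radial_count Z t - radial_count Z 0"
          by (intro ennreal_minus_mono) auto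
        thus "(\<Sum>a\<in>Kt. ennreal (real (n a))) \<le> radial_count Z t - radial_count Z 0"
          by (subst (asm) ennreal_add_diff_cancel_left) (auto simp: Z radial_count_0 ennreal_of_enat_enat)
      qed
      finally show ?thesis using True by simp
    qed
  qed
  finally show ?thesis .
qed

lemma radial_integral_count_eq:
  assumes "Z 0 = enat m" "r > 0"
  shows "radial_integral_count Z r = enn2ereal (count_integral Z r) + ereal (real m * ln r)"
  using assms by (simp add: radial_integral_count_def count_integral_def radial_count_0 ennreal_of_enat_enat ext_ln_def)

lemma paley_pos: "\<rho> > 0 \<Longrightarrow> paley \<rho> > 0"
  by (auto simp: paley_def sin_gt_zero)

lemma paley_eq: "\<rho> > 0 \<Longrightarrow> paley \<rho> = pi * \<rho> / sin (pi * \<rho> / max 1 (2 * \<rho>))"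
  by (auto simp: paley_def max_def field_simps)

lemma entire_of_bounded_count:
  assumes \<sigma>: "\<sigma> > 0" and \<rho>: "\<rho> > 0" and Z0: "Z 0 < \<infinity>" and C: "C \<ge> 0"
    and N: "\<And>r. r > 0 \<Longrightarrow> radial_integral_count Z r \<le> ereal (\<sigma> * r powr \<rho> + C)"
  shows "\<exists>f. f holomorphic_on UNIV \<and> f \<noteq> (\<lambda>_. 0) \<and> vanishes_on f Z \<and> (\<forall>z. norm (f z) \<le> exp (paley \<rho> * \<sigma> * norm z powr \<rho>))"
proof -
  obtain m where m: "Z 0 = enat m" using Z0 by (cases "Z 0") auto
  have N': "enn2ereal (count_integral Z r) + ereal (real m * ln r) \<le> ereal (\<sigma> * r powr \<rho> + C)" if "r > 0" for r
    using N[OF that] unfolding radial_integral_count_eq[where Z = Z, OF m that] .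
  have ci: "count_integral Z r < top" if "r > 0" for r
    using N'[OF that] by (cases "count_integral Z r") (auto simp: top.not_eq_extremum)
  have rc: "radial_count Z r < top" for r by (rule radial_count_finite[OF Z0 ci])
  define n where "n = (\<lambda>z. the_enat (Z z))"
  have Z: "Z z = enat (n z)" for z using distribution_locally_finite(1)[OF rc, of z] by (auto simp: n_def)
  have locfin: "finite {a. n a \<noteq> 0 \<and> norm a \<le> R}" for R
    using distribution_locally_finite(2)[OF rc, of R] by (simp add: Z zero_enat_def)
  have n0: "n 0 = m" using m Z[of 0] by simp
  have key: "(\<Sum>a\<in>K. real (n a) * max 0 (ln r - ln (norm a))) + real m * ln r \<le> \<sigma> * r powr \<rho> + C" if K: "finite K" "0 \<notin> K" and r: "r > 0" for K r
  proof -
    define X where "X = (\<Sum>a\<in>K. real (n a) * max 0 (ln r - ln (norm a)))"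
    have X: "X \<ge> 0" unfolding X_def by (intro sum_nonneg) auto
    have "ennreal X \<le> count_integral Z r" unfolding X_def by (rule log_sum_le_count_integral[OF Z K r])
    hence "enn2ereal (ennreal X) \<le> enn2ereal (count_integral Z r)" by (simp add: less_eq_ennreal.rep_eq)
    hence "ereal X \<le> enn2ereal (count_integral Z r)" using X by simp
    hence "ereal X + ereal (real m * ln r) \<le> ereal (\<sigma> * r powr \<rho> + C)" using N'[OF r] by (meson add_right_mono order_trans)
    thus ?thesis by (simp add: X_def)
  qed
  define \<beta> where "\<beta> = max 1 (2 * \<rho>)"
  have \<beta>: "\<beta> \<ge> 1" "\<rho> < \<beta>" using \<rho> by (auto simp: \<beta>_def)
  define P where "P = paley \<rho> * \<sigma>"
  have P: "P > 0" using paley_pos[OF \<rho>] \<sigma> by (simp add: P_def)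
  have U: "kernel_sum \<beta> K n log_mod r \<le> P * r powr \<rho> + \<beta> * (\<sigma> + C)" if K: "finite K" and r: "r \<ge> 0" for K r
  proof (cases "r = 0")
    case True
    thus ?thesis using \<beta> \<sigma> C by (simp add: kernel_sum_def)
  next
    case False
    hence r0: "r > 0" using r by simp
    \<comment> \<open>The origin is always included. Its hinge is \<open>max 0 y\<close>, because
      \<open>log_mod 0 = 0\<close>, and this agrees with the term \<open>ln r\<close> of the
      counting function for radii at least 1.\<close>
    define K' where "K' = insert 0 (K - {0})"
    have fin: "finite K'" using K by (simp add: K'_def)
    have nonneg: "(\<Sum>a\<in>K'. real (n a) * max 0 (y - log_mod a)) \<le> \<sigma> * exp (\<rho> * y) + C" if y: "y \<ge> 0" for y
    proof -
      have "(\<Sum>a\<in>K - {0}. real (n a) * max 0 (ln (exp y) - ln (norm a))) + real m * ln (exp y) \<le> \<sigma> * exp y powr \<rho> + C"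
        by (rule key) (use K in auto)
      moreover have "(\<Sum>a\<in>K'. real (n a) * max 0 (y - log_mod a)) = real m * y + (\<Sum>a\<in>K - {0}. real (n a) * max 0 (y - log_mod a))"
        unfolding K'_def using K y by (subst sum.insert) (auto simp: n0 log_mod_def)
      ultimately show ?thesis by (simp add: log_mod_def powr_def mult.commute)
    qed
    \<comment> \<open>For radii below 1 the term \<open>real m * ln r\<close> is negative, so the
      counting bound no longer controls the hinges. Monotonicity reduces this range to y = 0 at the
      price of the additional constant \<open>\<sigma>\<close>.\<close>
    have hinge: "(\<Sum>a\<in>K'. real (n a) * max 0 (y - log_mod a)) \<le> \<sigma> * exp (\<rho> * y) + (\<sigma> + C)" for y
    proof (cases "y \<ge> 0")
      case True
      thus ?thesis using nonneg[OF True] \<sigma> by simp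
    next
      case False
      have "(\<Sum>a\<in>K'. real (n a) * max 0 (y - log_mod a)) \<le> (\<Sum>a\<in>K'. real (n a) * max 0 (0 - log_mod a))"
        using False by (intro sum_mono mult_left_mono) auto
      also have "\<dots> \<le> \<sigma> + C" using nonneg[of 0] by simp
      also have "\<dots> \<le> \<sigma> * exp (\<rho> * y) + (\<sigma> + C)" using \<sigma> by simp
      finally show ?thesis .
    qed
    have e: "exp (\<beta> * (ln r - log_mod a)) = (r / exp (log_mod a)) powr \<beta>" for a
      using r0 by (simp add: powr_def ln_div)
    have "kernel_sum \<beta> K n log_mod r \<le> kernel_sum \<beta> K' n log_mod r"
      unfolding kernel_sum_def by (rule sum_mono2[OF fin]) (auto simp: K'_def)
    also have "\<dots> \<le> pi * \<rho> / sin (pi * \<rho> / \<beta>) * \<sigma> * exp (\<rho> * ln r) + \<beta> * (\<sigma> + C)"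
      unfolding kernel_sum_def e[symmetric] by (rule hinge_sum_le[OF \<rho> \<beta>(2) fin hinge])
    also have "exp (\<rho> * ln r) = r powr \<rho>" using r0 by (simp add: powr_def)
    also have "pi * \<rho> / sin (pi * \<rho> / \<beta>) = paley \<rho>" unfolding \<beta>_def by (rule paley_eq[OF \<rho>, symmetric])
    finally show ?thesis by (simp add: P_def)
  qed
  have C': "\<beta> * (\<sigma> + C) \<ge> 0" using \<beta> \<sigma> C by simp
  obtain f B where f: "f holomorphic_on UNIV" "f \<noteq> (\<lambda>_. 0)" "B \<ge> 0"
    "\<And>a. \<exists>g. g holomorphic_on UNIV \<and> (\<forall>z. f z = (z - a) ^ n a * g z)"
    "\<And>z. norm (f z) \<le> B * exp (P * norm z powr \<rho>)"
    using entire_majorant[OF \<beta>(1) \<rho> P C' locfin U] by metis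
  \<comment> \<open>Scaling turns the bound with a constant factor into the exact one; the summand 1
    keeps the divisor positive.\<close>
  define F where "F = (\<lambda>z. f z / of_real (B + 1))"
  have B1: "complex_of_real (B + 1) \<noteq> 0" using f(3) by (simp only: of_real_eq_0_iff)
  have Fh: "F holomorphic_on UNIV" unfolding F_def by (intro holomorphic_intros f B1)
  have F0: "F \<noteq> (\<lambda>_. 0)"
  proof
    assume "F = (\<lambda>_. 0)"
    hence "F z = 0" for z by simp
    hence "f z = 0" for z using B1 unfolding F_def divide_eq_0_iff by blast
    thus False using f(2) by auto
  qed
  have "vanishes_on F Z" unfolding vanishes_on_def
  proof
    fix a
    obtain g where g: "g holomorphic_on UNIV" "\<forall>z. f z = (z - a) ^ n a * g z" using f(4) by blast
    show "Z a \<le> zero_mult F a" unfolding Z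
    proof (rule zero_mult_ge[OF Fh F0])
      show "(\<lambda>z. g z / of_real (B + 1)) holomorphic_on UNIV" by (intro holomorphic_intros g B1)
    qed (use g in \<open>simp add: F_def\<close>)
  qed
  moreover have "norm (F z) \<le> exp (paley \<rho> * \<sigma> * norm z powr \<rho>)" for z
  proof -
    have "norm (F z) = norm (f z) / (B + 1)" unfolding F_def norm_divide norm_of_real using f(3) by simp
    also have "\<dots> \<le> (B * exp (P * norm z powr \<rho>)) / (B + 1)" using f by (intro divide_right_mono) auto
    also have "\<dots> \<le> exp (P * norm z powr \<rho>)" using f(3) by (simp add: field_simps)
    finally show ?thesis by (simp add: P_def)
  qed
  ultimately show ?thesis using Fh F0 by blast
qed

theorem corollary2_existence:
  assumes \<sigma>: "\<sigma> > 0" and \<rho>: "\<rho> > 0" and Z0: "Z 0 < \<infinity>"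
    and S: "(SUP r\<in>{0..}. radial_integral_count Z r - ereal (\<sigma> * r powr \<rho>)) < \<infinity>"
  shows "\<exists>f. f holomorphic_on UNIV \<and> f \<noteq> (\<lambda>_. 0) \<and> vanishes_on f Z \<and>
             (\<forall>r\<ge>0. max_modulus r f \<le> exp (paley \<rho> * \<sigma> * r powr \<rho>))"
proof -
  obtain c where c: "(SUP r\<in>{0..}. radial_integral_count Z r - ereal (\<sigma> * r powr \<rho>)) \<le> ereal c"
    using S by (metis ereal_dense2 less_imp_le)
  have N: "radial_integral_count Z r \<le> ereal (\<sigma> * r powr \<rho> + max 0 c)" if "r > 0" for r
  proof -
    have "radial_integral_count Z r - ereal (\<sigma> * r powr \<rho>) \<le> ereal c"
      by (rule order_trans[OF SUP_upper c]) (use that in auto)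
    thus ?thesis by (cases "radial_integral_count Z r") auto
  qed
  obtain f where f: "f holomorphic_on UNIV" "f \<noteq> (\<lambda>_. 0)" "vanishes_on f Z" "\<And>z. norm (f z) \<le> exp (paley \<rho> * \<sigma> * norm z powr \<rho>)"
    using entire_of_bounded_count[OF \<sigma> \<rho> Z0 _ N] by auto
  have "max_modulus r f \<le> exp (paley \<rho> * \<sigma> * r powr \<rho>)" if r: "r \<ge> 0" for r
    unfolding max_modulus_def
  proof (rule cSUP_least)
    show "sphere (0::complex) r \<noteq> {}" using r by simp
    show "norm (f z) \<le> exp (paley \<rho> * \<sigma> * r powr \<rho>)" if "z \<in> sphere 0 r" for z
      using f(4)[of z] that by simp
  qed
  thus ?thesis using f by blast
qed

theorem corollary2_limsup:
  assumes \<sigma>: "\<sigma> > 0" and \<rho>: "\<rho> > 0" and Z0: "Z 0 < \<infinity>"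
    and S: "Limsup at_top (\<lambda>r. radial_integral_count Z r / ereal (r powr \<rho>)) < ereal \<sigma>"
  shows "\<exists>f. f holomorphic_on UNIV \<and> f \<noteq> (\<lambda>_. 0) \<and> vanishes_on f Z \<and>
             Limsup at_infinity (\<lambda>z. ext_ln (norm (f z)) / ereal (norm z powr \<rho>)) < ereal (paley \<rho> * \<sigma>)"
proof -
  obtain s1 where s1: "Limsup at_top (\<lambda>r. radial_integral_count Z r / ereal (r powr \<rho>)) < ereal s1" "ereal s1 < ereal \<sigma>"
    using ereal_dense2[OF S] by blast
  \<comment> \<open>Strictly below \<open>\<sigma>\<close>, to leave room for the strict inequality
    in the conclusion, and at least \<open>\<sigma> / 2\<close>, since \<open>s1\<close> need not be
    positive.\<close>
  define \<tau> where "\<tau> = max s1 (\<sigma> / 2)"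
  have \<tau>: "\<tau> > 0" "\<tau> < \<sigma>" "s1 \<le> \<tau>" using \<sigma> s1 by (auto simp: \<tau>_def)
  obtain m where m: "Z 0 = enat m" using Z0 by (cases "Z 0") auto
  have "eventually (\<lambda>r. radial_integral_count Z r / ereal (r powr \<rho>) < ereal s1) at_top"
    by (rule Limsup_lessD[OF s1(1)])
  then obtain R0 where R0: "\<And>r. r \<ge> R0 \<Longrightarrow> radial_integral_count Z r / ereal (r powr \<rho>) < ereal s1"
    by (auto simp: eventually_at_top_linorder)
  define R where "R = max R0 1"
  have big: "radial_integral_count Z r \<le> ereal (\<tau> * r powr \<rho>)" if r: "r \<ge> R" for r
  proof -
    have rp: "r powr \<rho> > 0" using r by (auto simp: R_def)
    have "radial_integral_count Z r / ereal (r powr \<rho>) < ereal s1" using r by (intro R0) (auto simp: R_def)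
    hence "radial_integral_count Z r < ereal (s1 * r powr \<rho>)"
      using rp by (cases "radial_integral_count Z r") (auto simp: field_simps)
    also have "\<dots> \<le> ereal (\<tau> * r powr \<rho>)" using \<tau> by (simp add: mult_right_mono)
    finally show ?thesis by simp
  qed
  have mono: "radial_integral_count Z r \<le> radial_integral_count Z R" if r: "r > 0" "r \<le> R" for r
  proof -
    have R0: "R > 0" by (simp add: R_def)
    have "count_integral Z r \<le> count_integral Z R" unfolding count_integral_def
      by (rule nn_integral_mono) (use r in \<open>auto simp: indicator_def\<close>)
    hence "enn2ereal (count_integral Z r) \<le> enn2ereal (count_integral Z R)" by (simp add: less_eq_ennreal.rep_eq)
    moreover have "ereal (real m * ln r) \<le> ereal (real m * ln R)" using r R0 by (simp add: mult_left_mono)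
    ultimately show ?thesis
      unfolding radial_integral_count_eq[where Z = Z, OF m r(1)] radial_integral_count_eq[where Z = Z, OF m R0] by (rule add_mono)
  qed
  \<comment> \<open>Radii below R are covered by monotonicity, so that the asymptotic bound becomes
    one for all positive radii.\<close>
  define C where "C = \<tau> * R powr \<rho>"
  have C: "C \<ge> 0" using \<tau> by (simp add: C_def)
  have N: "radial_integral_count Z r \<le> ereal (\<tau> * r powr \<rho> + C)" if r: "r > 0" for r
  proof (cases "r \<ge> R")
    case True
    have "radial_integral_count Z r \<le> ereal (\<tau> * r powr \<rho>)" by (rule big[OF True])
    also have "\<dots> \<le> ereal (\<tau> * r powr \<rho> + C)" using C by simp
    finally show ?thesis .
  next
    case False
    have "radial_integral_count Z r \<le> radial_integral_count Z R" using False r by (intro mono) auto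
    also have "\<dots> \<le> ereal C" using big[of R] by (simp add: C_def)
    also have "\<dots> \<le> ereal (\<tau> * r powr \<rho> + C)" using \<tau> by simp
    finally show ?thesis .
  qed
  obtain f where f: "f holomorphic_on UNIV" "f \<noteq> (\<lambda>_. 0)" "vanishes_on f Z" "\<And>z. norm (f z) \<le> exp (paley \<rho> * \<tau> * norm z powr \<rho>)"
    using entire_of_bounded_count[OF \<tau>(1) \<rho> Z0 C N] by auto
  have "Limsup at_infinity (\<lambda>z. ext_ln (norm (f z)) / ereal (norm z powr \<rho>)) \<le> ereal (paley \<rho> * \<tau>)"
  proof (rule Limsup_bounded)
    have "eventually (\<lambda>z::complex. norm z \<ge> 1) at_infinity" by (auto simp: eventually_at_infinity)
    thus "eventually (\<lambda>z. ext_ln (norm (f z)) / ereal (norm z powr \<rho>) \<le> ereal (paley \<rho> * \<tau>)) at_infinity"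
    proof eventually_elim
      case (elim z)
      hence zp: "norm z powr \<rho> > 0" by auto
      show ?case
      proof (cases "f z = 0")
        case True
        thus ?thesis using zp by (simp add: ext_ln_def)
      next
        case False
        hence "ln (norm (f z)) \<le> ln (exp (paley \<rho> * \<tau> * norm z powr \<rho>))" using f(4)[of z] by (subst ln_le_cancel_iff) auto
        hence "ln (norm (f z)) / norm z powr \<rho> \<le> paley \<rho> * \<tau>" using zp by (simp add: field_simps)
        thus ?thesis using False zp by (simp add: ext_ln_def)
      qed
    qed
  qed
  also have "\<dots> < ereal (paley \<rho> * \<sigma>)" using \<tau> paley_pos[OF \<rho>] by simp
  finally show ?thesis using f by blast
qed

subsection \<open>Sharpness\<close>

lemma divide_out_zeros:
  assumes "finite K" "open S" "h holomorphic_on S" "\<And>a. a \<in> K \<Longrightarrow> a \<in> S \<and> a \<noteq> 0 \<and> h a = 0"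
  obtains g where "g holomorphic_on S" "\<And>z. h z = (\<Prod>a\<in>K. 1 - z / a) * g z"
proof -
  have "\<exists>g. g holomorphic_on S \<and> (\<forall>z. h z = (\<Prod>a\<in>K. 1 - z / a) * g z)"
    using assms(1,4)
  proof (induction K)
    case empty
    thus ?case using assms(3) by auto
  next
    case (insert a K)
    then obtain g where g: "g holomorphic_on S" "\<And>z. h z = (\<Prod>a\<in>K. 1 - z / a) * g z" by blast
    have a: "a \<in> S" "a \<noteq> 0" "h a = 0" using insert.prems by auto
    have "(\<Prod>b\<in>K. 1 - a / b) \<noteq> 0" using insert by (auto simp: field_simps)
    hence ga: "g a = 0" using g(2)[of a] a by auto
    define q where "q = (\<lambda>z. if z = a then deriv g a else (g z - g a) / (z - a))"
    have q: "q holomorphic_on S" unfolding q_def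
      by (rule pole_lemma[OF g(1)]) (use a \<open>open S\<close> in \<open>simp add: interior_open\<close>)
    have "g z = (1 - z / a) * (- a * q z)" for z
      using a ga by (auto simp: q_def divide_simps) (simp add: algebra_simps)?
    hence "h z = (\<Prod>b\<in>insert a K. 1 - z / b) * (- a * q z)" for z
      using insert.hyps by (simp only: g(2)[of z] prod.insert) (simp add: mult_ac)
    moreover have "(\<lambda>z. - a * q z) holomorphic_on S" by (intro holomorphic_intros q)
    ultimately show ?case by blast
  qed
  thus ?thesis using that by blast
qed

lemma maximum_modulus_half_disc:
  fixes f :: "complex \<Rightarrow> complex"
  assumes hol: "f holomorphic_on {z. Re z > 0}" and cont: "continuous_on {z. Re z \<ge> 0} f"
    and axis: "\<And>z. Re z = 0 \<Longrightarrow> norm z \<le> R \<Longrightarrow> norm (f z) \<le> B"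
    and arc: "\<And>z. Re z \<ge> 0 \<Longrightarrow> norm z = R \<Longrightarrow> norm (f z) \<le> B"
    and w: "Re w \<ge> 0" "norm w \<le> R"
  shows "norm (f w) \<le> B"
proof -
  define S where "S = {z. Re z \<ge> 0} \<inter> cball 0 R"
  have cl: "closed S" unfolding S_def by (intro closed_Int closed_halfspace_Re_ge closed_cball)
  have int: "interior S \<subseteq> {z. Re z > 0}"
  proof -
    have "interior S \<subseteq> interior {z. Re z \<ge> 0}" unfolding S_def by (intro interior_mono) auto
    also have "interior {z. Re z \<ge> 0} = {z. Re z > 0}"
      using interior_halfspace_ge[of "1::complex" 0] by (simp add: inner_complex_def)
    finally show ?thesis .
  qed
  have int2: "{z. Re z > 0} \<inter> ball 0 R \<subseteq> interior S"
    by (rule interior_maximal) (auto simp: S_def intro!: open_Int open_halfspace_Re_gt)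
  show ?thesis
  proof (rule maximum_modulus_frontier[of f S])
    show "f holomorphic_on interior S" using hol int by (rule holomorphic_on_subset)
    show "continuous_on (closure S) f" using cl by (auto intro: continuous_on_subset[OF cont] simp: S_def)
    show "bounded S" unfolding S_def by (rule bounded_subset[OF bounded_cball[of 0 R]]) auto
    show "w \<in> S" using w by (simp add: S_def)
    fix z assume "z \<in> frontier S"
    hence "z \<in> S" "z \<notin> interior S" using cl by (auto simp: frontier_def)
    hence "Re z \<ge> 0" "norm z \<le> R" "\<not> (Re z > 0 \<and> norm z < R)" using int2 by (auto simp: S_def)
    hence "Re z \<ge> 0" "norm z \<le> R" "Re z = 0 \<or> norm z = R" by linarith+
    thus "norm (f z) \<le> B" using axis arc by blast
  qed
qed

lemma mult_cos_le_sin: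
  assumes "0 \<le> t" "t \<le> pi / 2"
  shows "t * cos t \<le> sin t"
proof -
  have "sin 0 - 0 * cos 0 \<le> sin t - t * cos t"
  proof (rule DERIV_nonneg_imp_nondecreasing[OF assms(1)])
    fix x assume x: "0 \<le> x" "x \<le> t"
    have "((\<lambda>t. sin t - t * cos t) has_real_derivative x * sin x) (at x)"
      by (auto intro!: derivative_eq_intros simp: algebra_simps)
    moreover have "x * sin x \<ge> 0" using x assms by (intro mult_nonneg_nonneg sin_ge_zero) auto
    ultimately show "\<exists>y. ((\<lambda>t. sin t - t * cos t) has_real_derivative y) (at x) \<and> 0 \<le> y" by blast
  qed
  thus ?thesis by simp
qed

text \<open>On the imaginary axis \<open>Re (z * Ln z)\<close> is \<open>- pi / 2 * norm z\<close>; the shift by \<open>1\<close> avoids the singularity at \<open>0\<close>.\<close>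

lemma Re_mult_Ln_le:
  assumes a: "Re z \<ge> 0"
  shows "norm z + (2 / pi) * Re (z * Ln (1 + z)) \<le> 1 + 2 * Re z + (2 / pi) * Re z * ln (1 + norm z)"
proof -
  define \<phi> where "\<phi> = Im (Ln (1 + z))"
  define u where "u = norm (1 + z)"
  have pos: "Re (1 + z) > 0" using a by simp
  have n0: "1 + z \<noteq> 0" using pos by (metis less_irrefl zero_complex.simps(1))
  have u: "u > 0" using n0 by (simp add: u_def)
  have \<phi>: "\<bar>\<phi>\<bar> < pi / 2" unfolding \<phi>_def by (rule Re_Ln_pos_lt_imp[OF pos])
  have reln: "Re (Ln (1 + z)) = ln u" using n0 by (simp add: u_def)
  have ex: "exp (Re (Ln (1 + z))) = u" using reln u by simp
  have "Re (exp (Ln (1 + z))) = u * cos \<phi>" "Im (exp (Ln (1 + z))) = u * sin \<phi>"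
    by (simp_all only: Re_exp Im_exp ex \<phi>_def)
  hence re: "1 + Re z = u * cos \<phi>" and im: "Im z = u * sin \<phi>" using n0 by simp_all
  \<comment> \<open>The angle between \<open>1 + z\<close> and the nearer half of the imaginary
    axis. The inequality \<open>\<psi> * cos \<psi> \<le> sin \<psi>\<close> bounds what is lost by
    treating \<open>\<bar>\<phi>\<bar>\<close> as pi / 2.\<close>
  define \<psi> where "\<psi> = pi / 2 - \<bar>\<phi>\<bar>"
  have sc: "cos \<phi> = sin \<psi>" "sin \<bar>\<phi>\<bar> = cos \<psi>" by (simp_all add: \<psi>_def sin_diff cos_diff)
  have prod: "Im z * \<phi> = \<bar>Im z\<bar> * \<bar>\<phi>\<bar>"
  proof -
    have "sin \<bar>\<phi>\<bar> \<ge> 0" using \<phi> by (intro sin_ge_zero) auto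
    hence "Im z * \<phi> \<ge> 0" unfolding im using u by (cases "\<phi> \<ge> 0") (auto simp: mult_nonpos_nonneg mult_nonneg_nonpos mult_le_0_iff zero_le_mult_iff)
    thus ?thesis by (metis abs_mult abs_of_nonneg)
  qed
  have "\<bar>Im z\<bar> = u * cos \<psi>"
  proof -
    have "\<bar>sin \<phi>\<bar> = sin \<bar>\<phi>\<bar>" using sin_ge_zero[of "\<bar>\<phi>\<bar>"] \<phi> by (cases "\<phi> \<ge> 0") auto
    thus ?thesis unfolding im using u sc by (simp add: abs_mult)
  qed
  hence "\<bar>Im z\<bar> * \<psi> = u * (\<psi> * cos \<psi>)" by simp
  also have "\<dots> \<le> u * sin \<psi>" using u \<phi> by (intro mult_left_mono mult_cos_le_sin) (auto simp: \<psi>_def)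
  also have "\<dots> = 1 + Re z" using re sc by simp
  finally have key: "\<bar>Im z\<bar> * (pi / 2 - \<bar>\<phi>\<bar>) \<le> 1 + Re z" unfolding \<psi>_def .
  have "(2 / pi) * (\<bar>Im z\<bar> * (pi / 2 - \<bar>\<phi>\<bar>)) \<le> 1 * (1 + Re z)"
    using key a pi_ge_two u \<phi> by (intro mult_mono) auto
  hence k2: "\<bar>Im z\<bar> - (2 / pi) * (Im z * \<phi>) \<le> 1 + Re z" unfolding prod by (simp add: field_simps)
  have "u \<le> 1 + norm z" unfolding u_def using norm_triangle_ineq[of 1 z] by simp
  hence "ln u \<le> ln (1 + norm z)" using u by simp
  hence k3: "(2 / pi) * (Re z * ln u) \<le> (2 / pi) * (Re z * ln (1 + norm z))" using a by (intro mult_left_mono) auto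
  have "norm z \<le> Re z + \<bar>Im z\<bar>" using cmod_le[of z] a by simp
  moreover have eq: "Re (z * Ln (1 + z)) = Re z * ln u - Im z * \<phi>" by (simp only: times_complex.sel reln \<phi>_def)
  ultimately show ?thesis unfolding eq using k2 k3 by (simp add: algebra_simps)
qed

text \<open>The inverse of a Blaschke factor has modulus 1 on the imaginary axis. On the arc of
  radius 2 N the point n is at distance at least N, and since the squares of the two moduli differ
  by \<open>4 * Re z * n\<close>, the quotient is close to 1. The exponents are such that their sum
  over n up to N is at most \<open>2 * Re z\<close>.\<close>

lemma norm_reflection_quotient_le:
  fixes z :: complex and N n :: nat
  assumes a: "Re z \<ge> 0" and n: "1 \<le> n" "n \<le> N" and z: "Re z = 0 \<or> norm z = 2 * real N" and zn: "z \<noteq> of_nat n"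
  shows "norm (of_nat n + z) \<le> norm (of_nat n - z) * exp (2 * Re z * n / N\<^sup>2)"
proof (cases "Re z = 0")
  case True
  hence "norm (of_nat n + z) = norm (of_nat n - z)" by (simp add: cmod_def)
  thus ?thesis using True by simp
next
  case False
  hence nz: "norm z = 2 * real N" using z by simp
  have N: "real N > 0" using n by simp
  have "norm z - norm (of_nat n :: complex) \<le> norm (z - of_nat n)" by (rule norm_triangle_ineq2)
  hence d: "real N \<le> norm (of_nat n - z)" using nz n by (simp add: norm_minus_commute)
  have "(norm (of_nat n + z))\<^sup>2 = (norm (of_nat n - z))\<^sup>2 + 4 * Re z * n"
    unfolding cmod_power2 by (simp add: power2_eq_square algebra_simps)
  also have "\<dots> \<le> (norm (of_nat n - z))\<^sup>2 + (norm (of_nat n - z))\<^sup>2 * (4 * Re z * n / N\<^sup>2)"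
  proof -
    have "(real N)\<^sup>2 \<le> (norm (of_nat n - z))\<^sup>2" using d by (intro power_mono) auto
    hence "(real N)\<^sup>2 * (4 * Re z * n / N\<^sup>2) \<le> (norm (of_nat n - z))\<^sup>2 * (4 * Re z * n / N\<^sup>2)"
      using a by (intro mult_right_mono) auto
    thus ?thesis using N by simp
  qed
  also have "\<dots> = (norm (of_nat n - z))\<^sup>2 * (1 + 4 * Re z * n / N\<^sup>2)" by (simp add: algebra_simps)
  also have "\<dots> \<le> (norm (of_nat n - z))\<^sup>2 * exp (4 * Re z * n / N\<^sup>2)"
    by (intro mult_left_mono exp_ge_add_one_self) auto
  also have "\<dots> = (norm (of_nat n - z) * exp (2 * Re z * n / N\<^sup>2))\<^sup>2"
    by (simp add: power_mult_distrib flip: exp_double)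
  finally show ?thesis by (rule power2_le_imp_le) auto
qed

text \<open>As x is below 1, the sum dominates the harmonic sum without its first term.\<close>

lemma ln_le_sum_inverse_shifted:
  assumes x: "0 < x" "x < (1::real)"
  shows "ln (real N + 1) - 1 \<le> (\<Sum>n=1..N. 1 / (real n + x))"
proof -
  have "ln (real N + 1) \<le> ln (real (Suc N) + 1)" by simp
  also have "\<dots> \<le> harm (Suc N)" by (rule ln_le_harm)
  also have "\<dots> = 1 + (\<Sum>n=1..N. 1 / (real n + 1))"
    unfolding harm_def by (subst sum.atLeast_Suc_atMost) (simp_all add: sum.atLeast_Suc_atMost_Suc_shift inverse_eq_divide add_ac del: sum.cl_ivl_Suc)
  also have "(\<Sum>n=1..N. 1 / (real n + 1)) \<le> (\<Sum>n=1..N. 1 / (real n + x))"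
    using x by (intro sum_mono divide_left_mono) auto
  finally show ?thesis by simp
qed

lemma sum_nat_div_square_le: "(\<Sum>n=1..N. c * real n / (real N)\<^sup>2) \<le> c" if "N \<ge> 1" "c \<ge> 0" for c :: real
proof -
  have "(\<Sum>n=1..N. c * real n / (real N)\<^sup>2) \<le> (\<Sum>n=1..N. c * real N / (real N)\<^sup>2)"
    using that by (intro sum_mono divide_right_mono mult_left_mono) auto
  also have "\<dots> = c" using that by (simp add: power2_eq_square)
  finally show ?thesis .
qed

text \<open>With \<open>c = 2 * \<tau> / pi\<close> the function
  \<open>exp (c * z * Ln (1 + z))\<close> cancels the growth of \<open>F\<close> on the imaginary
  axis up to a constant, and a linear term with coefficient of size \<open>c * ln N\<close> does so
  on the arc of radius 2 N. At x the linear term costs N to the power c x, while the Blaschke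
  factors gain N to the power 2 x. The condition \<open>\<tau> < pi\<close> says that c is below
  2.\<close>

theorem half_plane_uniqueness:
  fixes F :: "complex \<Rightarrow> complex"
  assumes \<tau>: "0 \<le> \<tau>" "\<tau> < pi"
    and hol: "F holomorphic_on {z. Re z > 0}" and cont: "continuous_on {z. Re z \<ge> 0} F"
    and bound: "\<And>z. Re z \<ge> 0 \<Longrightarrow> norm (F z) \<le> exp (\<tau> * norm z)"
    and zeros: "\<And>n::nat. n \<ge> 1 \<Longrightarrow> F (of_nat n) = 0"
    and x: "0 < x" "x < (1::real)"
  shows "F (of_real x) = 0"
proof -
  define c where "c = 2 * \<tau> / pi"
  have c: "0 \<le> c" "c < 2" using \<tau> by (auto simp: c_def field_simps)
  define D where "D = \<tau> + x * (c * ln 2 + 2 * \<tau> + 4)"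
  have main: "norm (F (of_real x)) \<le> exp (D - x * (2 - c) * ln (real N + 1))" if N: "N \<ge> 1" for N :: nat
  proof -
    define K where "K = (of_nat :: nat \<Rightarrow> complex) ` {1..N}"
    have injK: "inj_on (of_nat :: nat \<Rightarrow> complex) {1..N}" by (auto simp: inj_on_def)
    obtain g where g: "g holomorphic_on {z. Re z > 0}" "\<And>z. F z = (\<Prod>a\<in>K. 1 - z / a) * g z"
    proof (rule divide_out_zeros[of K "{z. Re z > 0}" F])
      show "open {z. Re z > 0}" by (rule open_halfspace_Re_gt)
    qed (use hol zeros in \<open>auto simp: K_def\<close>)
    have PK: "(\<Prod>a\<in>K. 1 - z / a) = (\<Prod>n=1..N. 1 - z / of_nat n)" for z
      unfolding K_def by (subst prod.reindex[OF injK]) simp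
    \<comment> \<open>The first two terms offset the error terms of \<open>Re_mult_Ln_le\<close> up
      to modulus 2 N, and the last one offsets the loss \<open>exp (2 * Re z)\<close> of the
      Blaschke factors.\<close>
    define A where "A = c * ln (1 + 2 * real N) + 2 * \<tau> + 2"
    define W where "W = (\<lambda>z. g z * (\<Prod>n=1..N. 1 + z / of_nat n) * exp (of_real c * z * Ln (1 + z) - of_real A * z))"
    have nz: "1 + z \<notin> \<real>\<^sub>\<le>\<^sub>0" if "Re z \<ge> 0" for z using that by (auto simp: complex_nonpos_Reals_iff)
    have Wh: "W holomorphic_on {z. Re z > 0}" unfolding W_def
      by (intro holomorphic_intros g) (use nz in auto)
    \<comment> \<open>The zeros were divided out in the open half-plane only. On the imaginary axis
      the product does not vanish, so \<open>g\<close> inherits continuity from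
      \<open>F\<close>.\<close>
    have gc: "continuous_on {z. Re z \<ge> 0} g"
      unfolding continuous_on_eq_continuous_within
    proof
      fix z :: complex assume "z \<in> {z. Re z \<ge> 0}"
      show "continuous (at z within {z. Re z \<ge> 0}) g"
      proof (cases "Re z > 0")
        case True
        have "isCont g z" using holomorphic_on_imp_continuous_on[OF g(1)] True
          by (subst (asm) continuous_on_eq_continuous_at) (auto intro: open_halfspace_Re_gt)
        thus ?thesis by (rule continuous_at_imp_continuous_at_within)
      next
        case False
        hence z: "Re z = 0" "z \<in> {z. Re z \<ge> 0}" using \<open>z \<in> _\<close> by auto
        have zK: "z \<in> - K" using z by (auto simp: K_def)
        have opK: "open (- K)" unfolding K_def by (intro open_Compl finite_imp_closed) auto
        have P0: "(\<Prod>a\<in>K. 1 - w / a) \<noteq> 0" if "w \<notin> K" for w using that by (auto simp: K_def divide_eq_1_iff)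
        have "continuous (at z within {z. Re z \<ge> 0}) (\<lambda>w. F w / (\<Prod>a\<in>K. 1 - w / a))"
          using cont z zK P0 by (intro continuous_intros) (auto simp: continuous_on_eq_continuous_within K_def)
        moreover have "eventually (\<lambda>w. F w / (\<Prod>a\<in>K. 1 - w / a) = g w) (at z within {z. Re z \<ge> 0})"
          using eventually_at_in_open[OF opK zK] unfolding eventually_at_filter
          by eventually_elim (use g(2) P0 in auto)
        ultimately have "(g \<longlongrightarrow> F z / (\<Prod>a\<in>K. 1 - z / a)) (at z within {z. Re z \<ge> 0})"
          unfolding continuous_within by (rule Lim_transform_eventually)
        moreover have "F z / (\<Prod>a\<in>K. 1 - z / a) = g z" using g(2)[of z] P0[of z] zK by auto
        ultimately show ?thesis unfolding continuous_within by (simp only:)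
      qed
    qed
    have Wc: "continuous_on {z. Re z \<ge> 0} W" unfolding W_def
      by (intro continuous_intros gc) (use nz in auto)
    have WF: "norm (W z) \<le> exp \<tau>" if z: "Re z \<ge> 0" "Re z = 0 \<or> norm z = 2 * real N" "norm z \<le> 2 * real N" for z
    proof -
      have zn: "z \<noteq> of_nat n" if "n \<in> {1..N}" for n using that z N by auto
      have "norm (\<Prod>n=1..N. 1 + z / of_nat n) = (\<Prod>n=1..N. norm (1 + z / of_nat n))" by (simp add: prod_norm)
      also have "\<dots> \<le> (\<Prod>n=1..N. norm (1 - z / of_nat n) * exp (2 * Re z * n / N\<^sup>2))"
      proof (rule prod_mono, safe)
        fix n assume n: "n \<in> {1..N}"
        hence n0: "real n > 0" by simp
        have "norm (1 + z / of_nat n) = norm (of_nat n + z) / n"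
        proof -
          have "1 + z / of_nat n = (of_nat n + z) / of_nat n" using n0 by (simp add: field_simps)
          thus ?thesis by (simp only: norm_divide norm_of_nat)
        qed
        also have "\<dots> \<le> norm (of_nat n - z) * exp (2 * Re z * n / N\<^sup>2) / n"
          using n z zn[OF n] n0 by (intro divide_right_mono norm_reflection_quotient_le) auto
        also have "\<dots> = norm (1 - z / of_nat n) * exp (2 * Re z * n / N\<^sup>2)"
        proof -
          have "1 - z / of_nat n = (of_nat n - z) / of_nat n" using n0 by (simp add: field_simps)
          thus ?thesis by (simp only: norm_divide norm_of_nat) simp
        qed
        finally show "norm (1 + z / of_nat n) \<le> norm (1 - z / of_nat n) * exp (2 * Re z * n / N\<^sup>2)" .
      qed auto
      also have "\<dots> = norm (\<Prod>n=1..N. 1 - z / of_nat n) * exp (\<Sum>n=1..N. 2 * Re z * n / N\<^sup>2)"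
        by (simp add: prod.distrib prod_norm exp_sum)
      also have "\<dots> \<le> norm (\<Prod>n=1..N. 1 - z / of_nat n) * exp (2 * Re z)"
        using sum_nat_div_square_le[OF N, of "2 * Re z"] z by (intro mult_left_mono) auto
      finally have P: "norm (\<Prod>n=1..N. 1 + z / of_nat n) \<le> norm (\<Prod>n=1..N. 1 - z / of_nat n) * exp (2 * Re z)" .
      define E where "E = exp (Re (of_real c * z * Ln (1 + z) - of_real A * z))"
      have "norm (W z) = norm (g z) * norm (\<Prod>n=1..N. 1 + z / of_nat n) * E"
        by (simp only: W_def norm_mult norm_exp_eq_Re E_def)
      also have "\<dots> \<le> norm (g z) * (norm (\<Prod>n=1..N. 1 - z / of_nat n) * exp (2 * Re z)) * E"
        by (intro mult_right_mono mult_left_mono P) (auto simp: E_def)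
      also have "\<dots> = norm (F z) * (exp (2 * Re z) * E)" by (simp add: g(2)[of z] PK norm_mult)
      also have "\<dots> \<le> exp (\<tau> * norm z) * (exp (2 * Re z) * E)"
        by (intro mult_right_mono bound z) (auto simp: E_def)
      also have "\<dots> = exp (\<tau> * norm z + c * Re (z * Ln (1 + z)) + (2 - A) * Re z)"
        by (simp add: E_def exp_add[symmetric] algebra_simps)
      also have "\<dots> \<le> exp \<tau>"
      proof -
        have "\<tau> * (norm z + (2 / pi) * Re (z * Ln (1 + z))) \<le> \<tau> * (1 + 2 * Re z + (2 / pi) * Re z * ln (1 + norm z))"
          by (intro mult_left_mono Re_mult_Ln_le z \<tau>)
        hence "\<tau> * norm z + c * Re (z * Ln (1 + z)) \<le> \<tau> + 2 * \<tau> * Re z + c * Re z * ln (1 + norm z)"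
          by (simp add: c_def algebra_simps)
        also have "\<dots> \<le> \<tau> + 2 * \<tau> * Re z + c * Re z * ln (1 + 2 * real N)"
        proof -
          have "ln (1 + norm z) \<le> ln (1 + 2 * real N)" using z by (subst ln_le_cancel_iff) (auto simp: add_pos_nonneg)
          thus ?thesis using c z by (intro add_left_mono mult_left_mono) auto
        qed
        also have "\<dots> = \<tau> + (A - 2) * Re z" by (simp add: A_def algebra_simps)
        finally show ?thesis by (simp add: algebra_simps)
      qed
      finally show ?thesis .
    qed
    have Wx: "norm (W (of_real x)) \<le> exp \<tau>"
    proof (rule maximum_modulus_half_disc[OF Wh Wc])
      show "norm (complex_of_real x) \<le> 2 * real N" using x N by simp
    qed (use WF x in auto)
    define L where "L = (\<lambda>n::nat. 1 + x / real n)"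
    have PL: "(\<Prod>n=1..N. L n) > 0" using x by (intro prod_pos) (auto simp: L_def add_pos_nonneg)
    \<comment> \<open>The Blaschke factor at x is 1 - 2 x / (n + x); bounding it by an exponential
      makes the product over n an exponential of a shifted harmonic sum.\<close>
    have "\<bar>1 - x / real n\<bar> \<le> L n * exp (- 2 * x / (real n + x))" if n: "n \<in> {1..N}" for n
    proof -
      have n1: "real n \<ge> 1" using n by simp
      have "L n = (real n + x) / real n" "1 + - 2 * x / (real n + x) = (real n - x) / (real n + x)"
        using n1 x by (simp_all add: L_def field_simps)
      hence "L n * (1 + - 2 * x / (real n + x)) = (real n - x) / real n" using n1 x by simp
      also have "\<dots> = \<bar>1 - x / real n\<bar>" using n1 x by (simp add: field_simps)
      finally have "\<bar>1 - x / real n\<bar> = L n * (1 + - 2 * x / (real n + x))" by simp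
      also have "\<dots> \<le> L n * exp (- 2 * x / (real n + x))"
        by (intro mult_left_mono exp_ge_add_one_self) (use x in \<open>simp add: L_def\<close>)
      finally show ?thesis .
    qed
    hence "(\<Prod>n=1..N. \<bar>1 - x / real n\<bar>) \<le> (\<Prod>n=1..N. L n * exp (- 2 * x / (real n + x)))"
      by (intro prod_mono) auto
    also have "\<dots> = (\<Prod>n=1..N. L n) * exp (- 2 * x * (\<Sum>n=1..N. 1 / (real n + x)))"
      by (simp add: prod.distrib exp_sum[symmetric] sum_distrib_left)
    also have "\<dots> \<le> (\<Prod>n=1..N. L n) * exp (- 2 * x * (ln (real N + 1) - 1))"
      using PL x ln_le_sum_inverse_shifted[OF x, of N] by (intro mult_left_mono) (auto simp: mult_left_mono)
    finally have PX: "(\<Prod>n=1..N. \<bar>1 - x / real n\<bar>) \<le> (\<Prod>n=1..N. L n) * exp (- 2 * x * (ln (real N + 1) - 1))" .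
    have lnx: "Ln (1 + complex_of_real x) = of_real (ln (1 + x))"
      using x Ln_of_real[of "1 + x"] by simp
    have "norm (W (of_real x)) = norm (g (of_real x)) * (\<Prod>n=1..N. L n) * exp (c * x * ln (1 + x) - A * x)"
    proof -
      have "norm (\<Prod>n=1..N. 1 + complex_of_real x / of_nat n) = (\<Prod>n=1..N. L n)"
      proof -
        have "(\<Prod>n=1..N. 1 + complex_of_real x / of_nat n) = of_real (\<Prod>n=1..N. L n)" by (simp add: L_def)
        thus ?thesis using PL by (simp only: norm_of_real)
      qed
      thus ?thesis by (simp add: W_def norm_mult lnx)
    qed
    hence gx: "norm (g (of_real x)) * (\<Prod>n=1..N. L n) * exp (c * x * ln (1 + x) - A * x) \<le> exp \<tau>" using Wx by simp
    have "exp (- (A * x)) \<le> exp (c * x * ln (1 + x) - A * x)" using c x by simp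
    hence "norm (g (of_real x)) * (\<Prod>n=1..N. L n) * exp (- (A * x)) \<le> exp \<tau>"
      using PL by (intro order_trans[OF _ gx] mult_left_mono) auto
    hence gx2: "norm (g (of_real x)) * (\<Prod>n=1..N. L n) \<le> exp (\<tau> + A * x)"
      by (simp add: exp_add exp_minus field_simps)
    have "norm (F (of_real x)) = norm (g (of_real x)) * (\<Prod>n=1..N. \<bar>1 - x / real n\<bar>)"
    proof -
      have "(\<Prod>n=1..N. 1 - complex_of_real x / of_nat n) = of_real (\<Prod>n=1..N. 1 - x / real n)" by simp
      hence "norm (\<Prod>n=1..N. 1 - complex_of_real x / of_nat n) = (\<Prod>n=1..N. \<bar>1 - x / real n\<bar>)"
        by (simp only: norm_of_real abs_prod)
      thus ?thesis by (simp add: g(2) PK norm_mult)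
    qed
    also have "\<dots> \<le> norm (g (of_real x)) * ((\<Prod>n=1..N. L n) * exp (- 2 * x * (ln (real N + 1) - 1)))"
      by (intro mult_left_mono PX) auto
    also have "\<dots> = norm (g (of_real x)) * (\<Prod>n=1..N. L n) * exp (- 2 * x * (ln (real N + 1) - 1))" by simp
    also have "\<dots> \<le> exp (\<tau> + A * x) * exp (- 2 * x * (ln (real N + 1) - 1))"
      by (intro mult_right_mono gx2) auto
    also have "\<dots> \<le> exp (D - x * (2 - c) * ln (real N + 1))"
    proof -
      have "ln (1 + 2 * real N) \<le> ln (2 * (real N + 1))" by simp
      also have "\<dots> = ln 2 + ln (real N + 1)" by (rule ln_mult_pos) auto
      finally have "x * (c * ln (1 + 2 * real N)) \<le> x * (c * (ln 2 + ln (real N + 1)))"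
        using c x by (intro mult_left_mono) auto
      thus ?thesis unfolding exp_add[symmetric] by (simp add: A_def D_def algebra_simps)
    qed
    finally show ?thesis .
  qed
  have "(\<lambda>N. exp (D - x * (2 - c) * ln (real N + 1))) \<longlonglongrightarrow> 0"
  proof -
    have "x * (2 - c) > 0" using x c by simp
    thus ?thesis by real_asymp
  qed
  moreover have "eventually (\<lambda>N. norm (F (of_real x)) \<le> exp (D - x * (2 - c) * ln (real N + 1))) sequentially"
    using main by (auto simp: eventually_sequentially)
  ultimately have "norm (F (of_real x)) \<le> 0" by (intro tendsto_lowerbound) auto
  thus ?thesis by simp
qed

text \<open>The substitution turns order \<open>\<rho>\<close> into order 1 and the zeros into the
  positive integers. Vanishing on the interval from 0 to 1 carries over to \<open>f\<close>, and the
  identity theorem finishes.\<close>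

theorem uniqueness_half_plane_powr:
  fixes f :: "complex \<Rightarrow> complex"
  assumes \<tau>: "0 \<le> \<tau>" "\<tau> < pi" and \<rho>: "\<rho> \<ge> 1 / 2" and f: "f holomorphic_on UNIV"
    and bound: "\<And>z. norm (f z) \<le> exp (\<tau> * norm z powr \<rho>)"
    and zeros: "\<And>n::nat. n \<ge> 1 \<Longrightarrow> f (of_real (real n powr (1 / \<rho>))) = 0"
  shows "f z = 0"
proof -
  define F where "F = (\<lambda>z. f (z powr of_real (1 / \<rho>)))"
  have \<rho>0: "\<rho> > 0" using \<rho> by simp
  have cf: "continuous_on UNIV f" by (rule holomorphic_on_imp_continuous_on[OF f])
  have z0: "F (of_real x) = 0" if x: "0 < x" "x < 1" for x
  proof (rule half_plane_uniqueness[OF \<tau> _ _ _ _ x])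
    have "(f \<circ> (\<lambda>z. z powr of_real (1 / \<rho>))) holomorphic_on {z. Re z > 0}"
      by (rule holomorphic_on_compose_gen[OF _ f]) (auto intro!: holomorphic_intros simp: complex_nonpos_Reals_iff)
    thus "F holomorphic_on {z. Re z > 0}" by (simp add: F_def o_def)
    show "continuous_on {z. Re z \<ge> 0} F" unfolding F_def
      by (rule continuous_on_compose2[OF cf]) (use \<rho>0 in \<open>auto intro!: continuous_intros\<close>)
    show "norm (F z) \<le> exp (\<tau> * norm z)" for z
    proof -
      have "norm (z powr of_real (1 / \<rho>)) powr \<rho> = norm z"
        using \<rho>0 by (simp add: norm_powr_real_powr' powr_powr)
      thus ?thesis using bound[of "z powr of_real (1 / \<rho>)"] by (simp add: F_def)
    qed
    show "F (of_nat n) = 0" if "n \<ge> 1" for n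
      using zeros[OF that] powr_of_real[of "real n" "1 / \<rho>"] by (simp add: F_def)
  qed
  have fz: "f (of_real y) = 0" if y: "0 < y" "y < 1" for y :: real
  proof -
    have "y powr \<rho> < 1" using y \<rho>0 powr_less_mono2[of \<rho> y 1] by simp
    moreover have "complex_of_real (y powr \<rho>) powr of_real (1 / \<rho>) = of_real y"
      using y \<rho>0 by (subst powr_of_real) (auto simp: powr_powr)
    ultimately show ?thesis using z0[of "y powr \<rho>"] y by (simp add: F_def)
  qed
  show ?thesis
  proof (rule analytic_continuation[OF f open_UNIV connected_UNIV, of "of_real ` {0<..<1}" 0])
    have "(0::complex) \<in> closure (of_real ` {0<..<1} - {0})"
      unfolding closure_approachable
    proof safe
      fix e :: real assume "e > 0"
      thus "\<exists>y\<in>complex_of_real ` {0<..<1} - {0}. dist y 0 < e"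
        by (intro bexI[of _ "of_real (min (1/2) (e / 2))"]) (auto simp: min_def)
    qed
    thus "(0::complex) islimpt of_real ` {0<..<1}" by (simp add: islimpt_in_closure)
  qed (use fz in auto)
qed

section \<open>Uniqueness for orders below 1/2\<close>

lemma sum_ln_le:
  assumes "m \<ge> 1"
  shows "(\<Sum>n=1..m. ln (real n)) \<le> (real m + 1) * ln (real m) - real m + 1"
  using assms
proof (induction m rule: nat_induct_at_least)
  case base
  thus ?case by simp
next
  case (Suc m)
  hence m: "real m > 0" by simp
  have "ln (real m) - ln (real m + 1) \<le> (real m - (real m + 1)) / (real m + 1)"
    using m by (intro ln_diff_le) auto
  hence "(real m + 1) * (ln (real m) - ln (real m + 1)) \<le> (real m + 1) * ((real m - (real m + 1)) / (real m + 1))"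
    using m by (intro mult_left_mono) auto
  also have "\<dots> = -1" using m by simp
  finally have "(real m + 1) * (ln (real m) - ln (real m + 1)) \<le> -1" .
  thus ?case using Suc.IH by (simp add: algebra_simps)
qed

text \<open>The hinges sum to the integral counting function of the points n powr (1 / \<rho>) at
  radius exp y. With m the integer part of \<open>exp (\<rho> * y)\<close> it is a difference of m
  \<rho> y and ln (m!), divided by \<open>\<rho>\<close>, and the Stirling bound
  \<open>sum_ln_le\<close> leaves an error linear in y. The condition on \<open>N\<close> says that
  these m points are among the first N.\<close>

lemma hinge_sum_ge:
  assumes \<rho>: "\<rho> > 0" and N: "exp (\<rho> * y) \<le> real N"
  shows "(exp (\<rho> * y) - 1) / \<rho> - max 0 y \<le> (\<Sum>n=1..N. max 0 (y - ln (real n) / \<rho>))"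
proof (cases "y < 0")
  case True
  hence "exp (\<rho> * y) \<le> 1" using \<rho> by (simp add: mult_le_0_iff)
  hence "(exp (\<rho> * y) - 1) / \<rho> - max 0 y \<le> 0" using \<rho> True by (simp add: divide_nonpos_pos)
  also have "0 \<le> (\<Sum>n=1..N. max 0 (y - ln (real n) / \<rho>))" by (intro sum_nonneg) auto
  finally show ?thesis .
next
  case False
  define E where "E = exp (\<rho> * y)"
  have E1: "E \<ge> 1" using False \<rho> by (simp add: E_def)
  have lnE: "ln E = \<rho> * y" by (simp add: E_def)
  define m where "m = nat \<lfloor>E\<rfloor>"
  have m: "m \<ge> 1" "real m \<le> E" "E \<le> real m + 1" unfolding m_def using E1 by linarith+
  have mN: "m \<le> N" using m(2) N unfolding E_def by linarith
  have "ln (real m) - ln E \<le> (real m - E) / E" using m E1 by (intro ln_diff_le) auto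
  hence "(real m + 1) * (ln (real m) - ln E) \<le> (real m + 1) * ((real m - E) / E)" by (intro mult_left_mono) auto
  also have "\<dots> = ((real m + 1) / E) * (real m - E)" by simp
  also have "\<dots> \<le> 1 * (real m - E)" using m E1 by (intro mult_right_mono_neg) auto
  finally have 1: "(real m + 1) * (ln (real m) - ln E) \<le> real m - E" by simp
  have "E - 1 - \<rho> * y \<le> real m * (\<rho> * y) - (\<Sum>n=1..m. ln (real n))"
    using 1 sum_ln_le[OF m(1)] unfolding lnE by (simp add: algebra_simps)
  hence "(E - 1 - \<rho> * y) / \<rho> \<le> (real m * (\<rho> * y) - (\<Sum>n=1..m. ln (real n))) / \<rho>"
    using \<rho> by (intro divide_right_mono) auto
  also have "\<dots> = (\<Sum>n=1..m. y - ln (real n) / \<rho>)"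
    using \<rho> by (simp add: sum_subtractf sum_divide_distrib diff_divide_distrib)
  also have "\<dots> \<le> (\<Sum>n=1..m. max 0 (y - ln (real n) / \<rho>))" by (intro sum_mono) auto
  also have "\<dots> \<le> (\<Sum>n=1..N. max 0 (y - ln (real n) / \<rho>))" using mN by (intro sum_mono2) auto
  finally show ?thesis using False \<rho> by (simp add: E_def diff_divide_distrib)
qed

text \<open>The averaging of \<open>hinge_sum_le\<close> in the opposite direction, with
  \<open>\<beta> = 1\<close>. The first N points give the lower bound for the hinges only up to a
  radius depending on N, so the integral is cut off at X. As \<open>c\<close> is below the full
  value, X can be chosen with enough of the integral left; \<open>S\<close> is then
  \<open>exp (\<rho> * X)\<close>.\<close>

lemma log_product_ge:
  assumes \<rho>: "0 < \<rho>" "\<rho> < 1" and c: "c < pi / sin (pi * \<rho>)"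
  obtains S where "S \<ge> 1"
    "\<And>N r. r > 0 \<Longrightarrow> S * r powr \<rho> \<le> real N \<Longrightarrow>
       c * r powr \<rho> - 1 / \<rho> - ln (1 + r) \<le> (\<Sum>n=1..N. ln (1 + r / real n powr (1 / \<rho>)))"
proof -
  define f where "f = (\<lambda>x. exp (\<rho> * x) * kern 1 x)"
  have hf: "has_bochner_integral lborel f (pi * \<rho> / sin (pi * \<rho>))"
    using kern_exp[of \<rho> 1] \<rho> by (simp add: f_def)
  hence intf: "integrable lborel f" and If: "integral\<^sup>L lborel f = pi * \<rho> / sin (pi * \<rho>)"
    by (simp_all add: has_bochner_integral_iff)
  have "((\<lambda>X. \<integral>x. indicator {..X} x *\<^sub>R f x \<partial>lborel) \<longlongrightarrow> pi * \<rho> / sin (pi * \<rho>)) at_top"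
    unfolding If[symmetric] by (rule tendsto_integral_at_top[OF _ intf]) simp
  moreover have "c * \<rho> < pi * \<rho> / sin (pi * \<rho>)" using mult_strict_right_mono[OF c \<rho>(1)] by simp
  ultimately have "eventually (\<lambda>X. c * \<rho> < (\<integral>x. indicator {..X} x *\<^sub>R f x \<partial>lborel)) at_top"
    by (rule order_tendstoD)
  hence "eventually (\<lambda>X. c * \<rho> < (\<integral>x. indicator {..X} x *\<^sub>R f x \<partial>lborel) \<and> X \<ge> 0) at_top"
    by (intro eventually_conj eventually_ge_at_top)
  then obtain X where X: "c * \<rho> < (\<integral>x. indicator {..X} x *\<^sub>R f x \<partial>lborel)" "X \<ge> 0"
    using eventually_happens'[OF trivial_limit_at_top_linorder] by blast
  define J where "J = (\<integral>x. indicator {..X} x *\<^sub>R f x \<partial>lborel)"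
  have hJ: "has_bochner_integral lborel (\<lambda>x. indicator {..X} x *\<^sub>R f x) J"
    unfolding J_def by (intro has_bochner_integral_integrable integrable_mult_indicator intf) auto
  show ?thesis
  proof (rule that[of "exp (\<rho> * X)"])
    show "exp (\<rho> * X) \<ge> 1" using \<rho> X by simp
    fix N :: nat and r :: real assume r: "r > 0" and N: "exp (\<rho> * X) * r powr \<rho> \<le> real N"
    define a where "a = ln r"
    have rp: "r powr \<rho> = exp (\<rho> * a)" using r by (simp add: powr_def a_def)
    define d where "d = (\<lambda>n::nat. a - ln (real n) / \<rho>)"
    have hL: "has_bochner_integral lborel (\<lambda>x. \<Sum>n=1..N. max 0 (d n + x) * kern 1 x) (\<Sum>n=1..N. ln (1 + exp (1 * d n)))"
      by (intro has_bochner_integral_sum kern_hinge) auto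
    have hR: "has_bochner_integral lborel
        (\<lambda>x. exp (\<rho> * a) / \<rho> * (indicator {..X} x *\<^sub>R f x) - 1 / \<rho> * kern 1 x - max 0 (a + x) * kern 1 x)
        (exp (\<rho> * a) / \<rho> * J - 1 / \<rho> * 1 - ln (1 + exp (1 * a)))"
      by (intro has_bochner_integral_diff has_bochner_integral_mult_right hJ kern_total kern_hinge) auto
    have "exp (\<rho> * a) / \<rho> * J - 1 / \<rho> * 1 - ln (1 + exp (1 * a)) \<le> (\<Sum>n=1..N. ln (1 + exp (1 * d n)))"
      unfolding has_bochner_integral_integral_eq[OF hL, symmetric] has_bochner_integral_integral_eq[OF hR, symmetric]
    proof (rule integral_mono)
      show "integrable lborel (\<lambda>x. exp (\<rho> * a) / \<rho> * (indicator {..X} x *\<^sub>R f x) - 1 / \<rho> * kern 1 x - max 0 (a + x) * kern 1 x)"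
        using hR by (simp only: has_bochner_integral_iff)
      show "integrable lborel (\<lambda>x. \<Sum>n=1..N. max 0 (d n + x) * kern 1 x)"
        using hL by (simp only: has_bochner_integral_iff)
      fix x
      have k: "kern 1 x \<ge> 0" by (rule kern_nonneg)
      have "exp (\<rho> * a) / \<rho> * (indicator {..X} x * exp (\<rho> * x)) - 1 / \<rho> - max 0 (a + x) \<le> (\<Sum>n=1..N. max 0 (d n + x))"
      proof (cases "x \<le> X")
        case True
        have "exp (\<rho> * (a + x)) = exp (\<rho> * x) * exp (\<rho> * a)" by (simp add: exp_add[symmetric] algebra_simps)
        also have "\<dots> \<le> exp (\<rho> * X) * exp (\<rho> * a)" using True \<rho> by simp
        also have "\<dots> \<le> real N" using N rp by simp
        finally have "exp (\<rho> * (a + x)) \<le> real N" .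
        from hinge_sum_ge[OF \<rho>(1) this] show ?thesis using True
          by (simp add: d_def diff_divide_distrib exp_add[symmetric] algebra_simps)
      next
        case False
        have "0 \<le> (\<Sum>n=1..N. max 0 (d n + x))" by (intro sum_nonneg) auto
        moreover have "1 / \<rho> \<ge> 0" "max 0 (a + x) \<ge> 0" using \<rho> by simp_all
        ultimately have "0 - 1 / \<rho> - max 0 (a + x) \<le> (\<Sum>n=1..N. max 0 (d n + x))" by linarith
        moreover have "indicator {..X} x = (0::real)" using False by simp
        ultimately show ?thesis by (simp only: mult_zero_left mult_zero_right)
      qed
      from mult_right_mono[OF this k, unfolded sum_distrib_right]
      show "exp (\<rho> * a) / \<rho> * (indicator {..X} x *\<^sub>R f x) - 1 / \<rho> * kern 1 x - max 0 (a + x) * kern 1 x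
          \<le> (\<Sum>n=1..N. max 0 (d n + x) * kern 1 x)"
        by (simp add: f_def algebra_simps)
    qed
    moreover have "exp (1 * d n) = r / real n powr (1 / \<rho>)" if "n \<in> {1..N}" for n
      using that r by (simp add: d_def exp_diff a_def powr_def)
    ultimately have "exp (\<rho> * a) / \<rho> * J - 1 / \<rho> - ln (1 + r) \<le> (\<Sum>n=1..N. ln (1 + r / real n powr (1 / \<rho>)))"
      using r by (simp add: a_def)
    moreover have "c * r powr \<rho> \<le> exp (\<rho> * a) / \<rho> * J"
    proof -
      have "c * \<rho> * (r powr \<rho> / \<rho>) \<le> J * (r powr \<rho> / \<rho>)" using X(1) \<rho> by (intro mult_right_mono) (auto simp: J_def)
      thus ?thesis using \<rho> rp by (simp add: mult_ac)
    qed
    ultimately show "c * r powr \<rho> - 1 / \<rho> - ln (1 + r) \<le> (\<Sum>n=1..N. ln (1 + r / real n powr (1 / \<rho>)))" by linarith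
  qed
qed

text \<open>For \<open>s < 1\<close> the power maps the right half-plane into a smaller sector
  around the positive axis, where real part and modulus are comparable.\<close>

lemma Re_powr_bounds:
  fixes s :: real
  assumes w: "Re w \<ge> 0" and s: "0 \<le> s" "s \<le> 1"
  shows "cos (pi * s / 2) * norm w powr s \<le> Re (w powr of_real s)" "Re (w powr of_real s) \<le> norm w powr s"
proof -
  show "Re (w powr of_real s) \<le> norm w powr s"
    using complex_Re_le_cmod[of "w powr of_real s"] by (simp add: norm_powr_real_powr')
  show "cos (pi * s / 2) * norm w powr s \<le> Re (w powr of_real s)"
  proof (cases "w = 0")
    case False
    have im: "\<bar>Im (Ln w)\<bar> \<le> pi / 2" using Re_Ln_pos_le[OF False] w by simp
    have "s * \<bar>Im (Ln w)\<bar> \<le> s * (pi / 2)" using s im by (intro mult_left_mono) auto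
    moreover have "s * (pi / 2) \<le> 1 * pi" using s pi_gt_zero by (intro mult_mono) auto
    ultimately have "cos (s * (pi / 2)) \<le> cos (s * \<bar>Im (Ln w)\<bar>)" using s by (intro cos_monotone_0_pi_le) auto
    also have "\<dots> = cos (s * Im (Ln w))" by (cases "Im (Ln w) \<ge> 0") auto
    finally have "cos (pi * s / 2) * norm w powr s \<le> cos (s * Im (Ln w)) * norm w powr s"
      by (intro mult_right_mono) (auto simp: mult_ac)
    also have "\<dots> = Re (w powr of_real s)" using False by (simp add: powr_def Re_exp mult_ac)
    finally show ?thesis .
  qed simp
qed

text \<open>For given modulus, the factors of the product are largest on the negative axis, so there
  the quotient of \<open>f\<close> by the first N factors decays, up to a radius that grows with N.
  A Phragmen-Lindelof argument in the slit plane, where orders below 1/2 are admissible, spreads the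
  decay to all directions. The product itself stays bounded at a fixed point, so \<open>f\<close>
  vanishes there when the radius tends to infinity.\<close>

theorem uniqueness_small_order:
  fixes f :: "complex \<Rightarrow> complex"
  assumes \<tau>: "0 \<le> \<tau>" "\<tau> < pi / sin (pi * \<rho>)" and \<rho>: "0 < \<rho>" "\<rho> < 1 / 2" and f: "f holomorphic_on UNIV"
    and bound: "\<And>z. norm (f z) \<le> exp (\<tau> * norm z powr \<rho>)"
    and zeros: "\<And>n::nat. n \<ge> 1 \<Longrightarrow> f (of_real (real n powr (1 / \<rho>))) = 0"
  shows "f z1 = 0"
proof -
  define t where "t = (\<lambda>n::nat. real n powr (1 / \<rho>))"
  have t0: "t n > 0" if "n \<ge> 1" for n using that by (simp add: t_def)
  have tmono: "t n \<le> t N" if "n \<le> N" for n N unfolding t_def using that \<rho> by (intro powr_mono2) auto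
  have t\<rho>: "t n powr \<rho> = real n" for n using \<rho> by (simp add: t_def powr_powr)
  have injt: "inj_on (\<lambda>n. complex_of_real (t n)) A" for A
    by (rule inj_onI) (metis of_real_eq_iff of_nat_eq_iff t\<rho>)
  \<comment> \<open>Two quarters of the gap are spent: one absorbs \<open>ln (1 + r)\<close>, the
    other remains as the rate of decay.\<close>
  define e where "e = (pi / sin (pi * \<rho>) - \<tau>) / 4"
  have e: "e > 0" using \<tau> by (simp add: e_def)
  have e2: "\<tau> + 2 * e < pi / sin (pi * \<rho>)" 
  proof -
    have "a + 2 * ((b - a) / 4) < b" if "a < b" for a b :: real using that by (simp add: field_simps)
    from this[OF \<tau>(2)] show ?thesis by (simp only: e_def)
  qed
  have \<rho>1: "\<rho> < 1" using \<rho> by simp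
  obtain S where S: "S \<ge> 1" and low: "\<And>N r. r > 0 \<Longrightarrow> S * r powr \<rho> \<le> real N \<Longrightarrow>
       (\<tau> + 2 * e) * r powr \<rho> - 1 / \<rho> - ln (1 + r) \<le> (\<Sum>n=1..N. ln (1 + r / t n))"
    using log_product_ge[OF \<rho>(1) \<rho>1 e2] unfolding t_def by metis
  have "eventually (\<lambda>r. ln (1 + r) \<le> e * r powr \<rho>) at_top" using e \<rho>(1) by real_asymp
  then obtain R0 where R0: "\<And>r. r \<ge> R0 \<Longrightarrow> ln (1 + r) \<le> e * r powr \<rho>" by (auto simp: eventually_at_top_linorder)
  define C1 where "C1 = ln (1 + \<bar>R0\<bar>)"
  have C1: "C1 \<ge> 0" by (simp add: C1_def)
  have lnr: "ln (1 + r) \<le> e * r powr \<rho> + C1" if r: "r > 0" for r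
  proof (cases "r \<ge> R0")
    case True
    thus ?thesis using R0[OF True] C1 by simp
  next
    case False
    hence "ln (1 + r) \<le> C1" unfolding C1_def using r by (subst ln_le_cancel_iff) auto
    thus ?thesis using e by (simp add: add_increasing)
  qed
  define C0 where "C0 = exp (1 / \<rho> + C1)"
  have C0: "C0 \<ge> 1" using \<rho> C1 by (simp add: C0_def)
  have "\<exists>g. g holomorphic_on UNIV \<and> (\<forall>z. f z = (\<Prod>n=1..N. 1 - z / of_real (t n)) * g z)" for N
  proof -
    define K where "K = (\<lambda>n. complex_of_real (t n)) ` {1..N}"
    obtain g where g: "g holomorphic_on UNIV" "\<And>z. f z = (\<Prod>a\<in>K. 1 - z / a) * g z"
    proof (rule divide_out_zeros[of K UNIV f])
      fix a assume "a \<in> K"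
      then obtain n where n: "n \<ge> 1" "a = of_real (t n)" by (auto simp: K_def)
      thus "a \<in> UNIV \<and> a \<noteq> 0 \<and> f a = 0" using zeros[of n] t0[of n] by (auto simp: t_def)
    qed (use f in \<open>auto simp: K_def\<close>)
    have "(\<Prod>a\<in>K. 1 - z / a) = (\<Prod>n=1..N. 1 - z / of_real (t n))" for z
      unfolding K_def by (subst prod.reindex[OF injt]) simp
    thus ?thesis using g by auto
  qed
  then obtain g where gh: "\<And>N. g N holomorphic_on UNIV"
    and gf: "\<And>N z. f z = (\<Prod>n=1..N. 1 - z / of_real (t n)) * g N z" by metis
  have neg: "norm (g N (- of_real r)) \<le> C0 * exp (- e * r powr \<rho>)" if r: "r \<ge> 0" "S * r powr \<rho> \<le> real N" for N r
  proof (cases "r = 0")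
    case True
    thus ?thesis using bound[of 0] gf[of 0 N] C0 \<rho> by simp
  next
    case False
    hence r0: "r > 0" using r by simp
    define P where "P = (\<Prod>n=1..N. 1 + r / t n)"
    have "(\<Prod>n=1..N. 1 - (- of_real r) / of_real (t n)) = complex_of_real P" by (simp add: P_def)
    hence fP: "f (- of_real r) = of_real P * g N (- of_real r)" using gf[of "- of_real r" N] by simp
    have pos: "1 + r / t n > 0" if "n \<in> {1..N}" for n using that r0 t0[of n] by (simp add: add_pos_nonneg)
    have "P = exp (\<Sum>n=1..N. ln (1 + r / t n))" unfolding P_def exp_sum[OF finite_atLeastAtMost]
      by (rule prod.cong) (use pos in auto)
    moreover have "(\<tau> + e) * r powr \<rho> - (1 / \<rho> + C1) \<le> (\<Sum>n=1..N. ln (1 + r / t n))"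
      using low[OF r0 r(2)] lnr[OF r0] by (simp add: algebra_simps)
    ultimately have P: "exp ((\<tau> + e) * r powr \<rho> - (1 / \<rho> + C1)) \<le> P" by simp
    have "norm (g N (- of_real r)) * exp ((\<tau> + e) * r powr \<rho> - (1 / \<rho> + C1)) \<le> norm (g N (- of_real r)) * P"
      by (intro mult_left_mono P) auto
    also have "\<dots> = norm (f (- of_real r))" unfolding fP using P order.strict_trans2[OF exp_gt_zero P]
      by (simp add: norm_mult)
    also have "\<dots> \<le> exp (\<tau> * r powr \<rho>)" using bound[of "- of_real r"] r0 by simp
    finally have "norm (g N (- of_real r)) \<le> exp (\<tau> * r powr \<rho>) / exp ((\<tau> + e) * r powr \<rho> - (1 / \<rho> + C1))"
      by (simp add: pos_le_divide_eq)
    also have "\<dots> = C0 * exp (- e * r powr \<rho>)"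
      by (simp add: C0_def exp_diff[symmetric] exp_add[symmetric] algebra_simps)
    finally show ?thesis .
  qed
  \<comment> \<open>A crude bound: on the circle of radius \<open>2 * t N\<close> every factor has
    modulus at least 1, so the quotient is no larger than \<open>f\<close> there.\<close>
  have far: "norm (g N z) \<le> exp (2 * \<tau> * real N)" if z: "norm z \<le> 2 * t N" and N: "N \<ge> 1" for N z
  proof (rule maximum_modulus_cball[where p = 0 and r = "2 * t N", OF gh])
    show "z \<in> cball 0 (2 * t N)" "2 * t N > 0" using z t0[OF N] by auto
    fix w :: complex assume w: "w \<in> sphere 0 (2 * t N)"
    have "1 \<le> norm (\<Prod>n=1..N. 1 - w / of_real (t n))" unfolding prod_norm[symmetric]
    proof (rule prod_ge_1)
      fix n assume n: "n \<in> {1..N}"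
      have "2 \<le> norm w / t n" using w t0[of n] tmono[of n N] n by (simp add: field_simps)
      also have "norm w / t n = norm (w / of_real (t n))" using t0[of n] n by (simp add: norm_divide)
      finally have "1 \<le> norm (w / of_real (t n)) - norm (1::complex)" by simp
      also have "\<dots> \<le> norm (1 - w / of_real (t n))" by (metis norm_minus_commute norm_triangle_ineq2)
      finally show "1 \<le> norm (1 - w / of_real (t n))" .
    qed
    hence "1 * norm (g N w) \<le> norm (\<Prod>n=1..N. 1 - w / of_real (t n)) * norm (g N w)" by (intro mult_right_mono) auto
    also have "\<dots> = norm (f w)" by (simp only: gf[of w N] norm_mult)
    also have "\<dots> \<le> exp (\<tau> * (2 * t N) powr \<rho>)" using bound[of w] w by simp
    also have "(2 * t N) powr \<rho> = 2 powr \<rho> * real N" using t\<rho>[of N] t0[OF N] by (simp add: powr_mult)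
    also have "exp (\<tau> * (2 powr \<rho> * real N)) \<le> exp (2 * \<tau> * real N)"
    proof -
      have "2 powr \<rho> \<le> (2::real) powr 1" using \<rho> by (intro powr_mono) auto
      hence "\<tau> * (2 powr \<rho> * real N) \<le> \<tau> * (2 * real N)" using \<tau> by (intro mult_left_mono mult_right_mono) auto
      thus ?thesis by (simp add: mult_ac)
    qed
    finally show "norm (g N w) \<le> exp (2 * \<tau> * real N)" by simp
  qed
  \<comment> \<open>Larger than \<open>\<rho>\<close> to beat the crude bound far out, smaller than
    1/2 so that the corresponding power has positive real part in the slit plane.\<close>
  define \<kappa> where "\<kappa> = (\<rho> + 1 / 2) / 2"
  have \<kappa>: "\<rho> < \<kappa>" "\<kappa> < 1 / 2" "0 < \<kappa>" using \<rho> by (auto simp: \<kappa>_def)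
  have cosp: "cos (pi * a) > 0" if "0 < a" "a < 1 / 2" for a :: real
  proof (rule cos_gt_zero)
    show "pi * a < pi / 2" using mult_strict_left_mono[OF that(2) pi_gt_zero] by simp
  qed (use that in simp)
  have cos\<kappa>: "cos (pi * \<kappa>) > 0" and cos\<rho>: "cos (pi * \<rho>) > 0"
    using \<kappa> \<rho> by (auto intro: cosp)
  define \<delta> where "\<delta> = e * cos (pi * \<rho>)"
  have \<delta>: "\<delta> > 0" using e cos\<rho> by (simp add: \<delta>_def)
  have decay: "eventually (\<lambda>N. \<forall>z. S * norm z powr \<rho> \<le> real N \<longrightarrow>
      norm (g N z) \<le> C0 * exp (\<epsilon> * norm z powr \<kappa> - \<delta> * norm z powr \<rho>)) sequentially" if \<epsilon>: "\<epsilon> > 0" for \<epsilon>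
  proof -
    define p where "p = \<kappa> / \<rho>"
    have p: "p > 1" using \<kappa> \<rho> by (simp add: p_def)
    define b where "b = \<epsilon> * cos (pi * \<kappa>)"
    have b: "b > 0" using \<epsilon> cos\<kappa> by (simp add: b_def)
    define B where "B = (2 * \<tau> * S + e) / b"
    have "eventually (\<lambda>x::real. B * x \<le> x powr p) at_top" using p by real_asymp
    moreover have "filterlim (\<lambda>N. real N / S) at_top sequentially" using S by real_asymp
    ultimately have "eventually (\<lambda>N. B * (real N / S) \<le> (real N / S) powr p) sequentially"
      by (rule eventually_compose_filterlim)
    moreover have "eventually (\<lambda>N. N \<ge> 1) sequentially" by (rule eventually_ge_at_top)
    ultimately show ?thesis
    proof eventually_elim
      case (elim N)
      define X where "X = real N / S"
      have X: "X > 0" using elim S by (simp add: X_def)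
      \<comment> \<open>In the variable w with w squared equal to z, the disc of radius
        \<open>R\<close> is the region where the decay on the negative axis is available for this
        N.\<close>
      define R where "R = X powr (1 / (2 * \<rho>))"
      have R: "R > 0" "R powr (2 * \<rho>) = X" "R powr (2 * \<kappa>) = X powr p" 
        using X \<rho> by (simp_all add: R_def powr_powr p_def)
      have Rt: "R\<^sup>2 \<le> t N"
      proof -
        have "R\<^sup>2 = X powr (1 / \<rho>)" using R(1) \<rho> by (simp add: R_def powr_powr flip: powr_numeral)
        also have "\<dots> \<le> real N powr (1 / \<rho>)" using X S \<rho> by (intro powr_mono2) (auto simp: X_def field_simps)
        finally show ?thesis by (simp add: t_def)
      qed
      \<comment> \<open>The first exponent undoes the decay on the imaginary axis, which corresponds
        to negative z; the second makes the crude bound harmless on the arc of radius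
        \<open>R\<close>.\<close>
      define G where "G = (\<lambda>w. g N (w\<^sup>2) * exp (of_real e * w powr of_real (2 * \<rho>) - of_real \<epsilon> * w powr of_real (2 * \<kappa>)))"
      have nG: "norm (G w) = norm (g N (w\<^sup>2)) * exp (e * Re (w powr of_real (2 * \<rho>)) - \<epsilon> * Re (w powr of_real (2 * \<kappa>)))" for w
        by (simp add: G_def norm_mult)
      have sq: "norm (w\<^sup>2) powr a = norm w powr (2 * a)" for w :: complex and a
        by (cases "w = 0") (simp_all add: norm_power powr_powr flip: powr_numeral)
      have cg: "continuous_on UNIV (g N)" by (rule holomorphic_on_imp_continuous_on[OF gh])
      have gsq: "(\<lambda>w. g N (w\<^sup>2)) holomorphic_on A" for A
      proof -
        have "(\<lambda>w::complex. w\<^sup>2) holomorphic_on A" by (intro holomorphic_intros)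
        from holomorphic_on_compose_gen[OF this gh, of N] show ?thesis by (simp add: o_def)
      qed
      have Gw: "norm (G w) \<le> C0" if w: "Re w \<ge> 0" "norm w \<le> R" for w
      proof (rule maximum_modulus_half_disc[OF _ _ _ _ w])
        show "G holomorphic_on {z. Re z > 0}" unfolding G_def
          by (intro holomorphic_intros gsq) (auto simp: complex_nonpos_Reals_iff)
        show "continuous_on {z. Re z \<ge> 0} G" unfolding G_def
          by (intro continuous_intros continuous_on_compose2[OF cg]) (use \<rho> \<kappa> in auto)
        fix w assume w: "Re w = 0" "norm w \<le> R"
        have "w\<^sup>2 = - of_real ((norm w)\<^sup>2)" using w(1) by (simp add: complex_eq_iff cmod_def power2_eq_square)
        moreover have rr: "(norm w)\<^sup>2 powr \<rho> = norm w powr (2 * \<rho>)" using sq[of w \<rho>] by (simp add: norm_power)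
        moreover have "norm w powr (2 * \<rho>) \<le> R powr (2 * \<rho>)" using w \<rho> by (intro powr_mono2) auto
        hence "S * (norm w)\<^sup>2 powr \<rho> \<le> real N" unfolding rr R(2) X_def using S by (simp add: field_simps)
        ultimately have g1: "norm (g N (w\<^sup>2)) \<le> C0 * exp (- e * norm w powr (2 * \<rho>))"
          using neg[of "(norm w)\<^sup>2" N] by (simp only: zero_le_power2)
        have "Re (w powr of_real (2 * \<kappa>)) \<ge> 0"
          using Re_powr_bounds(1)[of w "2 * \<kappa>"] w \<kappa> cos\<kappa> by (simp add: mult_ac) (smt (verit) mult_nonneg_nonneg powr_ge_zero)
        hence "\<epsilon> * Re (w powr of_real (2 * \<kappa>)) \<ge> 0" using \<epsilon> by simp
        moreover have "e * Re (w powr of_real (2 * \<rho>)) \<le> e * norm w powr (2 * \<rho>)"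
          using Re_powr_bounds(2)[of w "2 * \<rho>"] w \<rho> e by (intro mult_left_mono) auto
        ultimately have "norm (G w) \<le> (C0 * exp (- e * norm w powr (2 * \<rho>))) * exp (e * norm w powr (2 * \<rho>))"
          unfolding nG using C0 by (intro mult_mono g1) auto
        also have "\<dots> = C0" by (simp add: exp_minus)
        finally show "norm (G w) \<le> C0" .
      next
        fix w assume w: "Re w \<ge> 0" "norm w = R"
        have "norm (w\<^sup>2) = R\<^sup>2" using w by (simp add: norm_power)
        hence g1: "norm (g N (w\<^sup>2)) \<le> exp (2 * \<tau> * real N)" using Rt t0[of N] elim by (intro far) auto
        have "cos (pi * \<kappa>) * R powr (2 * \<kappa>) \<le> Re (w powr of_real (2 * \<kappa>))"
          using Re_powr_bounds(1)[of w "2 * \<kappa>"] w \<kappa> by (simp add: mult_ac)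
        hence "\<epsilon> * (cos (pi * \<kappa>) * X powr p) \<le> \<epsilon> * Re (w powr of_real (2 * \<kappa>))" unfolding R(3) using \<epsilon> by simp
        moreover have "e * Re (w powr of_real (2 * \<rho>)) \<le> e * X"
          using Re_powr_bounds(2)[of w "2 * \<rho>"] w \<rho> e R(2) by (intro mult_left_mono) auto
        ultimately have "norm (G w) \<le> exp (2 * \<tau> * real N) * exp (e * X - b * X powr p)"
          unfolding nG by (intro mult_mono g1) (auto simp: b_def)
        also have "\<dots> = exp ((2 * \<tau> * S + e) * X - b * X powr p)"
          using S by (simp add: exp_add[symmetric] X_def field_simps)
        also have "\<dots> \<le> exp 0"
        proof -
          have "b * (B * X) \<le> b * X powr p" using elim(1) b unfolding X_def by (intro mult_left_mono) auto
          moreover have "b * (B * X) = (2 * \<tau> * S + e) * X" using b by (simp add: B_def)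
          ultimately show ?thesis by simp
        qed
        finally show "norm (G w) \<le> C0" using C0 by simp
      qed
      show ?case
      proof (intro allI impI)
        fix z :: complex assume z: "S * norm z powr \<rho> \<le> real N"
        define w where "w = csqrt z"
        have w2: "w\<^sup>2 = z" and w: "Re w \<ge> 0" using csqrt_principal[of z] by (auto simp: w_def)
        have "norm w powr (2 * \<rho>) \<le> X" using z S sq[of w \<rho>] by (simp add: w2 X_def field_simps)
        hence "(norm w powr (2 * \<rho>)) powr (1 / (2 * \<rho>)) \<le> R" unfolding R_def using \<rho> by (intro powr_mono2) auto
        hence "norm w \<le> R" using \<rho> by (simp add: powr_powr)
        hence "norm (G w) \<le> C0" using w by (intro Gw)
        hence "norm (g N z) * exp (e * Re (w powr of_real (2 * \<rho>)) - \<epsilon> * Re (w powr of_real (2 * \<kappa>))) \<le> C0"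
          unfolding nG w2 .
        hence "norm (g N z) \<le> C0 * exp (\<epsilon> * Re (w powr of_real (2 * \<kappa>)) - e * Re (w powr of_real (2 * \<rho>)))"
          by (simp add: exp_diff field_simps)
        also have "\<dots> \<le> C0 * exp (\<epsilon> * norm z powr \<kappa> - \<delta> * norm z powr \<rho>)"
        proof -
          have "\<epsilon> * Re (w powr of_real (2 * \<kappa>)) \<le> \<epsilon> * norm z powr \<kappa>"
            using Re_powr_bounds(2)[of w "2 * \<kappa>"] w \<kappa> \<epsilon> sq[of w \<kappa>] by (simp add: w2)
          moreover have "e * (cos (pi * \<rho>) * norm z powr \<rho>) \<le> e * Re (w powr of_real (2 * \<rho>))"
            using Re_powr_bounds(1)[of w "2 * \<rho>"] w \<rho> e sq[of w \<rho>] by (simp add: w2 mult_ac)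
          ultimately show ?thesis using C0 by (simp add: \<delta>_def)
        qed
        finally show "norm (g N z) \<le> C0 * exp (\<epsilon> * norm z powr \<kappa> - \<delta> * norm z powr \<rho>)" .
      qed
    qed
  qed
  \<comment> \<open>As \<open>\<rho>\<close> is below 1 the reciprocals of the zeros are summable,
    which bounds the divided-out products at \<open>z1\<close> uniformly in N.\<close>
  have sm: "summable (\<lambda>n. real n powr (- 1 / \<rho>))" using \<rho> by (subst summable_real_powr_iff) (auto simp: field_simps)
  define M where "M = exp (norm z1 * (\<Sum>n. real n powr (- 1 / \<rho>)))"
  have M: "norm (\<Prod>n=1..N. 1 - z1 / of_real (t n)) \<le> M" for N
  proof -
    have "norm (\<Prod>n=1..N. 1 - z1 / of_real (t n)) \<le> (\<Prod>n=1..N. exp (norm z1 * real n powr (- 1 / \<rho>)))"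
      unfolding prod_norm[symmetric]
    proof (rule prod_mono, safe)
      fix n assume "n \<in> {1..N}"
      hence n: "t n > 0" using t0 by auto
      have "norm (1 - z1 / of_real (t n)) \<le> 1 + norm (z1 / of_real (t n))" by (metis norm_one norm_triangle_ineq4)
      also have "norm (z1 / of_real (t n)) = norm z1 * real n powr (- 1 / \<rho>)"
        using n by (simp add: norm_divide t_def powr_minus divide_simps)
      also have "1 + \<dots> \<le> exp \<dots>" by (rule exp_ge_add_one_self)
      finally show "norm (1 - z1 / of_real (t n)) \<le> exp (norm z1 * real n powr (- 1 / \<rho>))" .
    qed auto
    also have "\<dots> = exp (norm z1 * (\<Sum>n=1..N. real n powr (- 1 / \<rho>)))" by (simp add: exp_sum sum_distrib_left)
    also have "\<dots> \<le> M" unfolding M_def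
      using sum_le_suminf[OF sm, of "{1..N}"] by (simp add: mult_left_mono)
    finally show ?thesis .
  qed
  \<comment> \<open>With \<open>r powr (- \<kappa>)\<close> for \<open>\<epsilon>\<close> the
    auxiliary term equals 1 on the circle of radius r; N is chosen after r.\<close>
  have "norm (f z1) \<le> M * (C0 * exp (1 - \<delta> * r powr \<rho>))" if r: "r \<ge> 1" "norm z1 \<le> r" for r
  proof -
    have "eventually (\<lambda>N::nat. S * r powr \<rho> \<le> real N) sequentially" by real_asymp
    moreover have "r powr (- \<kappa>) > 0" using r by simp
    ultimately have "eventually (\<lambda>N. S * r powr \<rho> \<le> real N \<and> (\<forall>z. S * norm z powr \<rho> \<le> real N \<longrightarrow>
      norm (g N z) \<le> C0 * exp (r powr (- \<kappa>) * norm z powr \<kappa> - \<delta> * norm z powr \<rho>))) sequentially"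
      by (intro eventually_conj decay)
    then obtain N where N: "S * r powr \<rho> \<le> real N" "\<And>z. S * norm z powr \<rho> \<le> real N \<Longrightarrow>
      norm (g N z) \<le> C0 * exp (r powr (- \<kappa>) * norm z powr \<kappa> - \<delta> * norm z powr \<rho>)"
      using eventually_happens'[OF sequentially_bot] by blast
    have "norm (g N z1) \<le> C0 * exp (1 - \<delta> * r powr \<rho>)"
    proof (rule maximum_modulus_cball[where p = 0 and r = r, OF gh])
      fix z :: complex assume "z \<in> sphere 0 r"
      moreover have "r powr (- \<kappa>) * r powr \<kappa> = 1" using r by (simp add: powr_add[symmetric])
      ultimately show "norm (g N z) \<le> C0 * exp (1 - \<delta> * r powr \<rho>)" using N(2)[of z] N(1) by simp
    qed (use r in auto)
    hence "norm (\<Prod>n=1..N. 1 - z1 / of_real (t n)) * norm (g N z1) \<le> M * (C0 * exp (1 - \<delta> * r powr \<rho>))"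
      by (intro mult_mono M) (auto simp: M_def)
    thus ?thesis by (simp only: gf[of z1 N] norm_mult)
  qed
  hence "eventually (\<lambda>r. norm (f z1) \<le> M * (C0 * exp (1 - \<delta> * r powr \<rho>))) at_top"
    using eventually_ge_at_top[of "max 1 (norm z1)"] by (auto elim!: eventually_mono)
  moreover have "((\<lambda>r. M * (C0 * exp (1 - \<delta> * r powr \<rho>))) \<longlongrightarrow> 0) at_top"
  proof -
    have "((\<lambda>r. exp (1 - \<delta> * r powr \<rho>)) \<longlongrightarrow> 0) at_top" using \<delta> \<rho>(1) by real_asymp
    from tendsto_mult_right_zero[OF tendsto_mult_right_zero[OF this]] show ?thesis .
  qed
  ultimately have "norm (f z1) \<le> 0" by (intro tendsto_lowerbound[where F = at_top]) auto
  thus ?thesis by simp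
qed

section \<open>The extremal sequence\<close>

definition power_sequence :: "real \<Rightarrow> point_distribution" where
  "power_sequence \<rho> z = (if \<exists>n\<ge>1. z = of_real (real n powr (1 / \<rho>)) then 1 else 0)"

lemma power_sequence_0: "power_sequence \<rho> 0 = 0"
  by (auto simp: power_sequence_def)

text \<open>The n-th point has modulus at most r exactly if n is at most
  \<open>r powr \<rho>\<close>. Recording the value 0 for radii below 1 lets the integration of the
  count against 1 / t start at 1, away from the origin.\<close>

lemma radial_count_power_sequence_le:
  assumes \<rho>: "\<rho> > 0" and r: "r \<ge> 0"
  shows "radial_count (power_sequence \<rho>) r \<le> ennreal (if r < 1 then 0 else r powr \<rho>)"
  unfolding radial_count_def
proof (subst nonneg_infsum_complete)
  define m where "m = nat \<lfloor>r powr \<rho>\<rfloor>"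
  show "(SUP F\<in>{F. finite F \<and> F \<subseteq> cball 0 r}. \<Sum>z\<in>F. ennreal_of_enat (power_sequence \<rho> z)) \<le> ennreal (if r < 1 then 0 else r powr \<rho>)"
  proof (rule SUP_least, safe)
    fix F :: "complex set" assume F: "finite F" "F \<subseteq> cball 0 r"
    define A where "A = {z\<in>F. power_sequence \<rho> z \<noteq> 0}"
    have "(\<Sum>z\<in>F. ennreal_of_enat (power_sequence \<rho> z)) = (\<Sum>z\<in>A. 1)"
      by (rule sum.mono_neutral_cong_right) (use F in \<open>auto simp: A_def power_sequence_def split: if_splits\<close>)
    also have "\<dots> = ennreal (real (card A))" by (simp add: ennreal_of_nat_eq_real_of_nat)
    also have "\<dots> \<le> ennreal (if r < 1 then 0 else r powr \<rho>)"
    proof (rule ennreal_leI)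
      have "A \<subseteq> (\<lambda>n. of_real (real n powr (1 / \<rho>))) ` {1..m}"
      proof
        fix z assume z: "z \<in> A"
        then obtain n where n: "n \<ge> 1" "z = of_real (real n powr (1 / \<rho>))"
          by (auto simp: A_def power_sequence_def split: if_splits)
        have "norm z \<le> r" using z F by (auto simp: A_def)
        hence "(real n powr (1 / \<rho>)) powr \<rho> \<le> r powr \<rho>" using n \<rho> by (intro powr_mono2) auto
        hence "real n \<le> r powr \<rho>" using \<rho> by (simp add: powr_powr)
        hence "n \<le> m" unfolding m_def by linarith
        thus "z \<in> (\<lambda>n. of_real (real n powr (1 / \<rho>))) ` {1..m}" using n by auto
      qed
      hence "card A \<le> m" using surj_card_le[of "{1..m}" A] by simp
      moreover have "real m \<le> r powr \<rho>" unfolding m_def by simp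
      moreover have "m = 0" if "r < 1"
      proof -
        have "r powr \<rho> < 1" using that r \<rho> powr_less_mono2[of \<rho> r 1] by simp
        thus ?thesis unfolding m_def by linarith
      qed
      ultimately show "real (card A) \<le> (if r < 1 then 0 else r powr \<rho>)" by auto
    qed
    finally show "(\<Sum>z\<in>F. ennreal_of_enat (power_sequence \<rho> z)) \<le> ennreal (if r < 1 then 0 else r powr \<rho>)" .
  qed
qed simp

lemma count_integral_power_sequence_le:
  assumes \<rho>: "\<rho> > 0" and r: "r \<ge> 0"
  shows "count_integral (power_sequence \<rho>) r \<le> ennreal (r powr \<rho> / \<rho>)"
proof -
  let ?Z = "power_sequence \<rho>"
  have pw: "(radial_count ?Z t - radial_count ?Z 0) / ennreal t * indicator {0..r} t
      \<le> ennreal (t powr (\<rho> - 1)) * indicator {1..max 1 r} t" for t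
  proof (cases "t \<in> {0..r}")
    case True
    have "radial_count ?Z t - radial_count ?Z 0 \<le> radial_count ?Z t" by (rule diff_le_self_ennreal)
    also have "\<dots> \<le> ennreal (if t < 1 then 0 else t powr \<rho>)"
      using True by (intro radial_count_power_sequence_le[OF \<rho>]) auto
    finally have le: "radial_count ?Z t - radial_count ?Z 0 \<le> ennreal (if t < 1 then 0 else t powr \<rho>)" .
    show ?thesis
    proof (cases "t < 1")
      case True
      thus ?thesis using le by simp
    next
      case False
      have "(radial_count ?Z t - radial_count ?Z 0) / ennreal t \<le> ennreal (t powr \<rho>) / ennreal t"
        using le False by (intro divide_right_mono_ennreal) auto
      also have "\<dots> = ennreal (t powr (\<rho> - 1))" using False by (simp add: divide_ennreal powr_diff)
      finally show ?thesis using True False by simp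
    qed
  qed simp
  have "count_integral ?Z r \<le> (\<integral>\<^sup>+t. ennreal (t powr (\<rho> - 1)) * indicator {1..max 1 r} t \<partial>lborel)"
    unfolding count_integral_def by (intro nn_integral_mono pw)
  also have "\<dots> = ennreal (max 1 r powr \<rho> / \<rho> - 1 powr \<rho> / \<rho>)"
  proof (rule nn_integral_FTC_Icc)
    fix t assume "t \<in> {1..max 1 r}"
    thus "((\<lambda>t. t powr \<rho> / \<rho>) has_real_derivative t powr (\<rho> - 1)) (at t)"
      using \<rho> by (auto intro!: derivative_eq_intros)
  qed auto
  also have "\<dots> \<le> ennreal (r powr \<rho> / \<rho>)"
  proof (rule ennreal_leI)
    show "max 1 r powr \<rho> / \<rho> - 1 powr \<rho> / \<rho> \<le> r powr \<rho> / \<rho>" using \<rho> by (cases "r \<le> 1") (auto simp: max_def)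
  qed
  finally show ?thesis .
qed

lemma SUP_power_sequence_finite:
  assumes \<rho>: "\<rho> > 0"
  shows "(SUP r\<in>{0..}. radial_integral_count (power_sequence \<rho>) r - ereal (1 / \<rho> * r powr \<rho>)) < \<infinity>"
proof -
  have "(SUP r\<in>{0..}. radial_integral_count (power_sequence \<rho>) r - ereal (1 / \<rho> * r powr \<rho>)) \<le> 0"
  proof (rule SUP_least)
    fix r :: real assume r: "r \<in> {0..}"
    have "enn2ereal (count_integral (power_sequence \<rho>) r) \<le> enn2ereal (ennreal (r powr \<rho> / \<rho>))"
      using count_integral_power_sequence_le[OF \<rho>, of r] r by (simp add: less_eq_ennreal.rep_eq)
    also have "\<dots> = ereal (1 / \<rho> * r powr \<rho>)" using \<rho> by simp
    finally have "radial_integral_count (power_sequence \<rho>) r \<le> ereal (1 / \<rho> * r powr \<rho>)"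
      by (simp add: radial_integral_count_def count_integral_def radial_count_0 power_sequence_0 zero_ennreal.rep_eq)
    thus "radial_integral_count (power_sequence \<rho>) r - ereal (1 / \<rho> * r powr \<rho>) \<le> 0"
      by (cases "radial_integral_count (power_sequence \<rho>) r") auto
  qed
  thus ?thesis by (rule le_less_trans) simp
qed

lemma norm_le_max_modulus:
  assumes "f holomorphic_on UNIV"
  shows "norm (f z) \<le> max_modulus (norm z) f"
  unfolding max_modulus_def
proof (rule cSUP_upper)
  have "continuous_on (sphere 0 (norm z)) (\<lambda>z. norm (f z))"
    by (intro continuous_on_norm continuous_on_subset[OF holomorphic_on_imp_continuous_on[OF assms]]) auto
  thus "bdd_above ((\<lambda>z. norm (f z)) ` sphere 0 (norm z))"
    by (intro bounded_imp_bdd_above compact_imp_bounded compact_continuous_image) auto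
qed simp

theorem corollary2_sharpness:
  assumes \<rho>: "\<rho> > 0" and P': "P' < paley \<rho>"
  shows "\<exists>\<sigma> (Z::point_distribution). \<sigma> > 0 \<and> Z 0 < \<infinity> \<and>
    (SUP r\<in>{0..}. radial_integral_count Z r - ereal (\<sigma> * r powr \<rho>)) < \<infinity> \<and>
    \<not> (\<exists>f. f holomorphic_on UNIV \<and> f \<noteq> (\<lambda>_. 0) \<and> vanishes_on f Z \<and>
          (\<forall>r\<ge>0. max_modulus r f \<le> exp (P' * \<sigma> * r powr \<rho>)))"
proof (intro exI conjI notI)
  show "1 / \<rho> > 0" using \<rho> by simp
  show "power_sequence \<rho> 0 < \<infinity>" by (simp add: power_sequence_0)
  show "(SUP r\<in>{0..}. radial_integral_count (power_sequence \<rho>) r - ereal (1 / \<rho> * r powr \<rho>)) < \<infinity>"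
    by (rule SUP_power_sequence_finite[OF \<rho>])
  assume "\<exists>f. f holomorphic_on UNIV \<and> f \<noteq> (\<lambda>_. 0) \<and> vanishes_on f (power_sequence \<rho>) \<and>
          (\<forall>r\<ge>0. max_modulus r f \<le> exp (P' * (1 / \<rho>) * r powr \<rho>))"
  then obtain f where f: "f holomorphic_on UNIV" "f \<noteq> (\<lambda>_. 0)" "vanishes_on f (power_sequence \<rho>)"
    "\<And>r. r \<ge> 0 \<Longrightarrow> max_modulus r f \<le> exp (P' * (1 / \<rho>) * r powr \<rho>)" by blast
  \<comment> \<open>The maximum covers negative \<open>P'\<close>, and the division is by the
    reciprocal of the \<open>\<sigma>\<close> of the example. The bound
    \<open>paley \<rho> / \<rho>\<close> is pi in one case and \<open>pi / sin (pi * \<rho>)\<close>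
    in the other.\<close>
  define \<tau> where "\<tau> = max 0 P' / \<rho>"
  have \<tau>: "0 \<le> \<tau>" "\<tau> < paley \<rho> / \<rho>"
    using \<rho> P' paley_pos[OF \<rho>] by (auto simp: \<tau>_def intro!: divide_strict_right_mono)
  have bound: "norm (f z) \<le> exp (\<tau> * norm z powr \<rho>)" for z
  proof -
    have "norm (f z) \<le> exp (P' * (1 / \<rho>) * norm z powr \<rho>)"
      using norm_le_max_modulus[OF f(1), of z] f(4)[of "norm z"] by simp
    also have "P' * (1 / \<rho>) * norm z powr \<rho> \<le> \<tau> * norm z powr \<rho>"
      using \<rho> by (intro mult_right_mono) (auto simp: \<tau>_def intro!: divide_right_mono)
    hence "exp (P' * (1 / \<rho>) * norm z powr \<rho>) \<le> exp (\<tau> * norm z powr \<rho>)" by simp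
    finally show ?thesis .
  qed
  have zeros: "f (of_real (real n powr (1 / \<rho>))) = 0" if n: "n \<ge> 1" for n :: nat
  proof (rule ccontr)
    assume "f (of_real (real n powr (1 / \<rho>))) \<noteq> 0"
    hence "zero_mult f (of_real (real n powr (1 / \<rho>))) = 0" using f(2) by (simp add: zero_mult_def)
    moreover have "power_sequence \<rho> (of_real (real n powr (1 / \<rho>))) = 1" using n by (auto simp: power_sequence_def)
    ultimately have "(1::enat) \<le> 0" using f(3) unfolding vanishes_on_def by metis
    thus False by simp
  qed
  have "f z = 0" for z
  proof (cases "\<rho> \<ge> 1 / 2")
    case True
    have "\<tau> < pi" using \<tau> \<rho> True by (simp add: paley_def)
    thus ?thesis using \<tau> by (intro uniqueness_half_plane_powr[OF _ _ True f(1) bound zeros])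
  next
    case False
    have "\<tau> < pi / sin (pi * \<rho>)" using \<tau>(2) \<rho> False by (simp add: paley_def)
    thus ?thesis using \<tau> \<rho> False by (intro uniqueness_small_order[OF _ _ \<rho> _ f(1) bound zeros]) auto
  qed
  thus False using f(2) by auto
qed

theorem corollary2:
  shows
    "(\<forall>(\<sigma>::real) (\<rho>::real) (Z::point_distribution).
        \<sigma> > 0 \<longrightarrow> \<rho> > 0 \<longrightarrow> Z 0 < \<infinity> \<longrightarrow>
        (SUP r\<in>{0..}. radial_integral_count Z r - ereal (\<sigma> * r powr \<rho>)) < \<infinity> \<longrightarrow>
        (\<exists>f. f holomorphic_on UNIV \<and> f \<noteq> (\<lambda>_. 0) \<and> vanishes_on f Z \<and>
             (\<forall>r\<ge>0. max_modulus r f \<le> exp (paley \<rho> * \<sigma> * r powr \<rho>))))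
     \<and>
     (\<forall>(\<rho>::real) (P'::real). \<rho> > 0 \<longrightarrow> P' < paley \<rho> \<longrightarrow>
        (\<exists>(\<sigma>::real) (Z::point_distribution).
           \<sigma> > 0 \<and> Z 0 < \<infinity> \<and>
           (SUP r\<in>{0..}. radial_integral_count Z r - ereal (\<sigma> * r powr \<rho>)) < \<infinity> \<and>
           \<not> (\<exists>f. f holomorphic_on UNIV \<and> f \<noteq> (\<lambda>_. 0) \<and> vanishes_on f Z \<and>
                  (\<forall>r\<ge>0. max_modulus r f \<le> exp (P' * \<sigma> * r powr \<rho>)))))
     \<and>
     (\<forall>(\<sigma>::real) (\<rho>::real) (Z::point_distribution).
        \<sigma> > 0 \<longrightarrow> \<rho> > 0 \<longrightarrow> Z 0 < \<infinity> \<longrightarrow>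
        Limsup at_top (\<lambda>r. radial_integral_count Z r / ereal (r powr \<rho>)) < ereal \<sigma> \<longrightarrow>
        (\<exists>f. f holomorphic_on UNIV \<and> f \<noteq> (\<lambda>_. 0) \<and> vanishes_on f Z \<and>
             Limsup at_infinity (\<lambda>z. ext_ln (norm (f z)) / ereal (norm z powr \<rho>))
               < ereal (paley \<rho> * \<sigma>)))"
  using corollary2_existence corollary2_sharpness corollary2_limsup by simp

end
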